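(* Let $S$ be a countable (discrete) $F$-inverse semigroup with $P$-representation $S=P(X,Y,G)$ for a McAlister triple $(X,Y,G)$; in particular $Y=E(S)$ and $G=G(S)$. Then $C^*(S)$ is strongly Morita equivalent to the universal cross product algebra $C^*(X)\rtimes G\cong C_0(\widehat X)\rtimes G$, and $C^*_r(S)$ is strongly Morita equivalent to the reduced cross product algebra $C^*(X)\rtimes_r G\cong C_0(\widehat X)\rtimes_r G$.
   Context: For an inverse semigroup $S$ (each $s\in S$ has a unique $s^*$ with $ss^*s=s$, $s^*ss^*=s^*$), $E(S)$ is the semilattice of idempotents, $s\le t$ means $s=et$ with $e\in E(S)$, and $\sigma\colon S\to G(S)$ is the maximal group image, i.e. the quotient of $S$ identifying elements with a common lower bound. $S$ is $F$-inverse if $\sigma^{-1}(g)\cap eSf$ has a maximum element for all $g\in G(S)$ and $e,f\in E(S)$. A McAlister triple $(X,Y,G)$ consists of a group $G$ acting (by order automorphisms) on a poset $X$ and a downset $Y$ of $X$ such that $Y$ has all binary meets, $G\cdot Y=X$, and $gY\cap Y\ne\emptyset$ for all $g\in G$. The inverse semigroup $P(X,Y,G)$ is the set of $(y,g)\in Y\times G$ with $g^{-1}y\in Y$, with product $(y,g)(y',g')=(g(g^{-1}y\wedge y'),gg')=(y\wedge gy',gg')$ and inverse $(y,g)^*=(g^{-1}y,g^{-1})$; its idempotent semilattice is (identified with) $Y$ and its maximal group image is $G$. By a known result of Lawson, $P(X,Y,G)$ is $F$-inverse if and only if $X$ is a meet semilattice; thus in the theorem $X$ is a semilattice on which $G$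 acts by automorphisms. For a semilattice $X$, regarded as an inverse semigroup under meet, $\widehat X$ is the locally compact Hausdorff space of non-zero homomorphisms $X\to\{0,1\}$ with the topology of pointwise convergence; $G$ acts on $\widehat X$ by $(g\varphi)(e)=\varphi(g^{-1}e)$, and on $C^*(X)\cong C_0(\widehat X)$ correspondingly. $C^*(S)$ is the universal $C^*$-algebra for $*$-representations of $S$ by partial isometries on Hilbert spaces; $C^*_r(S)$ is the $C^*$-algebra generated by the left regular representation on $\ell^2(S)$, $\lambda(s)\delta_t=\delta_{st}$ if $tt^*\le s^*s$ and $0$ otherwise. Strong Morita equivalence of $C^*$-algebras is in the sense of Rieffel. *)

theory Defs
  imports "HOL-Analysis.Analysis"
begin

section \<open>The Hilbert spaces of square summable families\<close>

typedef 'k ell2 = "{f :: 'k \<Rightarrow> complex. (\<lambda>k. (norm (f k))\<^sup>2) summable_on UNIV}"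
  morphisms ell2_coord ell2_of
  by (rule exI[of _ "\<lambda>_. 0"]) simp

setup_lifting type_definition_ell2

lemma ell2_coord_summable: "(\<lambda>k. (norm (ell2_coord x k))\<^sup>2) summable_on UNIV"
  using ell2_coord[of x] by simp

lemma square_summable_prod:
  fixes f g :: "'k \<Rightarrow> complex"
  assumes "(\<lambda>k. (norm (f k))\<^sup>2) summable_on UNIV" "(\<lambda>k. (norm (g k))\<^sup>2) summable_on UNIV"
  shows "(\<lambda>k. norm (f k) * norm (g k)) summable_on UNIV"
proof (rule summable_on_comparison_test)
  show "(\<lambda>k. (norm (f k))\<^sup>2 + (norm (g k))\<^sup>2) summable_on UNIV"
    using assms by (rule summable_on_add)
  show "norm (f k) * norm (g k) \<le> (norm (f k))\<^sup>2 + (norm (g k))\<^sup>2" for k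
    using sum_squares_bound[of "norm (f k)" "norm (g k)"]
      mult_nonneg_nonneg[OF norm_ge_zero norm_ge_zero, of "f k" "g k"] by linarith
qed simp

lemma square_summable_add:
  fixes f g :: "'k \<Rightarrow> complex"
  assumes "(\<lambda>k. (norm (f k))\<^sup>2) summable_on UNIV" "(\<lambda>k. (norm (g k))\<^sup>2) summable_on UNIV"
  shows "(\<lambda>k. (norm (f k + g k))\<^sup>2) summable_on UNIV"
proof (rule summable_on_comparison_test)
  show "(\<lambda>k. 2 * ((norm (f k))\<^sup>2 + (norm (g k))\<^sup>2)) summable_on UNIV"
    using assms by (intro summable_on_cmult_right summable_on_add)
  fix k
  have "(norm (f k + g k))\<^sup>2 \<le> (norm (f k) + norm (g k))\<^sup>2"
    by (intro power_mono norm_triangle_ineq) simp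
  also have "\<dots> \<le> 2 * ((norm (f k))\<^sup>2 + (norm (g k))\<^sup>2)"
    using sum_squares_bound[of "norm (f k)" "norm (g k)"] by (simp add: power2_sum)
  finally show "(norm (f k + g k))\<^sup>2 \<le> 2 * ((norm (f k))\<^sup>2 + (norm (g k))\<^sup>2)" .
qed simp

lemma square_summable_scale:
  fixes f :: "'k \<Rightarrow> complex"
  assumes "(\<lambda>k. (norm (f k))\<^sup>2) summable_on UNIV"
  shows "(\<lambda>k. (norm (c * f k))\<^sup>2) summable_on UNIV"
  using summable_on_cmult_right[OF assms, of "(norm c)\<^sup>2"] by (simp add: norm_mult power_mult_distrib)

lift_definition ell2_scale :: "complex \<Rightarrow> 'k ell2 \<Rightarrow> 'k ell2" is "\<lambda>c f k. c * f k"
  using square_summable_scale by auto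

definition ell2_cinner :: "'k ell2 \<Rightarrow> 'k ell2 \<Rightarrow> complex" where
  "ell2_cinner x y = (\<Sum>\<^sub>\<infinity>k. cnj (ell2_coord x k) * ell2_coord y k)"

lift_definition ell2_delta :: "'k \<Rightarrow> 'k ell2" is "\<lambda>j k. if k = j then 1 else 0"
proof -
  fix j :: 'k
  let ?f = "\<lambda>k. (norm (if k = j then 1 else 0 :: complex))\<^sup>2"
  have "?f summable_on {j}" by (rule summable_on_finite) simp
  moreover have "?f summable_on {j} \<longleftrightarrow> ?f summable_on UNIV"
    by (rule summable_on_cong_neutral) auto
  ultimately show "?f summable_on UNIV" by blast
qed

instantiation ell2 :: (type) real_vector
begin

lift_definition zero_ell2 :: "'a ell2" is "\<lambda>_. 0" by simp
lift_definition plus_ell2 :: "'a ell2 \<Rightarrow> 'a ell2 \<Rightarrow> 'a ell2" is "\<lambda>f g k. f k + g k"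
  using square_summable_add by auto
lift_definition uminus_ell2 :: "'a ell2 \<Rightarrow> 'a ell2" is "\<lambda>f k. - f k" by simp
lift_definition scaleR_ell2 :: "real \<Rightarrow> 'a ell2 \<Rightarrow> 'a ell2" is "\<lambda>r f k. r *\<^sub>R f k"
  by (simp only: mem_Collect_eq scaleR_conv_of_real) (rule square_summable_scale)
definition minus_ell2 :: "'a ell2 \<Rightarrow> 'a ell2 \<Rightarrow> 'a ell2" where "minus_ell2 x y = x + (- y)"

instance
proof
  fix x y z :: "'a ell2" and r s :: real
  show "x + y + z = x + (y + z)" by transfer (simp add: add.assoc)
  show "x + y = y + x" by transfer (simp add: add.commute)
  show "0 + x = x" by transfer simp
  show "- x + x = 0" by transfer simp
  show "x - y = x + - y" by (rule minus_ell2_def)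
  show "r *\<^sub>R (x + y) = r *\<^sub>R x + r *\<^sub>R y" by transfer (simp add: scaleR_right_distrib)
  show "(r + s) *\<^sub>R x = r *\<^sub>R x + s *\<^sub>R x" by transfer (simp add: scaleR_left_distrib)
  show "r *\<^sub>R s *\<^sub>R x = (r * s) *\<^sub>R x" by transfer simp
  show "1 *\<^sub>R x = x" by transfer simp
qed

end

instantiation ell2 :: (type) real_inner
begin

definition inner_ell2 :: "'a ell2 \<Rightarrow> 'a ell2 \<Rightarrow> real" where
  "inner_ell2 x y = (\<Sum>\<^sub>\<infinity>k. inner (ell2_coord x k) (ell2_coord y k))"
definition norm_ell2 :: "'a ell2 \<Rightarrow> real" where "norm_ell2 x = sqrt (inner x x)"
definition sgn_ell2 :: "'a ell2 \<Rightarrow> 'a ell2" where "sgn_ell2 x = x /\<^sub>R norm x"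
definition dist_ell2 :: "'a ell2 \<Rightarrow> 'a ell2 \<Rightarrow> real" where "dist_ell2 x y = norm (x - y)"
definition uniformity_ell2 :: "('a ell2 \<times> 'a ell2) filter" where
  "uniformity_ell2 = (INF e\<in>{0 <..}. principal {(x, y). dist x y < e})"
definition open_ell2 :: "'a ell2 set \<Rightarrow> bool" where
  "open_ell2 U = (\<forall>x\<in>U. eventually (\<lambda>(x', y). x' = x \<longrightarrow> y \<in> U) uniformity)"

instance
proof
  fix x y z :: "'a ell2" and r s :: real
  have coord_summable: "(\<lambda>k. inner (ell2_coord x k) (ell2_coord y k)) summable_on UNIV" for x y :: "'a ell2"
  proof (rule abs_summable_summable, rule Infinite_Sum.abs_summable_on_comparison_test)
    show "(\<lambda>k. norm (norm (ell2_coord x k) * norm (ell2_coord y k))) summable_on UNIV"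
      using square_summable_prod[OF ell2_coord_summable ell2_coord_summable] by simp
    show "norm (inner (ell2_coord x k) (ell2_coord y k))
        \<le> norm (norm (ell2_coord x k) * norm (ell2_coord y k))" for k
      using Cauchy_Schwarz_ineq2[of "ell2_coord x k" "ell2_coord y k"] by simp
  qed
  show "sgn x = x /\<^sub>R norm x" by (rule sgn_ell2_def)
  show "dist x y = norm (x - y)" by (rule dist_ell2_def)
  show "uniformity = (INF e\<in>{0<..}. principal {(x::'a ell2, y). dist x y < e})"
    by (rule uniformity_ell2_def)
  show "open U = (\<forall>x\<in>U. eventually (\<lambda>(x', y). x' = x \<longrightarrow> y \<in> U) uniformity)" for U :: "'a ell2 set"
    by (rule open_ell2_def)
  show "inner x y = inner y x" by (simp add: inner_ell2_def inner_commute)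
  show "inner (x + y) z = inner x z + inner y z"
    by (simp add: inner_ell2_def plus_ell2.rep_eq inner_add_left infsum_add coord_summable)
  show "inner (r *\<^sub>R x) y = r * inner x y"
    by (simp add: inner_ell2_def scaleR_ell2.rep_eq infsum_cmult_right')
  show nonneg: "0 \<le> inner x x" by (simp add: inner_ell2_def infsum_nonneg)
  show "inner x x = 0 \<longleftrightarrow> x = 0"
  proof
    assume *: "inner x x = 0"
    have "inner (ell2_coord x k) (ell2_coord x k) = 0" for k
      by (rule nonneg_infsum_le_0D[where A = UNIV])
        (use * coord_summable in \<open>auto simp: inner_ell2_def\<close>)
    then show "x = 0" by (simp add: ell2_coord_inject[symmetric] zero_ell2.rep_eq fun_eq_iff)
  qed (simp add: inner_ell2_def zero_ell2.rep_eq)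
  show "norm x = sqrt (inner x x)" by (rule norm_ell2_def)
qed

end

lemma norm_ell2_squared: "(norm x)\<^sup>2 = (\<Sum>\<^sub>\<infinity>k. (norm (ell2_coord x k))\<^sup>2)"
  by (simp add: power2_norm_eq_inner inner_ell2_def)

lemma ell2_sum_le_norm:
  assumes "finite F" shows "(\<Sum>k\<in>F. (norm (ell2_coord x k))\<^sup>2) \<le> (norm x)\<^sup>2"
  unfolding norm_ell2_squared
  by (rule finite_sum_le_infsum) (use assms ell2_coord_summable in auto)

lemma ell2_coord_le_norm: "norm (ell2_coord x k) \<le> norm x"
  by (rule power2_le_imp_le) (use ell2_sum_le_norm[of "{k}" x] in simp_all)

lemma ell2_coord_diff: "ell2_coord (x - y) k = ell2_coord x k - ell2_coord y k"
  unfolding minus_ell2_def plus_ell2.rep_eq uminus_ell2.rep_eq by simp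

instance ell2 :: (type) banach
proof
  fix X :: "nat \<Rightarrow> 'a ell2"
  assume "Cauchy X"
  then have C: "\<exists>M. \<forall>m\<ge>M. \<forall>n\<ge>M. norm (X m - X n) < e" if "e > 0" for e
    using that by (simp add: Cauchy_def dist_norm)
  have "\<exists>l. (\<lambda>n. ell2_coord (X n) k) \<longlonglongrightarrow> l" for k
  proof -
    have "Cauchy (\<lambda>n. ell2_coord (X n) k)"
      unfolding Cauchy_def dist_norm
    proof (intro allI impI)
      fix e :: real assume "e > 0"
      then obtain M where M: "\<forall>m\<ge>M. \<forall>n\<ge>M. norm (X m - X n) < e" using C by blast
      have "norm (ell2_coord (X m) k - ell2_coord (X n) k) < e" if "m \<ge> M" "n \<ge> M" for m n
        using ell2_coord_le_norm[of "X m - X n" k] M[rule_format, OF that]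
        unfolding ell2_coord_diff by (rule order_le_less_trans)
      then show "\<exists>M. \<forall>m\<ge>M. \<forall>n\<ge>M. norm (ell2_coord (X m) k - ell2_coord (X n) k) < e" by blast
    qed
    then show ?thesis by (simp add: Cauchy_convergent_iff convergent_def)
  qed
  then obtain f where f: "\<And>k. (\<lambda>n. ell2_coord (X n) k) \<longlonglongrightarrow> f k" by metis
  have bound: "(\<Sum>k\<in>F. (norm (ell2_coord (X m) k - f k))\<^sup>2) \<le> e\<^sup>2"
    if "finite F" "\<forall>n\<ge>M. norm (X m - X n) < e" for F m M e
  proof (rule Lim_bounded)
    show "(\<lambda>n. \<Sum>k\<in>F. (norm (ell2_coord (X m) k - ell2_coord (X n) k))\<^sup>2)
        \<longlonglongrightarrow> (\<Sum>k\<in>F. (norm (ell2_coord (X m) k - f k))\<^sup>2)"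
      by (intro tendsto_intros f)
    show "\<forall>n\<ge>M. (\<Sum>k\<in>F. (norm (ell2_coord (X m) k - ell2_coord (X n) k))\<^sup>2) \<le> e\<^sup>2"
    proof (intro allI impI)
      fix n assume "n \<ge> M"
      have "(\<Sum>k\<in>F. (norm (ell2_coord (X m) k - ell2_coord (X n) k))\<^sup>2) \<le> (norm (X m - X n))\<^sup>2"
        using ell2_sum_le_norm[OF that(1), of "X m - X n"] by (simp add: ell2_coord_diff)
      also have "\<dots> \<le> e\<^sup>2"
        using that(2)[rule_format, OF \<open>n \<ge> M\<close>] by (intro power_mono) simp_all
      finally show "(\<Sum>k\<in>F. (norm (ell2_coord (X m) k - ell2_coord (X n) k))\<^sup>2) \<le> e\<^sup>2" .
    qed
  qed
  have summ: "(\<lambda>k. (norm (ell2_coord (X m) k - f k))\<^sup>2) summable_on UNIV"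
    if "\<forall>n\<ge>M. norm (X m - X n) < e" for m M e
  proof (rule nonneg_bdd_above_summable_on)
    show "bdd_above (sum (\<lambda>k. (norm (ell2_coord (X m) k - f k))\<^sup>2) ` {F. F \<subseteq> UNIV \<and> finite F})"
      by (rule bdd_aboveI[where M = "e\<^sup>2"]) (use bound[OF _ that] in blast)
  qed simp
  obtain M1 where M1: "\<forall>m\<ge>M1. \<forall>n\<ge>M1. norm (X m - X n) < 1" using C[of 1] by auto
  have "(\<lambda>k. (norm (ell2_coord (X M1) k + (-1) * (ell2_coord (X M1) k - f k)))\<^sup>2) summable_on UNIV"
    by (rule square_summable_add[OF ell2_coord_summable square_summable_scale[OF summ[of M1 M1 1]]])
      (use M1 in blast)
  then have "(\<lambda>k. (norm (f k))\<^sup>2) summable_on UNIV" by simp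
  then have fL: "ell2_coord (ell2_of f) = f" by (simp add: ell2_of_inverse)
  have "X \<longlonglongrightarrow> ell2_of f"
  proof (rule LIMSEQ_I)
    fix r :: real assume "r > 0"
    then obtain M where M: "\<forall>m\<ge>M. \<forall>n\<ge>M. norm (X m - X n) < r / 2" using C[of "r / 2"] by auto
    have "norm (X m - ell2_of f) < r" if "m \<ge> M" for m
    proof -
      have Mm: "\<forall>n\<ge>M. norm (X m - X n) < r / 2" using M that by auto
      have "(norm (X m - ell2_of f))\<^sup>2 \<le> (r / 2)\<^sup>2"
        unfolding norm_ell2_squared ell2_coord_diff fL
        by (rule infsum_le_finite_sums[OF summ[OF Mm] bound[OF _ Mm]])
      then have "norm (X m - ell2_of f) \<le> r / 2"
        by (rule power2_le_imp_le) (use \<open>r > 0\<close> in simp)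
      then show ?thesis using \<open>r > 0\<close> by simp
    qed
    then show "\<exists>no. \<forall>n\<ge>no. norm (X n - ell2_of f) < r" by blast
  qed
  then show "convergent X" by (auto simp: convergent_def)
qed


section \<open>Bounded operators\<close>

type_synonym 'k op = "'k ell2 \<Rightarrow>\<^sub>L 'k ell2"

text \<open>The library type of bounded operators only knows real linearity, so complex linearity is
  imposed separately.\<close>

definition clinear_op :: "'k op \<Rightarrow> bool" where
  "clinear_op T \<longleftrightarrow> (\<forall>c x. blinfun_apply T (ell2_scale c x) = ell2_scale c (blinfun_apply T x))"

definition op_scale :: "complex \<Rightarrow> 'k op \<Rightarrow> 'k op" where
  "op_scale c T = Blinfun (\<lambda>x. ell2_scale c (blinfun_apply T x))"

definition op_adj :: "'k op \<Rightarrow> 'k op" where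
  "op_adj T = (THE T'. \<forall>x y. ell2_cinner (blinfun_apply T' x) y = ell2_cinner x (blinfun_apply T y))"


section \<open>C*-algebras\<close>

record 'a star_algebra =
  elems :: "'a set"
  szero :: 'a
  splus :: "'a \<Rightarrow> 'a \<Rightarrow> 'a"
  sscale :: "complex \<Rightarrow> 'a \<Rightarrow> 'a"
  smult :: "'a \<Rightarrow> 'a \<Rightarrow> 'a"
  sstar :: "'a \<Rightarrow> 'a"
  snorm :: "'a \<Rightarrow> real"

definition sdist :: "'a star_algebra \<Rightarrow> 'a \<Rightarrow> 'a \<Rightarrow> real" where
  "sdist A x y = snorm A (splus A x (sscale A (-1) y))"

definition dist_complete :: "'a set \<Rightarrow> ('a \<Rightarrow> 'a \<Rightarrow> real) \<Rightarrow> bool" where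
  "dist_complete V d \<longleftrightarrow>
    (\<forall>f :: nat \<Rightarrow> 'a. (\<forall>n. f n \<in> V) \<and> (\<forall>e>0. \<exists>N. \<forall>m\<ge>N. \<forall>n\<ge>N. d (f m) (f n) < e)
      \<longrightarrow> (\<exists>l\<in>V. (\<lambda>n. d (f n) l) \<longlonglongrightarrow> 0))"

locale complex_space =
  fixes V :: "'v set" and zero :: 'v and plus :: "'v \<Rightarrow> 'v \<Rightarrow> 'v" and scale :: "complex \<Rightarrow> 'v \<Rightarrow> 'v"
  assumes zero_closed: "zero \<in> V"
    and plus_closed: "\<lbrakk>x \<in> V; y \<in> V\<rbrakk> \<Longrightarrow> plus x y \<in> V"
    and scale_closed: "x \<in> V \<Longrightarrow> scale c x \<in> V"
    and plus_assoc: "\<lbrakk>x \<in> V; y \<in> V; z \<in> V\<rbrakk> \<Longrightarrow> plus (plus x y) z = plus x (plus y z)"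
    and plus_commute: "\<lbrakk>x \<in> V; y \<in> V\<rbrakk> \<Longrightarrow> plus x y = plus y x"
    and plus_zero: "x \<in> V \<Longrightarrow> plus x zero = x"
    and scale_zero: "x \<in> V \<Longrightarrow> scale 0 x = zero"
    and scale_one: "x \<in> V \<Longrightarrow> scale 1 x = x"
    and scale_scale: "x \<in> V \<Longrightarrow> scale c (scale d x) = scale (c * d) x"
    and scale_plus: "\<lbrakk>x \<in> V; y \<in> V\<rbrakk> \<Longrightarrow> scale c (plus x y) = plus (scale c x) (scale c y)"
    and plus_scale: "x \<in> V \<Longrightarrow> scale (c + d) x = plus (scale c x) (scale d x)"

locale cstar_algebra =
  complex_space "elems A" "szero A" "splus A" "sscale A" for A :: "'a star_algebra" +
  assumes mult_closed: "\<lbrakk>x \<in> elems A; y \<in> elems A\<rbrakk> \<Longrightarrow> smult A x y \<in> elems A"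
    and mult_assoc: "\<lbrakk>x \<in> elems A; y \<in> elems A; z \<in> elems A\<rbrakk>
      \<Longrightarrow> smult A (smult A x y) z = smult A x (smult A y z)"
    and mult_plus: "\<lbrakk>x \<in> elems A; y \<in> elems A; z \<in> elems A\<rbrakk>
      \<Longrightarrow> smult A x (splus A y z) = splus A (smult A x y) (smult A x z)"
    and plus_mult: "\<lbrakk>x \<in> elems A; y \<in> elems A; z \<in> elems A\<rbrakk>
      \<Longrightarrow> smult A (splus A x y) z = splus A (smult A x z) (smult A y z)"
    and scale_mult: "\<lbrakk>x \<in> elems A; y \<in> elems A\<rbrakk> \<Longrightarrow> smult A (sscale A c x) y = sscale A c (smult A x y)"
    and mult_scale: "\<lbrakk>x \<in> elems A; y \<in> elems A\<rbrakk> \<Longrightarrow> smult A x (sscale A c y) = sscale A c (smult A x y)"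
    and star_closed: "x \<in> elems A \<Longrightarrow> sstar A x \<in> elems A"
    and star_star: "x \<in> elems A \<Longrightarrow> sstar A (sstar A x) = x"
    and star_plus: "\<lbrakk>x \<in> elems A; y \<in> elems A\<rbrakk> \<Longrightarrow> sstar A (splus A x y) = splus A (sstar A x) (sstar A y)"
    and star_scale: "x \<in> elems A \<Longrightarrow> sstar A (sscale A c x) = sscale A (cnj c) (sstar A x)"
    and star_mult: "\<lbrakk>x \<in> elems A; y \<in> elems A\<rbrakk> \<Longrightarrow> sstar A (smult A x y) = smult A (sstar A y) (sstar A x)"
    and norm_zero_iff: "x \<in> elems A \<Longrightarrow> snorm A x = 0 \<longleftrightarrow> x = szero A"
    and norm_triangle: "\<lbrakk>x \<in> elems A; y \<in> elems A\<rbrakk> \<Longrightarrow> snorm A (splus A x y) \<le> snorm A x + snorm A y"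
    and norm_scale: "x \<in> elems A \<Longrightarrow> snorm A (sscale A c x) = cmod c * snorm A x"
    and norm_mult: "\<lbrakk>x \<in> elems A; y \<in> elems A\<rbrakk> \<Longrightarrow> snorm A (smult A x y) \<le> snorm A x * snorm A y"
    and cstar_identity: "x \<in> elems A \<Longrightarrow> snorm A (smult A (sstar A x) x) = (snorm A x)\<^sup>2"
    and complete: "dist_complete (elems A) (sdist A)"

definition star_isomorphic :: "'a star_algebra \<Rightarrow> 'b star_algebra \<Rightarrow> bool" where
  "star_isomorphic A B \<longleftrightarrow> cstar_algebra A \<and> cstar_algebra B \<and>
    (\<exists>\<phi>. bij_betw \<phi> (elems A) (elems B) \<and>
      (\<forall>x\<in>elems A. \<forall>y\<in>elems A. \<phi> (splus A x y) = splus B (\<phi> x) (\<phi> y)) \<and>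
      (\<forall>c. \<forall>x\<in>elems A. \<phi> (sscale A c x) = sscale B c (\<phi> x)) \<and>
      (\<forall>x\<in>elems A. \<forall>y\<in>elems A. \<phi> (smult A x y) = smult B (\<phi> x) (\<phi> y)) \<and>
      (\<forall>x\<in>elems A. \<phi> (sstar A x) = sstar B (\<phi> x)))"

definition closed_subspace :: "'a star_algebra \<Rightarrow> 'a set \<Rightarrow> bool" where
  "closed_subspace A B \<longleftrightarrow> B \<subseteq> elems A \<and> szero A \<in> B \<and>
    (\<forall>x\<in>B. \<forall>y\<in>B. splus A x y \<in> B) \<and> (\<forall>c. \<forall>x\<in>B. sscale A c x \<in> B) \<and>
    (\<forall>f l. (\<forall>n :: nat. f n \<in> B) \<and> l \<in> elems A \<and> (\<lambda>n. sdist A (f n) l) \<longlonglongrightarrow> 0 \<longrightarrow> l \<in> B)"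

definition closed_star_subalgebra :: "'a star_algebra \<Rightarrow> 'a set \<Rightarrow> bool" where
  "closed_star_subalgebra A B \<longleftrightarrow> closed_subspace A B \<and>
    (\<forall>x\<in>B. \<forall>y\<in>B. smult A x y \<in> B) \<and> (\<forall>x\<in>B. sstar A x \<in> B)"

text \<open>The C*-algebra generated by a set \<open>T\<close> of elements of an ambient C*-algebra.\<close>

definition cstar_generated :: "'a star_algebra \<Rightarrow> 'a set \<Rightarrow> 'a star_algebra" where
  "cstar_generated A T = A\<lparr>elems := {x \<in> elems A. \<forall>B. closed_star_subalgebra A B \<and> T \<subseteq> B \<longrightarrow> x \<in> B}\<rparr>"

definition spositive :: "'a star_algebra \<Rightarrow> 'a \<Rightarrow> bool" where
  "spositive A a \<longleftrightarrow> (\<exists>b\<in>elems A. a = smult A (sstar A b) b)"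

definition span_dense :: "'a star_algebra \<Rightarrow> 'a set \<Rightarrow> bool" where
  "span_dense A T \<longleftrightarrow> (\<forall>B. closed_subspace A B \<and> T \<subseteq> B \<longrightarrow> elems A \<subseteq> B)"

definition op_algebra :: "'k op star_algebra" where
  "op_algebra = \<lparr>elems = {T. clinear_op T}, szero = 0, splus = (+), sscale = op_scale,
     smult = (o\<^sub>L), sstar = op_adj, snorm = norm\<rparr>"

text \<open>Bounded families of operators indexed by a set \<open>R\<close> (extended by \<open>0\<close> off \<open>R\<close>), with the supremum
  norm. If \<open>R\<close> is a set of representations of a *-algebra \<open>V\<close>, the closure in here of the elements
  \<open>(\<rho>(v))\<^sub>\<rho>\<close> with \<open>v\<close> in \<open>V\<close> is the Hausdorff completion of \<open>V\<close> with respect to the norm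
  \<open>sup \<parallel>\<rho>(v)\<parallel>\<close> over all \<open>\<rho>\<close> in \<open>R\<close>; universal C*-algebras are presented in this way below.\<close>

definition op_family_algebra :: "'r set \<Rightarrow> ('r \<Rightarrow> 'k op) star_algebra" where
  "op_family_algebra R =
    \<lparr>elems = {a. (\<forall>\<rho>. clinear_op (a \<rho>)) \<and> (\<forall>\<rho>. \<rho> \<notin> R \<longrightarrow> a \<rho> = 0) \<and> bdd_above (range (\<lambda>\<rho>. norm (a \<rho>)))},
     szero = (\<lambda>_. 0), splus = (\<lambda>a b \<rho>. a \<rho> + b \<rho>), sscale = (\<lambda>c a \<rho>. op_scale c (a \<rho>)),
     smult = (\<lambda>a b \<rho>. a \<rho> o\<^sub>L b \<rho>), sstar = (\<lambda>a \<rho>. op_adj (a \<rho>)), snorm = (\<lambda>a. SUP \<rho>. norm (a \<rho>))\<rparr>"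

definition family_on :: "'r set \<Rightarrow> ('r \<Rightarrow> 'k op) \<Rightarrow> 'r \<Rightarrow> 'k op" where
  "family_on R F \<rho> = (if \<rho> \<in> R then F \<rho> else 0)"

definition C0_algebra :: "'t::topological_space set \<Rightarrow> ('t \<Rightarrow> complex) star_algebra" where
  "C0_algebra T =
    \<lparr>elems = {f. (\<forall>t. t \<notin> T \<longrightarrow> f t = 0) \<and> continuous_on T f \<and> (\<forall>e>0. compact {t \<in> T. e \<le> cmod (f t)})},
     szero = (\<lambda>_. 0), splus = (\<lambda>f g t. f t + g t), sscale = (\<lambda>c f t. c * f t),
     smult = (\<lambda>f g t. f t * g t), sstar = (\<lambda>f t. cnj (f t)), snorm = (\<lambda>f. SUP t. cmod (f t))\<rparr>"


section \<open>Strong Morita equivalence\<close>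

record ('e, 'a, 'b) bimodule =
  vecs :: "'e set"
  vzero :: 'e
  vplus :: "'e \<Rightarrow> 'e \<Rightarrow> 'e"
  vscale :: "complex \<Rightarrow> 'e \<Rightarrow> 'e"
  lact :: "'a \<Rightarrow> 'e \<Rightarrow> 'e"
  ract :: "'e \<Rightarrow> 'b \<Rightarrow> 'e"
  lip :: "'e \<Rightarrow> 'e \<Rightarrow> 'a"
  rip :: "'e \<Rightarrow> 'e \<Rightarrow> 'b"

definition vdiff :: "('e, 'a, 'b) bimodule \<Rightarrow> 'e \<Rightarrow> 'e \<Rightarrow> 'e" where
  "vdiff E x y = vplus E x (vscale E (-1) y)"

locale imprimitivity_bimodule =
  A: cstar_algebra A + B: cstar_algebra B + complex_space "vecs E" "vzero E" "vplus E" "vscale E"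
  for A :: "'a star_algebra" and B :: "'b star_algebra" and E :: "('e, 'a, 'b) bimodule" +
  assumes lact_closed: "\<lbrakk>a \<in> elems A; x \<in> vecs E\<rbrakk> \<Longrightarrow> lact E a x \<in> vecs E"
    and lact_plus: "\<lbrakk>a \<in> elems A; x \<in> vecs E; y \<in> vecs E\<rbrakk>
      \<Longrightarrow> lact E a (vplus E x y) = vplus E (lact E a x) (lact E a y)"
    and plus_lact: "\<lbrakk>a \<in> elems A; a' \<in> elems A; x \<in> vecs E\<rbrakk>
      \<Longrightarrow> lact E (splus A a a') x = vplus E (lact E a x) (lact E a' x)"
    and lact_scale: "\<lbrakk>a \<in> elems A; x \<in> vecs E\<rbrakk> \<Longrightarrow> lact E a (vscale E c x) = vscale E c (lact E a x)"
    and scale_lact: "\<lbrakk>a \<in> elems A; x \<in> vecs E\<rbrakk> \<Longrightarrow> lact E (sscale A c a) x = vscale E c (lact E a x)"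
    and lact_lact: "\<lbrakk>a \<in> elems A; a' \<in> elems A; x \<in> vecs E\<rbrakk>
      \<Longrightarrow> lact E a (lact E a' x) = lact E (smult A a a') x"
    and ract_closed: "\<lbrakk>x \<in> vecs E; b \<in> elems B\<rbrakk> \<Longrightarrow> ract E x b \<in> vecs E"
    and plus_ract: "\<lbrakk>x \<in> vecs E; y \<in> vecs E; b \<in> elems B\<rbrakk>
      \<Longrightarrow> ract E (vplus E x y) b = vplus E (ract E x b) (ract E y b)"
    and ract_plus: "\<lbrakk>x \<in> vecs E; b \<in> elems B; b' \<in> elems B\<rbrakk>
      \<Longrightarrow> ract E x (splus B b b') = vplus E (ract E x b) (ract E x b')"
    and scale_ract: "\<lbrakk>x \<in> vecs E; b \<in> elems B\<rbrakk> \<Longrightarrow> ract E (vscale E c x) b = vscale E c (ract E x b)"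
    and ract_scale: "\<lbrakk>x \<in> vecs E; b \<in> elems B\<rbrakk> \<Longrightarrow> ract E x (sscale B c b) = vscale E c (ract E x b)"
    and ract_ract: "\<lbrakk>x \<in> vecs E; b \<in> elems B; b' \<in> elems B\<rbrakk>
      \<Longrightarrow> ract E (ract E x b) b' = ract E x (smult B b b')"
    and lact_ract: "\<lbrakk>a \<in> elems A; x \<in> vecs E; b \<in> elems B\<rbrakk>
      \<Longrightarrow> ract E (lact E a x) b = lact E a (ract E x b)"
    \<comment> \<open>a full left Hilbert \<open>A\<close>-module\<close>
    and lip_closed: "\<lbrakk>x \<in> vecs E; y \<in> vecs E\<rbrakk> \<Longrightarrow> lip E x y \<in> elems A"
    and lip_plus: "\<lbrakk>x \<in> vecs E; y \<in> vecs E; z \<in> vecs E\<rbrakk>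
      \<Longrightarrow> lip E (vplus E x y) z = splus A (lip E x z) (lip E y z)"
    and lip_scale: "\<lbrakk>x \<in> vecs E; y \<in> vecs E\<rbrakk> \<Longrightarrow> lip E (vscale E c x) y = sscale A c (lip E x y)"
    and lip_lact: "\<lbrakk>a \<in> elems A; x \<in> vecs E; y \<in> vecs E\<rbrakk> \<Longrightarrow> lip E (lact E a x) y = smult A a (lip E x y)"
    and lip_star: "\<lbrakk>x \<in> vecs E; y \<in> vecs E\<rbrakk> \<Longrightarrow> sstar A (lip E x y) = lip E y x"
    and lip_positive: "x \<in> vecs E \<Longrightarrow> spositive A (lip E x x)"
    and lip_definite: "\<lbrakk>x \<in> vecs E; lip E x x = szero A\<rbrakk> \<Longrightarrow> x = vzero E"
    and lip_complete: "dist_complete (vecs E) (\<lambda>x y. sqrt (snorm A (lip E (vdiff E x y) (vdiff E x y))))"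
    and lip_full: "span_dense A {lip E x y | x y. x \<in> vecs E \<and> y \<in> vecs E}"
    \<comment> \<open>a full right Hilbert \<open>B\<close>-module\<close>
    and rip_closed: "\<lbrakk>x \<in> vecs E; y \<in> vecs E\<rbrakk> \<Longrightarrow> rip E x y \<in> elems B"
    and rip_plus: "\<lbrakk>x \<in> vecs E; y \<in> vecs E; z \<in> vecs E\<rbrakk>
      \<Longrightarrow> rip E x (vplus E y z) = splus B (rip E x y) (rip E x z)"
    and rip_scale: "\<lbrakk>x \<in> vecs E; y \<in> vecs E\<rbrakk> \<Longrightarrow> rip E x (vscale E c y) = sscale B c (rip E x y)"
    and rip_ract: "\<lbrakk>x \<in> vecs E; y \<in> vecs E; b \<in> elems B\<rbrakk> \<Longrightarrow> rip E x (ract E y b) = smult B (rip E x y) b"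
    and rip_star: "\<lbrakk>x \<in> vecs E; y \<in> vecs E\<rbrakk> \<Longrightarrow> sstar B (rip E x y) = rip E y x"
    and rip_positive: "x \<in> vecs E \<Longrightarrow> spositive B (rip E x x)"
    and rip_definite: "\<lbrakk>x \<in> vecs E; rip E x x = szero B\<rbrakk> \<Longrightarrow> x = vzero E"
    and rip_complete: "dist_complete (vecs E) (\<lambda>x y. sqrt (snorm B (rip E (vdiff E x y) (vdiff E x y))))"
    and rip_full: "span_dense B {rip E x y | x y. x \<in> vecs E \<and> y \<in> vecs E}"
    \<comment> \<open>compatibility of the two structures\<close>
    and rip_lact: "\<lbrakk>a \<in> elems A; x \<in> vecs E; y \<in> vecs E\<rbrakk>
      \<Longrightarrow> rip E (lact E a x) y = rip E x (lact E (sstar A a) y)"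
    and lip_ract: "\<lbrakk>x \<in> vecs E; y \<in> vecs E; b \<in> elems B\<rbrakk>
      \<Longrightarrow> lip E (ract E x b) y = lip E x (ract E y (sstar B b))"
    and lip_rip: "\<lbrakk>x \<in> vecs E; y \<in> vecs E; z \<in> vecs E\<rbrakk>
      \<Longrightarrow> lact E (lip E x y) z = ract E x (rip E y z)"

text \<open>The existential has to name a type for the vectors, and \<open>'a \<times> 'b\<close> is always large enough.
  An imprimitivity bimodule has a dense subspace spanned by the vectors \<open>x b\<close>, where \<open>b\<close> ranges
  over a dense subset of \<open>B\<close> and \<open>x\<close> over the entries of a family of inner products
  spanning a dense subspace of \<open>A\<close>. So its density character is at most \<open>\<aleph>\<^sub>0\<close> times those
  of \<open>A\<close> and \<open>B\<close>, and its cardinality is at most that of \<open>A \<times> B\<close>, because a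
  nonzero Banach space of density character \<open>\<kappa>\<close> has \<open>\<kappa>\<^sup>\<omega>\<close> elements.\<close>

definition strongly_Morita_equivalent :: "'a star_algebra \<Rightarrow> 'b star_algebra \<Rightarrow> bool" where
  "strongly_Morita_equivalent A B \<longleftrightarrow>
    (\<exists>E :: ('a \<times> 'b, 'a, 'b) bimodule. imprimitivity_bimodule A B E)"


section \<open>Crossed products by discrete groups\<close>

text \<open>Groups are types of class \<^class>\<open>group_add\<close>, which are not assumed to be commutative: \<open>g + h\<close>
  is the product, \<open>- g\<close> the inverse and \<open>0\<close> the identity.

  Representations are formed on the spaces \<^typ>\<open>'k ell2\<close> and may be degenerate. Every cyclic
  representation of the algebra in question acts on a Hilbert space whose dimension is at most
  the cardinality of the chosen index type, hence is unitarily equivalent to the restriction of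
  one of the representations below to a reducing subspace on whose complement the algebra acts by \<open>0\<close>.
  Therefore the suprema of norms over these representations
  agree with the suprema over all representations on arbitrary Hilbert spaces.\<close>

definition star_reps :: "'a star_algebra \<Rightarrow> ('a \<Rightarrow> 'k op) set" where
  "star_reps A = {\<pi>.
    (\<forall>a\<in>elems A. clinear_op (\<pi> a)) \<and>
    (\<forall>a\<in>elems A. \<forall>b\<in>elems A. \<pi> (splus A a b) = \<pi> a + \<pi> b) \<and>
    (\<forall>c. \<forall>a\<in>elems A. \<pi> (sscale A c a) = op_scale c (\<pi> a)) \<and>
    (\<forall>a\<in>elems A. \<forall>b\<in>elems A. \<pi> (smult A a b) = \<pi> a o\<^sub>L \<pi> b) \<and>
    (\<forall>a\<in>elems A. \<pi> (sstar A a) = op_adj (\<pi> a))}"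

definition unitary_reps :: "('g::group_add \<Rightarrow> 'k op) set" where
  "unitary_reps = {U. (\<forall>g. clinear_op (U g)) \<and> U 0 = id_blinfun \<and>
    (\<forall>g h. U (g + h) = U g o\<^sub>L U h) \<and> (\<forall>g. op_adj (U g) = U (- g))}"

definition covariant_reps ::
    "'a star_algebra \<Rightarrow> ('g::group_add \<Rightarrow> 'a \<Rightarrow> 'a) \<Rightarrow> (('a \<Rightarrow> 'k op) \<times> ('g \<Rightarrow> 'k op)) set" where
  "covariant_reps A \<alpha> = {(\<pi>, U). \<pi> \<in> star_reps A \<and> U \<in> unitary_reps \<and>
    (\<forall>g. \<forall>a\<in>elems A. U g o\<^sub>L \<pi> a o\<^sub>L op_adj (U g) = \<pi> (\<alpha> g a))}"

text \<open>The generator for \<open>a\<close> and \<open>g\<close> is the finitely supported function \<open>a \<delta>\<^sub>g\<close> from \<open>G\<close> to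
  \<open>A\<close>, seen through its integrated forms; the linear span of these is the image of the *-algebra of all
  finitely supported functions.\<close>

definition crossed_product ::
    "'a star_algebra \<Rightarrow> ('g::group_add \<Rightarrow> 'a \<Rightarrow> 'a) \<Rightarrow>
      ((('a \<Rightarrow> ('a \<times> 'g \<times> nat) op) \<times> ('g \<Rightarrow> ('a \<times> 'g \<times> nat) op)) \<Rightarrow> ('a \<times> 'g \<times> nat) op) star_algebra" where
  "crossed_product A \<alpha> = cstar_generated (op_family_algebra (covariant_reps A \<alpha>))
    {family_on (covariant_reps A \<alpha>) (\<lambda>(\<pi>, U). \<pi> a o\<^sub>L U g) | a g. a \<in> elems A}"

text \<open>The regular covariant representation on \<open>\<ell>\<^sup>2(G, H)\<close> induced from a representation
  \<open>\<pi>\<close> of \<open>A\<close> on \<open>H\<close>: \<open>(a \<xi>)(h) = \<pi>(\<alpha>\<^sub>h\<^sup>-\<^sup>1(a)) \<xi>(h)\<close> and \<open>(g \<xi>)(h) = \<xi>(g\<^sup>-\<^sup>1 h)\<close>.\<close>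

definition ell2_slice :: "('g \<times> 'k) ell2 \<Rightarrow> 'g \<Rightarrow> 'k ell2" where
  "ell2_slice \<xi> h = ell2_of (\<lambda>k. ell2_coord \<xi> (h, k))"

definition induced_rep ::
    "('g::group_add \<Rightarrow> 'a \<Rightarrow> 'a) \<Rightarrow> ('a \<Rightarrow> 'k op) \<Rightarrow> 'a \<Rightarrow> ('g \<times> 'k) op" where
  "induced_rep \<alpha> \<pi> a = Blinfun (\<lambda>\<xi>. ell2_of (\<lambda>(h, k).
    ell2_coord (blinfun_apply (\<pi> (\<alpha> (- h) a)) (ell2_slice \<xi> h)) k))"

definition left_translation :: "'g::group_add \<Rightarrow> ('g \<times> 'k) op" where
  "left_translation g = Blinfun (\<lambda>\<xi>. ell2_of (\<lambda>(h, k). ell2_coord \<xi> (- g + h, k)))"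

definition reduced_crossed_product ::
    "'a star_algebra \<Rightarrow> ('g::group_add \<Rightarrow> 'a \<Rightarrow> 'a) \<Rightarrow>
      (('a \<Rightarrow> ('a \<times> nat) op) \<Rightarrow> ('g \<times> 'a \<times> nat) op) star_algebra" where
  "reduced_crossed_product A \<alpha> = cstar_generated (op_family_algebra (star_reps A))
    {family_on (star_reps A) (\<lambda>\<pi>. induced_rep \<alpha> \<pi> a o\<^sub>L left_translation g) | a g. a \<in> elems A}"


section \<open>Inverse semigroups and their C*-algebras\<close>

record 's semigrp =
  selems :: "'s set"
  sgmult :: "'s \<Rightarrow> 's \<Rightarrow> 's"

definition inverse_semigroup :: "'s semigrp \<Rightarrow> bool" where
  "inverse_semigroup S \<longleftrightarrow>
    (\<forall>s\<in>selems S. \<forall>t\<in>selems S. sgmult S s t \<in> selems S) \<and>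
    (\<forall>r\<in>selems S. \<forall>s\<in>selems S. \<forall>t\<in>selems S. sgmult S (sgmult S r s) t = sgmult S r (sgmult S s t)) \<and>
    (\<forall>s\<in>selems S. \<exists>!t. t \<in> selems S \<and> sgmult S (sgmult S s t) s = s \<and> sgmult S (sgmult S t s) t = t)"

definition sginv :: "'s semigrp \<Rightarrow> 's \<Rightarrow> 's" where
  "sginv S s = (THE t. t \<in> selems S \<and> sgmult S (sgmult S s t) s = s \<and> sgmult S (sgmult S t s) t = t)"

definition idempotents :: "'s semigrp \<Rightarrow> 's set" where
  "idempotents S = {e \<in> selems S. sgmult S e e = e}"

definition sgle :: "'s semigrp \<Rightarrow> 's \<Rightarrow> 's \<Rightarrow> bool" where
  "sgle S s t \<longleftrightarrow> (\<exists>e\<in>idempotents S. s = sgmult S e t)"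

definition sigma_rel :: "'s semigrp \<Rightarrow> ('s \<times> 's) set" where
  "sigma_rel S = {(s, t). s \<in> selems S \<and> t \<in> selems S \<and> (\<exists>r\<in>selems S. sgle S r s \<and> sgle S r t)}"

text \<open>The elements of the maximal group image are the classes of \<^const>\<open>sigma_rel\<close>, and the fibre of
  the quotient map over such an element is the class itself.\<close>

definition F_inverse :: "'s semigrp \<Rightarrow> bool" where
  "F_inverse S \<longleftrightarrow> inverse_semigroup S \<and>
    (\<forall>C \<in> selems S // sigma_rel S. \<forall>e\<in>idempotents S. \<forall>f\<in>idempotents S.
      let D = C \<inter> {sgmult S (sgmult S e s) f | s. s \<in> selems S}
      in \<exists>m\<in>D. \<forall>t\<in>D. sgle S t m)"

text \<open>The operators of such a representation automatically are partial isometries, since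
  \<open>\<pi>(s) \<pi>(s)\<^sup>* \<pi>(s) = \<pi>(s s\<^sup>* s) = \<pi>(s)\<close>.\<close>

definition semigroup_reps :: "'s semigrp \<Rightarrow> ('s \<Rightarrow> 'k op) set" where
  "semigroup_reps S = {\<pi>.
    (\<forall>s\<in>selems S. clinear_op (\<pi> s)) \<and>
    (\<forall>s\<in>selems S. \<forall>t\<in>selems S. \<pi> (sgmult S s t) = \<pi> s o\<^sub>L \<pi> t) \<and>
    (\<forall>s\<in>selems S. \<pi> (sginv S s) = op_adj (\<pi> s))}"

definition semigroup_cstar :: "'s semigrp \<Rightarrow> (('s \<Rightarrow> ('s \<times> nat) op) \<Rightarrow> ('s \<times> nat) op) star_algebra" where
  "semigroup_cstar S = cstar_generated (op_family_algebra (semigroup_reps S))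
    {family_on (semigroup_reps S) (\<lambda>\<pi>. \<pi> s) | s. s \<in> selems S}"

text \<open>The operators live on \<open>\<ell>\<^sup>2(S)\<close>, extended by \<open>0\<close> to the square summable families on the
  whole type.\<close>

definition left_regular :: "'s semigrp \<Rightarrow> 's \<Rightarrow> 's op" where
  "left_regular S s = (THE T. clinear_op T \<and>
    (\<forall>t. blinfun_apply T (ell2_delta t) =
      (if t \<in> selems S \<and> sgle S (sgmult S t (sginv S t)) (sgmult S (sginv S s) s)
       then ell2_delta (sgmult S s t) else 0)))"

definition reduced_semigroup_cstar :: "'s semigrp \<Rightarrow> 's op star_algebra" where
  "reduced_semigroup_cstar S = cstar_generated op_algebra (left_regular S ` selems S)"


section \<open>McAlister triples\<close>

definition is_meet :: "'x::order \<Rightarrow> 'x \<Rightarrow> 'x \<Rightarrow> bool" where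
  "is_meet x y z \<longleftrightarrow> z \<le> x \<and> z \<le> y \<and> (\<forall>w. w \<le> x \<and> w \<le> y \<longrightarrow> w \<le> z)"

definition meet :: "'x::order \<Rightarrow> 'x \<Rightarrow> 'x" where
  "meet x y = (THE z. is_meet x y z)"

text \<open>The poset \<open>X\<close> and the group \<open>G\<close> are the types \<open>'x\<close> and \<open>'g\<close>. As \<open>Y\<close> is a downset, meets in
  \<open>Y\<close> are the same as meets in \<open>X\<close> of elements of \<open>Y\<close>.\<close>

definition McAlister_triple :: "('g::group_add \<Rightarrow> 'x::order \<Rightarrow> 'x) \<Rightarrow> 'x set \<Rightarrow> bool" where
  "McAlister_triple act Y \<longleftrightarrow>
    (\<forall>x. act 0 x = x) \<and> (\<forall>g h x. act (g + h) x = act g (act h x)) \<and>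
    (\<forall>g x y. x \<le> y \<longrightarrow> act g x \<le> act g y) \<and>
    (\<forall>x y. y \<in> Y \<and> x \<le> y \<longrightarrow> x \<in> Y) \<and>
    (\<forall>x\<in>Y. \<forall>y\<in>Y. \<exists>z. is_meet x y z) \<and>
    (\<Union>g. act g ` Y) = UNIV \<and>
    (\<forall>g. act g ` Y \<inter> Y \<noteq> {})"

definition McAlister_semigroup :: "('g::group_add \<Rightarrow> 'x::order \<Rightarrow> 'x) \<Rightarrow> 'x set \<Rightarrow> ('x \<times> 'g) semigrp" where
  "McAlister_semigroup act Y =
    \<lparr>selems = {(y, g). y \<in> Y \<and> act (- g) y \<in> Y},
     sgmult = (\<lambda>(y, g) (y', g'). (act g (meet (act (- g) y) y'), g + g'))\<rparr>"

definition meet_semigroup :: "'x::order semigrp" where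
  "meet_semigroup = \<lparr>selems = UNIV, sgmult = meet\<rparr>"

text \<open>Homomorphisms to \<open>{0, 1}\<close> are encoded as predicates; the topology of pointwise convergence is the
  product topology that the library puts on \<^typ>\<open>'x \<Rightarrow> bool\<close>, \<^typ>\<open>bool\<close> being discrete.\<close>

definition characters :: "('x::order \<Rightarrow> bool) set" where
  "characters = {\<phi>. (\<exists>x. \<phi> x) \<and> (\<forall>x y. \<phi> (meet x y) \<longleftrightarrow> \<phi> x \<and> \<phi> y)}"

definition character_action :: "('g::group_add \<Rightarrow> 'x \<Rightarrow> 'x) \<Rightarrow> 'g \<Rightarrow> ('x \<Rightarrow> bool) \<Rightarrow> 'x \<Rightarrow> bool" where
  "character_action act g \<phi> = (\<lambda>e. \<phi> (act (- g) e))"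

definition C0_action ::
    "('g::group_add \<Rightarrow> 'x \<Rightarrow> 'x) \<Rightarrow> 'g \<Rightarrow> (('x \<Rightarrow> bool) \<Rightarrow> complex) \<Rightarrow> ('x \<Rightarrow> bool) \<Rightarrow> complex" where
  "C0_action act g f = (\<lambda>\<phi>. f (character_action act (- g) \<phi>))"

text \<open>The automorphism of the C*-algebra of the semilattice \<open>X\<close> that sends the generator \<open>x\<close> to the
  generator \<open>g x\<close>: the value at \<open>\<pi>\<close> of the family representing \<open>g x\<close> is \<open>\<pi>(g x)\<close>, which is the value at
  the representation \<open>\<pi> \<circ> g\<close> of the family representing \<open>x\<close>.\<close>

definition semilattice_cstar_action ::
    "('g \<Rightarrow> 'x \<Rightarrow> 'x) \<Rightarrow> 'g \<Rightarrow> (('x \<Rightarrow> 'k op) \<Rightarrow> 'k op) \<Rightarrow> ('x \<Rightarrow> 'k op) \<Rightarrow> 'k op" where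
  "semilattice_cstar_action act g a = (\<lambda>\<pi>. a (\<lambda>x. \<pi> (act g x)))"

end

theory Submission
  imports Defs
begin

text \<open>The F-inverse property makes \<open>X\<close> a semilattice. Then \<open>C\<^sup>*(S)\<close> and the crossed products are closed
  spans of generators labelled by pairs \<open>(x, g)\<close> that multiply by one and the same rule, so that only norms of
  finite linear combinations have to be compared.

  A covariant pair of representations of \<open>X\<close> and \<open>G\<close> restricts to a representation of \<open>S\<close>. Conversely, for
  a representation \<open>\<rho>\<close> of \<open>S\<close> and indices \<open>i = (y, g)\<close>, \<open>j = (z, h)\<close> in \<open>Y \<times> G\<close>, the kernel
  \<open>\<theta>\<^sub>i\<^sub>j = \<rho>(y \<and> g\<^sup>-\<^sup>1h z, g\<^sup>-\<^sup>1h)\<close> factors as \<open>J\<^sub>i\<^sup>* J\<^sub>j\<close>. Translating the second component of the index is implemented by a unitary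
  representation of \<open>G\<close>, and the range projection of \<open>J\<^sub>i\<close> depends on \<open>g y\<close> only. This is a covariant
  pair that dilates \<open>\<rho>\<close>, so \<open>C\<^sup>*(S)\<close> embeds into \<open>C\<^sup>*(X) \<rtimes> G\<close> as the closed span of
  the generators \<open>(y, g)\<close> with \<open>y\<close> and \<open>g\<^sup>-\<^sup>1 y\<close> in \<open>Y\<close>. With \<open>E\<close> the closed span of those with \<open>y\<close> in \<open>Y\<close>,
  the products \<open>E E\<^sup>*\<close> span this subalgebra, and \<open>E\<^sup>* E\<close> spans the crossed product because \<open>G Y = X\<close>.

  In the reduced case, both norms are the supremum over \<open>t\<close> of the norms of the operators
  \<open>(b\<^sub>t \<zeta>)(h) = [h t \<le> x] \<zeta>(g\<^sup>-\<^sup>1 h)\<close> on \<open>\<ell>\<^sup>2(G)\<close>: the regular representation of \<open>S\<close> is their sum over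
  \<open>t\<close> in \<open>Y\<close>, and translating \<open>t\<close> by \<open>G\<close> yields a unitarily equivalent operator. Finally, over finitely
  many elements a representation of \<open>X\<close> is a sum of characters, which identifies \<open>C\<^sup>*(X)\<close> and
  \<open>C\<^sub>0\<close> of the character space as far as covariant representations are concerned.\<close>

section \<open>Operators between spaces of square summable families\<close>

text \<open>One obstacle that shapes the proof is the size of the Hilbert spaces. Each universal
  algebra is defined through representations over one fixed index type, and these types differ from
  algebra to algebra, so a norm computed over one type has to bound representations over another.
  This is achieved one test vector at a time: countably many operators and a vector generate a
  separable reducing subspace, which fits into every infinite index type
  (\<open>countable_compression\<close>). Countability of \<open>S\<close> is what makes this work,
  and it also provides the enumeration behind the factorization of kernels.

  Another obstacle is that units may be missing: \<open>Y\<close> may have no top element. Therefore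
  the bimodule is a closed subspace rather than a multiple of the algebra by a projection, and a
  representation is compared with its dilation on one finite combination and one vector at a time.
  Contractivity of homomorphisms and the square roots needed for positivity both come from iterating
  \<open>y\<close> to \<open>(a + y y) / 2\<close>, whose fixed point, formally
  \<open>1 - sqrt (1 - a)\<close>, makes sense without a unit.\<close>

abbreviation cip :: "'k ell2 \<Rightarrow> 'k ell2 \<Rightarrow> complex" (\<open>\<langle>_ | _\<rangle>\<close>)
  where "\<langle>x | y\<rangle> \<equiv> ell2_cinner x y"

abbreviation cscale (infixr \<open>*\<^sub>c\<close> 75) where "c *\<^sub>c x \<equiv> ell2_scale c x"

lemma ell2_eqI: "(\<And>k. ell2_coord x k = ell2_coord y k) \<Longrightarrow> x = y"
  by (simp add: ell2_coord_inject[symmetric] fun_eq_iff)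

lemma ell2_coord_of:
  "(\<lambda>k. (norm (f k))\<^sup>2) summable_on UNIV \<Longrightarrow> ell2_coord (ell2_of f) = f"
  by (simp add: ell2_of_inverse)

lemmas coord_simps [simp] = zero_ell2.rep_eq plus_ell2.rep_eq uminus_ell2.rep_eq
  scaleR_ell2.rep_eq ell2_scale.rep_eq ell2_delta.rep_eq ell2_coord_diff

lemma coord_sum: "ell2_coord (sum f F) k = (\<Sum>i\<in>F. ell2_coord (f i) k)"
  by (induction F rule: infinite_finite_induct) simp_all

lemma cscale_simps [simp]:
  "c *\<^sub>c (0 :: 'k ell2) = 0" "0 *\<^sub>c (x :: 'k ell2) = 0" "1 *\<^sub>c (x :: 'k ell2) = x"
  "c *\<^sub>c d *\<^sub>c (x :: 'k ell2) = (c * d) *\<^sub>c x"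
  by (auto intro!: ell2_eqI)

lemma cscale_add: "c *\<^sub>c (x + y) = c *\<^sub>c x + c *\<^sub>c y"
  and cscale_diff: "c *\<^sub>c (x - y) = c *\<^sub>c x - c *\<^sub>c y"
  and cscale_add_left: "(c + d) *\<^sub>c x = c *\<^sub>c x + d *\<^sub>c x"
  and cscale_minus: "c *\<^sub>c (- x) = - (c *\<^sub>c x)"
  and cscale_minus_left: "(- c) *\<^sub>c x = - (c *\<^sub>c x)"
  and cscale_scaleR: "c *\<^sub>c (r *\<^sub>R x) = r *\<^sub>R (c *\<^sub>c x)"
  and scaleR_cscale: "r *\<^sub>R x = complex_of_real r *\<^sub>c x"
  by (auto intro!: ell2_eqI simp: algebra_simps scaleR_conv_of_real)

section \<open>The complex inner product, conjugate linear in its first argument\<close>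

lemma cinner_summable: "(\<lambda>k. cnj (ell2_coord x k) * ell2_coord y k) summable_on UNIV"
  by (rule abs_summable_summable)
    (use square_summable_prod[OF ell2_coord_summable ell2_coord_summable] in \<open>simp add: norm_mult\<close>)

lemma cinner_add_right: "\<langle>x | y + z\<rangle> = \<langle>x | y\<rangle> + \<langle>x | z\<rangle>"
  by (simp add: ell2_cinner_def distrib_left infsum_add cinner_summable)

lemma cinner_scale_right [simp]: "\<langle>x | c *\<^sub>c y\<rangle> = c * \<langle>x | y\<rangle>"
  unfolding ell2_cinner_def
  by (subst infsum_cmult_right'[symmetric]) (auto intro!: infsum_cong simp: algebra_simps)

lemma cinner_commute: "\<langle>x | y\<rangle> = cnj \<langle>y | x\<rangle>"
  unfolding ell2_cinner_def infsum_cnj[symmetric] by (simp add: mult.commute)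

lemma cinner_add_left: "\<langle>x + y | z\<rangle> = \<langle>x | z\<rangle> + \<langle>y | z\<rangle>"
  by (metis cinner_add_right cinner_commute complex_cnj_add)

lemma cinner_scale_left [simp]: "\<langle>c *\<^sub>c x | y\<rangle> = cnj c * \<langle>x | y\<rangle>"
  by (metis cinner_scale_right cinner_commute complex_cnj_mult)

lemma cinner_zero [simp]: "\<langle>0 | y\<rangle> = 0" "\<langle>x | 0\<rangle> = 0"
  by (simp_all add: ell2_cinner_def)

lemma cinner_minus [simp]: "\<langle>- x | y\<rangle> = - \<langle>x | y\<rangle>" "\<langle>x | - y\<rangle> = - \<langle>x | y\<rangle>"
  using cinner_scale_left[of "-1" x y] cinner_scale_right[of x "-1" y]
  by (simp_all add: cscale_minus_left)

lemma cinner_diff_left: "\<langle>x - y | z\<rangle> = \<langle>x | z\<rangle> - \<langle>y | z\<rangle>"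
  and cinner_diff_right: "\<langle>z | x - y\<rangle> = \<langle>z | x\<rangle> - \<langle>z | y\<rangle>"
  using cinner_add_left[of x "- y" z] cinner_add_right[of z x "- y"] by simp_all

lemma cinner_sum_left: "\<langle>sum f F | z\<rangle> = (\<Sum>i\<in>F. \<langle>f i | z\<rangle>)"
  and cinner_sum_right: "\<langle>z | sum f F\<rangle> = (\<Sum>i\<in>F. \<langle>z | f i\<rangle>)"
  by (induction F rule: infinite_finite_induct) (simp_all add: cinner_add_left cinner_add_right)

lemma inner_eq_Re_cinner: "inner x y = Re \<langle>x | y\<rangle>"
proof -
  have "Re \<langle>x | y\<rangle> = (\<Sum>\<^sub>\<infinity>k. Re (cnj (ell2_coord x k) * ell2_coord y k))"
    unfolding ell2_cinner_def by (rule infsum_Re[OF cinner_summable, symmetric])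
  then show ?thesis by (simp add: inner_ell2_def inner_complex_def)
qed

lemma cinner_self: "\<langle>x | x\<rangle> = of_real ((norm x)\<^sup>2)"
proof -
  have "\<langle>x | x\<rangle> \<in> \<real>"
    unfolding Reals_cnj_iff by (rule cinner_commute[symmetric])
  then have "\<langle>x | x\<rangle> = of_real (Re \<langle>x | x\<rangle>)" by simp
  then show ?thesis by (simp add: power2_norm_eq_inner inner_eq_Re_cinner)
qed

lemma cinner_self_eq_0 [simp]: "\<langle>x | x\<rangle> = 0 \<longleftrightarrow> x = 0"
  by (simp add: cinner_self)

lemma norm_eq_cinner: "(norm x)\<^sup>2 = Re \<langle>x | x\<rangle>"
  by (simp add: cinner_self)

lemma norm_cscale [simp]: "norm (c *\<^sub>c x) = cmod c * norm x"
proof -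
  have "complex_of_real ((norm (c *\<^sub>c x))\<^sup>2) = c * cnj c * complex_of_real ((norm x)\<^sup>2)"
    unfolding cinner_self[symmetric] by simp
  also have "\<dots> = complex_of_real ((cmod c * norm x)\<^sup>2)"
    by (simp only: complex_norm_square[symmetric] power_mult_distrib of_real_mult)
  finally have "(norm (c *\<^sub>c x))\<^sup>2 = (cmod c * norm x)\<^sup>2"
    by (simp only: of_real_eq_iff)
  then show ?thesis by (simp add: power2_eq_iff_nonneg)
qed

lemma cinner_Cauchy_Schwarz: "cmod \<langle>x | y\<rangle> \<le> norm x * norm y"
proof (cases "\<langle>x | y\<rangle> = 0")
  case False
  \<comment> \<open>Multiplying \<open>y\<close> by this phase makes the inner product real and
    nonnegative, so that the real Cauchy-Schwarz inequality applies.\<close>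
  let ?c = "cnj (sgn \<langle>x | y\<rangle>)"
  have "cmod \<langle>x | y\<rangle> = inner x (?c *\<^sub>c y)"
    using False by (simp add: inner_eq_Re_cinner sgn_div_norm complex_norm_square[symmetric]
      power2_eq_square divide_simps) (simp add: cmod_power2[symmetric] power2_eq_square[symmetric])
  also have "\<dots> \<le> norm x * norm (?c *\<^sub>c y)" by (rule norm_cauchy_schwarz)
  also have "\<dots> = norm x * norm y" using False by (simp add: norm_sgn)
  finally show ?thesis .
qed simp

lemma cinner_extI: "(\<And>y. \<langle>x | y\<rangle> = \<langle>x' | y\<rangle>) \<Longrightarrow> x = x'"
  by (metis cinner_diff_left cinner_self_eq_0 eq_iff_diff_eq_0)

lemma cinner_extI_right: "(\<And>y. \<langle>y | x\<rangle> = \<langle>y | x'\<rangle>) \<Longrightarrow> x = x'"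
  by (metis cinner_commute cinner_extI)

section \<open>Basis vectors and density of finite sums\<close>

lemma cinner_delta: "\<langle>ell2_delta k | x\<rangle> = ell2_coord x k"
proof -
  have "\<langle>ell2_delta k | x\<rangle> = (\<Sum>\<^sub>\<infinity>j\<in>{k}. cnj (ell2_coord (ell2_delta k) j) * ell2_coord x j)"
    unfolding ell2_cinner_def by (rule infsum_cong_neutral) auto
  then show ?thesis by simp
qed

lemma norm_delta [simp]: "norm (ell2_delta k) = 1"
proof -
  have "(norm (ell2_delta k))\<^sup>2 = 1\<^sup>2"
    unfolding norm_eq_cinner[of "ell2_delta k"] by (simp add: cinner_delta)
  then show ?thesis by (simp only: power2_eq_iff_nonneg norm_ge_zero zero_le_one)
qed

text \<open>By orthogonality, the squared distance from \<open>x\<close> to a partial sum is the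
  tail of the series for its squared norm.\<close>

lemma tendsto_ell2_partial_sums:
  "((\<lambda>F. \<Sum>k\<in>F. ell2_coord x k *\<^sub>c ell2_delta k) \<longlongrightarrow> x) (finite_subsets_at_top UNIV)"
proof -
  let ?S = "\<lambda>F. \<Sum>k\<in>F. ell2_coord x k *\<^sub>c ell2_delta k"
  have eq: "(norm (x - ?S F))\<^sup>2 = (norm x)\<^sup>2 - (\<Sum>k\<in>F. (norm (ell2_coord x k))\<^sup>2)" if "finite F" for F
  proof -
    have xS: "\<langle>x | ?S F\<rangle> = of_real (\<Sum>k\<in>F. (norm (ell2_coord x k))\<^sup>2)"
      unfolding cinner_sum_right of_real_sum
      by (intro sum.cong refl)
         (simp add: cinner_commute[of x] cinner_delta complex_norm_square del: of_real_power)
    have SS: "\<langle>?S F | ?S F\<rangle> = of_real (\<Sum>k\<in>F. (norm (ell2_coord x k))\<^sup>2)"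
      unfolding cinner_sum_left of_real_sum using that
      by (intro sum.cong refl)
         (simp add: cinner_delta coord_sum complex_norm_square mult.commute if_distrib sum.delta del: of_real_power cong: if_cong)
    have "\<langle>?S F | x\<rangle> = of_real (\<Sum>k\<in>F. (norm (ell2_coord x k))\<^sup>2)"
      using xS by (metis cinner_commute complex_cnj_complex_of_real)
    with xS SS show ?thesis
      unfolding norm_eq_cinner[of "x - ?S F"] by (simp add: cinner_diff_left cinner_diff_right norm_eq_cinner)
  qed
  have "((\<lambda>F. \<Sum>k\<in>F. (norm (ell2_coord x k))\<^sup>2) \<longlongrightarrow> (norm x)\<^sup>2) (finite_subsets_at_top UNIV)"
    using has_sum_infsum[OF ell2_coord_summable[of x]] unfolding norm_ell2_squared has_sum_def .
  then have "((\<lambda>F. (norm x)\<^sup>2 - (\<Sum>k\<in>F. (norm (ell2_coord x k))\<^sup>2)) \<longlongrightarrow> 0) (finite_subsets_at_top UNIV)"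
    by (drule_tac tendsto_diff[OF tendsto_const[of "(norm x)\<^sup>2"]]) simp
  then have "((\<lambda>F. (norm (x - ?S F))\<^sup>2) \<longlongrightarrow> 0) (finite_subsets_at_top UNIV)"
    by (rule Lim_transform_eventually)
      (use eq in \<open>auto intro!: eventually_finite_subsets_at_top_weakI\<close>)
  then have "((\<lambda>F. sqrt ((norm (x - ?S F))\<^sup>2)) \<longlongrightarrow> sqrt 0) (finite_subsets_at_top UNIV)"
    by (rule tendsto_real_sqrt)
  then have "((\<lambda>F. norm (?S F - x)) \<longlongrightarrow> 0) (finite_subsets_at_top UNIV)"
    by (simp add: norm_minus_commute)
  then have "((\<lambda>F. ?S F - x) \<longlongrightarrow> 0) (finite_subsets_at_top UNIV)"
    by (rule tendsto_norm_zero_cancel)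
  then show ?thesis by (rule LIM_zero_cancel)
qed

text \<open>Phrased for a closed set, so that it directly extends identities between bounded maps
  from the basis vectors to all vectors.\<close>

lemma ell2_dense_induct:
  assumes "closed C" "0 \<in> C" "\<And>x c k. x \<in> C \<Longrightarrow> x + c *\<^sub>c ell2_delta k \<in> C"
  shows "x \<in> C"
proof -
  have "(\<Sum>k\<in>F. ell2_coord x k *\<^sub>c ell2_delta k) \<in> C" for F
    by (induction F rule: infinite_finite_induct) (simp_all add: assms add.commute[of "_ *\<^sub>c _"])
  then show ?thesis
    by (intro Lim_in_closed_set[OF assms(1) _ _ tendsto_ell2_partial_sums]) simp_all
qed

text \<open>\<open>clinear_op\<close> covers only operators on a single space, but compressions and
  dilations run between spaces over different index types. \<open>adj\<close> below generalizes
  \<open>op_adj\<close> for the same reason.\<close>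

definition clin :: "('k ell2 \<Rightarrow>\<^sub>L 'j ell2) \<Rightarrow> bool" where
  "clin T \<longleftrightarrow> (\<forall>c x. T (c *\<^sub>c x) = c *\<^sub>c T x)"

lemma clinear_op_clin: "clinear_op = clin"
  by (simp add: fun_eq_iff clinear_op_def clin_def)

lemma clinD: "clin T \<Longrightarrow> T (c *\<^sub>c x) = c *\<^sub>c T x"
  by (simp add: clin_def)

lemma clin_intros [intro!, simp]:
  "clin (0 :: 'k ell2 \<Rightarrow>\<^sub>L 'j ell2)" "clin (id_blinfun :: 'k ell2 \<Rightarrow>\<^sub>L 'k ell2)"
  "clin S \<Longrightarrow> clin T \<Longrightarrow> clin (S + T)" "clin S \<Longrightarrow> clin T \<Longrightarrow> clin (S - T)"
  "clin S \<Longrightarrow> clin (- S)" "clin S \<Longrightarrow> clin (r *\<^sub>R S)" "clin S \<Longrightarrow> clin R \<Longrightarrow> clin (S o\<^sub>L R)"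
  by (auto simp: clin_def blinfun.add_left blinfun.diff_left blinfun.minus_left blinfun.scaleR_left
      cscale_add cscale_diff cscale_minus cscale_scaleR)

lemma clin_sum [intro!]: "(\<And>i. i \<in> F \<Longrightarrow> clin (T i)) \<Longrightarrow> clin (sum T F)"
  by (induction F rule: infinite_finite_induct) auto

lemma clin_eqI:
  assumes "clin S" "clin T" "\<And>k. S (ell2_delta k) = T (ell2_delta k)"
  shows "S = T"
proof (rule blinfun_eqI)
  fix x
  have "x \<in> {x. S x = T x}"
    by (rule ell2_dense_induct)
      (auto simp: assms clinD blinfun.add_right intro!: closed_Collect_eq continuous_intros)
  then show "S x = T x" by simp
qed

lemma bounded_linear_cinner_right: "bounded_linear (\<lambda>y. \<langle>x | y\<rangle>)"
  by (rule bounded_linear_intro[where K = "norm x"])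
    (simp_all add: cinner_add_right scaleR_cscale cinner_Cauchy_Schwarz mult.commute[of "norm y" "norm x" for y] scaleR_conv_of_real)

lemmas continuous_on_cinner_right [continuous_intros] =
  bounded_linear.continuous_on[OF bounded_linear_cinner_right]

lemma Blinfun_apply_bound:
  assumes "\<And>x y. f (x + y) = f x + f y" "\<And>c x. f (c *\<^sub>c x) = c *\<^sub>c f x"
    "\<And>x. norm (f x) \<le> K * norm x"
  shows "blinfun_apply (Blinfun f) = f" and "clin (Blinfun f)" and "0 \<le> K \<Longrightarrow> norm (Blinfun f) \<le> K"
proof -
  have "bounded_linear f"
    by (rule bounded_linear_intro[where K = K]) (simp_all add: assms scaleR_cscale mult.commute)
  then show *: "blinfun_apply (Blinfun f) = f" by (rule bounded_linear_Blinfun_apply)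
  show "clin (Blinfun f)" by (simp add: clin_def * assms)
  show "norm (Blinfun f) \<le> K" if "0 \<le> K" by (rule norm_blinfun_bound[OF that]) (simp add: * assms)
qed

definition adj :: "('k ell2 \<Rightarrow>\<^sub>L 'j ell2) \<Rightarrow> ('j ell2 \<Rightarrow>\<^sub>L 'k ell2)" where
  "adj T = (THE T'. \<forall>x y. \<langle>blinfun_apply T' x | y\<rangle> = \<langle>x | T y\<rangle>)"

lemma op_adj_adj: "op_adj = adj"
  by (simp add: fun_eq_iff op_adj_def adj_def)

lemma adjI:
  fixes S :: "'j ell2 \<Rightarrow>\<^sub>L 'k ell2" and T :: "'k ell2 \<Rightarrow>\<^sub>L 'j ell2"
  assumes "\<And>x y. \<langle>S x | y\<rangle> = \<langle>x | T y\<rangle>"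
  shows "adj T = S"
  unfolding adj_def
  by (rule the_equality) (use assms in \<open>auto intro!: blinfun_eqI cinner_extI\<close>)

text \<open>The coordinates of the adjoint are forced by the basis vectors. They are square summable
  because, for a finite truncation \<open>?y\<close> of the candidate, the inner product of
  \<open>T ?y\<close> with \<open>x\<close> equals the squared norm of \<open>?y\<close>, and one
  factor cancels in the Cauchy-Schwarz estimate.\<close>

lemma adj_exists:
  fixes T :: "'k ell2 \<Rightarrow>\<^sub>L 'j ell2"
  assumes T: "clin T"
  shows "\<exists>S. clin S \<and> (\<forall>x y. \<langle>blinfun_apply S x | y\<rangle> = \<langle>x | T y\<rangle>) \<and> norm S \<le> norm T"
proof -
  let ?f = "\<lambda>x k. \<langle>T (ell2_delta k) | x\<rangle>"
  have bound: "(\<Sum>k\<in>F. (cmod (?f x k))\<^sup>2) \<le> (norm T * norm x)\<^sup>2" if "finite F" for F x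
  proof -
    let ?y = "\<Sum>k\<in>F. ?f x k *\<^sub>c ell2_delta k"
    have y: "\<langle>?y | ?y\<rangle> = of_real (\<Sum>k\<in>F. (cmod (?f x k))\<^sup>2)"
      unfolding cinner_sum_left of_real_sum using that
      by (intro sum.cong refl)
         (simp add: cinner_delta coord_sum complex_norm_square mult.commute if_distrib sum.delta del: of_real_power cong: if_cong)
    have "\<langle>T ?y | x\<rangle> = of_real (\<Sum>k\<in>F. (cmod (?f x k))\<^sup>2)"
      unfolding blinfun.sum_right cinner_sum_left of_real_sum
      by (intro sum.cong refl) (simp add: clinD[OF T] complex_norm_square mult.commute del: of_real_power)
    then have "(norm ?y)\<^sup>2 = Re \<langle>T ?y | x\<rangle>" using y by (simp add: norm_eq_cinner)
    also have "\<dots> \<le> norm (T ?y) * norm x"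
      using complex_Re_le_cmod cinner_Cauchy_Schwarz order_trans by blast
    also have "\<dots> \<le> norm T * norm ?y * norm x"
      by (intro mult_right_mono norm_blinfun) simp
    finally have "norm ?y * norm ?y \<le> (norm T * norm x) * norm ?y"
      by (simp add: power2_eq_square algebra_simps)
    then have "norm ?y \<le> norm T * norm x"
      by (cases "?y = 0") (auto dest: mult_right_le_imp_le)
    then have "(norm ?y)\<^sup>2 \<le> (norm T * norm x)\<^sup>2" by (intro power_mono) auto
    with y show ?thesis by (simp add: norm_eq_cinner)
  qed
  have summ: "(\<lambda>k. (norm (?f x k))\<^sup>2) summable_on UNIV" for x
    by (rule nonneg_bdd_above_summable_on) (use bound[of _ x] in \<open>auto intro!: bdd_aboveI\<close>)
  define S where "S x = ell2_of (?f x)" for x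
  have S: "ell2_coord (S x) = ?f x" for x
    unfolding S_def by (rule ell2_coord_of[OF summ])
  have nS: "norm (S x) \<le> norm T * norm x" for x
  proof (rule power2_le_imp_le)
    show "(norm (S x))\<^sup>2 \<le> (norm T * norm x)\<^sup>2"
      unfolding norm_ell2_squared S
      by (rule infsum_le_finite_sums[OF summ]) (use bound in auto)
  qed simp
  have Sadd: "S (x + y) = S x + S y" and Sscale: "S (c *\<^sub>c x) = c *\<^sub>c S x" for x y c
    by (auto intro!: ell2_eqI simp: S cinner_add_right)
  have B: "blinfun_apply (Blinfun S) = S" "clin (Blinfun S)" "norm (Blinfun S) \<le> norm T"
    using Blinfun_apply_bound[of S "norm T", OF Sadd Sscale nS] by simp_all
  have "\<langle>S x | y\<rangle> = \<langle>x | T y\<rangle>" for x y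
  proof -
    have "y \<in> {y. \<langle>S x | y\<rangle> = \<langle>x | T y\<rangle>}"
    proof (rule ell2_dense_induct)
      show "closed {y. \<langle>S x | y\<rangle> = \<langle>x | T y\<rangle>}"
        by (intro closed_Collect_eq continuous_on_cinner_right continuous_intros)
      have "\<langle>S x | ell2_delta k\<rangle> = \<langle>x | T (ell2_delta k)\<rangle>" for k
        by (subst cinner_commute, subst (2) cinner_commute) (simp add: cinner_delta S)
      then show "y + c *\<^sub>c ell2_delta k \<in> {y. \<langle>S x | y\<rangle> = \<langle>x | T y\<rangle>}"
        if "y \<in> {y. \<langle>S x | y\<rangle> = \<langle>x | T y\<rangle>}" for y c k
        using that by (simp add: cinner_add_right blinfun.add_right clinD[OF T])
    qed simp
    then show ?thesis by simp
  qed
  then show ?thesis using B by metis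
qed

lemma cinner_adj: "clin T \<Longrightarrow> \<langle>adj T x | y\<rangle> = \<langle>x | T y\<rangle>"
  by (metis adjI adj_exists)

lemma clin_adj [intro!, simp]: "clin T \<Longrightarrow> clin (adj T)"
  by (metis adjI adj_exists)

lemma norm_adj_le: "clin T \<Longrightarrow> norm (adj T) \<le> norm T"
  by (metis adjI adj_exists)

lemma cinner_adj_right: "clin T \<Longrightarrow> \<langle>x | adj T y\<rangle> = \<langle>T x | y\<rangle>"
  by (metis cinner_adj cinner_commute)

lemma adj_adj [simp]: "clin T \<Longrightarrow> adj (adj T) = T"
  by (intro adjI) (simp add: cinner_adj_right)

lemma norm_adj [simp]: "clin T \<Longrightarrow> norm (adj T) = norm T"
  by (metis adj_adj clin_adj norm_adj_le order_antisym)

lemma adj_comp [simp]: "clin S \<Longrightarrow> clin T \<Longrightarrow> adj (S o\<^sub>L T) = adj T o\<^sub>L adj S"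
  by (intro adjI) (simp add: cinner_adj)

lemma adj_add [simp]: "clin S \<Longrightarrow> clin T \<Longrightarrow> adj (S + T) = adj S + adj T"
  and adj_diff [simp]: "clin S \<Longrightarrow> clin T \<Longrightarrow> adj (S - T) = adj S - adj T"
  by (auto intro!: adjI simp: cinner_adj blinfun.add_left blinfun.diff_left
      cinner_add_left cinner_add_right cinner_diff_left cinner_diff_right)

lemma adj_id [simp]: "adj id_blinfun = id_blinfun" and adj_0 [simp]: "adj 0 = 0"
  by (auto intro!: adjI)

lemma norm_adj_comp_self:
  assumes "clin T" shows "norm (adj T o\<^sub>L T) = (norm T)\<^sup>2"
proof (rule antisym)
  show "norm (adj T o\<^sub>L T) \<le> (norm T)\<^sup>2"
    using norm_blinfun_compose[of "adj T" T] assms by (simp add: power2_eq_square)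
  have "norm (T x) \<le> sqrt (norm (adj T o\<^sub>L T)) * norm x" for x
  proof -
    have "(norm (T x))\<^sup>2 = Re \<langle>(adj T o\<^sub>L T) x | x\<rangle>"
      by (simp add: norm_eq_cinner cinner_adj assms)
    also have "\<dots> \<le> norm ((adj T o\<^sub>L T) x) * norm x"
      using complex_Re_le_cmod cinner_Cauchy_Schwarz order_trans by blast
    also have "\<dots> \<le> norm (adj T o\<^sub>L T) * norm x * norm x"
      by (intro mult_right_mono norm_blinfun) simp
    finally have "(norm (T x))\<^sup>2 \<le> (sqrt (norm (adj T o\<^sub>L T)) * norm x)\<^sup>2"
      by (simp add: power_mult_distrib power2_eq_square[of "norm x"] power2_eq_square[of "norm (T x)"] mult.assoc)
    then show ?thesis by (rule power2_le_imp_le) simp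
  qed
  then have "norm T \<le> sqrt (norm (adj T o\<^sub>L T))" by (intro norm_blinfun_bound) auto
  then show "(norm T)\<^sup>2 \<le> norm (adj T o\<^sub>L T)"
    using power_mono[of "norm T" "sqrt (norm (adj T o\<^sub>L T))" 2] by simp
qed

lemma op_scale_apply [simp]: "clin T \<Longrightarrow> blinfun_apply (op_scale c T) x = c *\<^sub>c T x"
  and clin_op_scale [intro!, simp]: "clin T \<Longrightarrow> clin (op_scale c T)"
proof -
  assume "clin T"
  have "norm (c *\<^sub>c T x) \<le> (cmod c * norm T) * norm x" for x
    using mult_left_mono[OF norm_blinfun[of T x], of "cmod c"] by (simp add: mult.assoc)
  then show "blinfun_apply (op_scale c T) x = c *\<^sub>c T x" "clin (op_scale c T)"
    using Blinfun_apply_bound[of "\<lambda>x. c *\<^sub>c T x" "cmod c * norm T"] \<open>clin T\<close>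
    by (auto simp: op_scale_def blinfun.add_right cscale_add clinD mult.commute)
qed

lemma norm_op_scale [simp]:
  assumes "clin T" shows "norm (op_scale c T) = cmod c * norm T"
proof -
  have le: "norm (op_scale c S) \<le> cmod c * norm S" if "clin S" for c and S :: "'a op"
    using mult_left_mono[OF norm_blinfun[of S], of "cmod c"] that
    by (intro norm_blinfun_bound) (simp_all add: mult.assoc)
  show ?thesis
  proof (cases "c = 0")
    case True
    then have "op_scale c T = 0" using assms by (intro blinfun_eqI) simp
    then show ?thesis using True by simp
  next
    case False
    then have "op_scale (1 / c) (op_scale c T) = T"
      using assms by (intro blinfun_eqI) simp
    then have "norm T \<le> cmod (1 / c) * norm (op_scale c T)"
      using le[of "op_scale c T" "1 / c"] assms by simp
    then show ?thesis using le[OF assms, of c] False by (simp add: norm_divide field_simps)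
  qed
qed

lemma adj_op_scale [simp]: "clin T \<Longrightarrow> adj (op_scale c T) = op_scale (cnj c) (adj T)"
  by (intro adjI) (simp add: cinner_adj)

section \<open>Families over products, changes of index, direct sums\<close>

lemma nonneg_summable_on_Sigma_iff:
  fixes f :: "'a \<times> 'b \<Rightarrow> real"
  assumes "\<And>p. 0 \<le> f p"
  shows "f summable_on UNIV \<longleftrightarrow>
    (\<forall>a. (\<lambda>b. f (a, b)) summable_on UNIV) \<and> (\<lambda>a. \<Sum>\<^sub>\<infinity>b. f (a, b)) summable_on UNIV"
proof
  assume f: "f summable_on UNIV"
  then have f': "(\<lambda>(a, b). f (a, b)) summable_on (SIGMA a:UNIV. UNIV)" by simp
  have "(\<lambda>b. f (a, b)) summable_on UNIV" for a
    using summable_on_reindex[of "Pair a" UNIV f] summable_on_subset_banach[OF f, of "range (Pair a)"]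
    by (simp add: o_def inj_on_def)
  moreover have "(\<lambda>a. \<Sum>\<^sub>\<infinity>b. f (a, b)) summable_on UNIV"
    using summable_on_Sigma_banach[of "\<lambda>a b. f (a, b)" UNIV "\<lambda>_. UNIV"] f' by simp
  ultimately show "(\<forall>a. (\<lambda>b. f (a, b)) summable_on UNIV) \<and> (\<lambda>a. \<Sum>\<^sub>\<infinity>b. f (a, b)) summable_on UNIV"
    by simp
next
  assume *: "(\<forall>a. (\<lambda>b. f (a, b)) summable_on UNIV) \<and> (\<lambda>a. \<Sum>\<^sub>\<infinity>b. f (a, b)) summable_on UNIV"
  have "f summable_on (SIGMA a:UNIV. UNIV)"
    by (rule summable_on_SigmaI[where g = "\<lambda>a. \<Sum>\<^sub>\<infinity>b. f (a, b)"]) (use * assms in \<open>auto\<close>)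
  then show "f summable_on UNIV" by simp
qed

lemma nonneg_infsum_product:
  fixes f :: "'a \<times> 'b \<Rightarrow> real"
  assumes "f summable_on UNIV"
  shows "infsum f UNIV = (\<Sum>\<^sub>\<infinity>a. \<Sum>\<^sub>\<infinity>b. f (a, b))"
  using infsum_Sigma'_banach[of "\<lambda>a b. f (a, b)" UNIV "\<lambda>_. UNIV"] assms by simp

text \<open>One construction covers all changes of index: embeddings, columns, translations, fibre
  operators and the regular representation are composition with a map \<open>p\<close> that is
  injective on \<open>D\<close>, extended by zero. Injectivity on \<open>D\<close> makes it a
  contraction and is therefore the standing hypothesis of its lemmas.\<close>

definition pmap_op :: "('j \<Rightarrow> bool) \<Rightarrow> ('j \<Rightarrow> 'k) \<Rightarrow> 'k ell2 \<Rightarrow>\<^sub>L 'j ell2" where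
  "pmap_op D p = Blinfun (\<lambda>\<xi>. ell2_of (\<lambda>j. if D j then ell2_coord \<xi> (p j) else 0))"

lemma
  fixes D :: "'j \<Rightarrow> bool" and p :: "'j \<Rightarrow> 'k"
  assumes inj: "inj_on p {j. D j}"
  shows coord_pmap_op: "ell2_coord (pmap_op D p \<xi>) j = (if D j then ell2_coord \<xi> (p j) else 0)"
    and clin_pmap_op: "clin (pmap_op D p)"
    and norm_pmap_op: "norm (pmap_op D p) \<le> 1"
proof -
  let ?h = "\<lambda>\<xi> j. if D j then ell2_coord \<xi> (p j) else 0"
  have s1: "(\<lambda>j. (norm (ell2_coord \<xi> (p j)))\<^sup>2) summable_on {j. D j}" for \<xi>
    using summable_on_reindex[OF inj, of "\<lambda>k. (norm (ell2_coord \<xi> k))\<^sup>2"]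
      summable_on_subset_banach[OF ell2_coord_summable, of "p ` {j. D j}" \<xi>] by (simp add: o_def)
  have s: "(\<lambda>j. (norm (?h \<xi> j))\<^sup>2) summable_on UNIV" for \<xi>
  proof -
    have "(\<lambda>j. (norm (?h \<xi> j))\<^sup>2) summable_on UNIV
        \<longleftrightarrow> (\<lambda>j. (norm (ell2_coord \<xi> (p j)))\<^sup>2) summable_on {j. D j}"
      by (rule summable_on_cong_neutral) auto
    then show ?thesis using s1 by blast
  qed
  define f where "f \<xi> = ell2_of (?h \<xi>)" for \<xi>
  have f: "ell2_coord (f \<xi>) = ?h \<xi>" for \<xi>
    unfolding f_def by (rule ell2_coord_of[OF s])
  have "(norm (f \<xi>))\<^sup>2 \<le> (norm \<xi>)\<^sup>2" for \<xi>
  proof -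
    have "(norm (f \<xi>))\<^sup>2 = (\<Sum>\<^sub>\<infinity>j\<in>{j. D j}. (norm (ell2_coord \<xi> (p j)))\<^sup>2)"
      unfolding norm_ell2_squared f by (rule infsum_cong_neutral) auto
    also have "\<dots> = (\<Sum>\<^sub>\<infinity>k\<in>p ` {j. D j}. (norm (ell2_coord \<xi> k))\<^sup>2)"
      using infsum_reindex[OF inj, of "\<lambda>k. (norm (ell2_coord \<xi> k))\<^sup>2"] by (simp add: o_def)
    also have "\<dots> \<le> (norm \<xi>)\<^sup>2"
      unfolding norm_ell2_squared
      by (rule infsum_mono2) (auto intro: ell2_coord_summable summable_on_subset_banach[OF ell2_coord_summable])
    finally show ?thesis .
  qed
  then have n: "norm (f \<xi>) \<le> 1 * norm \<xi>" for \<xi>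
    by (metis mult_1 norm_ge_zero power2_le_imp_le)
  have add: "f (x + y) = f x + f y" and scale: "f (c *\<^sub>c x) = c *\<^sub>c f x" for x y c
    by (auto intro!: ell2_eqI simp: f)
  have B: "blinfun_apply (Blinfun f) = f" "clin (Blinfun f)" "norm (Blinfun f) \<le> 1"
    using Blinfun_apply_bound[of f 1, OF add scale n] by simp_all
  have "pmap_op D p = Blinfun f" by (simp add: pmap_op_def f_def[abs_def])
  with B show "ell2_coord (pmap_op D p \<xi>) j = (if D j then ell2_coord \<xi> (p j) else 0)"
    "clin (pmap_op D p)" "norm (pmap_op D p) \<le> 1"
    by (simp_all add: f)
qed

lemma cinner_pmap_op:
  assumes inj: "inj_on p {j. D j}" and surj: "p ` {j. D j} = UNIV"
  shows "\<langle>pmap_op D p x | pmap_op D p y\<rangle> = \<langle>x | y\<rangle>"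
proof -
  have "\<langle>pmap_op D p x | pmap_op D p y\<rangle>
      = (\<Sum>\<^sub>\<infinity>j\<in>{j. D j}. cnj (ell2_coord x (p j)) * ell2_coord y (p j))"
    unfolding ell2_cinner_def by (rule infsum_cong_neutral) (auto simp: coord_pmap_op[OF inj])
  also have "\<dots> = (\<Sum>\<^sub>\<infinity>k\<in>p ` {j. D j}. cnj (ell2_coord x k) * ell2_coord y k)"
    using infsum_reindex[OF inj, of "\<lambda>k. cnj (ell2_coord x k) * ell2_coord y k"] by (simp add: o_def)
  finally show ?thesis by (simp add: surj ell2_cinner_def)
qed

definition index_embedding :: "('k \<Rightarrow> 'j) \<Rightarrow> 'k ell2 \<Rightarrow>\<^sub>L 'j ell2" where
  "index_embedding \<iota> = pmap_op (\<lambda>j. j \<in> range \<iota>) (inv \<iota>)"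

lemma
  assumes "inj \<iota>"
  shows clin_index_embedding [simp]: "clin (index_embedding \<iota>)"
    and cinner_index_embedding: "\<langle>index_embedding \<iota> x | index_embedding \<iota> y\<rangle> = \<langle>x | y\<rangle>"
    and coord_index_embedding: "ell2_coord (index_embedding \<iota> x) j = (if j \<in> range \<iota> then ell2_coord x (inv \<iota> j) else 0)"
    and norm_index_embedding: "norm (index_embedding \<iota> x) = norm x"
proof -
  have i: "inj_on (inv \<iota>) {j. j \<in> range \<iota>}" "inv \<iota> ` {j. j \<in> range \<iota>} = UNIV"
    using assms by (auto simp: inj_on_inv_into image_image)
  show "clin (index_embedding \<iota>)" unfolding index_embedding_def by (rule clin_pmap_op[OF i(1)])
  show c: "\<langle>index_embedding \<iota> x | index_embedding \<iota> y\<rangle> = \<langle>x | y\<rangle>" for x y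
    unfolding index_embedding_def using i by (rule cinner_pmap_op)
  show "ell2_coord (index_embedding \<iota> x) j = (if j \<in> range \<iota> then ell2_coord x (inv \<iota> j) else 0)"
    unfolding index_embedding_def by (rule coord_pmap_op[OF i(1)])
  have "(norm (index_embedding \<iota> x))\<^sup>2 = (norm x)\<^sup>2"
    unfolding norm_eq_cinner c ..
  then show "norm (index_embedding \<iota> x) = norm x" by simp
qed

lemma cinner_eq_0_disjoint:
  assumes "\<And>k. ell2_coord x k = 0 \<or> ell2_coord y k = 0"
  shows "\<langle>x | y\<rangle> = 0"
  unfolding ell2_cinner_def using assms by (intro infsum_0) auto

lemma ell2_coord_slice [simp]: "ell2_coord (ell2_slice \<xi> h) k = ell2_coord \<xi> (h, k)"
proof -
  have "(\<lambda>k. (norm (ell2_coord \<xi> (h, k)))\<^sup>2) summable_on UNIV"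
    using nonneg_summable_on_Sigma_iff[of "\<lambda>p. (norm (ell2_coord \<xi> p))\<^sup>2"] ell2_coord_summable[of \<xi>]
    by auto
  then show ?thesis by (simp add: ell2_slice_def ell2_coord_of)
qed

lemma norm2_slices:
  shows "(\<lambda>h. (norm (ell2_slice \<xi> h))\<^sup>2) summable_on UNIV"
    and "(norm \<xi>)\<^sup>2 = (\<Sum>\<^sub>\<infinity>h. (norm (ell2_slice \<xi> h))\<^sup>2)"
  using nonneg_summable_on_Sigma_iff[of "\<lambda>p. (norm (ell2_coord \<xi> p))\<^sup>2"] ell2_coord_summable[of \<xi>]
    nonneg_infsum_product[OF ell2_coord_summable[of \<xi>]]
  by (simp_all add: norm_ell2_squared)

lemma slice_simps [simp]:
  "ell2_slice (\<xi> + \<eta>) h = ell2_slice \<xi> h + ell2_slice \<eta> h"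
  "ell2_slice (c *\<^sub>c \<xi>) h = c *\<^sub>c ell2_slice \<xi> h"
  "ell2_slice 0 h = 0"
  by (auto intro!: ell2_eqI)

lemma slices_eqI: "(\<And>h. ell2_slice \<xi> h = ell2_slice \<eta> h) \<Longrightarrow> \<xi> = \<eta>"
  by (metis ell2_coord_slice ell2_eqI surj_pair)

text \<open>The direct sum of the operators \<open>B h\<close> over the fibres \<open>h\<close>. The
  body has the shape of \<open>induced_rep\<close>, which thereby becomes an instance.\<close>

definition diag_op :: "('g \<Rightarrow> 'k op) \<Rightarrow> ('g \<times> 'k) op" where
  "diag_op B = Blinfun (\<lambda>\<xi>. ell2_of (\<lambda>(h, k). ell2_coord (B h (ell2_slice \<xi> h)) k))"

lemma
  fixes B :: "'g \<Rightarrow> 'k op"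
  assumes B: "\<And>h. clin (B h)" "\<And>h. norm (B h) \<le> M"
  shows slice_diag_op: "ell2_slice (diag_op B \<xi>) h = B h (ell2_slice \<xi> h)"
    and clin_diag_op: "clin (diag_op B)"
    and norm_diag_op: "norm (diag_op B) \<le> M"
proof -
  have M: "0 \<le> M" using B(2)[of undefined] norm_ge_zero order_trans by blast
  let ?g = "\<lambda>\<xi> p. case p of (h, k) \<Rightarrow> ell2_coord (B h (ell2_slice \<xi> h)) k"
  have le: "(norm (B h (ell2_slice \<xi> h)))\<^sup>2 \<le> M\<^sup>2 * (norm (ell2_slice \<xi> h))\<^sup>2" for h \<xi>
    using norm_blinfun[of "B h" "ell2_slice \<xi> h"] mult_right_mono[OF B(2)[of h], of "norm (ell2_slice \<xi> h)"]
    by (simp flip: power_mult_distrib add: power_mono)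
  have summ1: "(\<lambda>h. (norm (B h (ell2_slice \<xi> h)))\<^sup>2) summable_on UNIV" for \<xi>
    by (rule summable_on_comparison_test[OF summable_on_cmult_right[OF norm2_slices(1)[of \<xi>], of "M\<^sup>2"]])
      (use le in auto)
  have summ: "(\<lambda>p. (norm (?g \<xi> p))\<^sup>2) summable_on UNIV" for \<xi>
    by (subst nonneg_summable_on_Sigma_iff)
      (use summ1[of \<xi>] in \<open>auto simp: norm_ell2_squared intro: ell2_coord_summable\<close>)
  define f where "f \<xi> = ell2_of (?g \<xi>)" for \<xi>
  have f: "ell2_coord (f \<xi>) = ?g \<xi>" for \<xi>
    unfolding f_def by (rule ell2_coord_of[OF summ])
  have sf: "ell2_slice (f \<xi>) h = B h (ell2_slice \<xi> h)" for \<xi> h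
    by (rule ell2_eqI) (simp add: f)
  have "(norm (f \<xi>))\<^sup>2 \<le> (M * norm \<xi>)\<^sup>2" for \<xi>
    unfolding power_mult_distrib norm2_slices(2)[of "f \<xi>"] norm2_slices(2)[of \<xi>] sf
    by (subst infsum_cmult_right'[symmetric])
      (rule infsum_mono[OF summ1 summable_on_cmult_right[OF norm2_slices(1)] le])
  then have n: "norm (f \<xi>) \<le> M * norm \<xi>" for \<xi>
    by (rule power2_le_imp_le) (use M in simp)
  have add: "f (x + y) = f x + f y" and scale: "f (c *\<^sub>c x) = c *\<^sub>c f x" for x y c
    by (auto intro!: slices_eqI simp: sf blinfun.add_right clinD[OF B(1)])
  have *: "blinfun_apply (Blinfun f) = f" "clin (Blinfun f)" "norm (Blinfun f) \<le> M"
    using Blinfun_apply_bound[of f M, OF add scale n] M by simp_all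
  have "diag_op B = Blinfun f" by (simp add: diag_op_def f_def[abs_def])
  with * sf show "ell2_slice (diag_op B \<xi>) h = B h (ell2_slice \<xi> h)" "clin (diag_op B)"
    "norm (diag_op B) \<le> M" by simp_all
qed

section \<open>Gram-Schmidt orthogonalization and compressions\<close>

lemma blinfun_compose_assoc: "(A o\<^sub>L B) o\<^sub>L C = A o\<^sub>L (B o\<^sub>L C)"
  by (rule blinfun_eqI) simp

text \<open>Exposes the bound \<open>m < n\<close> of the sum to the termination proof of the
  recursion below.\<close>

declare sum.cong [fundef_cong]

text \<open>A vector that depends on its predecessors has residue 0, and the division by its norm
  yields 0 again. The result is an orthogonal sequence of vectors of norm 1 or 0, indexed like
  \<open>u\<close>, for arbitrary \<open>u\<close>.\<close>

fun gram_schmidt :: "(nat \<Rightarrow> 'k ell2) \<Rightarrow> nat \<Rightarrow> 'k ell2" where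
  "gram_schmidt u n = (let c = u n - (\<Sum>m<n. \<langle>gram_schmidt u m | u n\<rangle> *\<^sub>c gram_schmidt u m)
    in (1 / norm c) *\<^sub>R c)"

declare gram_schmidt.simps [simp del]

definition gs_residue :: "(nat \<Rightarrow> 'k ell2) \<Rightarrow> nat \<Rightarrow> 'k ell2" where
  "gs_residue u n = u n - (\<Sum>m<n. \<langle>gram_schmidt u m | u n\<rangle> *\<^sub>c gram_schmidt u m)"

lemma gram_schmidt_residue: "gram_schmidt u n = (1 / norm (gs_residue u n)) *\<^sub>R gs_residue u n"
  by (subst gram_schmidt.simps) (simp add: gs_residue_def Let_def)

text \<open>Expresses "norm 1 or 0" without a case distinction, in the form in which the coefficient
  sums below consume it.\<close>

lemma gram_schmidt_normalized: "\<langle>gram_schmidt u n | gram_schmidt u n\<rangle> *\<^sub>c gram_schmidt u n = gram_schmidt u n"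
proof (cases "gs_residue u n = 0")
  case False
  then have "norm (gram_schmidt u n) = 1" by (simp add: gram_schmidt_residue)
  then show ?thesis by (simp add: cinner_self)
qed (simp add: gram_schmidt_residue)

lemma cinner_scaleR_right [simp]: "\<langle>x | r *\<^sub>R y\<rangle> = of_real r * \<langle>x | y\<rangle>"
  and cinner_scaleR_left [simp]: "\<langle>r *\<^sub>R x | y\<rangle> = of_real r * \<langle>x | y\<rangle>"
  by (simp_all add: scaleR_cscale)

lemma gram_schmidt_orth_less: "m < n \<Longrightarrow> \<langle>gram_schmidt u m | gram_schmidt u n\<rangle> = 0"
  and gram_schmidt_orth_residue: "m < n \<Longrightarrow> \<langle>gram_schmidt u m | gs_residue u n\<rangle> = 0"
proof (induction n arbitrary: m rule: less_induct)
  case (less n)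
  let ?e = "gram_schmidt u"
  have orth: "\<langle>?e m | ?e k\<rangle> = 0" if "k < n" "m < n" "k \<noteq> m" for k m
    using less.IH(1)[of k m] less.IH(1)[of m k] that cinner_commute[of "?e m" "?e k"]
    by (cases k m rule: linorder_cases) auto
  have res: "\<langle>?e m | gs_residue u n\<rangle> = 0" if "m < n" for m
  proof -
    have "(\<Sum>k<n. \<langle>?e k | u n\<rangle> * \<langle>?e m | ?e k\<rangle>) = \<langle>?e m | u n\<rangle> * \<langle>?e m | ?e m\<rangle>"
      using that orth[OF _ that] by (subst sum.remove[of _ m]) (auto intro!: sum.neutral)
    also have "\<dots> = \<langle>\<langle>?e m | ?e m\<rangle> *\<^sub>c ?e m | u n\<rangle>"
      by (simp add: cinner_commute[of "?e m" "?e m", symmetric] mult.commute)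
    finally show ?thesis
      by (simp add: gs_residue_def cinner_diff_right cinner_sum_right gram_schmidt_normalized)
  qed
  { case 1 then show ?case using res by (subst (2) gram_schmidt_residue) simp }
  { case 2 then show ?case using res by simp }
qed

lemma gram_schmidt_orth: "m \<noteq> n \<Longrightarrow> \<langle>gram_schmidt u m | gram_schmidt u n\<rangle> = 0"
  by (metis cinner_commute complex_cnj_zero gram_schmidt_orth_less linorder_neqE_nat)

lemma gram_schmidt_expansion:
  "u n = (\<Sum>m\<le>n. \<langle>gram_schmidt u m | u n\<rangle> *\<^sub>c gram_schmidt u m)"
proof -
  let ?e = "gram_schmidt u" and ?r = "gs_residue u n"
  have u: "u n = ?r + (\<Sum>m<n. \<langle>?e m | u n\<rangle> *\<^sub>c ?e m)" by (simp add: gs_residue_def)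
  have "\<langle>?e n | u n\<rangle> = \<langle>?e n | ?r\<rangle>"
    by (subst u) (simp add: cinner_add_right cinner_sum_right gram_schmidt_orth)
  also have "\<dots> = norm ?r"
    by (simp add: gram_schmidt_residue cinner_self power2_eq_square)
  finally have "\<langle>?e n | u n\<rangle> *\<^sub>c ?e n = ?r"
    by (simp add: gram_schmidt_residue[of u n] scaleR_cscale)
  then show ?thesis using u by (simp add: lessThan_Suc_atMost[symmetric] add.commute)
qed

lemma gram_schmidt_induct:
  assumes "\<And>n. P (u n)" "P 0" "\<And>x y. P x \<Longrightarrow> P y \<Longrightarrow> P (x + y)" "\<And>c x. P x \<Longrightarrow> P (c *\<^sub>c x)"
  shows "P (gram_schmidt u n)"
proof (induction n rule: less_induct)
  case (less n)
  have "P (\<Sum>m\<in>F. c m *\<^sub>c gram_schmidt u m)" if "F \<subseteq> {..<n}" for c F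
    using finite_subset[OF that] that
    by (induction F rule: finite_induct) (use less assms in auto)
  from this[of "{..<n}" "\<lambda>m. \<langle>gram_schmidt u m | u n\<rangle>"]
  have "P (u n + (-1) *\<^sub>c (\<Sum>m<n. \<langle>gram_schmidt u m | u n\<rangle> *\<^sub>c gram_schmidt u m))"
    by (intro assms) auto
  then have "P (gs_residue u n)"
    by (simp add: gs_residue_def cscale_minus_left)
  then show ?case
    unfolding gram_schmidt_residue scaleR_cscale by (rule assms(4))
qed

text \<open>Every coefficient of the procedure is computed from the Gram matrix alone, so families
  in different spaces with equal Gram matrices have equal coordinates.\<close>

lemma gram_schmidt_gram:
  assumes "\<And>i j. \<langle>u i | u j\<rangle> = \<langle>w i | w j\<rangle>"
  shows "\<langle>gram_schmidt u n | u i\<rangle> = \<langle>gram_schmidt w n | w i\<rangle>"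
proof (induction n arbitrary: i rule: less_induct)
  case (less n)
  have *: "\<langle>gs_residue v n | v i\<rangle>
      = \<langle>v n | v i\<rangle> - (\<Sum>m<n. cnj \<langle>gram_schmidt v m | v n\<rangle> * \<langle>gram_schmidt v m | v i\<rangle>)"
    for v :: "nat \<Rightarrow> 'x ell2" and i
    by (simp add: gs_residue_def cinner_diff_left cinner_sum_left)
  have eq: "\<langle>gs_residue u n | u i\<rangle> = \<langle>gs_residue w n | w i\<rangle>" for i
    unfolding * using less by (simp add: assms)
  \<comment> \<open>The residue is orthogonal to what was subtracted from \<open>v n\<close>, so its
    squared norm is an inner product of the form compared in \<open>eq\<close>.\<close>
  have r: "\<langle>gs_residue v n | gs_residue v n\<rangle> = \<langle>gs_residue v n | v n\<rangle>" for v :: "nat \<Rightarrow> 'x ell2"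
  proof -
    have "\<langle>gs_residue v n | gram_schmidt v m\<rangle> = 0" if "m < n" for m
      using gram_schmidt_orth_residue[OF that, of v] by (subst cinner_commute) simp
    then show ?thesis
      by (subst (2) gs_residue_def) (simp add: cinner_diff_right cinner_sum_right)
  qed
  have "(norm (gs_residue u n))\<^sup>2 = (norm (gs_residue w n))\<^sup>2"
    unfolding norm_eq_cinner r eq ..
  then have "norm (gs_residue u n) = norm (gs_residue w n)" by simp
  then show ?case by (simp add: gram_schmidt_residue[of _ n] eq)
qed

lemma gram_schmidt_Bessel:
  assumes "finite F"
  shows "(\<Sum>n\<in>F. (cmod \<langle>gram_schmidt u n | x\<rangle>)\<^sup>2) \<le> (norm x)\<^sup>2"
proof -
  let ?e = "gram_schmidt u" and ?s = "\<Sum>n\<in>F. \<langle>gram_schmidt u n | x\<rangle> *\<^sub>c gram_schmidt u n"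
  let ?R = "\<Sum>n\<in>F. (cmod \<langle>?e n | x\<rangle>)\<^sup>2"
  have sx: "\<langle>?s | x\<rangle> = of_real ?R"
    unfolding cinner_sum_left of_real_sum
    by (intro sum.cong refl) (simp add: complex_norm_square mult.commute del: of_real_power)
  have "\<langle>?e n | ?s\<rangle> = \<langle>?e n | x\<rangle>" if "n \<in> F" for n
  proof -
    have "\<langle>?e n | ?s\<rangle> = \<langle>?e n | x\<rangle> * \<langle>?e n | ?e n\<rangle>"
      using assms that unfolding cinner_sum_right
      by (subst sum.remove[of _ n]) (auto intro!: sum.neutral simp: gram_schmidt_orth)
    also have "\<dots> = \<langle>\<langle>?e n | ?e n\<rangle> *\<^sub>c ?e n | x\<rangle>"
      by (simp add: cinner_commute[of "?e n" "?e n", symmetric] mult.commute)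
    finally show ?thesis by (simp add: gram_schmidt_normalized)
  qed
  then have ss: "\<langle>?s | ?s\<rangle> = of_real ?R"
    unfolding cinner_sum_left[of "\<lambda>n. \<langle>?e n | x\<rangle> *\<^sub>c ?e n"] of_real_sum
    by (intro sum.cong refl) (simp add: complex_norm_square mult.commute del: of_real_power)
  have "\<langle>x | ?s\<rangle> = of_real ?R" using sx by (metis cinner_commute complex_cnj_complex_of_real)
  with sx ss have "(norm (x - ?s))\<^sup>2 = (norm x)\<^sup>2 - ?R"
    unfolding norm_eq_cinner[of "x - ?s"]
    by (simp add: cinner_diff_left cinner_diff_right norm_eq_cinner del: of_real_sum)
  then show ?thesis using zero_le_power2[of "norm (x - ?s)"] by linarith
qed

text \<open>A partial isometry whose initial space is the closed span of \<open>u\<close>; hence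
  \<open>adj (gs_op u) o\<^sub>L gs_op u\<close> is the orthogonal projection onto that
  span.\<close>

definition gs_op :: "(nat \<Rightarrow> 'k ell2) \<Rightarrow> 'k ell2 \<Rightarrow>\<^sub>L nat ell2" where
  "gs_op u = Blinfun (\<lambda>x. ell2_of (\<lambda>n. \<langle>gram_schmidt u n | x\<rangle>))"

lemma coord_gs_op [simp]: "ell2_coord (gs_op u x) n = \<langle>gram_schmidt u n | x\<rangle>"
  and clin_gs_op [simp]: "clin (gs_op u)"
proof -
  have summ: "(\<lambda>n. (norm \<langle>gram_schmidt u n | x\<rangle>)\<^sup>2) summable_on UNIV" for x
    by (rule nonneg_bdd_above_summable_on) (use gram_schmidt_Bessel[of _ u x] in \<open>auto intro!: bdd_aboveI\<close>)
  define f where "f x = ell2_of (\<lambda>n. \<langle>gram_schmidt u n | x\<rangle>)" for x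
  have f: "ell2_coord (f x) = (\<lambda>n. \<langle>gram_schmidt u n | x\<rangle>)" for x
    unfolding f_def by (rule ell2_coord_of[OF summ])
  have "(norm (f x))\<^sup>2 \<le> (norm x)\<^sup>2" for x
    unfolding norm_ell2_squared[of "f x"] f
    by (rule infsum_le_finite_sums[OF summ]) (use gram_schmidt_Bessel in auto)
  then have n: "norm (f x) \<le> 1 * norm x" for x
    by (metis mult_1 norm_ge_zero power2_le_imp_le)
  have add: "f (x + y) = f x + f y" and scale: "f (c *\<^sub>c x) = c *\<^sub>c f x" for x y c
    by (auto intro!: ell2_eqI simp: f cinner_add_right)
  have "blinfun_apply (Blinfun f) = f" "clin (Blinfun f)"
    using Blinfun_apply_bound[of f 1, OF add scale n] by simp_all
  moreover have "gs_op u = Blinfun f" by (simp add: gs_op_def f_def[abs_def])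
  ultimately show "ell2_coord (gs_op u x) n = \<langle>gram_schmidt u n | x\<rangle>" "clin (gs_op u)"
    by (simp_all add: f)
qed

lemma adj_gs_op_delta [simp]: "adj (gs_op u) (ell2_delta n) = gram_schmidt u n"
  by (rule cinner_extI) (simp add: cinner_adj cinner_delta)

lemma gs_op_gram_schmidt: "gs_op u (gram_schmidt u n) = \<langle>gram_schmidt u n | gram_schmidt u n\<rangle> *\<^sub>c ell2_delta n"
  by (rule ell2_eqI) (auto simp: gram_schmidt_orth)

lemma gs_proj_gram_schmidt: "adj (gs_op u) (gs_op u (gram_schmidt u n)) = gram_schmidt u n"
  by (simp add: gs_op_gram_schmidt clinD gram_schmidt_normalized)

lemma gs_proj_range: "adj (gs_op u) (gs_op u (u n)) = u n"
  by (subst (1 2) gram_schmidt_expansion)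
    (simp add: blinfun.sum_right clinD gs_proj_gram_schmidt)

lemma gs_proj_adj: "adj (gs_op u) o\<^sub>L gs_op u o\<^sub>L adj (gs_op u) = adj (gs_op u)"
  by (rule clin_eqI) (auto simp: gs_proj_gram_schmidt)

lemma gs_proj_op: "gs_op u o\<^sub>L adj (gs_op u) o\<^sub>L gs_op u = gs_op u"
  using arg_cong[OF gs_proj_adj[of u], of adj] by (simp add: blinfun_compose_assoc)

lemma gs_op_eq_0: "(\<And>n. \<langle>u n | x\<rangle> = 0) \<Longrightarrow> gs_op u x = 0"
proof -
  assume *: "\<And>n. \<langle>u n | x\<rangle> = 0"
  have "\<langle>gram_schmidt u n | x\<rangle> = 0" for n
    by (rule gram_schmidt_induct) (auto simp: * cinner_add_left)
  then show ?thesis by (intro ell2_eqI) simp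
qed

text \<open>The projection from \<open>gs_op\<close> splits every vector into a part in the closed
  span of \<open>u\<close> and a part orthogonal to \<open>u\<close>; agreement on both parts
  suffices.\<close>

lemma clin_ops_agree:
  fixes S T :: "'k ell2 \<Rightarrow>\<^sub>L 'j ell2" and u :: "nat \<Rightarrow> 'k ell2"
  assumes "clin S" "clin T" "\<And>n. S (u n) = T (u n)"
    and "\<And>x. (\<And>n. \<langle>u n | x\<rangle> = 0) \<Longrightarrow> S x = T x"
  shows "S = T"
proof (rule blinfun_eqI)
  fix x
  let ?P = "adj (gs_op u) o\<^sub>L gs_op u"
  have "S (gram_schmidt u n) = T (gram_schmidt u n)" for n
    by (rule gram_schmidt_induct[where P = "\<lambda>x. S x = T x"]) (auto simp: assms blinfun.add_right clinD)
  then have "S o\<^sub>L adj (gs_op u) = T o\<^sub>L adj (gs_op u)"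
    by (intro clin_eqI) (auto simp: assms)
  then have 1: "S (?P x) = T (?P x)"
    by (metis blinfun_apply_blinfun_compose)
  have "\<langle>u n | x - ?P x\<rangle> = 0" for n
    by (simp add: cinner_diff_right cinner_adj_right)
      (metis cinner_adj clin_gs_op gs_proj_range diff_self cinner_adj_right)
  then have "S (x - ?P x) = T (x - ?P x)" by (rule assms(4))
  with 1 show "S x = T x" by (simp add: blinfun.diff_right)
qed

text \<open>With equal Gram matrices, \<open>a n\<close> and \<open>b n\<close> have the same
  coordinates with respect to the two Gram-Schmidt sequences, and \<open>V\<close> passes from one
  sequence to the other through these coordinates.\<close>

lemma partial_isometry_of_gram:
  fixes a :: "nat \<Rightarrow> 'k ell2" and b :: "nat \<Rightarrow> 'j ell2"
  assumes gram: "\<And>i j. \<langle>a i | a j\<rangle> = \<langle>b i | b j\<rangle>"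
  obtains V where "clin V" "\<And>n. V (a n) = b n" "\<And>x. (\<And>n. \<langle>a n | x\<rangle> = 0) \<Longrightarrow> V x = 0"
    "\<And>n. adj V (b n) = a n" "\<And>x. (\<And>n. \<langle>b n | x\<rangle> = 0) \<Longrightarrow> adj V x = 0"
proof
  let ?V = "adj (gs_op b) o\<^sub>L gs_op a"
  have g: "gs_op a (a n) = gs_op b (b n)" for n
    by (rule ell2_eqI) (simp, intro gram_schmidt_gram gram)
  show "clin ?V" by simp
  show "?V (a n) = b n" for n by (simp add: g gs_proj_range)
  show "?V x = 0" if "\<And>n. \<langle>a n | x\<rangle> = 0" for x by (simp add: gs_op_eq_0[OF that])
  have adjV: "adj ?V = adj (gs_op a) o\<^sub>L gs_op b" by simp
  show "adj ?V (b n) = a n" for n unfolding adjV by (simp add: g[symmetric] gs_proj_range)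
  show "adj ?V x = 0" if "\<And>n. \<langle>b n | x\<rangle> = 0" for x unfolding adjV by (simp add: gs_op_eq_0[OF that])
qed

lemma adj_isometry:
  assumes "clin T" "\<And>x y. \<langle>T x | T y\<rangle> = \<langle>x | y\<rangle>"
  shows "adj T (T x) = x"
  by (rule cinner_extI) (simp add: cinner_adj assms)

text \<open>The vectors obtained from \<open>v\<close> by words in \<T> are countable in number, and
  their closed span is reducing. \<open>W\<close> maps this span isometrically into a space over any
  infinite index type and kills the complement, so that \<open>W o\<^sub>L T o\<^sub>L adj W\<close>
  acts on \<open>W v\<close> as \<open>T\<close> does on \<open>v\<close>.\<close>

lemma countable_compression:
  fixes \<T> :: "'k op set" and \<iota> :: "nat \<Rightarrow> 'j"
  assumes \<T>: "countable \<T>" "\<And>T. T \<in> \<T> \<Longrightarrow> clin T" "\<And>T. T \<in> \<T> \<Longrightarrow> adj T \<in> \<T>" and \<iota>: "inj \<iota>"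
  obtains W :: "'k ell2 \<Rightarrow>\<^sub>L 'j ell2" where
    "clin W" "adj W (W v) = v" "W o\<^sub>L adj W o\<^sub>L W = W"
    "\<And>T. T \<in> \<T> \<Longrightarrow> adj W o\<^sub>L W o\<^sub>L T = T o\<^sub>L adj W o\<^sub>L W"
proof -
  define \<Omega> where "\<Omega> = (\<lambda>Ts. foldr blinfun_apply Ts v) ` lists \<T>"
  define u where "u = from_nat_into \<Omega>"
  have "\<Omega> \<noteq> {}" "countable \<Omega>" using \<T>(1) by (auto simp: \<Omega>_def)
  then have u: "range u = \<Omega>" unfolding u_def by (rule range_from_nat_into)
  define W where "W = index_embedding \<iota> o\<^sub>L gs_op u"
  have cW: "clin W" using \<iota> by (simp add: W_def)
  have adjW: "adj W = adj (gs_op u) o\<^sub>L adj (index_embedding \<iota>)" using \<iota> by (simp add: W_def)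
  have em: "adj (index_embedding \<iota>) (index_embedding \<iota> x) = x" for x
    using \<iota> by (intro adj_isometry) (auto simp: cinner_index_embedding)
  have P: "adj W o\<^sub>L W = adj (gs_op u) o\<^sub>L gs_op u"
    unfolding adjW by (rule blinfun_eqI) (simp add: W_def em)
  have v: "adj W (W v) = v"
  proof -
    have "v \<in> \<Omega>" unfolding \<Omega>_def by (rule image_eqI[of _ _ "[]"]) auto
    then obtain n where "v = u n" using u by auto
    then show ?thesis using arg_cong[OF P, of "\<lambda>T. T v"] gs_proj_range[of u n] by simp
  qed
  have WPW: "W o\<^sub>L adj W o\<^sub>L W = W"
    unfolding blinfun_compose_assoc P by (simp add: W_def blinfun_compose_assoc gs_proj_op[unfolded blinfun_compose_assoc])
  let ?P = "adj (gs_op u) o\<^sub>L gs_op u"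
  \<comment> \<open>Invariance of the span: \<open>T\<close> prolongs a word by one letter.\<close>
  have PTP: "?P o\<^sub>L T o\<^sub>L ?P = T o\<^sub>L ?P" if T: "T \<in> \<T>" for T
  proof -
    have "?P (T (u n)) = T (u n)" for n
    proof -
      obtain Ts where "Ts \<in> lists \<T>" "u n = foldr blinfun_apply Ts v"
        using u unfolding \<Omega>_def by blast
      then have "T (u n) \<in> \<Omega>" unfolding \<Omega>_def
        by (intro image_eqI[of _ _ "T # Ts"]) (use T in auto)
      then obtain m where "T (u n) = u m" using u by auto
      then show ?thesis by (simp add: gs_proj_range)
    qed
    then have "?P (T (gram_schmidt u n)) = T (gram_schmidt u n)" for n
      by (intro gram_schmidt_induct[where P = "\<lambda>x. ?P (T x) = T x"])
        (auto simp: blinfun.add_right clinD \<T>(2)[OF T])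
    then have "?P o\<^sub>L T o\<^sub>L adj (gs_op u) = T o\<^sub>L adj (gs_op u)"
      by (intro clin_eqI) (auto simp: \<T>(2)[OF T])
    then show ?thesis by (metis blinfun_compose_assoc)
  qed
  \<comment> \<open>Taking adjoints in the previous identity for \<open>adj T\<close> gives P T P =
    P T, which together with P T P = T P is commutation.\<close>
  have comm: "?P o\<^sub>L T = T o\<^sub>L ?P" if T: "T \<in> \<T>" for T
  proof -
    have "adj (?P o\<^sub>L adj T o\<^sub>L ?P) = adj (adj T o\<^sub>L ?P)" using PTP[OF \<T>(3)[OF T]] by simp
    then have "?P o\<^sub>L T o\<^sub>L ?P = ?P o\<^sub>L T"
      using \<T>(2)[OF T] by (simp add: blinfun_compose_assoc)
    then show ?thesis using PTP[OF T] by simp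
  qed
  show thesis
    by (rule that[OF cW v WPW]) (use comm P in \<open>simp add: blinfun_compose_assoc\<close>)
qed

section \<open>Algebras of operators and of families of operators\<close>

lemma op_algebra_simps [simp]:
  "elems op_algebra = {T. clin T}" "szero op_algebra = 0" "splus op_algebra = (+)"
  "sscale op_algebra = op_scale" "smult op_algebra = (o\<^sub>L)" "sstar op_algebra = adj" "snorm op_algebra = norm"
  by (simp_all add: op_algebra_def op_adj_adj clinear_op_clin)

lemma op_scale_0: "op_scale c 0 = 0"
  by (rule blinfun_eqI) simp

lemma op_scale_minus_one: "clin y \<Longrightarrow> op_scale (-1) y = - y"
  by (rule blinfun_eqI) (simp add: cscale_minus_left blinfun.minus_left)

lemma sdist_op_algebra: "clin y \<Longrightarrow> sdist op_algebra x y = dist x y"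
  by (simp add: sdist_def op_scale_minus_one dist_norm)

text \<open>Complex linearity survives norm limits; this is what completeness of
  \<open>op_algebra\<close> needs beyond completeness of the bounded real linear operators.\<close>

lemma closed_clin: "closed {T :: 'k ell2 \<Rightarrow>\<^sub>L 'j ell2. clin T}"
proof -
  have cs: "continuous_on UNIV (\<lambda>x :: 'j ell2. c *\<^sub>c x)" for c
  proof -
    have "bounded_linear (\<lambda>x :: 'j ell2. c *\<^sub>c x)"
      by (rule bounded_linear_intro[where K = "cmod c"]) (simp_all add: cscale_add cscale_scaleR mult.commute)
    then show ?thesis by (simp add: linear_continuous_on)
  qed
  then have *: "continuous_on UNIV (\<lambda>T :: 'k ell2 \<Rightarrow>\<^sub>L 'j ell2. c *\<^sub>c T x)" for c x
  proof -
    have "continuous_on UNIV (\<lambda>T :: 'k ell2 \<Rightarrow>\<^sub>L 'j ell2. T x)" by (intro continuous_intros)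
    then show ?thesis by (rule continuous_on_compose2[OF cs]) simp
  qed
  have "{T :: 'k ell2 \<Rightarrow>\<^sub>L 'j ell2. clin T} = (\<Inter>c. \<Inter>x. {T. blinfun_apply T (c *\<^sub>c x) = c *\<^sub>c blinfun_apply T x})"
    by (auto simp: clin_def)
  also have "closed \<dots>"
  proof (intro closed_INT ballI)
    fix c x
    have "continuous_on UNIV (\<lambda>T :: 'k ell2 \<Rightarrow>\<^sub>L 'j ell2. T (c *\<^sub>c x))"
      by (intro continuous_intros)
    then show "closed {T :: 'k ell2 \<Rightarrow>\<^sub>L 'j ell2. T (c *\<^sub>c x) = c *\<^sub>c T x}"
      by (rule closed_Collect_eq[OF _ *])
  qed
  finally show ?thesis .
qed

lemma op_scale_unary:
  assumes "clin S"
  shows "op_scale 0 S = 0" "op_scale 1 S = S" "op_scale c (op_scale d S) = op_scale (c * d) S"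
    "op_scale (c + d) S = op_scale c S + op_scale d S"
  using assms by (auto intro!: blinfun_eqI simp: blinfun.add_left cscale_add_left)

lemma op_scale_binary:
  assumes "clin S" "clin T"
  shows "op_scale c (S + T) = op_scale c S + op_scale c T"
    "op_scale c S o\<^sub>L T = op_scale c (S o\<^sub>L T)" "S o\<^sub>L op_scale c T = op_scale c (S o\<^sub>L T)"
  using assms by (auto intro!: blinfun_eqI simp: blinfun.add_left cscale_add clinD)

lemmas op_scale_rules = op_scale_unary op_scale_binary

lemma blinfun_compose_zero [simp]: "0 o\<^sub>L S = 0" "S o\<^sub>L 0 = 0"
  by (auto intro!: blinfun_eqI)

lemma blinfun_compose_add:
  "(S + T) o\<^sub>L R = (S o\<^sub>L R) + (T o\<^sub>L R)" "R' o\<^sub>L (S + T) = (R' o\<^sub>L S) + (R' o\<^sub>L T)"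
  "(S - T) o\<^sub>L R = (S o\<^sub>L R) - (T o\<^sub>L R)" "R' o\<^sub>L (S - T) = (R' o\<^sub>L S) - (R' o\<^sub>L T)"
  by (auto intro!: blinfun_eqI simp: blinfun.add_left blinfun.add_right blinfun.diff_left blinfun.diff_right)

lemma cstar_algebra_op_algebra: "cstar_algebra (op_algebra :: 'k op star_algebra)"
proof
  show "dist_complete (elems op_algebra) (sdist (op_algebra :: 'k op star_algebra))"
    unfolding dist_complete_def
  proof (intro allI impI)
    fix f :: "nat \<Rightarrow> 'k op"
    assume f: "(\<forall>n. f n \<in> elems op_algebra) \<and>
      (\<forall>e>0. \<exists>N. \<forall>m\<ge>N. \<forall>n\<ge>N. sdist op_algebra (f m) (f n) < e)"
    then have c: "clin (f n)" for n by simp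
    from f c have "Cauchy f" by (simp add: Cauchy_def sdist_op_algebra)
    then obtain l where l: "f \<longlonglongrightarrow> l" by (auto simp: Cauchy_convergent_iff convergent_def)
    have "clin l" using closed_sequentially[OF closed_clin, of f l] c l by simp
    then show "\<exists>l\<in>elems op_algebra. (\<lambda>n. sdist op_algebra (f n) l) \<longlonglongrightarrow> 0"
      using l by (intro bexI[of _ l]) (simp_all add: sdist_op_algebra tendsto_dist_iff[symmetric])
  qed
qed (auto simp: op_scale_rules norm_triangle_ineq norm_blinfun_compose norm_adj_comp_self
      blinfun_compose_assoc blinfun_compose_add add.assoc add.commute)

section \<open>Bounded families of operators under the supremum norm\<close>

lemma
  shows elems_op_family: "elems (op_family_algebra R) =
      {a. (\<forall>\<rho>. clin (a \<rho>)) \<and> (\<forall>\<rho>. \<rho> \<notin> R \<longrightarrow> a \<rho> = 0) \<and> bdd_above (range (\<lambda>\<rho>. norm (a \<rho>)))}"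
    and op_family_simps [simp]: "szero (op_family_algebra R) = (\<lambda>_. 0)"
      "splus (op_family_algebra R) = (\<lambda>a b \<rho>. a \<rho> + b \<rho>)"
      "sscale (op_family_algebra R) = (\<lambda>c a \<rho>. op_scale c (a \<rho>))"
      "smult (op_family_algebra R) = (\<lambda>a b \<rho>. a \<rho> o\<^sub>L b \<rho>)"
      "sstar (op_family_algebra R) = (\<lambda>a \<rho>. adj (a \<rho>))"
    and snorm_op_family: "snorm (op_family_algebra R) = (\<lambda>a. SUP \<rho>. norm (a \<rho>))"
  by (simp_all add: op_family_algebra_def op_adj_adj clinear_op_clin)

lemma op_family_memI:
  assumes "\<And>\<rho>. clin (a \<rho>)" "\<And>\<rho>. \<rho> \<notin> R \<Longrightarrow> a \<rho> = 0" "\<And>\<rho>. norm (a \<rho>) \<le> C"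
  shows "a \<in> elems (op_family_algebra R)"
  using assms by (auto simp: elems_op_family intro!: bdd_aboveI[of _ C])

lemma op_familyD:
  assumes "a \<in> elems (op_family_algebra R)"
  shows "clin (a \<rho>)" "\<rho> \<notin> R \<Longrightarrow> a \<rho> = 0" "norm (a \<rho>) \<le> snorm (op_family_algebra R) a"
  using assms by (auto simp: elems_op_family snorm_op_family intro: cSUP_upper)

lemma op_family_norm_le: "(\<And>\<rho>. norm (a \<rho>) \<le> C) \<Longrightarrow> snorm (op_family_algebra R) a \<le> C"
  by (auto simp: snorm_op_family intro!: cSUP_least)

lemma op_family_norm_le_iff:
  "a \<in> elems (op_family_algebra R) \<Longrightarrow> snorm (op_family_algebra R) a \<le> C \<longleftrightarrow> (\<forall>\<rho>. norm (a \<rho>) \<le> C)"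
  by (meson op_familyD(3) op_family_norm_le order_trans)

lemma op_family_norm_nonneg: "a \<in> elems (op_family_algebra R) \<Longrightarrow> 0 \<le> snorm (op_family_algebra R) a"
  by (rule order_trans[OF norm_ge_zero op_familyD(3)])

lemma sdist_op_family:
  "b \<in> elems (op_family_algebra R) \<Longrightarrow>
    sdist (op_family_algebra R) a b = snorm (op_family_algebra R) (\<lambda>\<rho>. a \<rho> - b \<rho>)"
  by (simp add: sdist_def op_scale_minus_one op_familyD)

lemma cstar_algebra_op_family: "cstar_algebra (op_family_algebra R :: ('r \<Rightarrow> 'k op) star_algebra)"
proof
  let ?A = "op_family_algebra R :: ('r \<Rightarrow> 'k op) star_algebra"
  note D = op_familyD[of _ R]
  show "szero ?A \<in> elems ?A" by (auto intro!: op_family_memI[where C = 0])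
  have diff: "(\<lambda>\<rho>. a \<rho> - b \<rho>) \<in> elems ?A" if "a \<in> elems ?A" "b \<in> elems ?A" for a b
    by (rule op_family_memI[where C = "snorm ?A a + snorm ?A b"])
      (simp_all add: D(1,2)[OF that(1)] D(1,2)[OF that(2)]
        order_trans[OF norm_triangle_ineq4 add_mono[OF D(3)[OF that(1)] D(3)[OF that(2)]]])
  fix x y z :: "'r \<Rightarrow> 'k op" and c d :: complex
  assume x: "x \<in> elems ?A"
  show "sscale ?A c x \<in> elems ?A"
    by (rule op_family_memI[where C = "cmod c * snorm ?A x"])
      (simp_all add: D[OF x] op_scale_0 mult_left_mono)
  show "sstar ?A x \<in> elems ?A"
    by (rule op_family_memI[where C = "snorm ?A x"]) (simp_all add: D[OF x])
  show "splus ?A x (szero ?A) = x" by simp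
  show "sscale ?A 0 x = szero ?A" "sscale ?A 1 x = x" "sscale ?A c (sscale ?A d x) = sscale ?A (c * d) x"
    "sscale ?A (c + d) x = splus ?A (sscale ?A c x) (sscale ?A d x)"
    using D(1)[OF x] by (simp_all add: op_scale_rules fun_eq_iff)
  show "sstar ?A (sstar ?A x) = x" "sstar ?A (sscale ?A c x) = sscale ?A (cnj c) (sstar ?A x)"
    using D(1)[OF x] by simp_all
  show "snorm ?A x = 0 \<longleftrightarrow> x = szero ?A"
  proof
    assume "snorm ?A x = 0"
    then have "norm (x \<rho>) \<le> 0" for \<rho> using D(3)[OF x, of \<rho>] by simp
    then show "x = szero ?A" by (simp add: fun_eq_iff)
  qed (simp add: snorm_op_family)
  show "snorm ?A (sscale ?A c x) = cmod c * snorm ?A x"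
  proof (cases "c = 0")
    case True then show ?thesis using D(1)[OF x] by (simp add: snorm_op_family op_scale_rules)
  next
    case False
    have bd: "bdd_above (range (\<lambda>\<rho>. norm (x \<rho>)))" using x by (simp add: elems_op_family)
    have "snorm ?A (sscale ?A c x) = (SUP \<rho>. cmod c * norm (x \<rho>))"
      using D(1)[OF x] by (simp add: snorm_op_family)
    also have "\<dots> = cmod c * (SUP \<rho>. norm (x \<rho>))"
    proof (rule antisym)
      show "(SUP \<rho>. cmod c * norm (x \<rho>)) \<le> cmod c * (SUP \<rho>. norm (x \<rho>))"
        by (intro cSUP_least mult_left_mono cSUP_upper bd) auto
      have bd2: "bdd_above (range (\<lambda>\<rho>. cmod c * norm (x \<rho>)))"
        using D(3)[OF x] by (auto intro!: bdd_aboveI[of _ "cmod c * snorm ?A x"] mult_left_mono)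
      have "(SUP \<rho>. norm (x \<rho>)) \<le> (SUP \<rho>. cmod c * norm (x \<rho>)) / cmod c"
        by (intro cSUP_least) (use False cSUP_upper[OF _ bd2] in \<open>auto simp: field_simps\<close>)
      then show "cmod c * (SUP \<rho>. norm (x \<rho>)) \<le> (SUP \<rho>. cmod c * norm (x \<rho>))"
        using False by (simp add: field_simps)
    qed
    finally show ?thesis by (simp add: snorm_op_family)
  qed
  have star_mult_mem: "smult ?A a b \<in> elems ?A" if "a \<in> elems ?A" "b \<in> elems ?A" for a b
    by (rule op_family_memI[where C = "snorm ?A a * snorm ?A b"])
      (simp_all add: D(1,2)[OF that(1)] D(1,2)[OF that(2)]
        order_trans[OF norm_blinfun_compose mult_mono'[OF D(3)[OF that(1)] D(3)[OF that(2)]]])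
  have sx: "sstar ?A x \<in> elems ?A" by fact
  show "snorm ?A (smult ?A (sstar ?A x) x) = (snorm ?A x)\<^sup>2"
  proof (rule antisym)
    show "snorm ?A (smult ?A (sstar ?A x) x) \<le> (snorm ?A x)\<^sup>2"
      using D[OF x] by (intro op_family_norm_le) (auto simp: norm_adj_comp_self intro!: power_mono)
    let ?s = "snorm ?A (smult ?A (sstar ?A x) x)"
    have "(norm (x \<rho>))\<^sup>2 \<le> ?s" for \<rho>
      using D(3)[OF star_mult_mem[OF sx x], of \<rho>] D(1)[OF x] by (simp add: norm_adj_comp_self)
    then have "norm (x \<rho>) \<le> sqrt ?s" for \<rho> by (simp add: real_le_rsqrt)
    then have "snorm ?A x \<le> sqrt ?s" by (intro op_family_norm_le)
    then have "(snorm ?A x)\<^sup>2 \<le> (sqrt ?s)\<^sup>2"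
      using op_family_norm_nonneg[OF x] by (intro power_mono)
    then show "(snorm ?A x)\<^sup>2 \<le> ?s"
      using op_family_norm_nonneg[OF star_mult_mem[OF sx x]] by simp
  qed
  assume y: "y \<in> elems ?A"
  show "splus ?A x y \<in> elems ?A"
    by (rule op_family_memI[where C = "snorm ?A x + snorm ?A y"])
      (simp_all add: D(1,2)[OF x] D(1,2)[OF y]
        order_trans[OF norm_triangle_ineq add_mono[OF D(3)[OF x] D(3)[OF y]]])
  show "splus ?A x y = splus ?A y x" by (simp add: add.commute)
  show "sscale ?A c (splus ?A x y) = splus ?A (sscale ?A c x) (sscale ?A c y)"
    using D(1)[OF x] D(1)[OF y] by (simp add: op_scale_rules fun_eq_iff)
  show "smult ?A x y \<in> elems ?A" by (rule star_mult_mem[OF x y])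
  show "smult ?A (sscale ?A c x) y = sscale ?A c (smult ?A x y)"
    "smult ?A x (sscale ?A c y) = sscale ?A c (smult ?A x y)"
    using D(1)[OF x] D(1)[OF y] by (simp_all add: op_scale_rules fun_eq_iff)
  show "sstar ?A (splus ?A x y) = splus ?A (sstar ?A x) (sstar ?A y)"
    "sstar ?A (smult ?A x y) = smult ?A (sstar ?A y) (sstar ?A x)"
    using D(1)[OF x] D(1)[OF y] by simp_all
  show "snorm ?A (splus ?A x y) \<le> snorm ?A x + snorm ?A y"
    by (rule op_family_norm_le)
      (simp add: order_trans[OF norm_triangle_ineq add_mono[OF D(3)[OF x] D(3)[OF y]]])
  show "snorm ?A (smult ?A x y) \<le> snorm ?A x * snorm ?A y"
    by (rule op_family_norm_le)
      (simp add: order_trans[OF norm_blinfun_compose mult_mono'[OF D(3)[OF x] D(3)[OF y]]])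
  assume z: "z \<in> elems ?A"
  show "splus ?A (splus ?A x y) z = splus ?A x (splus ?A y z)" by (simp add: add.assoc)
  show "smult ?A (smult ?A x y) z = smult ?A x (smult ?A y z)" by (simp add: blinfun_compose_assoc)
  show "smult ?A x (splus ?A y z) = splus ?A (smult ?A x y) (smult ?A x z)"
    "smult ?A (splus ?A x y) z = splus ?A (smult ?A x z) (smult ?A y z)"
    by (simp_all add: blinfun_compose_add)
next
  let ?A = "op_family_algebra R :: ('r \<Rightarrow> 'k op) star_algebra"
  note D = op_familyD[of _ R]
  show "dist_complete (elems ?A) (sdist ?A)"
    unfolding dist_complete_def
  proof (intro allI impI)
    fix f :: "nat \<Rightarrow> 'r \<Rightarrow> 'k op"
    assume f: "(\<forall>n. f n \<in> elems ?A) \<and> (\<forall>e>0. \<exists>N. \<forall>m\<ge>N. \<forall>n\<ge>N. sdist ?A (f m) (f n) < e)"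
    then have fA: "f n \<in> elems ?A" for n by simp
    have diff: "(\<lambda>\<rho>. f m \<rho> - f n \<rho>) \<in> elems ?A" for m n
      by (rule op_family_memI[where C = "snorm ?A (f m) + snorm ?A (f n)"])
        (simp_all add: D(1,2)[OF fA] order_trans[OF norm_triangle_ineq4 add_mono[OF D(3)[OF fA] D(3)[OF fA]]])
    have C: "\<exists>N. \<forall>m\<ge>N. \<forall>n\<ge>N. \<forall>\<rho>. dist (f m \<rho>) (f n \<rho>) < e" if e: "e > 0" for e
    proof -
      obtain N where N: "\<forall>m\<ge>N. \<forall>n\<ge>N. sdist ?A (f m) (f n) < e" using f e by blast
      have "dist (f m \<rho>) (f n \<rho>) < e" if "m \<ge> N" "n \<ge> N" for m n \<rho>
        using order.strict_trans1[OF D(3)[OF diff, of m \<rho> n]] N[rule_format, OF that] fA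
        by (simp add: sdist_op_family dist_norm)
      then show ?thesis by blast
    qed
    have "Cauchy (\<lambda>n. f n \<rho>)" for \<rho>
      unfolding Cauchy_def by (meson C)
    then obtain l where l: "\<And>\<rho>. (\<lambda>n. f n \<rho>) \<longlonglongrightarrow> l \<rho>"
      unfolding Cauchy_convergent_iff convergent_def by metis
    \<comment> \<open>The Cauchy estimate is uniform in the index \<rho>, so it passes to the
      pointwise limit with the same bound everywhere.\<close>
    have close: "\<exists>N. \<forall>m\<ge>N. \<forall>\<rho>. norm (f m \<rho> - l \<rho>) \<le> e" if e: "e > 0" for e
    proof -
      obtain N where N: "\<And>m n \<rho>. m \<ge> N \<Longrightarrow> n \<ge> N \<Longrightarrow> dist (f m \<rho>) (f n \<rho>) < e" using C[OF e] by blast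
      have "norm (f m \<rho> - l \<rho>) \<le> e" if m: "m \<ge> N" for m \<rho>
      proof (rule Lim_bounded)
        show "(\<lambda>n. norm (f m \<rho> - f n \<rho>)) \<longlonglongrightarrow> norm (f m \<rho> - l \<rho>)" by (intro tendsto_intros l)
        show "\<forall>n\<ge>N. norm (f m \<rho> - f n \<rho>) \<le> e" using N[OF m] by (auto simp: dist_norm less_imp_le)
      qed
      then show ?thesis by blast
    qed
    obtain N1 where N1: "norm (f N1 \<rho> - l \<rho>) \<le> 1" for \<rho> using close[of 1] by auto
    have lA: "l \<in> elems ?A"
    proof (rule op_family_memI)
      show "clin (l \<rho>)" for \<rho>
        using closed_sequentially[OF closed_clin, of "\<lambda>n. f n \<rho>" "l \<rho>"] l D(1)[OF fA] by simp
      show "l \<rho> = 0" if "\<rho> \<notin> R" for \<rho>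
        using l[of \<rho>] D(2)[OF fA that] by (simp add: LIMSEQ_const_iff)
      show "norm (l \<rho>) \<le> snorm ?A (f N1) + 1" for \<rho>
        using norm_triangle_ineq4[of "f N1 \<rho>" "f N1 \<rho> - l \<rho>"] N1[of \<rho>] D(3)[OF fA, of N1 \<rho>] by simp
    qed
    have "(\<lambda>n. sdist ?A (f n) l) \<longlonglongrightarrow> 0"
    proof (rule LIMSEQ_I)
      fix r :: real assume "r > 0"
      then obtain N where N: "\<And>m \<rho>. m \<ge> N \<Longrightarrow> norm (f m \<rho> - l \<rho>) \<le> r / 2" using close[of "r / 2"] by auto
      have "norm (sdist ?A (f n) l - 0) < r" if n: "n \<ge> N" for n
      proof -
        have "0 \<le> snorm ?A (\<lambda>\<rho>. f n \<rho> - l \<rho>)"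
          unfolding snorm_op_family
          by (rule cSUP_upper2[where x = undefined]) (use N[OF n] in \<open>auto intro!: bdd_aboveI[of _ "r / 2"]\<close>)
        moreover have "snorm ?A (\<lambda>\<rho>. f n \<rho> - l \<rho>) \<le> r / 2" by (rule op_family_norm_le[OF N[OF n]])
        ultimately show ?thesis using \<open>r > 0\<close> lA by (simp add: sdist_op_family)
      qed
      then show "\<exists>N. \<forall>n\<ge>N. norm (sdist ?A (f n) l - 0) < r" by blast
    qed
    then show "\<exists>l\<in>elems ?A. (\<lambda>n. sdist ?A (f n) l) \<longlonglongrightarrow> 0" using lA by blast
  qed
qed

section \<open>Closed spans and generated subalgebras\<close>

context cstar_algebra
begin

section \<open>Consequences of the axioms\<close>

lemma plus_ac:
  "\<lbrakk>x \<in> elems A; y \<in> elems A; z \<in> elems A\<rbrakk> \<Longrightarrow> splus A x (splus A y z) = splus A y (splus A x z)"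
  by (metis plus_assoc plus_commute)

lemmas closed_ops = zero_closed plus_closed scale_closed mult_closed star_closed

lemma zero_plus: "x \<in> elems A \<Longrightarrow> splus A (szero A) x = x"
  by (simp add: plus_commute plus_zero zero_closed)

lemma scale_szero: "sscale A c (szero A) = szero A"
  by (metis mult_zero_right scale_scale scale_zero zero_closed)

lemma plus_minus: "x \<in> elems A \<Longrightarrow> splus A x (sscale A (-1) x) = szero A"
  using plus_scale[of x 1 "-1"] by (simp add: scale_one scale_zero)

lemma minus_minus: "x \<in> elems A \<Longrightarrow> sscale A (-1) (sscale A (-1) x) = x"
  by (simp add: scale_scale scale_one)

lemma norm_szero: "snorm A (szero A) = 0"
  by (simp add: norm_zero_iff zero_closed)

lemma norm_nonneg: "x \<in> elems A \<Longrightarrow> 0 \<le> snorm A x"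
  using norm_triangle[of x "sscale A (-1) x"] norm_scale[of x "-1"]
  by (simp add: plus_minus norm_szero scale_closed)

lemma mult_szero: "x \<in> elems A \<Longrightarrow> smult A x (szero A) = szero A"
  by (metis mult_scale scale_zero zero_closed mult_closed)

lemma szero_mult: "x \<in> elems A \<Longrightarrow> smult A (szero A) x = szero A"
  by (metis scale_mult scale_zero zero_closed mult_closed)

lemma star_szero: "sstar A (szero A) = szero A"
  by (metis complex_cnj_zero scale_zero star_closed star_scale zero_closed)

lemma norm_star: "x \<in> elems A \<Longrightarrow> snorm A (sstar A x) = snorm A x"
proof -
  have le: "snorm A x \<le> snorm A (sstar A x)" if "x \<in> elems A" for x
  proof (cases "snorm A x = 0")
    case False
    then have "snorm A x > 0" using norm_nonneg[OF that] by simp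
    moreover have "snorm A x * snorm A x \<le> snorm A (sstar A x) * snorm A x"
      using cstar_identity[OF that] norm_mult[OF star_closed[OF that] that] by (simp add: power2_eq_square)
    ultimately show ?thesis by simp
  qed (simp add: norm_nonneg star_closed that)
  assume "x \<in> elems A"
  then show ?thesis using le[of x] le[of "sstar A x"] by (simp add: star_closed star_star)
qed

lemma sdist_self: "x \<in> elems A \<Longrightarrow> sdist A x x = 0"
  by (simp add: sdist_def plus_minus norm_szero)

lemma sdist_nonneg: "\<lbrakk>x \<in> elems A; y \<in> elems A\<rbrakk> \<Longrightarrow> 0 \<le> sdist A x y"
  by (simp add: sdist_def norm_nonneg closed_ops)

lemma sdist_zero: "x \<in> elems A \<Longrightarrow> sdist A x (szero A) = snorm A x"
  by (simp add: sdist_def scale_szero plus_zero)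

lemma sdist_eq_0: "\<lbrakk>x \<in> elems A; y \<in> elems A; sdist A x y = 0\<rbrakk> \<Longrightarrow> x = y"
proof -
  assume *: "x \<in> elems A" "y \<in> elems A" "sdist A x y = 0"
  then have "splus A x (sscale A (-1) y) = szero A"
    by (simp add: sdist_def norm_zero_iff closed_ops)
  then have "splus A (splus A x (sscale A (-1) y)) y = y" using * by (simp add: zero_plus)
  then show "x = y" using * plus_minus[of y]
    by (simp add: plus_assoc plus_commute[of "sscale A (-1) y" y] closed_ops plus_zero)
qed

lemma sdist_commute: "\<lbrakk>x \<in> elems A; y \<in> elems A\<rbrakk> \<Longrightarrow> sdist A x y = sdist A y x"
  using norm_scale[of "splus A x (sscale A (-1) y)" "-1"]
  by (simp add: sdist_def scale_plus closed_ops minus_minus plus_commute)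

lemma sdist_plus:
  assumes "x \<in> elems A" "y \<in> elems A" "x' \<in> elems A" "y' \<in> elems A"
  shows "sdist A (splus A x y) (splus A x' y') \<le> sdist A x x' + sdist A y y'"
proof -
  have "splus A (splus A x y) (sscale A (-1) (splus A x' y'))
      = splus A (splus A x (sscale A (-1) x')) (splus A y (sscale A (-1) y'))"
    using assms by (simp add: scale_plus closed_ops plus_assoc plus_ac)
  then show ?thesis using assms by (simp add: sdist_def norm_triangle closed_ops)
qed

lemma sdist_scale: "\<lbrakk>x \<in> elems A; y \<in> elems A\<rbrakk> \<Longrightarrow> sdist A (sscale A c x) (sscale A c y) = cmod c * sdist A x y"
  unfolding sdist_def by (subst norm_scale[symmetric]) (simp_all add: closed_ops scale_plus scale_scale)

lemma sdist_triangle: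
  assumes "x \<in> elems A" "y \<in> elems A" "z \<in> elems A"
  shows "sdist A x z \<le> sdist A x y + sdist A y z"
proof -
  have "splus A x (sscale A (-1) z)
      = splus A (splus A x (sscale A (-1) y)) (splus A y (sscale A (-1) z))"
    using assms plus_minus[of y]
    by (simp add: closed_ops plus_assoc) (metis closed_ops(3) plus_ac plus_assoc plus_commute plus_minus zero_plus)
  then show ?thesis using assms by (simp add: sdist_def norm_triangle closed_ops)
qed

lemma sdist_mult_right: "\<lbrakk>x \<in> elems A; y \<in> elems A; z \<in> elems A\<rbrakk>
  \<Longrightarrow> sdist A (smult A x z) (smult A y z) \<le> sdist A x y * snorm A z"
  unfolding sdist_def
  by (subst scale_mult[symmetric]) (simp_all add: closed_ops norm_mult flip: plus_mult)

lemma sdist_mult_left: "\<lbrakk>x \<in> elems A; y \<in> elems A; z \<in> elems A\<rbrakk>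
  \<Longrightarrow> sdist A (smult A z x) (smult A z y) \<le> snorm A z * sdist A x y"
  unfolding sdist_def
  by (subst mult_scale[symmetric]) (simp_all add: closed_ops norm_mult flip: mult_plus)

lemma sdist_star: "\<lbrakk>x \<in> elems A; y \<in> elems A\<rbrakk> \<Longrightarrow> sdist A (sstar A x) (sstar A y) = sdist A x y"
  unfolding sdist_def using norm_star[of "splus A x (sscale A (-1) y)"]
  by (simp add: closed_ops star_plus star_scale)

lemma norm_le_sdist: "\<lbrakk>x \<in> elems A; y \<in> elems A\<rbrakk> \<Longrightarrow> snorm A x \<le> snorm A y + sdist A x y"
  using sdist_triangle[of x y "szero A"] by (simp add: sdist_zero zero_closed)

section \<open>Convergence in norm\<close>

definition converges :: "(nat \<Rightarrow> 'a) \<Rightarrow> 'a \<Rightarrow> bool" where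
  "converges f l \<longleftrightarrow> (\<forall>n. f n \<in> elems A) \<and> l \<in> elems A \<and> (\<lambda>n. sdist A (f n) l) \<longlonglongrightarrow> 0"

lemma convergesD: "converges f l \<Longrightarrow> f n \<in> elems A" "converges f l \<Longrightarrow> l \<in> elems A"
  by (auto simp: converges_def)

lemma converges_squeeze:
  assumes "\<And>n. f n \<in> elems A" "l \<in> elems A" "\<And>n. sdist A (f n) l \<le> g n" "g \<longlonglongrightarrow> 0"
  shows "converges f l"
  unfolding converges_def using assms
  by (auto intro!: tendsto_sandwich[of "\<lambda>_. 0" "\<lambda>n. sdist A (f n) l" sequentially g 0] always_eventually sdist_nonneg)

lemma converges_const: "l \<in> elems A \<Longrightarrow> converges (\<lambda>_. l) l"
  by (simp add: converges_def sdist_self)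

lemma converges_plus: "converges f x \<Longrightarrow> converges g y \<Longrightarrow> converges (\<lambda>n. splus A (f n) (g n)) (splus A x y)"
  by (rule converges_squeeze[where g = "\<lambda>n. sdist A (f n) x + sdist A (g n) y"])
    (auto simp: converges_def closed_ops sdist_plus intro!: tendsto_eq_intros)

lemma converges_scale: "converges f x \<Longrightarrow> converges (\<lambda>n. sscale A c (f n)) (sscale A c x)"
  by (rule converges_squeeze[where g = "\<lambda>n. cmod c * sdist A (f n) x"])
    (auto simp: converges_def closed_ops sdist_scale intro!: tendsto_eq_intros)

lemma converges_star: "converges f x \<Longrightarrow> converges (\<lambda>n. sstar A (f n)) (sstar A x)"
  by (auto simp: converges_def closed_ops sdist_star)

lemma converges_norm: "converges f x \<Longrightarrow> (\<lambda>n. snorm A (f n)) \<longlonglongrightarrow> snorm A x"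
proof -
  assume f: "converges f x"
  have *: "norm (snorm A (f n) - snorm A x) \<le> sdist A (f n) x" for n
    using f norm_le_sdist[of "f n" x] norm_le_sdist[of x "f n"] sdist_commute[of x "f n"]
    by (auto simp: converges_def)
  have "(\<lambda>n. sdist A (f n) x) \<longlonglongrightarrow> 0" using f by (simp add: converges_def)
  then have "(\<lambda>n. snorm A (f n) - snorm A x) \<longlonglongrightarrow> 0"
    by (rule Lim_null_comparison[OF always_eventually[rule_format, OF *]])
  then show ?thesis by (rule LIM_zero_cancel)
qed

lemma converges_mult:
  assumes f: "converges f x" and g: "converges g y"
  shows "converges (\<lambda>n. smult A (f n) (g n)) (smult A x y)"
proof (rule converges_squeeze)
  note c = convergesD[OF f] convergesD[OF g]
  show "sdist A (smult A (f n) (g n)) (smult A x y)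
      \<le> snorm A (f n) * sdist A (g n) y + sdist A (f n) x * snorm A y" for n
    using sdist_triangle[of "smult A (f n) (g n)" "smult A (f n) y" "smult A x y"]
      sdist_mult_left[of "g n" y "f n"] sdist_mult_right[of "f n" x y] c
    by (force simp: closed_ops)
  have "(\<lambda>n. snorm A (f n) * sdist A (g n) y + sdist A (f n) x * snorm A y)
      \<longlonglongrightarrow> snorm A x * 0 + 0 * snorm A y"
    using f g by (intro tendsto_intros converges_norm) (auto simp: converges_def)
  then show "(\<lambda>n. snorm A (f n) * sdist A (g n) y + sdist A (f n) x * snorm A y) \<longlonglongrightarrow> 0" by simp
qed (use convergesD[OF f] convergesD[OF g] in \<open>auto simp: closed_ops\<close>)

lemma converges_unique: "converges f x \<Longrightarrow> converges f y \<Longrightarrow> x = y"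
proof -
  assume f: "converges f x" "converges f y"
  have "(\<lambda>n. sdist A (f n) x + sdist A (f n) y) \<longlonglongrightarrow> 0 + 0"
    using f by (intro tendsto_intros) (auto simp: converges_def)
  moreover have "sdist A x y \<le> sdist A (f n) x + sdist A (f n) y" for n
    using f sdist_triangle[of x "f n" y] sdist_commute[of x "f n"] by (auto simp: converges_def)
  ultimately have "sdist A x y \<le> 0 + 0"
    by (intro LIMSEQ_le_const[of "\<lambda>n. sdist A (f n) x + sdist A (f n) y"]) auto
  then have "sdist A x y = 0" using f sdist_nonneg[of x y] by (auto simp: converges_def)
  then show "x = y" using f by (auto simp: converges_def intro: sdist_eq_0)
qed

lemma converges_Cauchy:
  assumes "\<And>n. f n \<in> elems A" "\<And>e. e > 0 \<Longrightarrow> \<exists>N. \<forall>m\<ge>N. \<forall>n\<ge>N. sdist A (f m) (f n) < e"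
  obtains l where "converges f l"
proof -
  have "(\<forall>n. f n \<in> elems A) \<and> (\<forall>e>0. \<exists>N. \<forall>m\<ge>N. \<forall>n\<ge>N. sdist A (f m) (f n) < e)"
    using assms by simp
  then obtain l where "l \<in> elems A" "(\<lambda>n. sdist A (f n) l) \<longlonglongrightarrow> 0"
    using complete[unfolded dist_complete_def, THEN spec, THEN mp] by metis
  then show thesis using assms(1) that by (simp add: converges_def)
qed

section \<open>Closed subspaces, closed spans and subalgebras\<close>

lemma closed_subspace_iff:
  "closed_subspace A B \<longleftrightarrow> B \<subseteq> elems A \<and> szero A \<in> B \<and> (\<forall>x\<in>B. \<forall>y\<in>B. splus A x y \<in> B) \<and>
    (\<forall>c. \<forall>x\<in>B. sscale A c x \<in> B) \<and> (\<forall>f l. (\<forall>n. f n \<in> B) \<and> converges f l \<longrightarrow> l \<in> B)"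
  unfolding closed_subspace_def converges_def by blast

lemma closed_subspaceI:
  assumes "C \<subseteq> elems A" "szero A \<in> C" "\<And>x y. x \<in> C \<Longrightarrow> y \<in> C \<Longrightarrow> splus A x y \<in> C"
    "\<And>c x. x \<in> C \<Longrightarrow> sscale A c x \<in> C" "\<And>f l. (\<And>n. f n \<in> C) \<Longrightarrow> converges f l \<Longrightarrow> l \<in> C"
  shows "closed_subspace A C"
  unfolding closed_subspace_iff
proof (intro conjI allI ballI impI)
  show "l \<in> C" if "(\<forall>n. f n \<in> C) \<and> converges f l" for f l
    by (rule assms(5)[of f]) (use that in auto)
qed (use assms(1-4) in auto)

lemma closed_subspaceD:
  assumes "closed_subspace A C"
  shows "x \<in> C \<Longrightarrow> x \<in> elems A" "szero A \<in> C" "x \<in> C \<Longrightarrow> y \<in> C \<Longrightarrow> splus A x y \<in> C"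
    "x \<in> C \<Longrightarrow> sscale A c x \<in> C"
  using assms by (auto simp: closed_subspace_def)

lemma closed_star_subalgebraI:
  assumes "closed_subspace A C" "\<And>x y. x \<in> C \<Longrightarrow> y \<in> C \<Longrightarrow> smult A x y \<in> C"
    "\<And>x. x \<in> C \<Longrightarrow> sstar A x \<in> C"
  shows "closed_star_subalgebra A C"
  using assms by (simp add: closed_star_subalgebra_def)

lemma closed_star_subalgebraD:
  assumes "closed_star_subalgebra A C"
  shows "closed_subspace A C" "x \<in> C \<Longrightarrow> y \<in> C \<Longrightarrow> smult A x y \<in> C" "x \<in> C \<Longrightarrow> sstar A x \<in> C"
  using assms by (simp_all add: closed_star_subalgebra_def)

lemma closed_subspace_limit:
  assumes "closed_subspace A C" "\<forall>n. f n \<in> C" "converges f l"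
  shows "l \<in> C"
proof -
  have "\<forall>f l. (\<forall>n. f n \<in> C) \<and> converges f l \<longrightarrow> l \<in> C"
    using assms(1) unfolding closed_subspace_iff by (elim conjE)
  from this[THEN spec, THEN spec, THEN mp, OF conjI[OF assms(2,3)]] show ?thesis .
qed

lemma closed_subspace_elems: "closed_subspace A (elems A)"
  by (simp add: closed_subspace_def closed_ops)

text \<open>The device for passing from generators to closed spans: the elements that a bounded
  linear map sends into \<open>C\<close> form a closed subspace, so by \<open>cspan_least\<close> it
  suffices to test generators. The domain \<open>D\<close> may be a proper subspace because the
  inverse of an isomorphism onto a subalgebra is defined only there.\<close>

lemma closed_subspace_preimage:
  assumes C: "closed_subspace A C"
    and B: "closed_subspace B D" and cB: "cstar_algebra B"
    and f: "\<And>x. x \<in> D \<Longrightarrow> f x \<in> elems A"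
      "\<And>x y. x \<in> D \<Longrightarrow> y \<in> D \<Longrightarrow> f (splus B x y) = splus A (f x) (f y)"
      "\<And>c x. x \<in> D \<Longrightarrow> f (sscale B c x) = sscale A c (f x)"
      "\<And>x. x \<in> D \<Longrightarrow> snorm A (f x) \<le> K * snorm B x"
  shows "closed_subspace B {x \<in> D. f x \<in> C}"
proof -
  interpret B: cstar_algebra B by fact
  have D: "x \<in> elems B" if "x \<in> D" for x using that B by (auto simp: closed_subspace_def)
  have Dd: "splus B x (sscale B (-1) y) \<in> D" if "x \<in> D" "y \<in> D" for x y
    using that B by (auto simp: closed_subspace_def)
  have f0: "f (szero B) = szero A"
    using B C f(1)[of "szero B"] f(3)[of "szero B" 0] by (simp add: closed_subspace_def B.scale_szero scale_zero)
  have "f l \<in> C" if "\<forall>n. g n \<in> D \<and> f (g n) \<in> C" "B.converges g l" for g l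
  proof -
    have l: "l \<in> D" by (rule B.closed_subspace_limit[OF B _ that(2)]) (use that in simp)
    have "converges (\<lambda>n. f (g n)) (f l)"
    proof (rule converges_squeeze)
      have "sdist A (f (g n)) (f l) = snorm A (f (splus B (g n) (sscale B (-1) l)))" for n
        using that l B by (simp add: sdist_def f closed_subspace_def)
      also have "\<dots> n \<le> K * sdist B (g n) l" for n
        unfolding sdist_def by (rule f(4)) (use that l Dd in auto)
      finally show "sdist A (f (g n)) (f l) \<le> K * sdist B (g n) l" for n .
      show "(\<lambda>n. K * sdist B (g n) l) \<longlonglongrightarrow> 0"
        using that by (auto simp: B.converges_def intro!: tendsto_eq_intros)
    qed (use that l f in auto)
    then show ?thesis by (rule closed_subspace_limit[OF C, rotated]) (use that in simp)
  qed
  then have lim: "f l \<in> C" if "\<And>n. g n \<in> D \<and> f (g n) \<in> C" "B.converges g l" for g l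
    using that by blast
  show ?thesis
  proof (rule B.closed_subspaceI)
    show "l \<in> {x \<in> D. f x \<in> C}" if "\<And>n. g n \<in> {x \<in> D. f x \<in> C}" "B.converges g l" for g l
      using lim[of g l] B.closed_subspace_limit[OF B _ that(2)] that by simp
  qed (use B.closed_subspaceD[OF B] closed_subspaceD[OF C] in \<open>auto simp: f f0\<close>)
qed

text \<open>An intersection, as in \<open>cstar_generated\<close>, so that inclusions are proved by
  exhibiting closed subspaces; approximation by finite combinations is recovered in
  \<open>cspan_approx\<close>.\<close>

definition cspan :: "'a set \<Rightarrow> 'a set" where
  "cspan T = {x \<in> elems A. \<forall>C. closed_subspace A C \<and> T \<subseteq> C \<longrightarrow> x \<in> C}"

lemma cspan_least: "closed_subspace A C \<Longrightarrow> T \<subseteq> C \<Longrightarrow> cspan T \<subseteq> C"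
  by (auto simp: cspan_def)

lemma cspan_subset: "cspan T \<subseteq> elems A"
  by (auto simp: cspan_def)

lemma cspan_superset: "T \<subseteq> elems A \<Longrightarrow> T \<subseteq> cspan T"
  by (auto simp: cspan_def)

lemma closed_subspace_cspan: "closed_subspace A (cspan T)"
proof (rule closed_subspaceI)
  show "l \<in> cspan T" if f: "\<And>n. f n \<in> cspan T" "converges f l" for f l
  proof -
    have "l \<in> C" if C: "closed_subspace A C" "T \<subseteq> C" for C
      by (rule closed_subspace_limit[OF C(1) _ f(2)]) (use f C in \<open>auto simp: cspan_def\<close>)
    then show ?thesis using convergesD(2)[OF f(2)] by (auto simp: cspan_def)
  qed
qed (auto simp: cspan_def closed_ops closed_subspaceD)

lemma cspan_mono: "T \<subseteq> T' \<Longrightarrow> cspan T \<subseteq> cspan T'"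
  by (auto simp: cspan_def)

text \<open>One factor at a time: the left factor varies over its closed span while the right one is
  a generator, after which the left factor is fixed and the right one varies.\<close>

lemma cspan_mult:
  assumes C: "closed_subspace A C" and T: "T \<subseteq> elems A" "T' \<subseteq> elems A"
    and m: "\<And>t t'. t \<in> T \<Longrightarrow> t' \<in> T' \<Longrightarrow> smult A t t' \<in> C"
    and "x \<in> cspan T" "y \<in> cspan T'"
  shows "smult A x y \<in> C"
proof -
  have 1: "smult A x t \<in> C" if "x \<in> cspan T" "t \<in> T'" for x t
  proof -
    have t: "t \<in> elems A" using that T by auto
    have "closed_subspace A {x \<in> elems A. smult A x t \<in> C}"
      by (rule closed_subspace_preimage[OF C closed_subspace_elems cstar_algebra_axioms, where K = "snorm A t"])
        (use t norm_mult[OF _ t] in \<open>simp_all add: closed_ops plus_mult scale_mult mult.commute\<close>)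
    then show ?thesis using cspan_least[of "{x \<in> elems A. smult A x t \<in> C}" T] T m that by auto
  qed
  have x: "x \<in> elems A" using assms(5) cspan_subset by blast
  have "closed_subspace A {y \<in> elems A. smult A x y \<in> C}"
    by (rule closed_subspace_preimage[OF C closed_subspace_elems cstar_algebra_axioms, where K = "snorm A x"])
      (use x in \<open>auto simp: closed_ops mult_plus mult_scale norm_mult\<close>)
  then show ?thesis using cspan_least[of "{y \<in> elems A. smult A x y \<in> C}" T'] T 1 assms by auto
qed

text \<open>The adjoint is conjugate linear, so \<open>closed_subspace_preimage\<close> does not
  apply and the preimage is treated by hand.\<close>

lemma cspan_star:
  assumes C: "closed_subspace A C" and T: "T \<subseteq> elems A"
    and m: "\<And>t. t \<in> T \<Longrightarrow> sstar A t \<in> C" and x: "x \<in> cspan T"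
  shows "sstar A x \<in> C"
proof -
  have sub: "C \<subseteq> elems A" using C by (simp add: closed_subspace_def)
  have "closed_subspace A {x \<in> elems A. sstar A x \<in> C}"
  proof (rule closed_subspaceI)
    show "l \<in> {x \<in> elems A. sstar A x \<in> C}"
      if f: "\<And>n. f n \<in> {x \<in> elems A. sstar A x \<in> C}" "converges f l" for f l
      using closed_subspace_limit[OF C _ converges_star[OF f(2)]] f(1) convergesD(2)[OF f(2)] by simp
  qed (use closed_subspaceD[OF C] in \<open>auto simp: closed_ops star_plus star_scale star_szero\<close>)
  then show ?thesis using cspan_least[of "{x \<in> elems A. sstar A x \<in> C}" T] T m x by auto
qed

text \<open>If the generators are closed under products and adjoints, their closed linear span
  already is an algebra. This reduces the generated algebras below to linear combinations of
  generators.\<close>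

lemma elems_cstar_generated:
  assumes T: "T \<subseteq> elems A" and m: "\<And>s t. s \<in> T \<Longrightarrow> t \<in> T \<Longrightarrow> smult A s t \<in> T"
    and st: "\<And>t. t \<in> T \<Longrightarrow> sstar A t \<in> T"
  shows "elems (cstar_generated A T) = cspan T"
proof
  have "closed_star_subalgebra A (cspan T)"
    unfolding closed_star_subalgebra_def
    using closed_subspace_cspan cspan_mult[OF closed_subspace_cspan T T] cspan_star[OF closed_subspace_cspan T]
      m st cspan_superset[OF T] by blast
  then show "elems (cstar_generated A T) \<subseteq> cspan T"
    using cspan_superset[OF T] by (auto simp: cstar_generated_def)
  show "cspan T \<subseteq> elems (cstar_generated A T)"
    by (auto simp: cstar_generated_def closed_star_subalgebra_def cspan_def)
qed

lemma closed_star_subalgebra_generated: "closed_star_subalgebra A (elems (cstar_generated A T))"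
proof -
  let ?B = "elems (cstar_generated A T)"
  have in_B: "x \<in> ?B \<longleftrightarrow> x \<in> elems A \<and> (\<forall>B. closed_star_subalgebra A B \<and> T \<subseteq> B \<longrightarrow> x \<in> B)" for x
    by (simp add: cstar_generated_def)
  show ?thesis
  proof (intro closed_star_subalgebraI closed_subspaceI)
    show "l \<in> ?B" if f: "\<And>n. f n \<in> ?B" "converges f l" for f l
    proof -
      have "l \<in> B" if B: "closed_star_subalgebra A B" "T \<subseteq> B" for B
        by (rule closed_subspace_limit[OF closed_star_subalgebraD(1)[OF B(1)] _ f(2)])
          (use f(1) B in \<open>auto simp: in_B\<close>)
      then show ?thesis using convergesD(2)[OF f(2)] by (auto simp: in_B)
    qed
  qed (auto simp: in_B closed_ops closed_star_subalgebraD closed_subspaceD[OF closed_star_subalgebraD(1)])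
qed

lemma generated_superset: "T \<subseteq> elems A \<Longrightarrow> T \<subseteq> elems (cstar_generated A T)"
  by (auto simp: cstar_generated_def)

lemma generated_least: "closed_star_subalgebra A B \<Longrightarrow> T \<subseteq> B \<Longrightarrow> elems (cstar_generated A T) \<subseteq> B"
  by (auto simp: cstar_generated_def)

lemma cstar_subalgebra:
  assumes B: "closed_star_subalgebra A B"
  shows "cstar_algebra (A\<lparr>elems := B\<rparr>)"
proof -
  have sub: "B \<subseteq> elems A" using B by (simp add: closed_star_subalgebra_def closed_subspace_def)
  have sd: "sdist (A\<lparr>elems := B\<rparr>) = sdist A" by (simp add: sdist_def fun_eq_iff)
  have "dist_complete B (sdist A)"
    unfolding dist_complete_def
  proof (intro allI impI)
    fix f :: "nat \<Rightarrow> 'a"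
    assume f: "(\<forall>n. f n \<in> B) \<and> (\<forall>e>0. \<exists>N. \<forall>m\<ge>N. \<forall>n\<ge>N. sdist A (f m) (f n) < e)"
    then obtain l where l: "converges f l" using converges_Cauchy[of f] sub by blast
    then have "l \<in> B"
      using closed_subspace_limit[of B f l] f B unfolding closed_star_subalgebra_def by blast
    then show "\<exists>l\<in>B. (\<lambda>n. sdist A (f n) l) \<longlonglongrightarrow> 0" using l by (auto simp: converges_def)
  qed
  moreover note closed_star_subalgebraD(2,3)[OF B] closed_subspaceD(2,3,4)[OF closed_star_subalgebraD(1)[OF B]]
  moreover have "x \<in> elems A" if "x \<in> B" for x using that sub by auto
  ultimately show ?thesis
    by unfold_locales
      (simp_all add: sd plus_assoc plus_zero scale_zero
        scale_one scale_scale scale_plus plus_scale mult_assoc mult_plus plus_mult scale_mult mult_scale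
        star_star star_plus star_scale star_mult norm_zero_iff norm_triangle norm_scale norm_mult
        cstar_identity plus_commute plus_ac)
qed

lemma closed_subspace_of_subalgebra:
  assumes B: "closed_star_subalgebra A B" and C: "closed_subspace (A\<lparr>elems := B\<rparr>) C"
  shows "closed_subspace A C"
proof -
  interpret B: cstar_algebra "A\<lparr>elems := B\<rparr>" by (rule cstar_subalgebra[OF B])
  have sd: "sdist (A\<lparr>elems := B\<rparr>) = sdist A" by (simp add: sdist_def fun_eq_iff)
  note B' = closed_star_subalgebraD(1)[OF B]
  have CB: "x \<in> B" if "x \<in> C" for x using B.closed_subspaceD(1)[OF C that] by simp
  show ?thesis
  proof (rule closed_subspaceI)
    show "C \<subseteq> elems A" using CB closed_subspaceD(1)[OF B'] by auto
    show "l \<in> C" if f: "\<And>n. f n \<in> C" "converges f l" for f l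
    proof (rule B.closed_subspace_limit[OF C])
      show "B.converges f l"
        using f(2) CB[OF f(1)] closed_subspace_limit[OF B' _ f(2)] unfolding B.converges_def converges_def sd by auto
    qed (use f in auto)
  qed (use B.closed_subspaceD[OF C] in auto)
qed

lemma cstar_algebra_generated: "cstar_algebra (cstar_generated A T)"
  using cstar_subalgebra[OF closed_star_subalgebra_generated[of T]] by (simp add: cstar_generated_def)

end

lemma cstar_generated_simps [simp]:
  "szero (cstar_generated A T) = szero A" "splus (cstar_generated A T) = splus A"
  "sscale (cstar_generated A T) = sscale A" "smult (cstar_generated A T) = smult A"
  "sstar (cstar_generated A T) = sstar A" "snorm (cstar_generated A T) = snorm A"
  "sdist (cstar_generated A T) = sdist A"
  by (simp_all add: cstar_generated_def sdist_def fun_eq_iff)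

section \<open>Homomorphisms between generated algebras\<close>

declare in_listsD [rule del]

text \<open>Formal combinations are lists, so that one and the same combination can be evaluated in
  different algebras; repeated labels do no harm since only values are compared.\<close>

fun lcomb :: "'a star_algebra \<Rightarrow> ('m \<Rightarrow> 'a) \<Rightarrow> (complex \<times> 'm) list \<Rightarrow> 'a" where
  "lcomb A u [] = szero A"
| "lcomb A u ((c, m) # l) = splus A (sscale A c (u m)) (lcomb A u l)"

abbreviation comb_scale :: "complex \<Rightarrow> (complex \<times> 'm) list \<Rightarrow> (complex \<times> 'm) list" where
  "comb_scale d \<equiv> map (\<lambda>(c, m). (d * c, m))"

abbreviation comb_map :: "(complex \<Rightarrow> complex) \<Rightarrow> ('m \<Rightarrow> 'n) \<Rightarrow> (complex \<times> 'm) list \<Rightarrow> (complex \<times> 'n) list" where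
  "comb_map h f \<equiv> map (\<lambda>(c, m). (h c, f m))"

definition comb_mult :: "('m \<Rightarrow> 'm \<Rightarrow> 'm) \<Rightarrow> (complex \<times> 'm) list \<Rightarrow> (complex \<times> 'm) list \<Rightarrow> (complex \<times> 'm) list" where
  "comb_mult mul l l' = concat (map (\<lambda>(c, m). comb_map ((*) c) (mul m) l') l)"

abbreviation combs :: "'m set \<Rightarrow> (complex \<times> 'm) list set" where
  "combs M \<equiv> lists (UNIV \<times> M)"

lemma comb_scale_combs: "l \<in> combs M \<Longrightarrow> comb_scale d l \<in> combs M"
  by (induction l) auto

lemma comb_map_combs: "l \<in> combs M \<Longrightarrow> (\<And>m. m \<in> M \<Longrightarrow> f m \<in> N) \<Longrightarrow> comb_map h f l \<in> combs N"
  by (induction l) auto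

lemma lcomb_generated [simp]: "lcomb (cstar_generated A T) u = lcomb A u"
proof
  show "lcomb (cstar_generated A T) u l = lcomb A u l" for l by (induction l) auto
qed

lemma comb_mult_combs:
  "\<lbrakk>l \<in> combs M; l' \<in> combs M; \<And>m n. m \<in> M \<Longrightarrow> n \<in> M \<Longrightarrow> mul m n \<in> M\<rbrakk> \<Longrightarrow> comb_mult mul l l' \<in> combs M"
  by (fastforce simp: comb_mult_def in_lists_conv_set)

context cstar_algebra
begin

context
  fixes u :: "'m \<Rightarrow> 'a" and M :: "'m set"
  assumes u: "\<And>m. m \<in> M \<Longrightarrow> u m \<in> elems A"
begin

lemma lcomb_closed: "l \<in> combs M \<Longrightarrow> lcomb A u l \<in> elems A"
  by (induction l) (auto simp: closed_ops u)

lemma lcomb_append: "l \<in> combs M \<Longrightarrow> l' \<in> combs M \<Longrightarrow> lcomb A u (l @ l') = splus A (lcomb A u l) (lcomb A u l')"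
  by (induction l) (auto simp: closed_ops u zero_plus lcomb_closed plus_assoc)

lemma lcomb_scale: "l \<in> combs M \<Longrightarrow> lcomb A u (comb_scale d l) = sscale A d (lcomb A u l)"
  by (induction l) (auto simp: closed_ops u scale_szero lcomb_closed scale_plus scale_scale)

lemma lcomb_star:
  assumes "\<And>m. m \<in> M \<Longrightarrow> u (iv m) = sstar A (u m)"
  shows "l \<in> combs M \<Longrightarrow> lcomb A u (comb_map cnj iv l) = sstar A (lcomb A u l)"
  by (induction l) (auto simp: closed_ops u star_szero lcomb_closed star_plus star_scale assms)

lemma lcomb_mult:
  assumes mul: "\<And>m n. m \<in> M \<Longrightarrow> n \<in> M \<Longrightarrow> mul m n \<in> M \<and> u (mul m n) = smult A (u m) (u n)"
    and l': "l' \<in> combs M"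
  shows "l \<in> combs M \<Longrightarrow> lcomb A u (comb_mult mul l l') = smult A (lcomb A u l) (lcomb A u l')"
proof (induction l)
  case Nil
  then show ?case by (simp add: comb_mult_def szero_mult lcomb_closed[OF l'])
next
  case (Cons p l)
  obtain c m where p: "p = (c, m)" by force
  have m: "m \<in> M" and l: "l \<in> combs M" using Cons.prems by (auto simp: p)
  have 1: "lcomb A u (comb_map ((*) c) (mul m) k) = smult A (sscale A c (u m)) (lcomb A u k)"
    if "k \<in> combs M" for k
    using that
  proof (induction k)
    case Nil
    then show ?case by (simp add: mult_szero closed_ops u m)
  next
    case (Cons q k)
    then show ?case
      by (cases q) (auto simp: u m mul lcomb_closed closed_ops mult_plus scale_mult mult_scale scale_scale mult.commute)
  qed
  have "comb_map ((*) c) (mul m) l' \<in> combs M" using mul m by (intro comb_map_combs[OF l']) auto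
  then show ?case
    using Cons.IH[OF l] 1[OF l'] comb_mult_combs[OF l l'] mul
    by (simp add: comb_mult_def p) (simp add: lcomb_append plus_mult closed_ops u m lcomb_closed l l')
qed

lemma lcomb_diff:
  "l \<in> combs M \<Longrightarrow> l' \<in> combs M \<Longrightarrow> sdist A (lcomb A u l) (lcomb A u l') = snorm A (lcomb A u (l @ comb_scale (-1) l'))"
  by (simp only: lcomb_append comb_scale_combs lcomb_scale sdist_def)

lemma lcomb_in_cspan: "l \<in> combs M \<Longrightarrow> lcomb A u l \<in> cspan (u ` M)"
proof (induction l)
  case Nil
  then show ?case by (simp add: closed_subspaceD[OF closed_subspace_cspan])
next
  case (Cons p l)
  have "u ` M \<subseteq> cspan (u ` M)" using u by (intro cspan_superset) auto
  then show ?case using Cons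
    by (cases p) (auto intro!: closed_subspaceD(3,4)[OF closed_subspace_cspan])
qed

text \<open>The elements that finite combinations approximate form a closed subspace containing the
  generators.\<close>

lemma cspan_approx:
  assumes "x \<in> cspan (u ` M)"
  obtains f where "\<And>n. f n \<in> combs M" "converges (\<lambda>n. lcomb A u (f n)) x"
proof -
  let ?D = "{x \<in> elems A. \<forall>e>0. \<exists>l \<in> combs M. sdist A (lcomb A u l) x < e}"
  have "closed_subspace A ?D"
  proof (rule closed_subspaceI)
    have "sdist A (lcomb A u []) (szero A) = 0" by (simp add: sdist_self zero_closed)
    then show "szero A \<in> ?D"
      by (auto simp: zero_closed intro!: bexI[of _ "[]"])
  next
    fix x y assume x: "x \<in> ?D" and y: "y \<in> ?D"
    have "\<exists>l \<in> combs M. sdist A (lcomb A u l) (splus A x y) < e" if e: "e > 0" for e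
    proof -
      obtain l l' where l: "l \<in> combs M" "l' \<in> combs M"
        "sdist A (lcomb A u l) x < e / 2" "sdist A (lcomb A u l') y < e / 2"
        using x y half_gt_zero[OF e] by blast
      then have "sdist A (lcomb A u (l @ l')) (splus A x y) < e"
        using sdist_plus[of "lcomb A u l" "lcomb A u l'" x y] x y
        by (simp add: lcomb_append lcomb_closed)
      then show ?thesis using l by (intro bexI[of _ "l @ l'"]) auto
    qed
    then show "splus A x y \<in> ?D" using x y by (auto simp: closed_ops)
  next
    fix c x assume x: "x \<in> ?D"
    have "\<exists>l \<in> combs M. sdist A (lcomb A u l) (sscale A c x) < e" if e: "e > 0" for e
    proof -
      \<comment> \<open>The summand 1 keeps the divisor positive when \<open>c = 0\<close>.\<close>
      have "e / (cmod c + 1) > 0" using e by (simp add: add_nonneg_pos)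
      then obtain l where l: "l \<in> combs M" "sdist A (lcomb A u l) x < e / (cmod c + 1)"
        using x by auto
      have "sdist A (lcomb A u (comb_scale c l)) (sscale A c x) = cmod c * sdist A (lcomb A u l) x"
        using x l by (simp add: lcomb_scale sdist_scale lcomb_closed)
      also have "\<dots> \<le> cmod c * (e / (cmod c + 1))" using l by (intro mult_left_mono) auto
      also have "\<dots> < e" using e by (simp add: divide_simps add_nonneg_pos)
      finally show ?thesis using comb_scale_combs[OF l(1)] by blast
    qed
    then show "sscale A c x \<in> ?D" using x by (auto simp: closed_ops)
  next
    fix f x assume f: "\<And>n. f n \<in> ?D" "converges f x"
    have "\<exists>l \<in> combs M. sdist A (lcomb A u l) x < e" if e: "e > 0" for e
    proof -
      have "(\<lambda>n. sdist A (f n) x) \<longlonglongrightarrow> 0" using f by (simp add: converges_def)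
      then have "eventually (\<lambda>n. sdist A (f n) x < e / 2) sequentially"
        using that by (intro order_tendstoD) auto
      then obtain n where n: "sdist A (f n) x < e / 2" by (auto simp: eventually_sequentially)
      obtain l where l: "l \<in> combs M" "sdist A (lcomb A u l) (f n) < e / 2"
        using f(1)[of n] half_gt_zero[OF e] by blast
      have "sdist A (lcomb A u l) x \<le> sdist A (lcomb A u l) (f n) + sdist A (f n) x"
        using l f convergesD[OF f(2)] by (intro sdist_triangle) (auto simp: lcomb_closed)
      then show ?thesis using n l by (intro bexI[of _ l]) auto
    qed
    then show "x \<in> ?D" using convergesD[OF f(2)] by auto
  qed auto
  moreover have "u ` M \<subseteq> ?D"
  proof safe
    fix m e assume m: "m \<in> M" and "e > (0 :: real)"
    have "sdist A (lcomb A u [(1, m)]) (u m) = 0"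
      by (simp add: u m scale_one plus_zero sdist_self)
    then show "\<exists>l \<in> combs M. sdist A (lcomb A u l) (u m) < e"
      using m \<open>e > 0\<close> by (intro bexI[of _ "[(1, m)]"]) auto
  qed (simp add: u)
  ultimately have xD: "x \<in> ?D" using cspan_least[of ?D "u ` M"] assms by blast
  have "\<forall>n. \<exists>l. l \<in> combs M \<and> sdist A (lcomb A u l) x < 1 / real (Suc n)"
  proof
    fix n
    have "(0::real) < 1 / real (Suc n)" by simp
    then show "\<exists>l. l \<in> combs M \<and> sdist A (lcomb A u l) x < 1 / real (Suc n)" using xD by blast
  qed
  then obtain f where f: "\<And>n. f n \<in> combs M" "\<And>n. sdist A (lcomb A u (f n)) x < 1 / real (Suc n)"
    by metis
  have "converges (\<lambda>n. lcomb A u (f n)) x"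
    by (rule converges_squeeze[where g = "\<lambda>n. 1 / real (Suc n)"])
      (use f xD less_imp_le LIMSEQ_Suc[OF lim_1_over_n] in \<open>auto simp: lcomb_closed\<close>)
  with f(1) show thesis by (rule that)
qed

end

end

definition star_hom :: "'a star_algebra \<Rightarrow> 'b star_algebra \<Rightarrow> ('a \<Rightarrow> 'b) \<Rightarrow> bool" where
  "star_hom A B \<phi> \<longleftrightarrow> (\<forall>x\<in>elems A. \<phi> x \<in> elems B) \<and>
    (\<forall>x\<in>elems A. \<forall>y\<in>elems A. \<phi> (splus A x y) = splus B (\<phi> x) (\<phi> y)) \<and>
    (\<forall>c. \<forall>x\<in>elems A. \<phi> (sscale A c x) = sscale B c (\<phi> x)) \<and>
    (\<forall>x\<in>elems A. \<forall>y\<in>elems A. \<phi> (smult A x y) = smult B (\<phi> x) (\<phi> y)) \<and>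
    (\<forall>x\<in>elems A. \<phi> (sstar A x) = sstar B (\<phi> x))"

lemma star_homD:
  assumes "star_hom A B \<phi>" "x \<in> elems A"
  shows "\<phi> x \<in> elems B" "y \<in> elems A \<Longrightarrow> \<phi> (splus A x y) = splus B (\<phi> x) (\<phi> y)"
    "\<phi> (sscale A c x) = sscale B c (\<phi> x)" "y \<in> elems A \<Longrightarrow> \<phi> (smult A x y) = smult B (\<phi> x) (\<phi> y)"
    "\<phi> (sstar A x) = sstar B (\<phi> x)"
  using assms by (auto simp: star_hom_def)

text \<open>Two families with the same labels and the same multiplication rule. Comparing norms of
  formal combinations is then enough to compare the algebras that they generate.\<close>

locale comb_pair = A: cstar_algebra A + B: cstar_algebra B
  for A :: "'a star_algebra" and B :: "'b star_algebra" +
  fixes u :: "'m \<Rightarrow> 'a" and w :: "'m \<Rightarrow> 'b" and M :: "'m set"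
    and mul :: "'m \<Rightarrow> 'm \<Rightarrow> 'm" and iv :: "'m \<Rightarrow> 'm"
  assumes u: "m \<in> M \<Longrightarrow> u m \<in> elems A" and w: "m \<in> M \<Longrightarrow> w m \<in> elems B"
    and mul: "m \<in> M \<Longrightarrow> n \<in> M \<Longrightarrow> mul m n \<in> M" and iv: "m \<in> M \<Longrightarrow> iv m \<in> M"
    and u_mul: "m \<in> M \<Longrightarrow> n \<in> M \<Longrightarrow> u (mul m n) = smult A (u m) (u n)"
    and w_mul: "m \<in> M \<Longrightarrow> n \<in> M \<Longrightarrow> w (mul m n) = smult B (w m) (w n)"
    and u_iv: "m \<in> M \<Longrightarrow> u (iv m) = sstar A (u m)"
    and w_iv: "m \<in> M \<Longrightarrow> w (iv m) = sstar B (w m)"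
begin

lemma lcomb_A:
  assumes l: "l \<in> combs M"
  shows "lcomb A u l \<in> elems A"
    "l' \<in> combs M \<Longrightarrow> lcomb A u (l @ l') = splus A (lcomb A u l) (lcomb A u l')"
    "lcomb A u (comb_scale d l) = sscale A d (lcomb A u l)"
    "lcomb A u (comb_map cnj iv l) = sstar A (lcomb A u l)"
    "l' \<in> combs M \<Longrightarrow> lcomb A u (comb_mult mul l l') = smult A (lcomb A u l) (lcomb A u l')"
    "l' \<in> combs M \<Longrightarrow> sdist A (lcomb A u l) (lcomb A u l') = snorm A (lcomb A u (l @ comb_scale (-1) l'))"
    "lcomb A u l \<in> A.cspan (u ` M)"
  by (rule A.lcomb_closed[of M] A.lcomb_append[of M] A.lcomb_scale[of M] A.lcomb_star[of M]
      A.lcomb_mult[of M] A.lcomb_diff[of M] A.lcomb_in_cspan[of M];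
      simp add: u l mul iv u_mul u_iv)+

lemma lcomb_B:
  assumes l: "l \<in> combs M"
  shows "lcomb B w l \<in> elems B"
    "l' \<in> combs M \<Longrightarrow> lcomb B w (l @ l') = splus B (lcomb B w l) (lcomb B w l')"
    "lcomb B w (comb_scale d l) = sscale B d (lcomb B w l)"
    "lcomb B w (comb_map cnj iv l) = sstar B (lcomb B w l)"
    "l' \<in> combs M \<Longrightarrow> lcomb B w (comb_mult mul l l') = smult B (lcomb B w l) (lcomb B w l')"
    "l' \<in> combs M \<Longrightarrow> sdist B (lcomb B w l) (lcomb B w l') = snorm B (lcomb B w (l @ comb_scale (-1) l'))"
    "lcomb B w l \<in> B.cspan (w ` M)"
  by (rule B.lcomb_closed[of M] B.lcomb_append[of M] B.lcomb_scale[of M] B.lcomb_star[of M]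
      B.lcomb_mult[of M] B.lcomb_diff[of M] B.lcomb_in_cspan[of M];
      simp add: w l mul iv w_mul w_iv)+

text \<open>The closure of the relation between the two values of a formal combination. It respects
  all operations regardless of norms; a norm inequality then makes it total and single-valued, hence
  the graph of a homomorphism, and no choice of approximating sequences has to be checked for
  consistency.\<close>

definition graph :: "'a \<Rightarrow> 'b \<Rightarrow> bool" where
  "graph x y \<longleftrightarrow> (\<exists>f. (\<forall>n. f n \<in> combs M) \<and> A.converges (\<lambda>n. lcomb A u (f n)) x \<and>
    B.converges (\<lambda>n. lcomb B w (f n)) y)"

lemma graphE:
  assumes "graph x y"
  obtains f where "\<And>n. f n \<in> combs M" "A.converges (\<lambda>n. lcomb A u (f n)) x"
    "B.converges (\<lambda>n. lcomb B w (f n)) y"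
  using assms unfolding graph_def by blast

lemma graph_generator: "m \<in> M \<Longrightarrow> graph (u m) (w m)"
  unfolding graph_def
  by (rule exI[of _ "\<lambda>_. [(1, m)]"])
    (auto simp: u w A.scale_one B.scale_one A.plus_zero B.plus_zero A.converges_const B.converges_const)

lemma graph_plus: assumes "graph x y" "graph x' y'" shows "graph (splus A x x') (splus B y y')"
proof -
  obtain f where f: "\<And>n. f n \<in> combs M" "A.converges (\<lambda>n. lcomb A u (f n)) x"
    "B.converges (\<lambda>n. lcomb B w (f n)) y" by (rule graphE[OF assms(1)]) (rule that)
  obtain g where g: "\<And>n. g n \<in> combs M" "A.converges (\<lambda>n. lcomb A u (g n)) x'"
    "B.converges (\<lambda>n. lcomb B w (g n)) y'" by (rule graphE[OF assms(2)]) (rule that)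
  show ?thesis
    unfolding graph_def
    by (rule exI[of _ "\<lambda>n. f n @ g n"], simp only: lcomb_A(2)[OF f(1) g(1)] lcomb_B(2)[OF f(1) g(1)])
      (use f(1) g(1) A.converges_plus[OF f(2) g(2)] B.converges_plus[OF f(3) g(3)] in auto)
qed

lemma graph_scale: assumes "graph x y" shows "graph (sscale A c x) (sscale B c y)"
proof -
  obtain f where f: "\<And>n. f n \<in> combs M" "A.converges (\<lambda>n. lcomb A u (f n)) x"
    "B.converges (\<lambda>n. lcomb B w (f n)) y" by (rule graphE[OF assms(1)]) (rule that)
  have "comb_scale c (f n) \<in> combs M" for n by (rule comb_scale_combs[OF f(1)])
  then show ?thesis
    unfolding graph_def
    by (intro exI[of _ "\<lambda>n. comb_scale c (f n)"], simp only: lcomb_A(3)[OF f(1)] lcomb_B(3)[OF f(1)])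
      (use A.converges_scale[OF f(2)] B.converges_scale[OF f(3)] in auto)
qed

lemma graph_star: assumes "graph x y" shows "graph (sstar A x) (sstar B y)"
proof -
  obtain f where f: "\<And>n. f n \<in> combs M" "A.converges (\<lambda>n. lcomb A u (f n)) x"
    "B.converges (\<lambda>n. lcomb B w (f n)) y" by (rule graphE[OF assms(1)]) (rule that)
  have "comb_map cnj iv (f n) \<in> combs M" for n by (rule comb_map_combs[OF f(1) iv])
  then show ?thesis
    unfolding graph_def
    by (intro exI[of _ "\<lambda>n. comb_map cnj iv (f n)"], simp only: lcomb_A(4)[OF f(1)] lcomb_B(4)[OF f(1)])
      (use A.converges_star[OF f(2)] B.converges_star[OF f(3)] in auto)
qed

lemma graph_mult: assumes "graph x y" "graph x' y'" shows "graph (smult A x x') (smult B y y')"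
proof -
  obtain f where f: "\<And>n. f n \<in> combs M" "A.converges (\<lambda>n. lcomb A u (f n)) x"
    "B.converges (\<lambda>n. lcomb B w (f n)) y" by (rule graphE[OF assms(1)]) (rule that)
  obtain g where g: "\<And>n. g n \<in> combs M" "A.converges (\<lambda>n. lcomb A u (g n)) x'"
    "B.converges (\<lambda>n. lcomb B w (g n)) y'" by (rule graphE[OF assms(2)]) (rule that)
  have "lcomb A u (comb_mult mul (f n) (g n)) = smult A (lcomb A u (f n)) (lcomb A u (g n))" for n
    by (rule lcomb_A(5)[OF f(1) g(1)])
  moreover have "lcomb B w (comb_mult mul (f n) (g n)) = smult B (lcomb B w (f n)) (lcomb B w (g n))" for n
    by (rule lcomb_B(5)[OF f(1) g(1)])
  ultimately show ?thesis
    unfolding graph_def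
    by (intro exI[of _ "\<lambda>n. comb_mult mul (f n) (g n)"])
      (use comb_mult_combs[OF f(1) g(1) mul] A.converges_mult[OF f(2) g(2)] B.converges_mult[OF f(3) g(3)] in auto)
qed

lemma graph_closed: assumes "graph x y" shows "x \<in> A.cspan (u ` M)" "y \<in> B.cspan (w ` M)"
proof -
  obtain f where f: "\<And>n. f n \<in> combs M" "A.converges (\<lambda>n. lcomb A u (f n)) x"
    "B.converges (\<lambda>n. lcomb B w (f n)) y" by (rule graphE[OF assms]) (rule that)
  show "x \<in> A.cspan (u ` M)"
    by (rule A.closed_subspace_limit[OF A.closed_subspace_cspan _ f(2)]) (simp add: lcomb_A(7)[OF f(1)])
  show "y \<in> B.cspan (w ` M)"
    by (rule B.closed_subspace_limit[OF B.closed_subspace_cspan _ f(3)]) (simp add: lcomb_B(7)[OF f(1)])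
qed

lemma graph_norm_le:
  assumes "\<And>l. l \<in> combs M \<Longrightarrow> snorm B (lcomb B w l) \<le> snorm A (lcomb A u l)" "graph x y"
  shows "snorm B y \<le> snorm A x"
proof -
  obtain f where f: "\<And>n. f n \<in> combs M" "A.converges (\<lambda>n. lcomb A u (f n)) x"
    "B.converges (\<lambda>n. lcomb B w (f n)) y" by (rule graphE[OF assms(2)]) (rule that)
  show ?thesis
    by (rule LIMSEQ_le[OF B.converges_norm[OF f(3)] A.converges_norm[OF f(2)]]) (use assms(1) f(1) in blast)
qed

text \<open>The norm inequality, applied to differences of combinations, carries Cauchy sequences
  from \<open>A\<close> to \<open>B\<close>.\<close>

lemma graph_total:
  assumes le: "\<And>l. l \<in> combs M \<Longrightarrow> snorm B (lcomb B w l) \<le> snorm A (lcomb A u l)"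
    and x: "x \<in> A.cspan (u ` M)"
  shows "\<exists>y. graph x y"
proof -
  obtain f where f: "\<And>n. f n \<in> combs M" "A.converges (\<lambda>n. lcomb A u (f n)) x"
    by (rule A.cspan_approx[of M u x, OF u x]) (assumption, rule that)
  have cl: "lcomb A u (f n) \<in> elems A" "lcomb B w (f n) \<in> elems B" for n
    using lcomb_A(1)[OF f(1)] lcomb_B(1)[OF f(1)] by auto
  have "\<exists>N. \<forall>m\<ge>N. \<forall>n\<ge>N. sdist B (lcomb B w (f m)) (lcomb B w (f n)) < e" if "e > 0" for e
  proof -
    have "(\<lambda>n. sdist A (lcomb A u (f n)) x) \<longlonglongrightarrow> 0" using f by (simp add: A.converges_def)
    then have "eventually (\<lambda>n. sdist A (lcomb A u (f n)) x < e / 2) sequentially"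
      using that by (intro order_tendstoD) auto
    then obtain N where N: "\<And>n. n \<ge> N \<Longrightarrow> sdist A (lcomb A u (f n)) x < e / 2"
      by (auto simp: eventually_sequentially)
    have "sdist B (lcomb B w (f m)) (lcomb B w (f n)) < e" if "m \<ge> N" "n \<ge> N" for m n
    proof -
      have c: "f m @ comb_scale (-1) (f n) \<in> combs M"
        by (simp only: append_in_lists_conv f(1) comb_scale_combs[OF f(1)] simp_thms)
      have "sdist B (lcomb B w (f m)) (lcomb B w (f n)) \<le> sdist A (lcomb A u (f m)) (lcomb A u (f n))"
        unfolding lcomb_A(6)[OF f(1) f(1)] lcomb_B(6)[OF f(1) f(1)] by (rule le[OF c])
      also have "\<dots> \<le> sdist A (lcomb A u (f m)) x + sdist A (lcomb A u (f n)) x"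
        using A.sdist_triangle[of "lcomb A u (f m)" x "lcomb A u (f n)"] cl A.convergesD(2)[OF f(2)]
        by (simp add: A.sdist_commute)
      finally show ?thesis using N[OF that(1)] N[OF that(2)] by simp
    qed
    then show ?thesis by blast
  qed
  then obtain y where "B.converges (\<lambda>n. lcomb B w (f n)) y"
    using B.converges_Cauchy[of "\<lambda>n. lcomb B w (f n)"] cl by blast
  then show ?thesis using f unfolding graph_def by blast
qed

text \<open>The difference of the two values is related to \<open>x\<close> minus itself, so its
  norm is at most 0.\<close>

lemma graph_unique:
  assumes le: "\<And>l. l \<in> combs M \<Longrightarrow> snorm B (lcomb B w l) \<le> snorm A (lcomb A u l)"
    and g: "graph x y" "graph x y'"
  shows "y = y'"
proof -
  have x: "x \<in> elems A" and y: "y \<in> elems B" "y' \<in> elems B"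
    using graph_closed g A.cspan_subset B.cspan_subset by blast+
  have "snorm B (splus B y (sscale B (-1) y')) \<le> snorm A (splus A x (sscale A (-1) x))"
    by (rule graph_norm_le[OF le graph_plus[OF g(1) graph_scale[OF g(2)]]])
  then have "sdist B y y' = 0"
    using A.plus_minus[OF x] B.sdist_nonneg[OF y] by (simp add: A.norm_szero sdist_def)
  then show ?thesis using B.sdist_eq_0 y by blast
qed

lemma generated_elems:
  "elems (cstar_generated A (u ` M)) = A.cspan (u ` M)" "elems (cstar_generated B (w ` M)) = B.cspan (w ` M)"
proof -
  show "elems (cstar_generated A (u ` M)) = A.cspan (u ` M)"
    by (rule A.elems_cstar_generated) (auto simp: u simp flip: u_mul u_iv intro!: imageI mul iv)
  show "elems (cstar_generated B (w ` M)) = B.cspan (w ` M)"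
    by (rule B.elems_cstar_generated) (auto simp: w simp flip: w_mul w_iv intro!: imageI mul iv)
qed

theorem generated_hom:
  assumes le: "\<And>l. l \<in> combs M \<Longrightarrow> snorm B (lcomb B w l) \<le> snorm A (lcomb A u l)"
  obtains \<phi> where "star_hom (cstar_generated A (u ` M)) (cstar_generated B (w ` M)) \<phi>"
    "\<And>m. m \<in> M \<Longrightarrow> \<phi> (u m) = w m"
    "\<And>x. x \<in> elems (cstar_generated A (u ` M)) \<Longrightarrow> snorm B (\<phi> x) \<le> snorm A x"
    "\<And>x. x \<in> elems (cstar_generated A (u ` M)) \<Longrightarrow> graph x (\<phi> x)"
proof -
  define \<phi> where "\<phi> x = (SOME y. graph x y)" for x
  have \<phi>: "graph x (\<phi> x)" if "x \<in> A.cspan (u ` M)" for x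
    unfolding \<phi>_def by (rule someI_ex[OF graph_total[OF le that]])
  have eq: "\<phi> x = y" if "graph x y" for x y
    using graph_unique[OF le \<phi>[OF graph_closed(1)[OF that]] that] .
  show thesis
  proof (rule that[of \<phi>])
    show "star_hom (cstar_generated A (u ` M)) (cstar_generated B (w ` M)) \<phi>"
      unfolding star_hom_def generated_elems
      using graph_closed(2)[OF \<phi>] eq[OF graph_plus[OF \<phi> \<phi>]] eq[OF graph_scale[OF \<phi>]]
        eq[OF graph_mult[OF \<phi> \<phi>]] eq[OF graph_star[OF \<phi>]] by simp
  qed (use eq graph_generator graph_norm_le[OF le] \<phi> generated_elems in auto)
qed

theorem generated_iso:
  assumes eq: "\<And>l. l \<in> combs M \<Longrightarrow> snorm B (lcomb B w l) = snorm A (lcomb A u l)"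
  obtains \<phi> where "star_hom (cstar_generated A (u ` M)) (cstar_generated B (w ` M)) \<phi>"
    "bij_betw \<phi> (elems (cstar_generated A (u ` M))) (elems (cstar_generated B (w ` M)))"
    "\<And>m. m \<in> M \<Longrightarrow> \<phi> (u m) = w m"
    "\<And>x. x \<in> elems (cstar_generated A (u ` M)) \<Longrightarrow> snorm B (\<phi> x) = snorm A x"
proof -
  \<comment> \<open>The same situation with the two families exchanged. Its graph is the converse
    relation, which supplies injectivity and surjectivity.\<close>
  interpret F: comb_pair B A w u M mul iv
    by unfold_locales (auto simp: u w mul iv u_mul w_mul u_iv w_iv)
  have flip: "F.graph y x \<longleftrightarrow> graph x y" for x y
    unfolding F.graph_def graph_def by blast
  have le: "snorm B (lcomb B w l) \<le> snorm A (lcomb A u l)"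
    and ge: "snorm A (lcomb A u l) \<le> snorm B (lcomb B w l)" if "l \<in> combs M" for l
    using eq[OF that] by auto
  obtain \<phi> where \<phi>: "star_hom (cstar_generated A (u ` M)) (cstar_generated B (w ` M)) \<phi>"
    "\<And>m. m \<in> M \<Longrightarrow> \<phi> (u m) = w m"
    "\<And>x. x \<in> elems (cstar_generated A (u ` M)) \<Longrightarrow> snorm B (\<phi> x) \<le> snorm A x"
    "\<And>x. x \<in> elems (cstar_generated A (u ` M)) \<Longrightarrow> graph x (\<phi> x)"
    by (rule generated_hom[OF le]) (assumption, rule that)
  have norm: "snorm B (\<phi> x) = snorm A x" if "x \<in> elems (cstar_generated A (u ` M))" for x
    using \<phi>(3)[OF that] F.graph_norm_le[OF ge] \<phi>(4)[OF that] flip by (meson order_antisym)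
  have "bij_betw \<phi> (elems (cstar_generated A (u ` M))) (elems (cstar_generated B (w ` M)))"
    unfolding bij_betw_def
  proof (intro conjI inj_onI subset_antisym subsetI)
    show "x = y" if "x \<in> elems (cstar_generated A (u ` M))" "y \<in> elems (cstar_generated A (u ` M))"
      "\<phi> x = \<phi> y" for x y
      using F.graph_unique[OF ge, of "\<phi> x" x y] \<phi>(4) that flip by metis
    show "y \<in> \<phi> ` elems (cstar_generated A (u ` M))" if y: "y \<in> elems (cstar_generated B (w ` M))" for y
    proof -
      obtain x where x: "graph x y"
        using F.graph_total[OF ge, of y] y flip by (auto simp: generated_elems)
      then have x': "x \<in> elems (cstar_generated A (u ` M))" using graph_closed generated_elems by blast
      then have "\<phi> x = y" using graph_unique[OF le \<phi>(4) x] by blast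
      then show ?thesis using x' by blast
    qed
  qed (use star_homD(1)[OF \<phi>(1)] in auto)
  with \<phi>(1,2) norm show thesis by (intro that[of \<phi>]) auto
qed

end

section \<open>Contractivity and square roots\<close>

lemma blinfun_compose_id [simp]: "id_blinfun o\<^sub>L S = S" "S o\<^sub>L id_blinfun = S"
  by (auto intro!: blinfun_eqI)

text \<open>The scalar instance \<open>a = 1\<close> of the iteration \<open>sqrt_iter\<close>
  below. It increases to 1, the double root of \<open>L = (1 + L\<^sup>2) / 2\<close>, and dominates
  norms and increments of the iteration for every \<open>a\<close> of norm at most 1.\<close>

fun sqrt_bound :: "nat \<Rightarrow> real" where
  "sqrt_bound 0 = 0"
| "sqrt_bound (Suc n) = (1 + (sqrt_bound n)\<^sup>2) / 2"

lemma sqrt_bound_range: "0 \<le> sqrt_bound n \<and> sqrt_bound n \<le> 1"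
proof (induction n)
  case (Suc n)
  then show ?case using power_le_one[of "sqrt_bound n" 2] by auto
qed simp

lemma sqrt_bound_Suc: "sqrt_bound n \<le> sqrt_bound (Suc n)"
  using sum_squares_bound[of "sqrt_bound n" 1] by simp

lemma sqrt_bound_mono: "m \<le> n \<Longrightarrow> sqrt_bound m \<le> sqrt_bound n"
  by (rule lift_Suc_mono_le[of sqrt_bound, OF sqrt_bound_Suc])

lemma sqrt_bound_tendsto: "sqrt_bound \<longlonglongrightarrow> 1"
proof -
  have "incseq sqrt_bound" "\<forall>i. sqrt_bound i \<le> 1"
    using sqrt_bound_range sqrt_bound_mono by (auto simp: incseq_def)
  then obtain L where L: "sqrt_bound \<longlonglongrightarrow> L"
    using incseq_convergent[of sqrt_bound 1] by metis
  have "(\<lambda>n. sqrt_bound (Suc n)) \<longlonglongrightarrow> (1 + L\<^sup>2) / 2"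
    unfolding sqrt_bound.simps by (intro tendsto_intros L) simp
  then have "L = (1 + L\<^sup>2) / 2" using LIMSEQ_unique[OF LIMSEQ_Suc[OF L]] by blast
  then have "(L - 1)\<^sup>2 = 0" by (simp add: power2_diff field_simps)
  then show ?thesis using L by simp
qed

text \<open>A limit \<open>l\<close> satisfies \<open>l + l = a + l l\<close>, formally
  \<open>l = 1 - sqrt (1 - a)\<close>. In contrast to the square root of \<open>1 - a\<close>
  itself, this can be formed without a unit.\<close>

fun sqrt_iter :: "'a star_algebra \<Rightarrow> 'a \<Rightarrow> nat \<Rightarrow> 'a" where
  "sqrt_iter A a 0 = szero A"
| "sqrt_iter A a (Suc n) = sscale A (1/2) (splus A a (smult A (sqrt_iter A a n) (sqrt_iter A a n)))"

context cstar_algebra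
begin

context
  fixes a :: 'a
  assumes a: "a \<in> elems A" "snorm A a \<le> 1"
begin

lemma sqrt_iter_closed: "sqrt_iter A a n \<in> elems A"
  by (induction n) (auto simp: closed_ops a)

lemma sqrt_iter_norm: "snorm A (sqrt_iter A a n) \<le> sqrt_bound n"
proof (induction n)
  case (Suc n)
  let ?y = "sqrt_iter A a n"
  have "snorm A (smult A ?y ?y) \<le> snorm A ?y * snorm A ?y"
    by (intro norm_mult sqrt_iter_closed)
  also have "\<dots> \<le> sqrt_bound n * sqrt_bound n"
    using Suc norm_nonneg[OF sqrt_iter_closed] by (intro mult_mono') auto
  finally show ?case
    using norm_triangle[of a "smult A ?y ?y"] a
    by (simp add: norm_scale closed_ops sqrt_iter_closed power2_eq_square)
qed (simp add: norm_szero)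

text \<open>Writing \<open>z z - y y = z (z - y) + (z - y) y\<close> bounds each increment by the
  corresponding increment of the scalar iteration.\<close>

lemma sqrt_iter_step: "sdist A (sqrt_iter A a (Suc n)) (sqrt_iter A a n) \<le> sqrt_bound (Suc n) - sqrt_bound n"
proof (induction n)
  case 0
  then show ?case using a by (simp add: sdist_zero closed_ops norm_scale szero_mult zero_closed plus_zero)
next
  case (Suc n)
  let ?y = "sqrt_iter A a n" and ?z = "sqrt_iter A a (Suc n)" and ?r = "sqrt_bound n" and ?s = "sqrt_bound (Suc n)"
  have y: "?y \<in> elems A" and z: "?z \<in> elems A" by (rule sqrt_iter_closed)+
  have d: "0 \<le> sdist A ?z ?y" by (rule sdist_nonneg[OF z y])
  have "sdist A (sqrt_iter A a (Suc (Suc n))) ?z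
      = (1/2) * sdist A (splus A a (smult A ?z ?z)) (splus A a (smult A ?y ?y))"
    by (subst sqrt_iter.simps(2), subst sqrt_iter.simps(2)[of A a n])
      (simp only: sdist_scale closed_ops a y z, simp)
  also have "\<dots> \<le> (1/2) * sdist A (smult A ?z ?z) (smult A ?y ?y)"
    using sdist_plus[of a "smult A ?z ?z" a "smult A ?y ?y"] y z
    by (simp add: a closed_ops sdist_self del: sqrt_iter.simps)
  also have "sdist A (smult A ?z ?z) (smult A ?y ?y) \<le> snorm A ?z * sdist A ?z ?y + sdist A ?z ?y * snorm A ?y"
    using sdist_triangle[of "smult A ?z ?z" "smult A ?z ?y" "smult A ?y ?y"]
      sdist_mult_left[OF z y z] sdist_mult_right[OF z y y] closed_ops(4)[OF y y] closed_ops(4)[OF z y] closed_ops(4)[OF z z]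
    by linarith
  also have "\<dots> \<le> ?s * (?s - ?r) + (?s - ?r) * ?r"
    using Suc sqrt_iter_norm[of n] sqrt_iter_norm[of "Suc n"] d norm_nonneg[OF y] norm_nonneg[OF z]
      sqrt_bound_Suc[of n] sqrt_bound_range[of n] sqrt_bound_range[of "Suc n"]
    by (intro add_mono mult_mono) (simp_all del: sqrt_iter.simps sqrt_bound.simps)
  also have "(1/2) * \<dots> = sqrt_bound (Suc (Suc n)) - ?s"
  proof -
    have "sqrt_bound (Suc (Suc n)) = (1 + ?s\<^sup>2) / 2" "?s = (1 + ?r\<^sup>2) / 2" by (rule sqrt_bound.simps)+
    then have "sqrt_bound (Suc (Suc n)) - ?s = (1 + ?s\<^sup>2) / 2 - (1 + ?r\<^sup>2) / 2" by linarith
    then show ?thesis by (simp add: power2_eq_square field_simps del: sqrt_bound.simps)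
  qed
  finally show ?case by simp
qed

lemma sqrt_iter_dist:
  "m \<le> n \<Longrightarrow> sdist A (sqrt_iter A a n) (sqrt_iter A a m) \<le> sqrt_bound n - sqrt_bound m"
proof (induction n rule: dec_induct)
  case (step n)
  then show ?case
    using sdist_triangle[of "sqrt_iter A a (Suc n)" "sqrt_iter A a n" "sqrt_iter A a m"]
      sqrt_iter_step[of n] sqrt_iter_closed by (smt (verit))
qed (simp add: sdist_self sqrt_iter_closed)

lemma sqrt_iter_dist_abs:
  "sdist A (sqrt_iter A a m) (sqrt_iter A a n) \<le> \<bar>sqrt_bound m - sqrt_bound n\<bar>"
proof (cases m n rule: le_cases)
  case le
  then show ?thesis using sqrt_iter_dist[OF le] sqrt_bound_mono[OF le]
    by (simp add: sdist_commute sqrt_iter_closed)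
next
  case ge
  then show ?thesis using sqrt_iter_dist[OF ge] sqrt_bound_mono[OF ge] by simp
qed

lemma sqrt_iter_limit:
  assumes "sstar A a = a"
  obtains l where "converges (sqrt_iter A a) l" "sstar A l = l" "splus A l l = splus A a (smult A l l)"
proof -
  have "\<exists>N. \<forall>m\<ge>N. \<forall>n\<ge>N. sdist A (sqrt_iter A a m) (sqrt_iter A a n) < e" if e: "e > 0" for e
  proof -
    obtain N where "\<forall>m\<ge>N. \<forall>n\<ge>N. norm (sqrt_bound m - sqrt_bound n) < e"
      using CauchyD[OF LIMSEQ_imp_Cauchy[OF sqrt_bound_tendsto] e] by blast
    then show ?thesis using sqrt_iter_dist_abs by (metis order_le_less_trans real_norm_def)
  qed
  then obtain l where l: "converges (sqrt_iter A a) l"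
    using converges_Cauchy[of "sqrt_iter A a"] sqrt_iter_closed by blast
  have lA: "l \<in> elems A" using l convergesD by blast
  have "sstar A (sqrt_iter A a n) = sqrt_iter A a n" for n
    by (induction n) (simp_all add: star_szero star_scale star_plus star_mult closed_ops a sqrt_iter_closed assms)
  then have "converges (sqrt_iter A a) (sstar A l)" using converges_star[OF l] by simp
  then have 1: "sstar A l = l" using converges_unique l by blast
  have "converges (\<lambda>n. sqrt_iter A a (Suc n)) (sscale A (1/2) (splus A a (smult A l l)))"
    unfolding sqrt_iter.simps
    by (intro converges_scale converges_plus converges_mult converges_const a l)
  moreover have "converges (\<lambda>n. sqrt_iter A a (Suc n)) l"
    using l LIMSEQ_Suc unfolding converges_def by blast
  ultimately have "l = sscale A (1/2) (splus A a (smult A l l))" using converges_unique by blast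
  then have "sscale A 2 l = sscale A 2 (sscale A (1/2) (splus A a (smult A l l)))" by (rule arg_cong)
  also have "\<dots> = splus A a (smult A l l)"
    by (simp add: scale_scale scale_one closed_ops a lA)
  finally have "sscale A 2 l = splus A a (smult A l l)" .
  moreover have "sscale A 2 l = splus A l l"
    using plus_scale[OF lA, of 1 1] by (simp add: scale_one lA)
  ultimately show thesis using that[OF l 1] by simp
qed

end

text \<open>If \<open>\<parallel>x\<parallel> \<le> 1\<close>, then \<open>x\<^sup>* x = 2 l - l\<^sup>2\<close> with \<open>l\<close> self-adjoint; hence
  \<open>\<pi>(x)\<^sup>* \<pi>(x) = 1 - (1 - \<pi>(l))\<^sup>2 \<le> 1\<close>.\<close>

lemma star_hom_contractive:
  fixes \<pi> :: "'a \<Rightarrow> 'k op"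
  assumes \<pi>: "star_hom A op_algebra \<pi>" and x: "x \<in> elems A"
  shows "norm (\<pi> x) \<le> snorm A x"
proof -
  note h = star_homD[OF \<pi>]
  have cl: "clin (\<pi> x)" if "x \<in> elems A" for x using h(1)[OF that] by simp
  have le1: "norm (\<pi> x) \<le> 1" if x: "x \<in> elems A" "snorm A x \<le> 1" for x
  proof -
    let ?a = "smult A (sstar A x) x"
    have a: "?a \<in> elems A" "snorm A ?a \<le> 1" "sstar A ?a = ?a"
      using x power_le_one[of "snorm A x" 2] norm_nonneg[of x]
      by (simp_all add: closed_ops cstar_identity star_mult star_star)
    obtain l where l: "converges (sqrt_iter A ?a) l" "sstar A l = l" "splus A l l = splus A ?a (smult A l l)"
      using sqrt_iter_limit[OF a] by blast
    have lA: "l \<in> elems A" using convergesD[OF l(1)] by blast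
    have cll: "clin (\<pi> l)" by (rule cl[OF lA])
    have self: "adj (\<pi> l) = \<pi> l" using h(5)[OF lA] l(2) by simp
    have eq: "\<pi> l + \<pi> l = (adj (\<pi> x) o\<^sub>L \<pi> x) + (\<pi> l o\<^sub>L \<pi> l)"
      using arg_cong[OF l(3), of \<pi>] h(2,4)[OF lA lA] h(5)[OF x(1)] h(2)[OF a(1) mult_closed[OF lA lA]]
        h(4)[OF star_closed[OF x(1)] x(1)] by simp
    have "norm (\<pi> x v) \<le> 1 * norm v" for v
    proof -
      let ?L = "\<pi> l"
      have "\<langle>v | ?L v\<rangle> + \<langle>v | ?L v\<rangle> = \<langle>\<pi> x v | \<pi> x v\<rangle> + \<langle>?L v | ?L v\<rangle>"
        using arg_cong[OF eq, of "\<lambda>T. \<langle>v | T v\<rangle>"] cl[OF x(1)]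
        by (simp add: blinfun.add_left cinner_add_right cinner_adj_right) (metis cinner_adj cll self)
      moreover have "\<langle>?L v | v\<rangle> = \<langle>v | ?L v\<rangle>" by (metis cinner_adj cll self)
      ultimately have "\<langle>\<pi> x v | \<pi> x v\<rangle> = \<langle>v | v\<rangle> - \<langle>v - ?L v | v - ?L v\<rangle>"
        by (simp add: cinner_diff_left cinner_diff_right algebra_simps)
      then have "(norm (\<pi> x v))\<^sup>2 = (norm v)\<^sup>2 - (norm (v - ?L v))\<^sup>2"
        by (simp add: norm_eq_cinner)
      then show ?thesis using zero_le_power2[of "norm (v - ?L v)"] by (simp add: power2_le_imp_le)
    qed
    then show ?thesis by (intro norm_blinfun_bound) auto
  qed
  show ?thesis
  proof (cases "snorm A x = 0")
    case True
    then have "x = sscale A 0 x" using x norm_zero_iff scale_zero by metis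
    then have "\<pi> x = op_scale 0 (\<pi> x)" using h(3)[OF x, of 0] by simp
    then have "\<pi> x = 0" using cl[OF x] op_scale_unary(1) by metis
    then show ?thesis using norm_nonneg[OF x] by simp
  next
    case False
    let ?t = "snorm A x"
    have t: "?t > 0" using False norm_nonneg[OF x] by simp
    have "norm (\<pi> (sscale A (1 / of_real ?t) x)) \<le> 1"
      using t by (intro le1) (simp_all add: scale_closed x norm_scale norm_divide)
    then show ?thesis using t h(3)[OF x] cl[OF x] by (simp add: norm_divide field_simps)
  qed
qed

end

text \<open>In the expansion of the squared norm at \<open>v\<close>, the middle term, minus twice
  the squared norm of \<open>?w\<close>, outweighs the last one. The bound admits this operator as
  the datum of \<open>sqrt_iter\<close>.\<close>

lemma norm_id_minus_le:
  assumes x: "clin x" "norm x \<le> 1"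
  shows "norm (id_blinfun - (x o\<^sub>L adj x)) \<le> 1"
proof (rule norm_blinfun_bound)
  fix v
  let ?w = "adj x v"
  have "(norm (x ?w))\<^sup>2 \<le> (norm ?w)\<^sup>2"
    using norm_blinfun[of x ?w] x(2) mult_right_mono[OF x(2), of "norm ?w"]
    by (intro power_mono) auto
  moreover have "(norm ((id_blinfun - (x o\<^sub>L adj x)) v))\<^sup>2 = (norm v)\<^sup>2 - 2 * (norm ?w)\<^sup>2 + (norm (x ?w))\<^sup>2"
    unfolding norm_eq_cinner
    by (simp add: blinfun.diff_left cinner_diff_left cinner_diff_right)
      (simp add: cinner_adj_right x(1) flip: cinner_adj)
  ultimately have "(norm ((id_blinfun - (x o\<^sub>L adj x)) v))\<^sup>2 \<le> (norm v)\<^sup>2"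
    using zero_le_power2[of "norm ?w"] by linarith
  then show "norm ((id_blinfun - (x o\<^sub>L adj x)) v) \<le> 1 * norm v"
    by (metis mult_1 norm_ge_zero power2_le_imp_le)
qed simp

text \<open>The square root of \<open>x x\<^sup>*\<close> is obtained from the iteration above, applied to \<open>1 - x x\<^sup>*\<close> at every
  index; the iterates minus suitable scalars stay in the subalgebra, which need not contain a unit.\<close>

lemma op_family_sqrt:
  fixes R :: "'r set" and x :: "'r \<Rightarrow> 'k op"
  assumes B: "closed_star_subalgebra (op_family_algebra R) B"
    and x: "x \<in> elems (op_family_algebra R)" and xB: "(\<lambda>\<rho>. x \<rho> o\<^sub>L adj (x \<rho>)) \<in> B"
  shows "\<exists>c\<in>B. (\<lambda>\<rho>. x \<rho> o\<^sub>L adj (x \<rho>)) = (\<lambda>\<rho>. adj (c \<rho>) o\<^sub>L c \<rho>)"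
proof -
  let ?A = "op_family_algebra R :: ('r \<Rightarrow> 'k op) star_algebra"
  interpret A: cstar_algebra ?A by (rule cstar_algebra_op_family)
  interpret O: cstar_algebra "op_algebra :: 'k op star_algebra" by (rule cstar_algebra_op_algebra)
  note Bs = A.closed_star_subalgebraD[OF B]
  note Bd = A.closed_subspaceD[OF Bs(1)]
  have main: "\<exists>c\<in>B. (\<forall>\<rho>. adj (c \<rho>) = c \<rho>) \<and> (\<lambda>\<rho>. x \<rho> o\<^sub>L adj (x \<rho>)) = (\<lambda>\<rho>. c \<rho> o\<^sub>L c \<rho>)"
    if x: "x \<in> elems ?A" and n: "snorm ?A x \<le> 1" and aB: "(\<lambda>\<rho>. x \<rho> o\<^sub>L adj (x \<rho>)) \<in> B" for x
  proof -
    define a where "a \<rho> = x \<rho> o\<^sub>L adj (x \<rho>)" for \<rho>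
    have aB: "a \<in> B" using aB by (simp add: a_def[abs_def])
    have cx: "clin (x \<rho>)" for \<rho> by (rule op_familyD[OF x])
    have nx: "norm (x \<rho>) \<le> 1" for \<rho> using op_familyD(3)[OF x, of \<rho>] n by simp
    define b where "b \<rho> = id_blinfun - a \<rho>" for \<rho>
    have b: "b \<rho> \<in> elems op_algebra" "snorm op_algebra (b \<rho>) \<le> 1" "sstar op_algebra (b \<rho>) = b \<rho>" for \<rho>
      using norm_id_minus_le[OF cx nx, of \<rho>] cx by (simp_all add: b_def a_def)
    define y where "y n \<rho> = sqrt_iter op_algebra (b \<rho>) n" for n \<rho>
    have cy: "clin (y n \<rho>)" for n \<rho> using O.sqrt_iter_closed[OF b(1,2)] by (simp add: y_def)
    have yd: "dist (y m \<rho>) (y n \<rho>) \<le> \<bar>sqrt_bound m - sqrt_bound n\<bar>" for m n \<rho>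
      using O.sqrt_iter_dist_abs[OF b(1,2), of \<rho> m n] cy[of n \<rho>] by (simp add: sdist_op_algebra y_def)
    \<comment> \<open>The constant term of \<open>1 - y n\<close>, that is, its value for
      \<open>x = 0\<close>. Subtracting it leaves a polynomial in \<open>a\<close> without constant
      term, which stays in \<open>B\<close>.\<close>
    define s where "s n = 1 - sqrt_bound n" for n
    define d where "d n \<rho> = id_blinfun - y n \<rho> - s n *\<^sub>R id_blinfun" for n \<rho>
    have cd: "clin (d n \<rho>)" for n \<rho> by (simp add: d_def cy)
    have dB: "d n \<in> B" for n
    proof (induction n)
      case 0
      have "d 0 = szero ?A" by (simp add: d_def y_def s_def fun_eq_iff)
      then show ?case using Bd(2) by simp
    next
      case (Suc n)
      \<comment> \<open>The recursion of \<open>y\<close>, rewritten for \<open>d\<close> by means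
        of \<open>y n = (1 - s n) - d n\<close>: the unit cancels, and only \<open>a\<close> and
        \<open>d n\<close> remain.\<close>
      let ?d' = "splus ?A (d n) (sscale ?A (1/2) (splus ?A a
        (sscale ?A (-1) (splus ?A (smult ?A (d n) (d n)) (sscale ?A (of_real (2 * s n)) (d n))))))"
      have "d (Suc n) \<rho> v = ?d' \<rho> v" for \<rho> v
      proof -
        define Y where "Y = y n \<rho>"
        define r where "r = sqrt_bound n"
        have cY: "clin Y" and ca: "clin (a \<rho>)" using cx by (simp_all add: Y_def a_def cy)
        have d: "d n \<rho> w = r *\<^sub>R w - Y w" for w
          by (simp add: d_def s_def blinfun.diff_left blinfun.scaleR_left Y_def r_def algebra_simps)
        have cs: "(1/2) *\<^sub>c w = (1/2) *\<^sub>R w" "(-1) *\<^sub>c w = - w" "of_real p *\<^sub>c w = p *\<^sub>R w"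
          for w :: "'k ell2" and p
          using scaleR_cscale[of "1/2" w] scaleR_cscale[of "-1" w] scaleR_cscale[of p w] by simp_all
        have "y (Suc n) \<rho> v = (1/2) *\<^sub>R (v - a \<rho> v + Y (Y v))"
          using cY ca by (simp add: Y_def y_def b_def blinfun.diff_left blinfun.add_left cs)
        then have "d (Suc n) \<rho> v = ((1 + r\<^sup>2) / 2) *\<^sub>R v - (1/2) *\<^sub>R (v - a \<rho> v + Y (Y v))"
          by (simp add: d_def s_def blinfun.diff_left blinfun.scaleR_left r_def algebra_simps)
        moreover have "?d' \<rho> v = (r *\<^sub>R v - Y v) + (1/2) *\<^sub>R (a \<rho> v
            - ((r *\<^sub>R (r *\<^sub>R v - Y v) - Y (r *\<^sub>R v - Y v)) + (2 * (1 - r)) *\<^sub>R (r *\<^sub>R v - Y v)))"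
          using cd ca by (simp add: blinfun.add_left blinfun.diff_left cs d s_def r_def[symmetric] del: of_real_mult of_real_diff)
        moreover have two: "(t * 2) *\<^sub>R w = t *\<^sub>R w + t *\<^sub>R w" for t and w :: "'k ell2"
          by (metis mult_2_right scaleR_add_left)
        moreover have "2 *\<^sub>R (((1 + r\<^sup>2) / 2) *\<^sub>R v - (1/2) *\<^sub>R (v - a \<rho> v + Y (Y v)))
          = 2 *\<^sub>R ((r *\<^sub>R v - Y v) + (1/2) *\<^sub>R (a \<rho> v
            - ((r *\<^sub>R (r *\<^sub>R v - Y v) - Y (r *\<^sub>R v - Y v)) + (2 * (1 - r)) *\<^sub>R (r *\<^sub>R v - Y v))))"
          by (simp add: blinfun.diff_right blinfun.scaleR_right power2_eq_square scaleR_add_right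
            scaleR_diff_right scaleR_add_left scaleR_diff_left algebra_simps)
            (simp add: add_divide_distrib scaleR_add_left two flip: mult.assoc)
        ultimately show ?thesis using scaleR_cancel_left[of 2] by force
      qed
      then have "d (Suc n) = ?d'" by (intro ext blinfun_eqI) auto
      moreover have "?d' \<in> B" by (intro Bd Bs aB Suc)
      ultimately show ?case by simp
    qed
    have dA: "d n \<in> elems ?A" for n using dB Bd(1) by blast
    have "\<exists>N. \<forall>m\<ge>N. \<forall>n\<ge>N. sdist ?A (d m) (d n) < e" if e: "e > 0" for e
    proof -
      obtain N where N: "\<forall>m\<ge>N. \<forall>n\<ge>N. norm (sqrt_bound m - sqrt_bound n) < e / 4"
        using CauchyD[OF LIMSEQ_imp_Cauchy[OF sqrt_bound_tendsto], of "e / 4"] e by auto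
      have "sdist ?A (d m) (d n) \<le> e / 2" if "m \<ge> N" "n \<ge> N" for m n
        unfolding sdist_op_family[OF dA]
      proof (rule op_family_norm_le)
        fix \<rho>
        have "d m \<rho> - d n \<rho> = (y n \<rho> - y m \<rho>) + (s n - s m) *\<^sub>R id_blinfun"
          by (simp add: d_def algebra_simps)
        then have "norm (d m \<rho> - d n \<rho>) \<le> dist (y n \<rho>) (y m \<rho>) + \<bar>s n - s m\<bar> * norm (id_blinfun :: 'k op)"
          by (metis norm_triangle_ineq dist_norm norm_scaleR)
        also have "\<dots> \<le> e / 4 + e / 4 * 1"
          using N[rule_format, OF that] yd[of n \<rho> m] norm_blinfun_id_le[where 'a = "'k ell2"] e
          by (intro add_mono mult_mono) (auto simp: s_def abs_minus_commute[of "sqrt_bound n"])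
        finally show "norm (d m \<rho> - d n \<rho>) \<le> e / 2" by simp
      qed
      then show ?thesis using e by (intro exI[of _ N]) (smt (verit) field_sum_of_halves)
    qed
    then obtain c where c: "A.converges d c" using A.converges_Cauchy[of d] dA by blast
    have cB: "c \<in> B" by (rule A.closed_subspace_limit[OF Bs(1) _ c]) (use dB in blast)
    then have cA: "c \<in> elems ?A" by (rule Bd)
    \<comment> \<open>The limit of \<open>d\<close> is \<open>1 - l\<close> with
      \<open>l + l = b + l l\<close>, and \<open>b = 1 - a\<close> turns this into
      \<open>(1 - l)\<^sup>2 = a\<close>.\<close>
    have c\<rho>: "adj (c \<rho>) = c \<rho> \<and> a \<rho> = c \<rho> o\<^sub>L c \<rho>" for \<rho>
    proof -
      obtain l where l: "O.converges (sqrt_iter op_algebra (b \<rho>)) l" "adj l = l" "l + l = b \<rho> + (l o\<^sub>L l)"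
        using O.sqrt_iter_limit[OF b] by auto
      have cl: "clin l" using O.convergesD(2)[OF l(1)] by simp
      have "(\<lambda>n. y n \<rho>) \<longlonglongrightarrow> l"
        using l(1) cl unfolding O.converges_def
        by (simp add: sdist_op_algebra y_def tendsto_dist_iff[symmetric])
      moreover have "s \<longlonglongrightarrow> 0" using tendsto_diff[OF tendsto_const[of 1] sqrt_bound_tendsto] by (simp add: s_def[abs_def])
      ultimately have "(\<lambda>n. d n \<rho>) \<longlonglongrightarrow> id_blinfun - l - 0 *\<^sub>R id_blinfun"
        unfolding d_def by (intro tendsto_intros)
      moreover have "(\<lambda>n. d n \<rho>) \<longlonglongrightarrow> c \<rho>"
      proof (subst tendsto_dist_iff, rule tendsto_sandwich[OF _ _ tendsto_const])
        show "(\<lambda>n. sdist ?A (d n) c) \<longlonglongrightarrow> 0" using c by (simp add: A.converges_def)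
        have "(\<lambda>\<rho>. d n \<rho> - c \<rho>) \<in> elems ?A" for n
          using A.closed_ops(2)[OF dA A.closed_ops(3)[OF cA, of "-1"], of n] op_familyD(1)[OF cA]
          by (simp add: op_scale_minus_one)
        then show "\<forall>\<^sub>F n in sequentially. dist (d n \<rho>) (c \<rho>) \<le> sdist ?A (d n) c"
          unfolding sdist_op_family[OF cA] dist_norm by (intro always_eventually allI op_familyD(3))
      qed simp
      ultimately have "c \<rho> = id_blinfun - l" using LIMSEQ_unique by fastforce
      moreover have "a \<rho> = (id_blinfun - l) o\<^sub>L (id_blinfun - l)"
      proof -
        have "a \<rho> = id_blinfun - b \<rho>" by (simp add: b_def)
        also have "b \<rho> = l + l - (l o\<^sub>L l)" using l(3) by simp
        finally show ?thesis by (simp add: blinfun_compose_add)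
      qed
      ultimately show ?thesis using cl l(2) by simp
    qed
    then show ?thesis using cB by (intro bexI[of _ c]) (auto simp: a_def[symmetric])
  qed
  show ?thesis
  proof (cases "snorm ?A x = 0")
    case True
    then have "x = (\<lambda>_. 0)" using A.norm_zero_iff[OF x] by simp
    then show ?thesis using Bd(2) by (intro bexI[of _ "\<lambda>_. 0"]) auto
  next
    case False
    define t where "t = snorm ?A x"
    have t: "t > 0" using False A.norm_nonneg[OF x] by (simp add: t_def)
    have cx: "clin (x \<rho>)" for \<rho> by (rule op_familyD[OF x])
    let ?x = "sscale ?A (1 / of_real t) x"
    have eq: "(\<lambda>\<rho>. ?x \<rho> o\<^sub>L adj (?x \<rho>)) = sscale ?A (1 / of_real (t * t)) (\<lambda>\<rho>. x \<rho> o\<^sub>L adj (x \<rho>))"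
      using cx by (simp add: op_scale_rules)
    have "(\<lambda>\<rho>. ?x \<rho> o\<^sub>L adj (?x \<rho>)) \<in> B" unfolding eq by (intro Bd xB)
    moreover have "snorm ?A ?x \<le> 1" using t x by (simp only: A.norm_scale norm_divide) (simp add: t_def)
    ultimately obtain c where c: "c \<in> B" "\<And>\<rho>. adj (c \<rho>) = c \<rho>" "(\<lambda>\<rho>. ?x \<rho> o\<^sub>L adj (?x \<rho>)) = (\<lambda>\<rho>. c \<rho> o\<^sub>L c \<rho>)"
      using main[of ?x] A.scale_closed[OF x] by blast
    have cc: "clin (c \<rho>)" for \<rho> using op_familyD(1)[OF Bd(1)[OF c(1)]] .
    have "x \<rho> o\<^sub>L adj (x \<rho>) = op_scale (of_real (t * t)) (c \<rho> o\<^sub>L c \<rho>)" for \<rho>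
      using fun_cong[OF c(3), of \<rho>, symmetric] cx[of \<rho>] t by (simp add: op_scale_rules)
    then show ?thesis
      using cc c(2) by (intro bexI[of _ "sscale ?A (of_real t) c"] Bd c(1)) (simp add: op_scale_rules)
  qed
qed

section \<open>Morita equivalence of corners\<close>

lemma (in cstar_algebra) dist_complete_closed_subspace:
  assumes "closed_subspace A C"
  shows "dist_complete C (sdist A)"
  unfolding dist_complete_def
proof (intro allI impI)
  fix f :: "nat \<Rightarrow> 'a"
  assume f: "(\<forall>n. f n \<in> C) \<and> (\<forall>e>0. \<exists>N. \<forall>m\<ge>N. \<forall>n\<ge>N. sdist A (f m) (f n) < e)"
  then obtain l where l: "converges f l" 
    using converges_Cauchy[of f] closed_subspaceD(1)[OF assms] by blast
  then have "l \<in> C" using closed_subspace_limit[OF assms _ l] f by blast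
  then show "\<exists>l\<in>C. (\<lambda>n. sdist A (f n) l) \<longlonglongrightarrow> 0" using l by (auto simp: converges_def)
qed

lemma dist_complete_transfer:
  assumes V: "dist_complete V d" and g: "g ` V' = V" "\<And>x y. x \<in> V' \<Longrightarrow> y \<in> V' \<Longrightarrow> d' x y = d (g x) (g y)"
  shows "dist_complete V' d'"
  unfolding dist_complete_def
proof (intro allI impI)
  fix f :: "nat \<Rightarrow> _"
  assume f: "(\<forall>n. f n \<in> V') \<and> (\<forall>e>0. \<exists>N. \<forall>m\<ge>N. \<forall>n\<ge>N. d' (f m) (f n) < e)"
  then have "(\<forall>n. g (f n) \<in> V) \<and> (\<forall>e>0. \<exists>N. \<forall>m\<ge>N. \<forall>n\<ge>N. d (g (f m)) (g (f n)) < e)"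
    using g by auto
  then obtain l where l: "l \<in> V" "(\<lambda>n. d (g (f n)) l) \<longlonglongrightarrow> 0"
    using V[unfolded dist_complete_def, THEN spec, of "\<lambda>n. g (f n)"] by blast
  then obtain l' where "l' \<in> V'" "l = g l'" using g by auto
  then show "\<exists>l\<in>V'. (\<lambda>n. d' (f n) l) \<longlonglongrightarrow> 0" using l f g(2) by (intro bexI[of _ l']) auto
qed

text \<open>Positivity of \<open>x x\<^sup>*\<close> has to be witnessed inside \<open>A0\<close>, hence the square root among the hypotheses.\<close>

lemma (in cstar_algebra) strongly_Morita_equivalent_corner:
  fixes A' :: "'c star_algebra"
  assumes A': "cstar_algebra A'" and sub: "closed_star_subalgebra A A0" "closed_star_subalgebra A B0"
    and E0: "closed_subspace A E0" "E0 \<subseteq> B0"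
    and \<phi>: "star_hom A' (A\<lparr>elems := A0\<rparr>) \<phi>" "bij_betw \<phi> (elems A') A0"
      "\<And>a. a \<in> elems A' \<Longrightarrow> snorm A (\<phi> a) = snorm A' a"
    and AE: "\<And>a x. a \<in> A0 \<Longrightarrow> x \<in> E0 \<Longrightarrow> smult A a x \<in> E0"
    and EB: "\<And>x b. x \<in> E0 \<Longrightarrow> b \<in> B0 \<Longrightarrow> smult A x b \<in> E0"
    and EE: "\<And>x y. x \<in> E0 \<Longrightarrow> y \<in> E0 \<Longrightarrow> smult A x (sstar A y) \<in> A0"
    and sqrt: "\<And>x. x \<in> E0 \<Longrightarrow> \<exists>c\<in>A0. smult A x (sstar A x) = smult A (sstar A c) c"
    and full_A: "\<And>C. closed_subspace A C \<Longrightarrow> (\<And>x y. x \<in> E0 \<Longrightarrow> y \<in> E0 \<Longrightarrow> smult A x (sstar A y) \<in> C) \<Longrightarrow> A0 \<subseteq> C"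
    and full_B: "\<And>C. closed_subspace A C \<Longrightarrow> (\<And>x y. x \<in> E0 \<Longrightarrow> y \<in> E0 \<Longrightarrow> smult A (sstar A x) y \<in> C) \<Longrightarrow> B0 \<subseteq> C"
  shows "strongly_Morita_equivalent A' (A\<lparr>elems := B0\<rparr>)"
proof -
  interpret A': cstar_algebra A' by (rule A')
  note B0 = closed_star_subalgebraD[OF sub(2)] and A0 = closed_star_subalgebraD[OF sub(1)]
  note B0' = closed_subspaceD[OF B0(1)] and A0' = closed_subspaceD[OF A0(1)] and E' = closed_subspaceD[OF E0(1)]
  have EB0: "x \<in> B0" if "x \<in> E0" for x using that E0 by blast
  note h = star_homD[OF \<phi>(1), simplified]
  define \<psi> where "\<psi> = inv_into (elems A') \<phi>"
  have \<psi>: "\<phi> (\<psi> z) = z" "\<psi> z \<in> elems A'" if "z \<in> A0" for z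
    using that \<phi>(2) unfolding \<psi>_def bij_betw_def by (auto simp: f_inv_into_f intro: inv_into_into)
  have inj: "\<psi> z = a" if "a \<in> elems A'" "\<phi> a = z" for a z
    using that \<phi>(2) unfolding \<psi>_def bij_betw_def by (metis inv_into_f_f)
  have norm_\<psi>: "snorm A' (\<psi> z) = snorm A z" if "z \<in> A0" for z
    using \<phi>(3)[OF \<psi>(2)[OF that]] \<psi>(1)[OF that] by simp
  \<comment> \<open>The definition of \<open>strongly_Morita_equivalent\<close> prescribes pairs as
    vectors: \<open>E0\<close> occupies the second component, and the first one is constant. The
    left inner product takes values in \<open>A0\<close> and is pulled back to \<open>A'\<close>
    along \<psi>.\<close>
  define E where "E = \<lparr>vecs = Pair (szero A') ` E0, vzero = (szero A', szero A),
    vplus = (\<lambda>x y. (szero A', splus A (snd x) (snd y))), vscale = (\<lambda>c x. (szero A', sscale A c (snd x))),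
    lact = (\<lambda>a x. (szero A', smult A (\<phi> a) (snd x))), ract = (\<lambda>x b. (szero A', smult A (snd x) b)),
    lip = (\<lambda>x y. \<psi> (smult A (snd x) (sstar A (snd y)))), rip = (\<lambda>x y. smult A (sstar A (snd x)) (snd y))\<rparr>"
  have E [simp]: "vecs E = Pair (szero A') ` E0" "vzero E = (szero A', szero A)"
    "vplus E x y = (szero A', splus A (snd x) (snd y))" "vscale E c x = (szero A', sscale A c (snd x))"
    "lact E a x = (szero A', smult A (\<phi> a) (snd x))" "ract E x b = (szero A', smult A (snd x) b)"
    "lip E x y = \<psi> (smult A (snd x) (sstar A (snd y)))" "rip E x y = smult A (sstar A (snd x)) (snd y)"
    for x y a b c by (simp_all add: E_def)
  \<comment> \<open>Both inner products induce the norm of the ambient algebra on \<open>E0\<close>,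
    so both completeness conditions come down to \<open>E0\<close> being closed.\<close>
  have norm_x: "snorm A (smult A x (sstar A x)) = (snorm A x)\<^sup>2" if "x \<in> elems A" for x
    using cstar_identity[OF star_closed[OF that]] that by (simp add: star_star norm_star)
  have zero_x: "x = szero A" if "x \<in> elems A" "smult A (sstar A x) x = szero A \<or> smult A x (sstar A x) = szero A" for x
    using that cstar_identity[OF that(1)] norm_x[OF that(1)] by (auto simp: norm_szero norm_zero_iff)
  have zero_E: "x = szero A" if "x \<in> E0" "smult A (sstar A x) x = szero A \<or> smult A x (sstar A x) = szero A" for x
    using zero_x[OF E'(1)[OF that(1)] that(2)] .
  have EBE: "smult A x (smult A b (sstar A y)) \<in> A0" if "x \<in> E0" "b \<in> B0" "y \<in> E0" for x b y
    using EE[OF EB[OF that(1,2)] that(3)] that by (simp add: mult_assoc E' B0' closed_ops)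
  have \<psi>0: "\<psi> z = szero A' \<longleftrightarrow> z = szero A" if z: "z \<in> A0" for z
    using norm_\<psi>[OF z] norm_zero_iff[OF A0'(1)[OF z]] A'.norm_zero_iff[OF \<psi>(2)[OF z]] by auto
  have complete: "dist_complete E0 (sdist A)" by (rule dist_complete_closed_subspace[OF E0(1)])
  have img: "snd ` vecs E = E0" by (auto simp: image_image)
  have vd: "splus A x (sscale A (-1) y) \<in> E0" if "x \<in> E0" "y \<in> E0" for x y
    by (intro E' that)
  have "imprimitivity_bimodule A' (A\<lparr>elems := B0\<rparr>) E"
  proof (intro imprimitivity_bimodule.intro imprimitivity_bimodule_axioms.intro A' cstar_subalgebra[OF sub(2)])
    show "complex_space (vecs E) (vzero E) (vplus E) (vscale E)"
      by unfold_locales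
        (auto simp: E' plus_assoc plus_commute plus_ac plus_zero scale_zero scale_one scale_scale scale_plus plus_scale)
    show "dist_complete (vecs E) (\<lambda>x y. sqrt (snorm A' (lip E (vdiff E x y) (vdiff E x y))))"
      by (rule dist_complete_transfer[OF complete img])
        (auto simp: vdiff_def norm_\<psi> EE vd norm_x E' norm_nonneg sdist_def)
    show "dist_complete (vecs E) (\<lambda>x y. sqrt (snorm (A\<lparr>elems := B0\<rparr>) (rip E (vdiff E x y) (vdiff E x y))))"
      by (rule dist_complete_transfer[OF complete img])
        (auto simp: vdiff_def cstar_identity vd E' norm_nonneg sdist_def)
    show "span_dense (A\<lparr>elems := B0\<rparr>) {rip E x y |x y. x \<in> vecs E \<and> y \<in> vecs E}"
      unfolding span_dense_def
    proof (intro allI impI)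
      fix C assume C: "closed_subspace (A\<lparr>elems := B0\<rparr>) C \<and> {rip E x y |x y. x \<in> vecs E \<and> y \<in> vecs E} \<subseteq> C"
      have "closed_subspace A C" by (rule closed_subspace_of_subalgebra[OF sub(2) conjunct1[OF C]])
      then have "B0 \<subseteq> C" by (rule full_B) (use C in fastforce)
      then show "elems (A\<lparr>elems := B0\<rparr>) \<subseteq> C" by simp
    qed
    show "span_dense A' {lip E x y |x y. x \<in> vecs E \<and> y \<in> vecs E}"
      unfolding span_dense_def
    proof (intro allI impI)
      fix C assume C: "closed_subspace A' C \<and> {lip E x y |x y. x \<in> vecs E \<and> y \<in> vecs E} \<subseteq> C"
      have "closed_subspace A {z \<in> A0. \<psi> z \<in> C}"
        by (rule A'.closed_subspace_preimage[OF conjunct1[OF C] A0(1) cstar_algebra_axioms, where K = 1])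
          (auto simp: \<psi> norm_\<psi> h A0' A'.closed_ops intro!: inj)
      then have "A0 \<subseteq> {z \<in> A0. \<psi> z \<in> C}" by (rule full_A) (use C EE in fastforce)
      then show "elems A' \<subseteq> C" using inj h(1) by (metis (no_types, lifting) mem_Collect_eq subset_iff)
    qed
  next
    fix x assume x: "x \<in> vecs E"
    then show "spositive (A\<lparr>elems := B0\<rparr>) (rip E x x)"
      unfolding spositive_def using EB0 by auto
    obtain c where c: "c \<in> A0" "smult A (snd x) (sstar A (snd x)) = smult A (sstar A c) c"
      using sqrt[of "snd x"] x by fastforce
    have "\<psi> (smult A (sstar A c) c) = smult A' (sstar A' (\<psi> c)) (\<psi> c)"
      by (rule inj) (use c in \<open>auto simp: h \<psi> A'.closed_ops\<close>)
    then show "spositive A' (lip E x x)"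
      unfolding spositive_def using c \<psi> by (intro bexI[of _ "\<psi> c"]) auto
  next
    fix x y assume x: "x \<in> vecs E" and y: "y \<in> vecs E"
    then have xy: "smult A (snd x) (sstar A (snd y)) \<in> A0" using EE by auto
    show "sstar A' (lip E x y) = lip E y x"
      unfolding E by (rule inj[symmetric]) (use xy x y in \<open>auto simp: h \<psi> A'.closed_ops star_mult star_star E' closed_ops\<close>)
  qed (auto simp: AE EB E' h A0' B0' B0 EB0 EE \<psi> mult_plus plus_mult mult_scale scale_mult mult_assoc
      closed_ops star_mult star_star star_plus star_scale \<psi>0 A'.closed_ops
      EBE dest: zero_E intro!: inj)
  then show ?thesis unfolding strongly_Morita_equivalent_def by blast
qed

section \<open>Representations of semilattices\<close>

locale semilattice_action =
  fixes act :: "'g::group_add \<Rightarrow> 'x::order \<Rightarrow> 'x"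
  assumes act_0 [simp]: "act 0 x = x"
    and act_add: "act (g + h) x = act g (act h x)"
    and act_mono: "x \<le> y \<Longrightarrow> act g x \<le> act g y"
    and ex_meet: "\<exists>z. is_meet (x::'x) y z"
begin

lemma is_meet_meet: "is_meet x y (meet x y)" for x y :: 'x
proof -
  obtain z where z: "is_meet x y z" using ex_meet by blast
  have "meet x y = z"
    unfolding meet_def by (rule the_equality) (use z in \<open>auto simp: is_meet_def intro: antisym\<close>)
  then show ?thesis using z by simp
qed

lemma meet_lower: "meet x y \<le> x" "meet x y \<le> y" for x y :: 'x
  using is_meet_meet[of x y] by (simp_all add: is_meet_def)

lemma meet_greatest: "z \<le> x \<Longrightarrow> z \<le> y \<Longrightarrow> z \<le> meet x y" for x y z :: 'x
  using is_meet_meet[of x y] by (simp add: is_meet_def)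

sublocale meet: semilattice_inf meet "(\<le>) :: 'x \<Rightarrow> 'x \<Rightarrow> bool" "(<)"
  by unfold_locales (simp_all add: meet_lower meet_greatest)

lemma act_cancel [simp]: "act (- g) (act g x) = x" "act g (act (- g) x) = x"
  by (simp_all flip: act_add)

lemma act_le_iff: "act g x \<le> act g y \<longleftrightarrow> x \<le> y"
  by (metis act_cancel(1) act_mono)

lemma act_le_iff': "act (- g) x \<le> y \<longleftrightarrow> x \<le> act g y" "x \<le> act (- g) y \<longleftrightarrow> act g x \<le> y"
  by (metis act_cancel act_le_iff)+

lemma act_meet: "act g (meet x y) = meet (act g x) (act g y)"
proof (rule antisym)
  show "act g (meet x y) \<le> meet (act g x) (act g y)" by (simp add: act_mono)
  have "act (- g) (meet (act g x) (act g y)) \<le> meet x y"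
    by (simp add: act_le_iff')
  then show "meet (act g x) (act g y) \<le> act g (meet x y)" unfolding act_le_iff'(1) .
qed

lemma meet_semigroup_simps [simp]:
  "selems (meet_semigroup :: 'x semigrp) = UNIV" "sgmult (meet_semigroup :: 'x semigrp) = meet"
  by (simp_all add: meet_semigroup_def)

lemma sginv_meet_semigroup [simp]: "sginv meet_semigroup x = x" for x :: 'x
  unfolding sginv_def
proof (rule the_equality)
  fix t :: 'x
  assume "t \<in> selems meet_semigroup \<and> sgmult meet_semigroup (sgmult meet_semigroup x t) x = x
    \<and> sgmult meet_semigroup (sgmult meet_semigroup t x) t = t"
  then show "t = x" by (simp add: meet.inf.commute meet.inf.left_commute) (metis meet.inf.commute)
qed simp

lemma meet_reps_iff: "\<rho> \<in> semigroup_reps (meet_semigroup :: 'x semigrp) \<longleftrightarrow>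
    (\<forall>x. clin (\<rho> x)) \<and> (\<forall>x y. \<rho> (meet x y) = \<rho> x o\<^sub>L \<rho> y) \<and> (\<forall>x. adj (\<rho> x) = \<rho> x)"
  by (auto simp: semigroup_reps_def clinear_op_clin op_adj_adj)

lemma meet_repsD:
  assumes "\<rho> \<in> semigroup_reps (meet_semigroup :: 'x semigrp)"
  shows "clin (\<rho> x)" "\<rho> (meet x y) = \<rho> x o\<^sub>L \<rho> y" "adj (\<rho> x) = \<rho> x" "\<rho> x o\<^sub>L \<rho> x = \<rho> x"
    "\<rho> x o\<^sub>L \<rho> y = \<rho> y o\<^sub>L \<rho> x"
proof -
  have r: "clin (\<rho> x)" "\<rho> (meet x y) = \<rho> x o\<^sub>L \<rho> y" "adj (\<rho> x) = \<rho> x" for x y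
    using assms unfolding meet_reps_iff by blast+
  show "clin (\<rho> x)" "\<rho> (meet x y) = \<rho> x o\<^sub>L \<rho> y" "adj (\<rho> x) = \<rho> x" by (rule r)+
  show "\<rho> x o\<^sub>L \<rho> x = \<rho> x" "\<rho> x o\<^sub>L \<rho> y = \<rho> y o\<^sub>L \<rho> x"
    by (simp_all add: meet.inf.commute[of x y] flip: r(2))
qed

end

lemma norm_projection_split:
  assumes "clin p" "adj p = p" "p o\<^sub>L p = p"
  shows "(norm \<zeta>)\<^sup>2 = (norm (p \<zeta>))\<^sup>2 + (norm (\<zeta> - p \<zeta>))\<^sup>2"
proof -
  have "\<langle>p \<zeta> | p \<zeta>\<rangle> = \<langle>\<zeta> | p \<zeta>\<rangle>" "\<langle>p \<zeta> | \<zeta>\<rangle> = \<langle>\<zeta> | p \<zeta>\<rangle>"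
    using cinner_adj[OF assms(1), of \<zeta> "p \<zeta>"] cinner_adj[OF assms(1), of \<zeta> \<zeta>]
      arg_cong[OF assms(3), of "\<lambda>T. T \<zeta>"] by (simp_all add: assms(2))
  then show ?thesis
    by (simp add: norm_eq_cinner cinner_diff_left cinner_diff_right)
qed

lemma norm_projection_le: "\<lbrakk>clin p; adj p = p; p o\<^sub>L p = p\<rbrakk> \<Longrightarrow> norm p \<le> 1"
proof (rule norm_blinfun_bound)
  fix v
  assume "clin p" "adj p = p" "p o\<^sub>L p = p"
  then have "(norm (p v))\<^sup>2 \<le> (norm v)\<^sup>2" using norm_projection_split[of p v] by simp
  then show "norm (p v) \<le> 1 * norm v" by (metis mult_1 norm_ge_zero power2_le_imp_le)
qed simp

context semilattice_action
begin

text \<open>On the range of each \<open>q\<close>, the representation acts over \<open>F\<close> by the zero character or by the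
  character \<open>x \<mapsto> [t \<le> x]\<close>.\<close>

lemma spectral_decomposition_aux:
  fixes \<rho> :: "'x \<Rightarrow> 'k op"
  assumes \<rho>: "\<rho> \<in> semigroup_reps meet_semigroup" and "finite F"
  shows "\<exists>Q. (\<forall>\<eta>. (norm \<eta>)\<^sup>2 = (\<Sum>q\<leftarrow>Q. (norm (blinfun_apply q \<eta>))\<^sup>2)) \<and>
    (\<forall>q\<in>set Q. clin q \<and> (\<forall>y. q o\<^sub>L \<rho> y = \<rho> y o\<^sub>L q) \<and>
      ((\<forall>x\<in>F. q o\<^sub>L \<rho> x = 0) \<or> (\<exists>t. q o\<^sub>L \<rho> t = q \<and> (\<forall>x\<in>F. \<not> t \<le> x \<longrightarrow> q o\<^sub>L \<rho> x = 0))))"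
  using \<open>finite F\<close>
proof (induction F rule: finite_induct)
  case empty
  show ?case by (rule exI[of _ "[id_blinfun]"]) auto
next
  case (insert x F)
  note r = meet_repsD[OF \<rho>]
  obtain Q :: "'k op list" where Q: "\<And>\<eta>. (norm \<eta>)\<^sup>2 = (\<Sum>q\<leftarrow>Q. (norm (blinfun_apply q \<eta>))\<^sup>2)"
    "\<And>q. q \<in> set Q \<Longrightarrow> clin q" "\<And>q y. q \<in> set Q \<Longrightarrow> q o\<^sub>L \<rho> y = \<rho> y o\<^sub>L q"
    "\<And>q. q \<in> set Q \<Longrightarrow> (\<forall>x\<in>F. q o\<^sub>L \<rho> x = 0) \<or> (\<exists>t. q o\<^sub>L \<rho> t = q \<and> (\<forall>x\<in>F. \<not> t \<le> x \<longrightarrow> q o\<^sub>L \<rho> x = 0))"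
  proof -
    from insert.IH obtain Q where "\<forall>\<eta>. (norm \<eta>)\<^sup>2 = (\<Sum>q\<leftarrow>Q. (norm (blinfun_apply q \<eta>))\<^sup>2)"
      "\<forall>q\<in>set Q. clin q \<and> (\<forall>y. q o\<^sub>L \<rho> y = \<rho> y o\<^sub>L q) \<and>
      ((\<forall>x\<in>F. q o\<^sub>L \<rho> x = 0) \<or> (\<exists>t. q o\<^sub>L \<rho> t = q \<and> (\<forall>x\<in>F. \<not> t \<le> x \<longrightarrow> q o\<^sub>L \<rho> x = 0)))"
      by (elim exE conjE) (rule that)
    then show thesis by (intro that[of Q]; blast)
  qed
  \<comment> \<open>Each piece is cut into the part inside and the part outside the range of
    \<open>\<rho> x\<close>.\<close>
  let ?Q = "concat (map (\<lambda>q. [q o\<^sub>L \<rho> x, q - (q o\<^sub>L \<rho> x)]) Q)"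
  show ?case
  proof (intro exI[of _ ?Q] conjI allI ballI)
    fix \<eta>
    have eq: "(\<Sum>q\<leftarrow>concat (map (\<lambda>q. [q o\<^sub>L \<rho> x, q - (q o\<^sub>L \<rho> x)]) Q'). (norm (blinfun_apply q \<eta>))\<^sup>2)
        = (\<Sum>q\<leftarrow>Q'. (norm (blinfun_apply q \<eta>))\<^sup>2)" if "set Q' \<subseteq> set Q" for Q'
      using that
    proof (induction Q')
      case (Cons q Q')
      have q: "q (\<rho> x \<eta>) = \<rho> x (q \<eta>)"
        using Cons.prems Q(3)[of q x] by (metis blinfun_apply_blinfun_compose list.set_intros(1) subsetD)
      have "(norm (q \<eta>))\<^sup>2 = (norm (q (\<rho> x \<eta>)))\<^sup>2 + (norm (q \<eta> - q (\<rho> x \<eta>)))\<^sup>2"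
        unfolding q by (rule norm_projection_split) (simp_all add: r)
      then show ?case using Cons by (simp add: blinfun.diff_left)
    qed simp
    show "(norm \<eta>)\<^sup>2 = (\<Sum>q\<leftarrow>?Q. (norm (blinfun_apply q \<eta>))\<^sup>2)"
      by (rule trans[OF Q(1) eq[OF subset_refl, symmetric]])
  next
    fix q' assume "q' \<in> set ?Q"
    then obtain q where q: "q \<in> set Q" and q': "q' = q o\<^sub>L \<rho> x \<or> q' = q - (q o\<^sub>L \<rho> x)" by auto
    have comm: "q o\<^sub>L \<rho> x o\<^sub>L \<rho> y = q o\<^sub>L \<rho> y o\<^sub>L \<rho> x" for y
      by (simp add: blinfun_compose_assoc r(5)[of x y])
    have z: "q o\<^sub>L \<rho> x o\<^sub>L \<rho> y = 0" if "q o\<^sub>L \<rho> y = 0" for y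
      unfolding comm that by simp
    have xx: "q o\<^sub>L \<rho> x o\<^sub>L \<rho> x = q o\<^sub>L \<rho> x" by (simp add: blinfun_compose_assoc r)
    show "clin q'" using q' Q(2)[OF q] r(1) by auto
    show "q' o\<^sub>L \<rho> y = \<rho> y o\<^sub>L q'" for y
    proof -
      have "q o\<^sub>L \<rho> x o\<^sub>L \<rho> y = \<rho> y o\<^sub>L (q o\<^sub>L \<rho> x)"
        unfolding comm Q(3)[OF q, of y] by (simp add: blinfun_compose_assoc)
      then show ?thesis using q' Q(3)[OF q] by (auto simp: blinfun_compose_add)
    qed
    show "(\<forall>y\<in>insert x F. q' o\<^sub>L \<rho> y = 0) \<or>
        (\<exists>t. q' o\<^sub>L \<rho> t = q' \<and> (\<forall>y\<in>insert x F. \<not> t \<le> y \<longrightarrow> q' o\<^sub>L \<rho> y = 0))"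
      using q'
    proof
      assume q': "q' = q o\<^sub>L \<rho> x"
      \<comment> \<open>Inside the range of \<open>\<rho> x\<close>, a piece on which
        \<open>F\<close> acts by zero now carries the character of \<open>x\<close>, and a piece
        with the character of \<open>t\<close> carries that of \<open>meet t x\<close>.\<close>
      from Q(4)[OF q] show ?thesis
      proof
        assume "\<forall>x\<in>F. q o\<^sub>L \<rho> x = 0"
        then show ?thesis
          by (intro disjI2 exI[of _ x]) (auto simp: q' xx z)
      next
        assume "\<exists>t. q o\<^sub>L \<rho> t = q \<and> (\<forall>x\<in>F. \<not> t \<le> x \<longrightarrow> q o\<^sub>L \<rho> x = 0)"
        then obtain t where t: "q o\<^sub>L \<rho> t = q" "\<forall>x\<in>F. \<not> t \<le> x \<longrightarrow> q o\<^sub>L \<rho> x = 0" by blast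
        have "q' o\<^sub>L \<rho> (meet t x) = q'"
          unfolding q' r(2) blinfun_compose_assoc[symmetric] comm[of t] t(1) by (rule xx)
        moreover have "q' o\<^sub>L \<rho> y = 0" if "y \<in> insert x F" "\<not> meet t x \<le> y" for y
          using that t(2) meet.order_trans[OF meet.inf_le1[of t x]] meet.inf_le2[of t x]
          by (auto simp: q' z)
        ultimately show ?thesis by blast
      qed
    next
      assume q': "q' = q - (q o\<^sub>L \<rho> x)"
      have 0: "q' o\<^sub>L \<rho> x = 0" by (simp add: q' blinfun_compose_add xx)
      \<comment> \<open>Outside it, \<open>x\<close> acts by zero and \<open>t\<close> is kept. This
        is consistent even for \<open>t \<le> x\<close>, because the piece is then zero.\<close>
      from Q(4)[OF q] show ?thesis
      proof
        assume "\<forall>x\<in>F. q o\<^sub>L \<rho> x = 0"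
        then show ?thesis using 0 by (intro disjI1) (auto simp: q' blinfun_compose_add z)
      next
        assume "\<exists>t. q o\<^sub>L \<rho> t = q \<and> (\<forall>x\<in>F. \<not> t \<le> x \<longrightarrow> q o\<^sub>L \<rho> x = 0)"
        then obtain t where t: "q o\<^sub>L \<rho> t = q" "\<forall>x\<in>F. \<not> t \<le> x \<longrightarrow> q o\<^sub>L \<rho> x = 0" by blast
        show ?thesis
          by (intro disjI2 exI[of _ t]) (use t 0 in \<open>auto simp: q' blinfun_compose_add z comm[of t]\<close>)
      qed
    qed
  qed
qed

text \<open>On a finite set every character agrees with the zero character or with a principal one,
  \<open>\<lambda>x. t \<le> x\<close>. Limits of principal characters therefore never have to be
  considered, and the estimates below quantify over elements \<open>t\<close> only.\<close>

lemma spectral_decomposition: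
  fixes \<rho> :: "'x \<Rightarrow> 'k op"
  assumes \<rho>: "\<rho> \<in> semigroup_reps meet_semigroup" and "finite F"
  obtains Q :: "'k op list" where "\<And>\<eta>. (norm \<eta>)\<^sup>2 = (\<Sum>q\<leftarrow>Q. (norm (blinfun_apply q \<eta>))\<^sup>2)"
    "\<And>q. q \<in> set Q \<Longrightarrow> clin q" "\<And>q. q \<in> set Q \<Longrightarrow> norm q \<le> 1"
    "\<And>q. q \<in> set Q \<Longrightarrow> \<exists>\<kappa>. (\<kappa> = (\<lambda>_. False) \<or> (\<exists>t. \<kappa> = (\<lambda>x. t \<le> x))) \<and>
      (\<forall>x\<in>F. \<forall>v. q (\<rho> x v) = (if \<kappa> x then q v else 0))"
proof -
  note r = meet_repsD[OF \<rho>]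
  obtain Q :: "'k op list" where Q: "\<And>\<eta>. (norm \<eta>)\<^sup>2 = (\<Sum>q\<leftarrow>Q. (norm (blinfun_apply q \<eta>))\<^sup>2)"
    "\<And>q. q \<in> set Q \<Longrightarrow> clin q"
    "\<And>q. q \<in> set Q \<Longrightarrow> (\<forall>x\<in>F. q o\<^sub>L \<rho> x = 0) \<or> (\<exists>t. q o\<^sub>L \<rho> t = q \<and> (\<forall>x\<in>F. \<not> t \<le> x \<longrightarrow> q o\<^sub>L \<rho> x = 0))"
  proof -
    from spectral_decomposition_aux[OF assms] obtain Q where
      "\<forall>\<eta>. (norm \<eta>)\<^sup>2 = (\<Sum>q\<leftarrow>Q. (norm (blinfun_apply q \<eta>))\<^sup>2)"
      "\<forall>q\<in>set Q. clin q \<and> (\<forall>y. q o\<^sub>L \<rho> y = \<rho> y o\<^sub>L q) \<and>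
      ((\<forall>x\<in>F. q o\<^sub>L \<rho> x = 0) \<or> (\<exists>t. q o\<^sub>L \<rho> t = q \<and> (\<forall>x\<in>F. \<not> t \<le> x \<longrightarrow> q o\<^sub>L \<rho> x = 0)))"
      by (elim exE conjE) (rule that)
    then show thesis by (intro that[of Q]; blast)
  qed
  show thesis
  proof (rule that[of Q])
    fix q assume q: "q \<in> set Q"
    have "(norm (q \<eta>))\<^sup>2 \<le> (norm \<eta>)\<^sup>2" for \<eta>
      unfolding Q(1)[of \<eta>] by (rule member_le_sum_list) (use q in auto)
    then have "norm (q \<eta>) \<le> 1 * norm \<eta>" for \<eta> by (metis mult_1 norm_ge_zero power2_le_imp_le)
    then show "norm q \<le> 1" by (intro norm_blinfun_bound) auto
    from Q(3)[OF q] show "\<exists>\<kappa>. (\<kappa> = (\<lambda>_. False) \<or> (\<exists>t. \<kappa> = (\<lambda>x. t \<le> x))) \<and>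
      (\<forall>x\<in>F. \<forall>v. q (\<rho> x v) = (if \<kappa> x then q v else 0))"
    proof
      assume *: "\<forall>x\<in>F. q o\<^sub>L \<rho> x = 0"
      show ?thesis
        by (rule exI[of _ "\<lambda>_. False"])
          (use * in \<open>metis blinfun_apply_blinfun_compose zero_blinfun.rep_eq\<close>)
    next
      assume "\<exists>t. q o\<^sub>L \<rho> t = q \<and> (\<forall>x\<in>F. \<not> t \<le> x \<longrightarrow> q o\<^sub>L \<rho> x = 0)"
      then obtain t where t: "q o\<^sub>L \<rho> t = q" "\<forall>x\<in>F. \<not> t \<le> x \<longrightarrow> q o\<^sub>L \<rho> x = 0" by blast
      have "q o\<^sub>L \<rho> x = q" if "t \<le> x" for x
      proof -
        have "q o\<^sub>L \<rho> x = q o\<^sub>L \<rho> (meet t x)"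
          unfolding r(2) blinfun_compose_assoc[symmetric] t(1) ..
        then show ?thesis using that t(1) by (simp add: meet.inf.absorb1)
      qed
      then show ?thesis
        by (intro exI[of _ "\<lambda>x. t \<le> x"] conjI disjI2 exI[of _ t] refl ballI allI)
          (metis t(2) blinfun_apply_blinfun_compose zero_blinfun.rep_eq)
    qed
  qed (rule Q; assumption)+
qed

end

lemma lcomb_op_apply:
  "(\<And>m. clin (w m)) \<Longrightarrow> blinfun_apply (lcomb op_algebra w l) v = (\<Sum>(c, m)\<leftarrow>l. c *\<^sub>c blinfun_apply (w m) v)"
  by (induction l) (auto simp: blinfun.add_left)

lemma lcomb_op_family: "lcomb (op_family_algebra R) v l \<rho> = lcomb op_algebra (\<lambda>m. v m \<rho>) l"
  by (induction l) auto

lemma apply_sum_list: "clin T \<Longrightarrow> T (\<Sum>p\<leftarrow>l. f p) = (\<Sum>p\<leftarrow>l. T (f p))"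
  by (induction l) (auto simp: blinfun.add_right)

lemma coord_sum_list: "ell2_coord (\<Sum>p\<leftarrow>l. f p) k = (\<Sum>p\<leftarrow>l. ell2_coord (f p) k)"
  by (induction l) auto

lemma slice_sum_list: "ell2_slice (\<Sum>p\<leftarrow>l. f p) h = (\<Sum>p\<leftarrow>l. ell2_slice (f p) h)"
  by (induction l) auto

lemma op_bound_finite_slices:
  assumes "\<And>F. finite F \<Longrightarrow> (\<Sum>h\<in>F. (norm (ell2_slice \<xi> h))\<^sup>2) \<le> C"
  shows "(norm \<xi>)\<^sup>2 \<le> C"
  unfolding norm2_slices(2)[of \<xi>] using norm2_slices(1) assms by (rule infsum_le_finite_sums)

text \<open>Slices fix the first index and columns the second; an operator induced from a character
  acts on each column separately.\<close>

definition column :: "'k \<Rightarrow> ('g \<times> 'k) ell2 \<Rightarrow>\<^sub>L 'g ell2" where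
  "column k = pmap_op (\<lambda>_. True) (\<lambda>h. (h, k))"

lemma coord_column [simp]: "ell2_coord (column k \<xi>) h = ell2_coord \<xi> (h, k)"
  unfolding column_def by (subst coord_pmap_op) (auto simp: inj_on_def)

lemma clin_column [simp]: "clin (column k)"
  unfolding column_def by (rule clin_pmap_op) (auto simp: inj_on_def)

lemma norm2_columns:
  shows "(\<lambda>k. (norm (column k \<xi>))\<^sup>2) summable_on UNIV"
    and "(norm \<xi>)\<^sup>2 = (\<Sum>\<^sub>\<infinity>k. (norm (column k \<xi>))\<^sup>2)"
proof -
  let ?V = "pmap_op (\<lambda>_. True) (\<lambda>(k, h). (h, k)) :: ('g \<times> 'k) ell2 \<Rightarrow>\<^sub>L ('k \<times> 'g) ell2"
  have i: "inj_on (\<lambda>(k :: 'k, h :: 'g). (h, k)) {j. True}" by (auto simp: inj_on_def)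
  have s: "ell2_slice (?V \<xi>) k = column k \<xi>" for k
    by (rule ell2_eqI) (simp add: coord_pmap_op[OF i])
  have "\<langle>?V \<xi> | ?V \<xi>\<rangle> = \<langle>\<xi> | \<xi>\<rangle>" by (rule cinner_pmap_op[OF i]) auto
  then have n: "(norm (?V \<xi>))\<^sup>2 = (norm \<xi>)\<^sup>2" by (simp add: norm_eq_cinner)
  show "(\<lambda>k. (norm (column k \<xi>))\<^sup>2) summable_on UNIV"
    "(norm \<xi>)\<^sup>2 = (\<Sum>\<^sub>\<infinity>k. (norm (column k \<xi>))\<^sup>2)"
    using norm2_slices[of "?V \<xi>"] unfolding s n by auto
qed

lemma left_translation_pmap: "left_translation g = pmap_op (\<lambda>_. True) (\<lambda>(h, k). (- g + h, k))"
  unfolding left_translation_def pmap_op_def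
  by (intro arg_cong[where f = Blinfun] ext arg_cong[where f = ell2_of]) auto

lemma
  fixes g :: "'g::group_add"
  shows slice_left_translation [simp]: "ell2_slice (left_translation g \<xi>) h = ell2_slice \<xi> (- g + h)"
    and clin_left_translation [simp]: "clin (left_translation g)"
    and norm_left_translation: "norm (left_translation g) \<le> 1"
proof -
  have i: "inj_on (\<lambda>(h, k). (- g + h, k)) {j. True}" by (auto simp: inj_on_def)
  show "ell2_slice (left_translation g \<xi>) h = ell2_slice \<xi> (- g + h)"
    unfolding left_translation_pmap by (rule ell2_eqI) (simp add: coord_pmap_op[OF i])
  show "clin (left_translation g)" "norm (left_translation g) \<le> 1"
    unfolding left_translation_pmap using i by (rule clin_pmap_op norm_pmap_op)+
qed

section \<open>Regular representations and their fibres\<close>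

context semilattice_action
begin

text \<open>The regular representation induced from the character of \<open>t\<close>, stripped of
  its multiplicity space; compare \<open>coord_induced_character\<close>.\<close>

definition fiber_op :: "'x \<Rightarrow> 'x \<times> 'g \<Rightarrow> 'g op" where
  "fiber_op t m = pmap_op (\<lambda>h. act h t \<le> fst m) (\<lambda>h. - snd m + h)"

lemma coord_fiber_op [simp]: "ell2_coord (fiber_op t m \<zeta>) h = (if act h t \<le> fst m then ell2_coord \<zeta> (- snd m + h) else 0)"
  and clin_fiber_op [simp]: "clin (fiber_op t m)"
  unfolding fiber_op_def by (rule coord_pmap_op clin_pmap_op; simp add: inj_on_def)+

definition induced_op :: "('x \<Rightarrow> 'k op) \<Rightarrow> 'x \<times> 'g \<Rightarrow> ('g \<times> 'k) op" where
  "induced_op \<rho> m = diag_op (\<lambda>h. \<rho> (act (- h) (fst m))) o\<^sub>L left_translation (snd m)"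

lemma
  assumes \<rho>: "\<rho> \<in> semigroup_reps (meet_semigroup :: 'x semigrp)"
  shows slice_induced_op: "ell2_slice (induced_op \<rho> m \<xi>) h = \<rho> (act (- h) (fst m)) (ell2_slice \<xi> (- snd m + h))"
    and clin_induced_op: "clin (induced_op \<rho> m)"
proof -
  note r = meet_repsD[OF \<rho>]
  have n: "norm (\<rho> x) \<le> 1" for x by (rule norm_projection_le) (rule r)+
  show "ell2_slice (induced_op \<rho> m \<xi>) h = \<rho> (act (- h) (fst m)) (ell2_slice \<xi> (- snd m + h))"
    unfolding induced_op_def
    using slice_diag_op[of "\<lambda>h. \<rho> (act (- h) (fst m))" 1, OF r(1) n] by simp
  show "clin (induced_op \<rho> m)"
    unfolding induced_op_def
    using clin_diag_op[of "\<lambda>h. \<rho> (act (- h) (fst m))" 1, OF r(1) n] by simp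
qed

definition character_rep :: "'x \<Rightarrow> 'x \<Rightarrow> 'k op" where
  "character_rep t x = (if t \<le> x then id_blinfun else 0)"

lemma character_rep: "character_rep t \<in> semigroup_reps (meet_semigroup :: 'x semigrp)"
  unfolding meet_reps_iff by (auto simp: character_rep_def)

lemma coord_induced_character:
  "ell2_coord (induced_op (character_rep t) m \<xi>) (h, k) = (if act h t \<le> fst m then ell2_coord \<xi> (- snd m + h, k) else 0)"
proof -
  have "ell2_coord (induced_op (character_rep t) m \<xi>) (h, k)
      = ell2_coord (ell2_slice (induced_op (character_rep t) m \<xi>) h) k" by simp
  then show ?thesis
    unfolding slice_induced_op[OF character_rep] by (simp add: character_rep_def act_le_iff')
qed

lemma induced_character_le_fiber:
  "norm (lcomb op_algebra (induced_op (character_rep t :: 'x \<Rightarrow> 'k op)) l) \<le> norm (lcomb op_algebra (fiber_op t) l)"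
proof (rule norm_blinfun_bound)
  let ?T = "lcomb op_algebra (induced_op (character_rep t :: 'x \<Rightarrow> 'k op)) l"
  let ?b = "lcomb op_algebra (fiber_op t) l"
  fix \<xi>
  have col: "column k (?T \<xi>) = ?b (column k \<xi>)" for k
    unfolding lcomb_op_apply[OF clin_induced_op[OF character_rep]] lcomb_op_apply[OF clin_fiber_op]
    by (rule ell2_eqI) (auto simp: coord_sum_list coord_induced_character intro!: arg_cong[where f = sum_list])
  have "(norm (?T \<xi>))\<^sup>2 \<le> (norm ?b * norm \<xi>)\<^sup>2"
    unfolding power_mult_distrib norm2_columns(2)[of "?T \<xi>"] norm2_columns(2)[of \<xi>]
  proof (subst infsum_cmult_right'[symmetric], rule infsum_mono)
    fix k show "(norm (column k (?T \<xi>)))\<^sup>2 \<le> (norm ?b)\<^sup>2 * (norm (column k \<xi>))\<^sup>2"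
      unfolding col power_mult_distrib[symmetric] by (intro power_mono norm_blinfun) simp
  qed (intro norm2_columns(1) summable_on_cmult_right)+
  then show "norm (?T \<xi>) \<le> norm ?b * norm \<xi>" by (rule power2_le_imp_le) simp
qed simp

lemma fiber_le_induced_character:
  "norm (lcomb op_algebra (fiber_op t) l) \<le> norm (lcomb op_algebra (induced_op (character_rep t :: 'x \<Rightarrow> 'k op)) l)"
proof (rule norm_blinfun_bound)
  let ?T = "lcomb op_algebra (induced_op (character_rep t :: 'x \<Rightarrow> 'k op)) l"
  let ?b = "lcomb op_algebra (fiber_op t) l"
  fix \<zeta>
  define k0 :: 'k where "k0 = undefined"
  have i: "inj (\<lambda>h::'g. (h, k0))" by (auto simp: inj_on_def)
  have inv: "inv (\<lambda>h::'g. (h, k0)) (h, k0) = h" for h using inv_f_f[OF i, of h] by simp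
  let ?E = "index_embedding (\<lambda>h::'g. (h, k0))"
  have E: "ell2_coord (?E \<zeta>) (h, k) = (if k = k0 then ell2_coord \<zeta> h else 0)" for \<zeta> h k
    by (auto simp: coord_index_embedding[OF i] inv)
  have "?T (?E \<zeta>) = ?E (?b \<zeta>)"
    unfolding lcomb_op_apply[OF clin_induced_op[OF character_rep]] lcomb_op_apply[OF clin_fiber_op]
    by (rule ell2_eqI, clarify) (auto simp: coord_sum_list coord_induced_character E apply_sum_list[OF clin_index_embedding[OF i]]
       intro!: arg_cong[where f = sum_list])
  then have "norm (?b \<zeta>) = norm (?T (?E \<zeta>))" by (simp add: norm_index_embedding[OF i])
  also have "\<dots> \<le> norm ?T * norm (?E \<zeta>)" by (rule norm_blinfun)
  finally show "norm (?b \<zeta>) \<le> norm ?T * norm \<zeta>" by (simp add: norm_index_embedding[OF i])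
qed simp

text \<open>The norm is tested on finitely many slices, which involve only finitely many values of
  \<rho>. On each spectral piece \<rho> can then be replaced by a character, and the estimates for
  the pieces add up by Pythagoras.\<close>

lemma induced_le_fibers:
  fixes \<rho> :: "'x \<Rightarrow> 'k op"
  assumes \<rho>: "\<rho> \<in> semigroup_reps meet_semigroup" and C: "\<And>t. norm (lcomb op_algebra (fiber_op t) l) \<le> C"
  shows "norm (lcomb op_algebra (induced_op \<rho>) l) \<le> C"
proof -
  have C0: "0 \<le> C" using order_trans[OF norm_ge_zero C] .
  let ?T = "lcomb op_algebra (induced_op \<rho>) l"
  show ?thesis
  proof (rule norm_blinfun_bound[OF C0])
    fix \<xi>
    have sl: "ell2_slice (?T \<xi>) h = (\<Sum>(c, m)\<leftarrow>l. c *\<^sub>c \<rho> (act (- h) (fst m)) (ell2_slice \<xi> (- snd m + h)))" for h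
      unfolding lcomb_op_apply[OF clin_induced_op[OF \<rho>]] slice_sum_list
      by (intro arg_cong[where f = sum_list] map_cong refl) (auto simp: slice_induced_op[OF \<rho>])
    have "(\<Sum>h\<in>F. (norm (ell2_slice (?T \<xi>) h))\<^sup>2) \<le> (C * norm \<xi>)\<^sup>2" if F: "finite F" for F
    proof -
      \<comment> \<open>All elements at which \<rho> is evaluated in the slices over
        \<open>F\<close>.\<close>
      let ?X = "(\<lambda>(h, m). act (- h) (fst m)) ` (F \<times> snd ` set l)"
      have "finite ?X" using F by simp
      then obtain Q :: "'k op list" where Q: "\<And>\<eta>. (norm \<eta>)\<^sup>2 = (\<Sum>q\<leftarrow>Q. (norm (blinfun_apply q \<eta>))\<^sup>2)"
        "\<And>q. q \<in> set Q \<Longrightarrow> clin q" "\<And>q. q \<in> set Q \<Longrightarrow> norm q \<le> 1"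
        "\<And>q. q \<in> set Q \<Longrightarrow> \<exists>\<kappa>. (\<kappa> = (\<lambda>_. False) \<or> (\<exists>t. \<kappa> = (\<lambda>x. t \<le> x))) \<and>
          (\<forall>x\<in>?X. \<forall>v. q (\<rho> x v) = (if \<kappa> x then q v else 0))"
        by (rule spectral_decomposition[OF \<rho>]) (rule that)
      \<comment> \<open>The piece \<open>q\<close> has to act on all slices, because a slice over
        \<open>F\<close> of the image may draw on slices of \<xi> outside \<open>F\<close>.\<close>
      let ?D = "\<lambda>q. diag_op (\<lambda>_::'g. q)"
      have D: "ell2_slice (?D q \<xi>) h = q (ell2_slice \<xi> h)" if "q \<in> set Q" for q h
        using slice_diag_op[OF Q(2)[OF that] Q(3)[OF that]] .
      have part: "(\<Sum>h\<in>F. (norm (blinfun_apply q (ell2_slice (?T \<xi>) h)))\<^sup>2) \<le> C\<^sup>2 * (norm (?D q \<xi>))\<^sup>2" if q: "q \<in> set Q" for q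
      proof -
        obtain \<kappa> where \<kappa>: "\<kappa> = (\<lambda>_. False) \<or> (\<exists>t. \<kappa> = (\<lambda>x. t \<le> x))"
          "\<And>x v. x \<in> ?X \<Longrightarrow> q (\<rho> x v) = (if \<kappa> x then q v else 0)" using Q(4)[OF q] by blast
        have qs: "q (ell2_slice (?T \<xi>) h) = (\<Sum>(c, m)\<leftarrow>l. if \<kappa> (act (- h) (fst m)) then c *\<^sub>c q (ell2_slice \<xi> (- snd m + h)) else 0)"
          if "h \<in> F" for h
          unfolding sl apply_sum_list[OF Q(2)[OF q]]
        proof (intro arg_cong[where f = sum_list] map_cong refl)
          fix p assume p: "p \<in> set l"
          have "act (- h) (fst (snd p)) \<in> ?X" using that p by force
          note * = \<kappa>(2)[OF this]
          then show "q (case p of (c, m) \<Rightarrow> c *\<^sub>c \<rho> (act (- h) (fst m)) (ell2_slice \<xi> (- snd m + h)))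
              = (case p of (c, m) \<Rightarrow> if \<kappa> (act (- h) (fst m)) then c *\<^sub>c q (ell2_slice \<xi> (- snd m + h)) else 0)"
            using * by (cases p) (simp add: clinD[OF Q(2)[OF q]])
        qed
        show ?thesis using \<kappa>(1)
        proof
          assume "\<kappa> = (\<lambda>_. False)"
          then have "q (ell2_slice (?T \<xi>) h) = 0" if "h \<in> F" for h
            unfolding qs[OF that] by (induction l) auto
          then show ?thesis by simp
        next
          assume "\<exists>t. \<kappa> = (\<lambda>x. t \<le> x)"
          then obtain t where t: "\<kappa> = (\<lambda>x. t \<le> x)" by blast
          let ?S = "lcomb op_algebra (induced_op (character_rep t :: 'x \<Rightarrow> 'k op)) l"
          have "q (ell2_slice (?T \<xi>) h) = ell2_slice (?S (?D q \<xi>)) h" if "h \<in> F" for h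
            unfolding qs[OF that] lcomb_op_apply[OF clin_induced_op[OF character_rep]] slice_sum_list
            by (intro arg_cong[where f = sum_list] map_cong refl)
              (auto simp: slice_induced_op[OF character_rep] character_rep_def t D[OF q])
          then have "(\<Sum>h\<in>F. (norm (blinfun_apply q (ell2_slice (?T \<xi>) h)))\<^sup>2) = (\<Sum>h\<in>F. (norm (ell2_slice (?S (?D q \<xi>)) h))\<^sup>2)"
            by simp
          also have "\<dots> \<le> (norm (?S (?D q \<xi>)))\<^sup>2"
            unfolding norm2_slices(2) by (rule finite_sum_le_infsum[OF norm2_slices(1) F]) auto
          also have "\<dots> \<le> (C * norm (?D q \<xi>))\<^sup>2"
            using norm_blinfun[of ?S "?D q \<xi>"]
              mult_right_mono[OF order_trans[OF induced_character_le_fiber[where 'k = 'k] C], of "norm (?D q \<xi>)"]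
            by (intro power_mono) (auto intro: order_trans)
          finally show ?thesis by (simp add: power_mult_distrib)
        qed
      qed
      have swap: "(\<Sum>q\<leftarrow>Q'. (norm (?D q \<xi>))\<^sup>2) = (\<Sum>\<^sub>\<infinity>h. \<Sum>q\<leftarrow>Q'. (norm (blinfun_apply q (ell2_slice \<xi> h)))\<^sup>2) \<and>
          (\<lambda>h. \<Sum>q\<leftarrow>Q'. (norm (blinfun_apply q (ell2_slice \<xi> h)))\<^sup>2) summable_on UNIV" if "set Q' \<subseteq> set Q" for Q'
        using that
      proof (induction Q')
        case (Cons q Q')
        then have q: "q \<in> set Q" by simp
        show ?case
          using Cons norm2_slices[of "?D q \<xi>"] unfolding D[OF q]
          by (auto simp: infsum_add intro!: summable_on_add)
      qed simp
      have "(\<Sum>h\<in>F. (norm (ell2_slice (?T \<xi>) h))\<^sup>2) = (\<Sum>h\<in>F. \<Sum>q\<leftarrow>Q. (norm (blinfun_apply q (ell2_slice (?T \<xi>) h)))\<^sup>2)"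
        by (intro sum.cong refl Q(1))
      also have "\<dots> = (\<Sum>q\<leftarrow>Q. \<Sum>h\<in>F. (norm (blinfun_apply q (ell2_slice (?T \<xi>) h)))\<^sup>2)"
        by (induction Q) (auto simp: sum.distrib)
      also have "\<dots> \<le> (\<Sum>q\<leftarrow>Q. C\<^sup>2 * (norm (?D q \<xi>))\<^sup>2)"
        by (rule sum_list_mono) (rule part)
      also have "\<dots> = C\<^sup>2 * (\<Sum>q\<leftarrow>Q. (norm (?D q \<xi>))\<^sup>2)" by (rule sum_list_const_mult)
      also have "\<dots> = C\<^sup>2 * (norm \<xi>)\<^sup>2"
        using swap[OF subset_refl] by (simp add: Q(1)[symmetric] norm2_slices(2)[symmetric])
      finally show ?thesis by (simp add: power_mult_distrib)
    qed
    then have "(norm (?T \<xi>))\<^sup>2 \<le> (C * norm \<xi>)\<^sup>2" by (rule op_bound_finite_slices)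
    then show "norm (?T \<xi>) \<le> C * norm \<xi>" by (rule power2_le_imp_le) (use C0 in simp)
  qed
qed

definition character_value :: "'x \<Rightarrow> (complex \<times> 'x) list \<Rightarrow> complex" where
  "character_value t l = (\<Sum>(c, x)\<leftarrow>l. if t \<le> x then c else 0)"

text \<open>Together with the scalar representations \<open>character_rep\<close>, this computes the
  universal norm of a combination as the supremum of its values at the principal characters.\<close>

lemma rep_le_characters:
  fixes \<rho> :: "'x \<Rightarrow> 'k op"
  assumes \<rho>: "\<rho> \<in> semigroup_reps meet_semigroup" and C: "\<And>t. cmod (character_value t l) \<le> C"
  shows "norm (lcomb op_algebra \<rho> l) \<le> C"
proof -
  have C0: "0 \<le> C" using order_trans[OF norm_ge_zero C] .
  note r = meet_repsD[OF \<rho>]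
  let ?T = "lcomb op_algebra \<rho> l"
  show ?thesis
  proof (rule norm_blinfun_bound[OF C0])
    fix v
    have T: "?T v = (\<Sum>(c, x)\<leftarrow>l. c *\<^sub>c \<rho> x v)" by (rule lcomb_op_apply[OF r(1)])
    have "finite (snd ` set l)" by simp
    then obtain Q :: "'k op list" where Q: "\<And>\<eta>. (norm \<eta>)\<^sup>2 = (\<Sum>q\<leftarrow>Q. (norm (blinfun_apply q \<eta>))\<^sup>2)"
      "\<And>q. q \<in> set Q \<Longrightarrow> clin q" "\<And>q. q \<in> set Q \<Longrightarrow> norm q \<le> 1"
      "\<And>q. q \<in> set Q \<Longrightarrow> \<exists>\<kappa>. (\<kappa> = (\<lambda>_. False) \<or> (\<exists>t. \<kappa> = (\<lambda>x. t \<le> x))) \<and>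
        (\<forall>x\<in>snd ` set l. \<forall>v. q (\<rho> x v) = (if \<kappa> x then q v else 0))"
      by (rule spectral_decomposition[OF \<rho>]) (rule that)
    have part: "(norm (q (?T v)))\<^sup>2 \<le> C\<^sup>2 * (norm (blinfun_apply q v))\<^sup>2" if q: "q \<in> set Q" for q
    proof -
      obtain \<kappa> where \<kappa>: "\<kappa> = (\<lambda>_. False) \<or> (\<exists>t. \<kappa> = (\<lambda>x. t \<le> x))"
        "\<And>x v. x \<in> snd ` set l \<Longrightarrow> q (\<rho> x v) = (if \<kappa> x then q v else 0)" using Q(4)[OF q] by blast
      have "q (?T v) = (\<Sum>(c, x)\<leftarrow>l'. if \<kappa> x then c else 0) *\<^sub>c q v" if "l' = l" for l'
      proof -
        have "q (\<Sum>(c, x)\<leftarrow>k. c *\<^sub>c \<rho> x v) = (\<Sum>(c, x)\<leftarrow>k. if \<kappa> x then c else 0) *\<^sub>c q v"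
          if "set k \<subseteq> set l" for k
          using that
        proof (induction k)
          case (Cons p k)
          obtain c x where p: "p = (c, x)" by force
          then have "x \<in> snd ` set l" using Cons.prems by force
          then show ?case
            using Cons by (simp add: p blinfun.add_right clinD[OF Q(2)[OF q]] \<kappa>(2) cscale_add_left)
        qed simp
        then show ?thesis using that T by simp
      qed
      then have "norm (q (?T v)) = cmod (\<Sum>(c, x)\<leftarrow>l. if \<kappa> x then c else 0) * norm (q v)" by simp
      also have "cmod (\<Sum>(c, x)\<leftarrow>l. if \<kappa> x then c else 0) \<le> C"
      proof (cases "\<kappa> = (\<lambda>_. False)")
        case True
        then have "(\<Sum>(c, x)\<leftarrow>l. if \<kappa> x then c else (0::complex)) = 0" by (induction l) auto
        then show ?thesis using C0 by simp
      next
        case False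
        then show ?thesis using \<kappa>(1) C by (auto simp: character_value_def)
      qed
      finally have "norm (q (?T v)) \<le> C * norm (q v)" by (simp add: mult_right_mono)
      then show ?thesis by (simp flip: power_mult_distrib add: power_mono)
    qed
    have "(norm (?T v))\<^sup>2 \<le> (\<Sum>q\<leftarrow>Q. C\<^sup>2 * (norm (blinfun_apply q v))\<^sup>2)"
      unfolding Q(1)[of "?T v"] by (rule sum_list_mono) (rule part)
    also have "\<dots> = (C * norm v)\<^sup>2" unfolding power_mult_distrib Q(1)[of v] by (rule sum_list_const_mult)
    finally show "norm (?T v) \<le> C * norm v" by (rule power2_le_imp_le) (use C0 in simp)
  qed
qed

end

section \<open>Covariant pairs\<close>

lemma lcomb_op_apply_on:
  "l \<in> combs M \<Longrightarrow> (\<And>m. m \<in> M \<Longrightarrow> clin (w m)) \<Longrightarrow>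
    blinfun_apply (lcomb op_algebra w l) v = (\<Sum>(c, m)\<leftarrow>l. c *\<^sub>c blinfun_apply (w m) v)"
  by (induction l) (auto simp: blinfun.add_left)

lemma unitary_reps_iff: "U \<in> unitary_reps \<longleftrightarrow>
    (\<forall>g. clin (U g)) \<and> U 0 = id_blinfun \<and> (\<forall>g h. U (g + h) = U g o\<^sub>L U h) \<and> (\<forall>g. adj (U g) = U (- g))"
  by (simp add: unitary_reps_def clinear_op_clin op_adj_adj)

lemma unitary_repsD:
  assumes "U \<in> unitary_reps"
  shows "clin (U g)" "U 0 = id_blinfun" "U (g + h) = U g o\<^sub>L U h" "adj (U g) = U (- g)"
    "U (- g) o\<^sub>L U g = id_blinfun" "U g o\<^sub>L U (- g) = id_blinfun" "norm (U g) \<le> 1"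
proof -
  have r: "clin (U g)" "U 0 = id_blinfun" "U (g + h) = U g o\<^sub>L U h" "adj (U g) = U (- g)" for g h
    using assms unfolding unitary_reps_iff by blast+
  show "clin (U g)" "U 0 = id_blinfun" "U (g + h) = U g o\<^sub>L U h" "adj (U g) = U (- g)" by (rule r)+
  show 1: "U (- g) o\<^sub>L U g = id_blinfun" and "U g o\<^sub>L U (- g) = id_blinfun"
    using r(3)[of "- g" g] r(3)[of g "- g"] r(2) by simp_all
  show "norm (U g) \<le> 1"
  proof (rule norm_blinfun_bound)
    fix v
    have "\<langle>U g v | U g v\<rangle> = \<langle>(U (- g) o\<^sub>L U g) v | v\<rangle>"
      using cinner_adj[OF r(1), of g "U g v" v] r(4) by simp
    then have "\<langle>U g v | U g v\<rangle> = \<langle>v | v\<rangle>" by (simp add: 1)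
    then have "(norm (U g v))\<^sup>2 = (norm v)\<^sup>2" by (simp add: norm_eq_cinner)
    then show "norm (U g v) \<le> 1 * norm v" by simp
  qed simp
qed

lemma compress_apply:
  fixes W :: "'k ell2 \<Rightarrow>\<^sub>L 'j ell2"
  assumes W: "clin W" "\<And>T. T \<in> \<T> \<Longrightarrow> adj W o\<^sub>L W o\<^sub>L T = T o\<^sub>L adj W o\<^sub>L W"
    and "T \<in> \<T>" and v: "adj W (W v) = v"
  shows "adj W (W (T v)) = T v" "(W o\<^sub>L T o\<^sub>L adj W) (W v) = W (T v)"
  using arg_cong[OF W(2)[OF \<open>T \<in> \<T>\<close>], of "\<lambda>S. S v"] v by simp_all

lemma compress_comp:
  fixes W :: "'k ell2 \<Rightarrow>\<^sub>L 'j ell2"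
  assumes W: "W o\<^sub>L adj W o\<^sub>L W = W" "\<And>T. T \<in> \<T> \<Longrightarrow> adj W o\<^sub>L W o\<^sub>L T = T o\<^sub>L adj W o\<^sub>L W"
    and S: "S \<in> \<T>"
  shows "(W o\<^sub>L S o\<^sub>L adj W) o\<^sub>L (W o\<^sub>L T o\<^sub>L adj W) = W o\<^sub>L (S o\<^sub>L T) o\<^sub>L adj W"
proof -
  have "(W o\<^sub>L S o\<^sub>L adj W) o\<^sub>L (W o\<^sub>L T o\<^sub>L adj W) = W o\<^sub>L (S o\<^sub>L adj W o\<^sub>L W) o\<^sub>L T o\<^sub>L adj W"
    by (simp add: blinfun_compose_assoc)
  also have "S o\<^sub>L adj W o\<^sub>L W = adj W o\<^sub>L W o\<^sub>L S" using W(2)[OF S] by simp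
  also have "W o\<^sub>L (adj W o\<^sub>L W o\<^sub>L S) o\<^sub>L T o\<^sub>L adj W = (W o\<^sub>L adj W o\<^sub>L W) o\<^sub>L (S o\<^sub>L T) o\<^sub>L adj W"
    by (simp add: blinfun_compose_assoc)
  finally show ?thesis unfolding W(1) .
qed

lemma norm_compress:
  "clin W \<Longrightarrow> adj W (W v) = v \<Longrightarrow> norm (W v) = norm v"
proof -
  assume "clin W" "adj W (W v) = v"
  then have "\<langle>W v | W v\<rangle> = \<langle>v | v\<rangle>" by (metis cinner_adj_right)
  then have "(norm (W v))\<^sup>2 = (norm v)\<^sup>2" by (simp add: norm_eq_cinner)
  then show ?thesis by simp
qed

lemma semigroup_reps_iff: "\<pi> \<in> semigroup_reps S \<longleftrightarrow>
    (\<forall>s\<in>selems S. clin (\<pi> s)) \<and> (\<forall>s\<in>selems S. \<forall>t\<in>selems S. \<pi> (sgmult S s t) = \<pi> s o\<^sub>L \<pi> t) \<and>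
    (\<forall>s\<in>selems S. \<pi> (sginv S s) = adj (\<pi> s))"
  by (simp add: semigroup_reps_def clinear_op_clin op_adj_adj)

text \<open>Each vector \<open>v\<close> lies in a separable reducing subspace. Transported along
  \<open>W\<close>, the restriction to it becomes a representation over the index type
  \<open>'j\<close>, where the bound is known.\<close>

lemma semigroup_reps_norm_transfer:
  fixes \<pi> :: "'s \<Rightarrow> 'k op" and \<iota> :: "nat \<Rightarrow> 'j"
  assumes S: "countable (selems S)" "\<And>s. s \<in> selems S \<Longrightarrow> sginv S s \<in> selems S"
    and \<pi>: "\<pi> \<in> semigroup_reps S" and \<iota>: "inj \<iota>" and l: "l \<in> combs (selems S)" and C: "0 \<le> C"
    and le: "\<And>\<rho> :: 's \<Rightarrow> 'j op. \<rho> \<in> semigroup_reps S \<Longrightarrow> norm (lcomb op_algebra \<rho> l) \<le> C"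
  shows "norm (lcomb op_algebra \<pi> l) \<le> C"
proof (rule norm_blinfun_bound[OF C])
  fix v
  have r: "\<And>s. s \<in> selems S \<Longrightarrow> clin (\<pi> s)" using \<pi> by (simp add: semigroup_reps_iff)
  obtain W :: "'k ell2 \<Rightarrow>\<^sub>L 'j ell2" where W: "clin W" "adj W (W v) = v" "W o\<^sub>L adj W o\<^sub>L W = W"
    "\<And>T. T \<in> \<pi> ` selems S \<Longrightarrow> adj W o\<^sub>L W o\<^sub>L T = T o\<^sub>L adj W o\<^sub>L W"
  proof (rule countable_compression[of "\<pi> ` selems S" \<iota> v])
    show "adj T \<in> \<pi> ` selems S" if "T \<in> \<pi> ` selems S" for T
    proof -
      obtain s where s: "s \<in> selems S" "T = \<pi> s" using \<open>T \<in> _\<close> by blast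
      then have "adj T = \<pi> (sginv S s)" using \<pi> by (simp add: semigroup_reps_iff)
      then show ?thesis using S(2)[OF s(1)] by blast
    qed
  qed (use S r \<iota> in auto)
  define \<rho> where "\<rho> s = W o\<^sub>L \<pi> s o\<^sub>L adj W" for s
  have "\<rho> \<in> semigroup_reps S"
    unfolding semigroup_reps_iff \<rho>_def
    using \<pi> r W(1) compress_comp[OF W(3,4)] by (auto simp: semigroup_reps_iff blinfun_compose_assoc)
  then have le': "norm (lcomb op_algebra \<rho> l) \<le> C" by (rule le)
  have "lcomb op_algebra \<rho> k (W v) = W (lcomb op_algebra \<pi> k v) \<and>
      adj W (W (lcomb op_algebra \<pi> k v)) = lcomb op_algebra \<pi> k v" if "k \<in> combs (selems S)" for k
    using that
  proof (induction k)
    case (Cons p k)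
    obtain c s where p: "p = (c, s)" by force
    have s: "s \<in> selems S" and k: "k \<in> combs (selems S)" using Cons.hyps by (auto simp: p)
    note a = compress_apply[OF W(1,4) imageI[OF s] W(2)]
    have "clin (\<rho> s)" using r[OF s] W(1) by (simp add: \<rho>_def)
    then show ?case using Cons.IH a r[OF s] W(1)
      by (simp add: p blinfun.add_left blinfun.add_right clinD \<rho>_def)
  qed simp
  from this[OF l] have "norm (lcomb op_algebra \<pi> l v) \<le> norm (lcomb op_algebra \<rho> l) * norm (W v)"
    using norm_compress[OF W(1)] norm_blinfun by metis
  also have "\<dots> \<le> C * norm v"
    using le' norm_compress[OF W(1,2)] by (simp add: mult_right_mono)
  finally show "norm (lcomb op_algebra \<pi> l v) \<le> C * norm v" .
qed

context semilattice_action
begin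

text \<open>Covariant representations with the algebra of \<open>X\<close> replaced by
  \<open>X\<close> itself. The index type stays free, so that pairs over different types can be
  compared.\<close>

definition cov_pairs :: "(('x \<Rightarrow> 'k op) \<times> ('g \<Rightarrow> 'k op)) set" where
  "cov_pairs = {(\<rho>, U). \<rho> \<in> semigroup_reps meet_semigroup \<and> U \<in> unitary_reps \<and>
    (\<forall>g x. U g o\<^sub>L \<rho> x o\<^sub>L U (- g) = \<rho> (act g x))}"

definition pair_op :: "('x \<Rightarrow> 'k op) \<Rightarrow> ('g \<Rightarrow> 'k op) \<Rightarrow> 'x \<times> 'g \<Rightarrow> 'k op" where
  "pair_op \<rho> U m = \<rho> (fst m) o\<^sub>L U (snd m)"

text \<open>The product of P(X, X, G), that is, of the semidirect product of the semilattice
  \<open>X\<close> by \<open>G\<close>. The McAlister semigroup is closed under it, so one rule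
  serves the generators of all the algebras.\<close>

definition pair_mul :: "'x \<times> 'g \<Rightarrow> 'x \<times> 'g \<Rightarrow> 'x \<times> 'g" where
  "pair_mul m n = (meet (fst m) (act (snd m) (fst n)), snd m + snd n)"

definition pair_inv :: "'x \<times> 'g \<Rightarrow> 'x \<times> 'g" where
  "pair_inv m = (act (- snd m) (fst m), - snd m)"

lemma cov_pairsD:
  assumes "(\<rho>, U) \<in> cov_pairs"
  shows "\<rho> \<in> semigroup_reps meet_semigroup" "U \<in> unitary_reps" "U g o\<^sub>L \<rho> x o\<^sub>L U (- g) = \<rho> (act g x)"
    "U g o\<^sub>L \<rho> x = \<rho> (act g x) o\<^sub>L U g"
proof -
  show c: "\<rho> \<in> semigroup_reps meet_semigroup" "U \<in> unitary_reps" "U g o\<^sub>L \<rho> x o\<^sub>L U (- g) = \<rho> (act g x)"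
    using assms by (auto simp: cov_pairs_def)
  have "\<rho> (act g x) o\<^sub>L U g = U g o\<^sub>L \<rho> x o\<^sub>L (U (- g) o\<^sub>L U g)"
    unfolding c(3)[symmetric] by (simp only: blinfun_compose_assoc)
  then show "U g o\<^sub>L \<rho> x = \<rho> (act g x) o\<^sub>L U g" by (simp add: unitary_repsD(5)[OF c(2)])
qed

lemma pair_op:
  assumes "(\<rho>, U) \<in> cov_pairs"
  shows "clin (pair_op \<rho> U m)" "pair_op \<rho> U (pair_mul m n) = pair_op \<rho> U m o\<^sub>L pair_op \<rho> U n"
    "pair_op \<rho> U (pair_inv m) = adj (pair_op \<rho> U m)" "norm (pair_op \<rho> U m) \<le> 1"
proof -
  note c = cov_pairsD[OF assms]
  note r = meet_repsD[OF c(1)] and u = unitary_repsD[OF c(2)]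
  show "clin (pair_op \<rho> U m)" by (simp add: pair_op_def r u)
  have "pair_op \<rho> U (pair_mul m n) = \<rho> (fst m) o\<^sub>L (\<rho> (act (snd m) (fst n)) o\<^sub>L U (snd m)) o\<^sub>L U (snd n)"
    by (simp add: pair_op_def pair_mul_def r u blinfun_compose_assoc)
  then show "pair_op \<rho> U (pair_mul m n) = pair_op \<rho> U m o\<^sub>L pair_op \<rho> U n"
    unfolding c(4)[symmetric] by (simp add: pair_op_def blinfun_compose_assoc)
  show "pair_op \<rho> U (pair_inv m) = adj (pair_op \<rho> U m)"
    using c(4)[of "- snd m" "fst m"] by (simp add: pair_op_def pair_inv_def r u)
  show "norm (pair_op \<rho> U m) \<le> 1"
    unfolding pair_op_def
    using norm_blinfun_compose[of "\<rho> (fst m)" "U (snd m)"] u(7)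
      norm_projection_le[OF r(1) r(3) r(4)] mult_mono[of "norm (\<rho> (fst m))" 1 "norm (U (snd m))" 1]
    by fastforce
qed

lemma left_translation_unitary: "(left_translation :: 'g \<Rightarrow> ('g \<times> 'k) op) \<in> unitary_reps"
  unfolding unitary_reps_iff
proof (intro conjI allI)
  show "left_translation 0 = (id_blinfun :: ('g \<times> 'k) op)"
    by (intro blinfun_eqI slices_eqI) simp
  show "left_translation (g + h) = (left_translation g o\<^sub>L left_translation h :: ('g \<times> 'k) op)" for g h :: 'g
    by (intro blinfun_eqI slices_eqI) (simp add: minus_add add.assoc diff_conv_add_uminus del: add_uminus_conv_diff)
  show "adj (left_translation g) = (left_translation (- g) :: ('g \<times> 'k) op)" for g :: 'g
  proof (rule adjI)
    fix x y :: "('g \<times> 'k) ell2"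
    have inv: "left_translation g (left_translation (- g) x) = x"
      by (rule slices_eqI) (simp add: add.assoc[symmetric])
    have iso: "\<langle>left_translation g x | left_translation g y\<rangle> = \<langle>x | y\<rangle>" for x y :: "('g \<times> 'k) ell2"
      unfolding left_translation_pmap
    proof (rule cinner_pmap_op)
      show "(\<lambda>(h, k). (- g + h, k)) ` {j :: 'g \<times> 'k. True} = UNIV"
      proof -
        have "p \<in> (\<lambda>(h, k). (- g + h, k)) ` {j :: 'g \<times> 'k. True}" for p
          by (rule image_eqI[of _ _ "(g + fst p, snd p)"]) (simp_all add: add.assoc[symmetric])
        then show ?thesis by blast
      qed
    qed (auto simp: inj_on_def)
    show "\<langle>left_translation (- g) x | y\<rangle> = \<langle>x | left_translation g y\<rangle>"
      using iso[of "left_translation (- g) x" y] by (simp add: inv)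
  qed
qed simp

text \<open>Makes the product and adjoint rules of the reduced generators instances of
  \<open>pair_op\<close>.\<close>

lemma induced_cov_pair:
  assumes \<rho>: "\<rho> \<in> semigroup_reps (meet_semigroup :: 'x semigrp)"
  shows "((\<lambda>x. diag_op (\<lambda>h. \<rho> (act (- h) x))), left_translation) \<in> cov_pairs"
    and "induced_op \<rho> = pair_op (\<lambda>x. diag_op (\<lambda>h. \<rho> (act (- h) x))) left_translation"
proof -
  note r = meet_repsD[OF \<rho>]
  have n: "norm (\<rho> x) \<le> 1" for x by (rule norm_projection_le) (rule r)+
  have sl: "ell2_slice (diag_op (\<lambda>h. \<rho> (act (- h) x)) \<xi>) h = \<rho> (act (- h) x) (ell2_slice \<xi> h)" for x \<xi> h
    by (rule slice_diag_op[of "\<lambda>h. \<rho> (act (- h) x)" 1]) (rule r n)+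
  have cl: "clin (diag_op (\<lambda>h. \<rho> (act (- h) x)))" for x
    by (rule clin_diag_op[of "\<lambda>h. \<rho> (act (- h) x)" 1]) (rule r n)+
  have ad: "adj (diag_op (\<lambda>h. \<rho> (act (- h) x))) = diag_op (\<lambda>h. \<rho> (act (- h) x))" for x
  proof (rule adjI)
    fix \<xi> \<eta>
    have c: "\<langle>\<xi> | \<eta>\<rangle> = (\<Sum>\<^sub>\<infinity>h. \<langle>ell2_slice \<xi> h | ell2_slice \<eta> h\<rangle>)" for \<xi> \<eta> :: "('g \<times> 'b) ell2"
      unfolding ell2_cinner_def ell2_coord_slice
      using infsum_Sigma'_banach[of "\<lambda>h k. cnj (ell2_coord \<xi> (h, k)) * ell2_coord \<eta> (h, k)" UNIV "\<lambda>_. UNIV"]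
        cinner_summable[of \<xi> \<eta>] by (simp add: case_prod_unfold)
    show "\<langle>diag_op (\<lambda>h. \<rho> (act (- h) x)) \<xi> | \<eta>\<rangle> = \<langle>\<xi> | diag_op (\<lambda>h. \<rho> (act (- h) x)) \<eta>\<rangle>"
      unfolding c sl using cinner_adj[OF r(1)] by (simp add: r(3))
  qed
  have "left_translation g o\<^sub>L diag_op (\<lambda>h. \<rho> (act (- h) x)) o\<^sub>L left_translation (- g)
      = diag_op (\<lambda>h. \<rho> (act (- h) (act g x)))" for g x
    by (intro blinfun_eqI slices_eqI) (simp add: sl, simp add: add.assoc[symmetric] minus_add flip: act_add)
  moreover have "diag_op (\<lambda>h. \<rho> (act (- h) (meet x y))) = diag_op (\<lambda>h. \<rho> (act (- h) x)) o\<^sub>L diag_op (\<lambda>h. \<rho> (act (- h) y))" for x y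
    by (intro blinfun_eqI slices_eqI) (simp add: sl, simp add: act_meet r(2))
  ultimately show "((\<lambda>x. diag_op (\<lambda>h. \<rho> (act (- h) x))), left_translation) \<in> cov_pairs"
    unfolding cov_pairs_def meet_reps_iff using cl ad left_translation_unitary by simp
  show "induced_op \<rho> = pair_op (\<lambda>x. diag_op (\<lambda>h. \<rho> (act (- h) x))) left_translation"
    by (simp add: fun_eq_iff induced_op_def pair_op_def)
qed

end

locale countable_semilattice_action = semilattice_action act
  for act :: "'g::group_add \<Rightarrow> 'x::order \<Rightarrow> 'x" +
  assumes countable_X: "countable (UNIV :: 'x set)" and countable_G: "countable (UNIV :: 'g set)"
begin

lemma cov_pairs_norm_transfer:
  fixes \<rho> :: "'x \<Rightarrow> 'k op" and U :: "'g \<Rightarrow> 'k op" and \<iota> :: "nat \<Rightarrow> 'j"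
  assumes \<rho>: "(\<rho>, U) \<in> cov_pairs" and \<iota>: "inj \<iota>" and C: "0 \<le> C"
    and le: "\<And>(\<rho>' :: 'x \<Rightarrow> 'j op) U'. (\<rho>', U') \<in> cov_pairs \<Longrightarrow> norm (lcomb op_algebra (pair_op \<rho>' U') l) \<le> C"
  shows "norm (lcomb op_algebra (pair_op \<rho> U) l) \<le> C"
proof (rule norm_blinfun_bound[OF C])
  fix v
  note c = cov_pairsD[OF \<rho>]
  note r = meet_repsD[OF c(1)] and u = unitary_repsD[OF c(2)]
  let ?T = "range \<rho> \<union> range U"
  obtain W :: "'k ell2 \<Rightarrow>\<^sub>L 'j ell2" where W: "clin W" "adj W (W v) = v" "W o\<^sub>L adj W o\<^sub>L W = W"
    "\<And>T. T \<in> ?T \<Longrightarrow> adj W o\<^sub>L W o\<^sub>L T = T o\<^sub>L adj W o\<^sub>L W"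
    by (rule countable_compression[of ?T \<iota> v]) (use countable_X countable_G r u \<iota> in auto)
  \<comment> \<open>The range of \<open>W\<close> may be a proper subspace. Adding the projection
    onto its complement makes the compressed unitaries unitary again, while the compressed \<rho>
    vanishes there.\<close>
  let ?Q = "id_blinfun - (W o\<^sub>L adj W)"
  have W3: "adj W o\<^sub>L W o\<^sub>L adj W = adj W"
    using arg_cong[OF W(3), of adj] W(1) by (simp add: blinfun_compose_assoc)
  have QW: "?Q o\<^sub>L W = 0" "adj W o\<^sub>L ?Q = 0" "?Q o\<^sub>L ?Q = ?Q"
    using W(3) W3 by (simp_all add: blinfun_compose_add flip: blinfun_compose_assoc)
  define \<rho>' where "\<rho>' x = W o\<^sub>L \<rho> x o\<^sub>L adj W" for x
  define V where "V g = W o\<^sub>L U g o\<^sub>L adj W" for g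
  define U' where "U' g = V g + ?Q" for g
  have QV: "?Q o\<^sub>L V g = 0" "V g o\<^sub>L ?Q = 0" "?Q o\<^sub>L \<rho>' x = 0" "\<rho>' x o\<^sub>L ?Q = 0" for g x
    unfolding V_def \<rho>'_def using QW(1,2)
    by (simp_all add: blinfun_compose_assoc, simp_all flip: blinfun_compose_assoc)
  have comp: "(W o\<^sub>L S o\<^sub>L adj W) o\<^sub>L (W o\<^sub>L T o\<^sub>L adj W) = W o\<^sub>L (S o\<^sub>L T) o\<^sub>L adj W" if "S \<in> ?T" for S T
    using compress_comp[OF W(3,4) that] .
  have "U' \<in> unitary_reps"
    unfolding unitary_reps_iff
  proof (intro conjI allI)
    show "clin (U' g)" for g using W(1) u(1) by (simp add: U'_def V_def)
    show "U' 0 = id_blinfun" by (simp add: U'_def V_def u(2))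
    show "U' (g + h) = U' g o\<^sub>L U' h" for g h
    proof -
      have "V (g + h) = V g o\<^sub>L V h" unfolding V_def u(3) by (rule comp[symmetric]) auto
      then show ?thesis by (simp add: U'_def blinfun_compose_add(1,2) QV QW(3))
    qed
    show "adj (U' g) = U' (- g)" for g
      using W(1) u by (simp add: U'_def V_def blinfun_compose_assoc)
  qed
  moreover have "\<rho>' \<in> semigroup_reps meet_semigroup"
    unfolding meet_reps_iff \<rho>'_def using W(1) r comp by (auto simp: blinfun_compose_assoc)
  moreover have "U' g o\<^sub>L \<rho>' x o\<^sub>L U' (- g) = \<rho>' (act g x)" for g x
  proof -
    have "U' g o\<^sub>L \<rho>' x o\<^sub>L U' (- g) = V g o\<^sub>L \<rho>' x o\<^sub>L V (- g)"
      by (simp add: U'_def blinfun_compose_add(1,2) QV) (simp add: blinfun_compose_assoc QV)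
    also have "\<dots> = V g o\<^sub>L (\<rho>' x o\<^sub>L V (- g))" by (rule blinfun_compose_assoc)
    also have "\<rho>' x o\<^sub>L V (- g) = W o\<^sub>L (\<rho> x o\<^sub>L U (- g)) o\<^sub>L adj W"
      unfolding V_def \<rho>'_def by (rule comp) auto
    also have "V g o\<^sub>L \<dots> = W o\<^sub>L (U g o\<^sub>L (\<rho> x o\<^sub>L U (- g))) o\<^sub>L adj W"
      unfolding V_def by (rule comp) auto
    also have "U g o\<^sub>L (\<rho> x o\<^sub>L U (- g)) = U g o\<^sub>L \<rho> x o\<^sub>L U (- g)" by (rule blinfun_compose_assoc[symmetric])
    finally show ?thesis unfolding c(3) \<rho>'_def .
  qed
  ultimately have cov: "(\<rho>', U') \<in> cov_pairs" by (simp add: cov_pairs_def)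
  have one: "pair_op \<rho>' U' m (W v) = W (pair_op \<rho> U m v) \<and> adj W (W (pair_op \<rho> U m v)) = pair_op \<rho> U m v" for m
  proof -
    have Qv: "?Q (W v) = 0" using arg_cong[OF QW(1), of "\<lambda>T. T v"] by simp
    have 1: "adj W (W (U g v)) = U g v" "V g (W v) = W (U g v)" for g
      unfolding V_def using compress_apply[OF W(1,4) _ W(2), where T = "U g" and \<T> = ?T] by simp_all
    have 2: "adj W (W (\<rho> x (U g v))) = \<rho> x (U g v)" "\<rho>' x (W (U g v)) = W (\<rho> x (U g v))" for x g
      unfolding \<rho>'_def using compress_apply[OF W(1,4) _ 1(1), where T = "\<rho> x" and \<T> = ?T] by simp_all
    show ?thesis using 1 2 Qv by (simp add: pair_op_def U'_def blinfun.add_left del: blinfun.diff_left)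
  qed
  have "lcomb op_algebra (pair_op \<rho>' U') l (W v) = W (lcomb op_algebra (pair_op \<rho> U) l v) \<and>
      adj W (W (lcomb op_algebra (pair_op \<rho> U) l v)) = lcomb op_algebra (pair_op \<rho> U) l v"
    by (induction l) (auto simp: one blinfun.add_left blinfun.add_right clinD W(1) pair_op[OF \<rho>] pair_op[OF cov])
  then have "norm (lcomb op_algebra (pair_op \<rho> U) l v) \<le> norm (lcomb op_algebra (pair_op \<rho>' U') l) * norm (W v)"
    using norm_compress[OF W(1)] norm_blinfun by metis
  also have "\<dots> \<le> C * norm v"
    using le[OF cov] norm_compress[OF W(1,2)] by (simp add: mult_right_mono)
  finally show "norm (lcomb op_algebra (pair_op \<rho> U) l v) \<le> C * norm v" .
qed

end

section \<open>Crossed products by groups acting on semilattices\<close>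

lemma star_reps_iff: "\<pi> \<in> star_reps A \<longleftrightarrow> star_hom A op_algebra \<pi>"
  by (auto simp: star_reps_def star_hom_def clinear_op_clin op_adj_adj)

lemma star_isomorphicI:
  assumes "cstar_algebra A" "cstar_algebra B" "star_hom A B \<phi>" "bij_betw \<phi> (elems A) (elems B)"
  shows "star_isomorphic A B"
  using assms unfolding star_isomorphic_def star_hom_def by blast

lemma (in comb_pair) generated_star_isomorphic:
  assumes "\<And>l. l \<in> combs M \<Longrightarrow> snorm B (lcomb B w l) = snorm A (lcomb A u l)"
  shows "star_isomorphic (cstar_generated A (u ` M)) (cstar_generated B (w ` M))"
  by (rule generated_iso[OF assms])
    (assumption, rule star_isomorphicI[OF A.cstar_algebra_generated B.cstar_algebra_generated])

lemma elems_generated_subset: "elems (cstar_generated A T) \<subseteq> elems A"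
  by (auto simp: cstar_generated_def)

context cstar_algebra
begin

lemma op_map_vanish:
  fixes F :: "'a \<Rightarrow> 'k op"
  assumes F: "\<And>x. x \<in> elems A \<Longrightarrow> clin (F x)"
      "\<And>x y. x \<in> elems A \<Longrightarrow> y \<in> elems A \<Longrightarrow> F (splus A x y) = F x + F y"
      "\<And>c x. x \<in> elems A \<Longrightarrow> F (sscale A c x) = op_scale c (F x)"
      "\<And>x. x \<in> elems A \<Longrightarrow> norm (F x) \<le> K * snorm A x"
    and T: "\<And>t. t \<in> T \<Longrightarrow> F t = 0" "T \<subseteq> elems A" and x: "x \<in> cspan T"
  shows "F x = 0"
proof -
  interpret O: cstar_algebra "op_algebra :: 'k op star_algebra" by (rule cstar_algebra_op_algebra)
  have "closed_subspace (op_algebra :: 'k op star_algebra) {0}"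
  proof (rule O.closed_subspaceI)
    show "l \<in> {0}" if "\<And>n. f n \<in> {0}" "O.converges f l" for f :: "nat \<Rightarrow> 'k op" and l
    proof -
      have "f = (\<lambda>_. 0)" using that(1) by auto
      then show ?thesis using O.converges_unique[OF that(2)] O.converges_const[of 0] by auto
    qed
  qed (auto simp: op_scale_0)
  then have "closed_subspace A {x \<in> elems A. F x \<in> {0}}"
    by (rule O.closed_subspace_preimage[OF _ closed_subspace_elems cstar_algebra_axioms, where K = K])
      (use F in auto)
  then have "cspan T \<subseteq> {x \<in> elems A. F x \<in> {0}}" by (rule cspan_least) (use T in auto)
  then show ?thesis using x by auto
qed

lemma cstar_generated_eqI:
  assumes "T \<subseteq> T'" "T' \<subseteq> elems (cstar_generated A T)"
  shows "cstar_generated A T' = cstar_generated A T"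
proof -
  have "elems (cstar_generated A T') \<subseteq> elems (cstar_generated A T)"
    by (rule generated_least[OF closed_star_subalgebra_generated assms(2)])
  moreover have "elems (cstar_generated A T) \<subseteq> elems (cstar_generated A T')"
    using assms(1) by (auto simp: cstar_generated_def)
  ultimately have "elems (cstar_generated A T') = elems (cstar_generated A T)" by blast
  then show ?thesis by (simp add: cstar_generated_def)
qed

text \<open>The crossed products are generated by terms with arbitrary coefficients
  \<open>a\<close>; linearity and boundedness in \<open>a\<close> reduce these to coefficients from
  a spanning set.\<close>

lemma generated_from_spanning_set:
  fixes F :: "'c \<Rightarrow> 'g \<Rightarrow> 'a" and B :: "'c star_algebra"
  assumes B: "cstar_algebra B" and e: "e ` UNIV \<subseteq> elems B" "elems B \<subseteq> cstar_algebra.cspan B (range e)"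
    and F: "\<And>g x. x \<in> elems B \<Longrightarrow> F x g \<in> elems A"
      "\<And>g x y. x \<in> elems B \<Longrightarrow> y \<in> elems B \<Longrightarrow> F (splus B x y) g = splus A (F x g) (F y g)"
      "\<And>g c x. x \<in> elems B \<Longrightarrow> F (sscale B c x) g = sscale A c (F x g)"
      "\<And>g x. x \<in> elems B \<Longrightarrow> snorm A (F x g) \<le> snorm B x"
  shows "cstar_generated A {F a g | a g. a \<in> elems B} = cstar_generated A (range (\<lambda>m. F (e (fst m)) (snd m)))"
proof (rule cstar_generated_eqI)
  interpret B: cstar_algebra B by fact
  let ?T = "range (\<lambda>m. F (e (fst m)) (snd m))"
  show "?T \<subseteq> {F a g | a g. a \<in> elems B}" using e by auto
  have TA: "?T \<subseteq> elems A" using e F(1) by auto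
  show "{F a g | a g. a \<in> elems B} \<subseteq> elems (cstar_generated A ?T)"
  proof safe
    fix a g assume a: "a \<in> elems B"
    let ?C = "elems (cstar_generated A ?T)"
    have C: "closed_subspace A ?C" by (rule closed_star_subalgebraD(1)[OF closed_star_subalgebra_generated])
    have "closed_subspace B {x \<in> elems B. F x g \<in> ?C}"
      by (rule closed_subspace_preimage[OF C B.closed_subspace_elems B, where K = 1]) (use F in auto)
    moreover have "range e \<subseteq> {x \<in> elems B. F x g \<in> ?C}"
    proof safe
      fix x
      show "e x \<in> elems B" using e by auto
      have "F (e (fst (x, g))) (snd (x, g)) \<in> ?T" by (rule rangeI)
      then show "F (e x) g \<in> ?C" using generated_superset[OF TA] by auto
    qed
    ultimately have "B.cspan (range e) \<subseteq> {x \<in> elems B. F x g \<in> ?C}" by (rule B.cspan_least)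
    then show "F a g \<in> ?C" using a e(2) by blast
  qed
qed

end

lemma family_on_op_family:
  assumes "\<And>\<rho>. \<rho> \<in> R \<Longrightarrow> clin (f \<rho>)" "\<And>\<rho>. \<rho> \<in> R \<Longrightarrow> norm (f \<rho>) \<le> C" "0 \<le> C"
  shows "family_on R f \<in> elems (op_family_algebra R)" "snorm (op_family_algebra R) (family_on R f) \<le> C"
  using assms by (auto simp: family_on_def intro!: op_family_memI[where C = C] op_family_norm_le)

text \<open>Norms are compared through their upper bounds \<open>C\<close>. This turns the supremum
  over representations into a quantifier, which can be moved from one set of representations to
  another.\<close>

lemma lcomb_family_norm_le_iff:
  assumes "\<And>m. m \<in> M \<Longrightarrow> family_on R (f m) \<in> elems (op_family_algebra R)" "l \<in> combs M" "0 \<le> C"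
  shows "snorm (op_family_algebra R) (lcomb (op_family_algebra R) (\<lambda>m. family_on R (f m)) l) \<le> C \<longleftrightarrow>
    (\<forall>\<rho>\<in>R. norm (lcomb op_algebra (\<lambda>m. f m \<rho>) l) \<le> C)"
proof -
  interpret cstar_algebra "op_family_algebra R" by (rule cstar_algebra_op_family)
  have "lcomb (op_family_algebra R) (\<lambda>m. family_on R (f m)) l \<in> elems (op_family_algebra R)"
    by (rule lcomb_closed[OF assms(1,2)])
  then have "snorm (op_family_algebra R) (lcomb (op_family_algebra R) (\<lambda>m. family_on R (f m)) l) \<le> C \<longleftrightarrow>
      (\<forall>\<rho>. norm (lcomb op_algebra (\<lambda>m. family_on R (f m) \<rho>) l) \<le> C)"
    by (simp add: op_family_norm_le_iff lcomb_op_family)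
  moreover have "lcomb op_algebra (\<lambda>m. family_on R (f m) \<rho>) l = (if \<rho> \<in> R then lcomb op_algebra (\<lambda>m. f m \<rho>) l else 0)" for \<rho>
    by (induction l) (auto simp: family_on_def op_scale_0)
  ultimately show ?thesis using assms(3) by auto
qed

text \<open>Common abstraction of the universal algebra of \<open>X\<close> and of the functions on
  its character space. The essential axiom is \<open>character_le\<close>: combined with
  \<open>rep_le_characters\<close>, it makes every representation of \<open>X\<close> extend to
  \<open>A\<close>.\<close>

locale semilattice_algebra = semilattice_action act + A: cstar_algebra A
  for act :: "'g::group_add \<Rightarrow> 'x::order \<Rightarrow> 'x" and A :: "'a star_algebra" +
  fixes e :: "'x \<Rightarrow> 'a" and \<alpha> :: "'g \<Rightarrow> 'a \<Rightarrow> 'a"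
  assumes e_elems: "e x \<in> elems A" and e_meet: "e (meet x y) = smult A (e x) (e y)"
    and e_star: "sstar A (e x) = e x" and e_span: "elems A \<subseteq> A.cspan (range e)"
    and character_le: "cmod (character_value t l) \<le> snorm A (lcomb A e l)"
    and \<alpha>_hom: "star_hom A A (\<alpha> g)" and \<alpha>_norm: "a \<in> elems A \<Longrightarrow> snorm A (\<alpha> g a) \<le> snorm A a"
    and \<alpha>_e: "\<alpha> g (e x) = e (act g x)"
begin

lemma star_rep_restrict:
  assumes "\<pi> \<in> star_reps A"
  shows "(\<lambda>x. \<pi> (e x)) \<in> semigroup_reps meet_semigroup"
  unfolding meet_reps_iff
  using star_homD(1,4,5)[OF assms[unfolded star_reps_iff] e_elems] e_elems
  by (auto simp: e_meet e_star)

lemma star_rep_extend: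
  assumes \<rho>: "\<rho> \<in> semigroup_reps (meet_semigroup :: 'x semigrp)"
  shows "\<exists>\<pi>\<in>star_reps A. \<forall>x. \<pi> (e x) = \<rho> x"
proof -
  note r = meet_repsD[OF \<rho>]
  interpret P: comb_pair A op_algebra e \<rho> UNIV meet "\<lambda>x. x"
    using A.cstar_algebra_axioms cstar_algebra_op_algebra
    by (intro comb_pair.intro comb_pair_axioms.intro) (simp_all add: e_elems e_meet e_star r)
  obtain \<phi> where \<phi>: "star_hom (cstar_generated A (range e)) (cstar_generated op_algebra (range \<rho>)) \<phi>"
    "\<And>x. \<phi> (e x) = \<rho> x"
  proof (rule P.generated_hom)
    show "snorm op_algebra (lcomb op_algebra \<rho> l) \<le> snorm A (lcomb A e l)" for l
      using rep_le_characters[OF \<rho> character_le] by simp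
  qed auto
  have "elems (cstar_generated A (range e)) = elems A"
    using P.generated_elems(1) e_span A.cspan_subset by blast
  then have "star_hom A op_algebra \<phi>"
    using \<phi>(1) elems_generated_subset[of op_algebra "range \<rho>"] unfolding star_hom_def by (auto simp: subset_iff)
  then show ?thesis using \<phi>(2) star_reps_iff by blast
qed

lemma covariant_restrict:
  assumes "(\<pi>, U) \<in> covariant_reps A \<alpha>"
  shows "(\<lambda>x. \<pi> (e x), U) \<in> cov_pairs" "\<pi> \<in> star_reps A" "U \<in> unitary_reps"
proof -
  have c: "\<pi> \<in> star_reps A" "U \<in> unitary_reps" "\<And>g a. a \<in> elems A \<Longrightarrow> U g o\<^sub>L \<pi> a o\<^sub>L adj (U g) = \<pi> (\<alpha> g a)"
    using assms by (auto simp: covariant_reps_def op_adj_adj)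
  show "\<pi> \<in> star_reps A" "U \<in> unitary_reps" by fact+
  show "(\<lambda>x. \<pi> (e x), U) \<in> cov_pairs"
    using star_rep_restrict[OF c(1)] c(2) c(3)[OF e_elems] unitary_repsD(4)[OF c(2)]
    by (simp add: cov_pairs_def \<alpha>_e)
qed

lemma covariant_extend:
  assumes "(\<rho>, U) \<in> cov_pairs"
  shows "\<exists>\<pi>. (\<pi>, U) \<in> covariant_reps A \<alpha> \<and> (\<lambda>x. \<pi> (e x)) = \<rho>"
proof -
  note c = cov_pairsD[OF assms] note u = unitary_repsD[OF c(2)]
  obtain \<pi> where \<pi>: "\<pi> \<in> star_reps A" "\<And>x. \<pi> (e x) = \<rho> x"
    using star_rep_extend[OF c(1)] by blast
  have h: "star_hom A op_algebra \<pi>" using \<pi> star_reps_iff by blast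
  note \<pi>h = star_homD[OF h, simplified] note ah = star_homD[OF \<alpha>_hom]
  have "U g o\<^sub>L \<pi> a o\<^sub>L U (- g) = \<pi> (\<alpha> g a)" if a: "a \<in> elems A" for g a
  proof -
    \<comment> \<open>Both sides of the covariance relation are linear in \<open>a\<close> and
      contractive, so their difference has bound 2 and vanishes as soon as it vanishes on the
      generators.\<close>
    have "(U g o\<^sub>L \<pi> a o\<^sub>L U (- g)) - \<pi> (\<alpha> g a) = 0"
    proof (rule A.op_map_vanish[where F = "\<lambda>a. (U g o\<^sub>L \<pi> a o\<^sub>L U (- g)) - \<pi> (\<alpha> g a)" and x = a
          and T = "range e" and K = 2])
      fix x assume x: "x \<in> elems A"
      have "norm (U g o\<^sub>L \<pi> x o\<^sub>L U (- g)) \<le> norm (U g) * norm (\<pi> x) * norm (U (- g))"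
        by (intro order_trans[OF norm_blinfun_compose] mult_right_mono norm_blinfun_compose) auto
      also have "\<dots> \<le> 1 * norm (\<pi> x) * 1" using u(7) by (intro mult_mono) auto
      finally show "norm ((U g o\<^sub>L \<pi> x o\<^sub>L U (- g)) - \<pi> (\<alpha> g x)) \<le> 2 * snorm A x"
        using A.star_hom_contractive[OF h x] A.star_hom_contractive[OF h ah(1)[OF x], of g] \<alpha>_norm[OF x, of g]
          norm_triangle_ineq4[of "U g o\<^sub>L \<pi> x o\<^sub>L U (- g)" "\<pi> (\<alpha> g x)"] by linarith
    qed (use a e_span in \<open>auto simp: \<pi>h ah u e_elems \<alpha>_e \<pi>(2) c(3) blinfun_compose_add op_scale_binary\<close>,
      auto intro!: blinfun_eqI simp: blinfun.diff_left cscale_diff \<pi>h ah u)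
    then show ?thesis by simp
  qed
  then have "(\<pi>, U) \<in> covariant_reps A \<alpha>"
    using \<pi>(1) c(2) u(4) by (simp add: covariant_reps_def op_adj_adj)
  then show ?thesis using \<pi>(2) by (auto simp: fun_eq_iff)
qed

section \<open>Generators and norms of the crossed products\<close>

definition crossed_gen :: "'x \<times> 'g \<Rightarrow> (('a \<Rightarrow> ('a \<times> 'g \<times> nat) op) \<times> ('g \<Rightarrow> ('a \<times> 'g \<times> nat) op)) \<Rightarrow> ('a \<times> 'g \<times> nat) op" where
  "crossed_gen m = family_on (covariant_reps A \<alpha>) (\<lambda>(\<pi>, U). \<pi> (e (fst m)) o\<^sub>L U (snd m))"

definition reduced_gen :: "'x \<times> 'g \<Rightarrow> ('a \<Rightarrow> ('a \<times> nat) op) \<Rightarrow> ('g \<times> 'a \<times> nat) op" where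
  "reduced_gen m = family_on (star_reps A) (\<lambda>\<pi>. induced_rep \<alpha> \<pi> (e (fst m)) o\<^sub>L left_translation (snd m))"

lemma crossed_product_generated:
  "crossed_product A \<alpha> = cstar_generated (op_family_algebra (covariant_reps A \<alpha>)) (range crossed_gen)"
proof -
  let ?R = "covariant_reps A \<alpha> :: (('a \<Rightarrow> ('a \<times> 'g \<times> nat) op) \<times> ('g \<Rightarrow> ('a \<times> 'g \<times> nat) op)) set"
  interpret F: cstar_algebra "op_family_algebra ?R" by (rule cstar_algebra_op_family)
  let ?F = "\<lambda>a g. family_on ?R (\<lambda>(\<pi>, U). \<pi> a o\<^sub>L U g)"
  have 1: "clin (\<pi> x o\<^sub>L U g)" "norm (\<pi> x o\<^sub>L U g) \<le> snorm A x" if "(\<pi>, U) \<in> ?R" "x \<in> elems A" for \<pi> U x g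
  proof -
    note c = covariant_restrict[OF that(1)]
    have h: "star_hom A op_algebra \<pi>" using c star_reps_iff by blast
    show "clin (\<pi> x o\<^sub>L U g)" using star_homD(1)[OF h that(2)] unitary_repsD(1)[OF c(3)] by simp
    have "norm (\<pi> x o\<^sub>L U g) \<le> norm (\<pi> x) * norm (U g)" by (rule norm_blinfun_compose)
    also have "\<dots> \<le> snorm A x * 1"
      using A.star_hom_contractive[OF h that(2)] unitary_repsD(7)[OF c(3)] A.norm_nonneg[OF that(2)]
      by (intro mult_mono) auto
    finally show "norm (\<pi> x o\<^sub>L U g) \<le> snorm A x" by simp
  qed
  have 2: "?F x g \<in> elems (op_family_algebra ?R)" "snorm (op_family_algebra ?R) (?F x g) \<le> snorm A x"
    if "x \<in> elems A" for x g
  proof -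
    have 1: "clin ((\<lambda>(\<pi>, U). \<pi> x o\<^sub>L U g) r)" "norm ((\<lambda>(\<pi>, U). \<pi> x o\<^sub>L U g) r) \<le> snorm A x" if "r \<in> ?R" for r
      using 1[of "fst r" "snd r" x g] that \<open>x \<in> elems A\<close> by (simp_all add: case_prod_unfold)
    show "?F x g \<in> elems (op_family_algebra ?R)" "snorm (op_family_algebra ?R) (?F x g) \<le> snorm A x"
      using family_on_op_family[of ?R "\<lambda>(\<pi>, U). \<pi> x o\<^sub>L U g" "snorm A x"] 1 A.norm_nonneg[OF that] by blast+
  qed
  have "cstar_generated (op_family_algebra ?R) {?F a g |a g. a \<in> elems A}
      = cstar_generated (op_family_algebra ?R) (range (\<lambda>m. ?F (e (fst m)) (snd m)))"
  proof (rule F.generated_from_spanning_set[OF A.cstar_algebra_axioms _ e_span])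
    fix g x y assume x: "x \<in> elems A" and y: "y \<in> elems A"
    have *: "\<pi> (splus A x y) = \<pi> x + \<pi> y" if "(\<pi>, U) \<in> ?R" for \<pi> U
      using star_homD(2)[OF covariant_restrict(2)[OF that, unfolded star_reps_iff] x y] by simp
    show "?F (splus A x y) g = splus (op_family_algebra ?R) (?F x g) (?F y g)"
    proof
      fix r
      show "?F (splus A x y) g r = splus (op_family_algebra ?R) (?F x g) (?F y g) r"
        using *[of "fst r" "snd r"] by (cases r) (simp add: family_on_def blinfun_compose_add)
    qed
  next
    fix g c x assume x: "x \<in> elems A"
    have *: "\<pi> (sscale A c x) = op_scale c (\<pi> x) \<and> clin (\<pi> x) \<and> clin (U g)" if "(\<pi>, U) \<in> ?R" for \<pi> U
      using star_homD(1,3)[OF covariant_restrict(2)[OF that, unfolded star_reps_iff] x]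
        unitary_repsD(1)[OF covariant_restrict(3)[OF that]] by simp
    show "?F (sscale A c x) g = sscale (op_family_algebra ?R) c (?F x g)"
    proof
      fix r
      show "?F (sscale A c x) g r = sscale (op_family_algebra ?R) c (?F x g) r"
        using *[of "fst r" "snd r"] by (cases r) (simp add: family_on_def op_scale_binary op_scale_0)
    qed
  qed (use 2 e_elems in auto)
  then show ?thesis unfolding crossed_product_def crossed_gen_def[abs_def] .
qed

lemma crossed_gen_pair_op:
  "(\<pi>, U) \<in> covariant_reps A \<alpha> \<Longrightarrow> crossed_gen m (\<pi>, U) = pair_op (\<lambda>x. \<pi> (e x)) U m"
  by (simp add: crossed_gen_def family_on_def pair_op_def)

lemma crossed_gen:
  shows "crossed_gen m \<in> elems (op_family_algebra (covariant_reps A \<alpha>))"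
    and "crossed_gen (pair_mul m n) = smult (op_family_algebra (covariant_reps A \<alpha>)) (crossed_gen m) (crossed_gen n)"
    and "crossed_gen (pair_inv m) = sstar (op_family_algebra (covariant_reps A \<alpha>)) (crossed_gen m)"
proof -
  note p = pair_op[OF covariant_restrict(1)]
  have z: "crossed_gen m \<rho> = 0" if "\<rho> \<notin> covariant_reps A \<alpha>" for m \<rho>
    using that by (simp add: crossed_gen_def family_on_def)
  have eq: "crossed_gen m \<rho> = pair_op (\<lambda>x. fst \<rho> (e x)) (snd \<rho>) m" if "\<rho> \<in> covariant_reps A \<alpha>" for m \<rho>
    using crossed_gen_pair_op[of "fst \<rho>" "snd \<rho>"] that by simp
  have p': "clin (crossed_gen m \<rho>)" "norm (crossed_gen m \<rho>) \<le> 1"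
    "crossed_gen (pair_mul m n) \<rho> = crossed_gen m \<rho> o\<^sub>L crossed_gen n \<rho>"
    "crossed_gen (pair_inv m) \<rho> = adj (crossed_gen m \<rho>)" for m n \<rho>
    using p[of "fst \<rho>" "snd \<rho>"] eq[of \<rho>] z[of \<rho>] by (cases "\<rho> \<in> covariant_reps A \<alpha>"; simp)+
  show "crossed_gen m \<in> elems (op_family_algebra (covariant_reps A \<alpha>))"
    by (rule op_family_memI[where C = 1]) (use p' z in auto)
  show "crossed_gen (pair_mul m n) = smult (op_family_algebra (covariant_reps A \<alpha>)) (crossed_gen m) (crossed_gen n)"
    "crossed_gen (pair_inv m) = sstar (op_family_algebra (covariant_reps A \<alpha>)) (crossed_gen m)"
    by (simp_all add: fun_eq_iff p')
qed

text \<open>Restricting to the generators and extending back eliminates \<open>A\<close>; only its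
  type survives, in the index type of the Hilbert spaces.\<close>

lemma crossed_gen_norm_le_iff:
  assumes "0 \<le> C"
  shows "snorm (op_family_algebra (covariant_reps A \<alpha>)) (lcomb (op_family_algebra (covariant_reps A \<alpha>)) crossed_gen l) \<le> C \<longleftrightarrow>
    (\<forall>\<rho> U. (\<rho>, U) \<in> (cov_pairs :: (('x \<Rightarrow> ('a \<times> 'g \<times> nat) op) \<times> _) set) \<longrightarrow> norm (lcomb op_algebra (pair_op \<rho> U) l) \<le> C)"
proof -
  have "snorm (op_family_algebra (covariant_reps A \<alpha>)) (lcomb (op_family_algebra (covariant_reps A \<alpha>)) crossed_gen l) \<le> C \<longleftrightarrow>
      (\<forall>r\<in>(covariant_reps A \<alpha> :: (('a \<Rightarrow> ('a \<times> 'g \<times> nat) op) \<times> _) set). norm (lcomb op_algebra (\<lambda>m. (\<lambda>(\<pi>, U). \<pi> (e (fst m)) o\<^sub>L U (snd m)) r) l) \<le> C)"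
    unfolding crossed_gen_def[abs_def]
    by (rule lcomb_family_norm_le_iff[where M = UNIV and f = "\<lambda>m (\<pi>, U). \<pi> (e (fst m)) o\<^sub>L U (snd m)"]) (use crossed_gen(1)[unfolded crossed_gen_def] assms in auto)
  also have "\<dots> \<longleftrightarrow> (\<forall>(\<pi> :: 'a \<Rightarrow> ('a \<times> 'g \<times> nat) op) U. (\<pi>, U) \<in> covariant_reps A \<alpha> \<longrightarrow> norm (lcomb op_algebra (pair_op (\<lambda>x. \<pi> (e x)) U) l) \<le> C)"
    by (auto simp: pair_op_def[abs_def])
  also have "\<dots> \<longleftrightarrow> (\<forall>(\<rho> :: 'x \<Rightarrow> ('a \<times> 'g \<times> nat) op) U. (\<rho>, U) \<in> cov_pairs \<longrightarrow> norm (lcomb op_algebra (pair_op \<rho> U) l) \<le> C)"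
    using covariant_restrict(1) covariant_extend by blast
  finally show ?thesis .
qed

lemma induced_rep_diag: "induced_rep \<alpha> \<pi> a = diag_op (\<lambda>h. \<pi> (\<alpha> (- h) a))"
  by (simp add: induced_rep_def diag_op_def)

lemma reduced_gen_induced_op:
  "\<pi> \<in> star_reps A \<Longrightarrow> reduced_gen m \<pi> = induced_op (\<lambda>x. \<pi> (e x)) m"
  by (simp add: reduced_gen_def family_on_def induced_op_def induced_rep_diag \<alpha>_e)

lemma reduced_crossed_product_generated:
  "reduced_crossed_product A \<alpha> = cstar_generated (op_family_algebra (star_reps A)) (range reduced_gen)"
proof -
  let ?R = "star_reps A :: ('a \<Rightarrow> ('a \<times> nat) op) set"
  interpret F: cstar_algebra "op_family_algebra ?R :: (_ \<Rightarrow> ('g \<times> 'a \<times> nat) op) star_algebra" by (rule cstar_algebra_op_family)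
  let ?F = "\<lambda>a g. family_on ?R (\<lambda>\<pi>. induced_rep \<alpha> \<pi> a o\<^sub>L left_translation g)"
  note ah = star_homD[OF \<alpha>_hom]
  have 0: "clin (\<pi> (\<alpha> (- h) x))" "norm (\<pi> (\<alpha> (- h) x)) \<le> snorm A x" if "\<pi> \<in> ?R" "x \<in> elems A" for \<pi> x h
    using star_homD(1)[OF that(1)[unfolded star_reps_iff] ah(1)[OF that(2)]]
      A.star_hom_contractive[OF that(1)[unfolded star_reps_iff] ah(1)[OF that(2)], of "- h"]
      \<alpha>_norm[OF that(2), of "- h"] by auto
  have sl: "ell2_slice (induced_rep \<alpha> \<pi> x \<xi>) h = \<pi> (\<alpha> (- h) x) (ell2_slice \<xi> h)"
    and cl: "clin (induced_rep \<alpha> \<pi> x)" and nl: "norm (induced_rep \<alpha> \<pi> x) \<le> snorm A x"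
    if "\<pi> \<in> ?R" "x \<in> elems A" for \<pi> x \<xi> h
    unfolding induced_rep_diag
    by (rule slice_diag_op[of "\<lambda>h. \<pi> (\<alpha> (- h) x)"] clin_diag_op[of "\<lambda>h. \<pi> (\<alpha> (- h) x)"]
        norm_diag_op[of "\<lambda>h. \<pi> (\<alpha> (- h) x)"]; rule 0[OF that])+
  have 1: "clin (induced_rep \<alpha> \<pi> x o\<^sub>L left_translation g)" "norm (induced_rep \<alpha> \<pi> x o\<^sub>L left_translation g) \<le> snorm A x"
    if "\<pi> \<in> ?R" "x \<in> elems A" for \<pi> x g
  proof -
    show "clin (induced_rep \<alpha> \<pi> x o\<^sub>L left_translation g)" using cl[OF that] by simp
    have "norm (induced_rep \<alpha> \<pi> x o\<^sub>L left_translation g) \<le> norm (induced_rep \<alpha> \<pi> x) * norm (left_translation g :: ('g \<times> 'a \<times> nat) op)"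
      by (rule norm_blinfun_compose)
    also have "\<dots> \<le> snorm A x * 1"
      using nl[OF that] norm_left_translation A.norm_nonneg[OF that(2)] by (intro mult_mono) auto
    finally show "norm (induced_rep \<alpha> \<pi> x o\<^sub>L left_translation g) \<le> snorm A x" by simp
  qed
  have 2: "?F x g \<in> elems (op_family_algebra ?R)" "snorm (op_family_algebra ?R) (?F x g) \<le> snorm A x"
    if "x \<in> elems A" for x g
    by (rule family_on_op_family[OF 1(1)[OF _ that] 1(2)[OF _ that] A.norm_nonneg[OF that]]; assumption)+
  have "cstar_generated (op_family_algebra ?R) {?F a g |a g. a \<in> elems A}
      = cstar_generated (op_family_algebra ?R) (range (\<lambda>m. ?F (e (fst m)) (snd m)))"
  proof (rule F.generated_from_spanning_set[OF A.cstar_algebra_axioms _ e_span])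
    fix g x y assume x: "x \<in> elems A" and y: "y \<in> elems A"
    have "induced_rep \<alpha> \<pi> (splus A x y) = induced_rep \<alpha> \<pi> x + induced_rep \<alpha> \<pi> y" if "\<pi> \<in> ?R" for \<pi>
      using star_homD(2)[OF that[unfolded star_reps_iff] ah(1)[OF x] ah(1)[OF y]]
      by (intro blinfun_eqI slices_eqI) (simp add: blinfun.add_left sl[OF that] x y A.closed_ops ah(2))
    then show "?F (splus A x y) g = splus (op_family_algebra ?R) (?F x g) (?F y g)"
      by (auto simp: family_on_def fun_eq_iff blinfun_compose_add)
  next
    fix g c x assume x: "x \<in> elems A"
    have "induced_rep \<alpha> \<pi> (sscale A c x) = op_scale c (induced_rep \<alpha> \<pi> x)" if "\<pi> \<in> ?R" for \<pi>
      using star_homD(3)[OF that[unfolded star_reps_iff] ah(1)[OF x]]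
      by (intro blinfun_eqI slices_eqI) (simp add: sl[OF that] x A.closed_ops ah(3)[OF x] cl[OF that] 0[OF that])
    then show "?F (sscale A c x) g = sscale (op_family_algebra ?R) c (?F x g)"
      using cl x by (auto simp: family_on_def fun_eq_iff op_scale_binary op_scale_0)
  qed (use 2 e_elems in auto)
  then show ?thesis unfolding reduced_crossed_product_def reduced_gen_def[abs_def] .
qed

lemma reduced_gen:
  shows "reduced_gen m \<in> elems (op_family_algebra (star_reps A))"
    and "reduced_gen (pair_mul m n) = smult (op_family_algebra (star_reps A)) (reduced_gen m) (reduced_gen n)"
    and "reduced_gen (pair_inv m) = sstar (op_family_algebra (star_reps A)) (reduced_gen m)"
proof -
  have z: "reduced_gen m \<rho> = 0" if "\<rho> \<notin> star_reps A" for m \<rho>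
    using that by (simp add: reduced_gen_def family_on_def)
  have p: "clin (reduced_gen m \<rho>)" "norm (reduced_gen m \<rho>) \<le> 1"
    "reduced_gen (pair_mul m n) \<rho> = reduced_gen m \<rho> o\<^sub>L reduced_gen n \<rho>"
    "reduced_gen (pair_inv m) \<rho> = adj (reduced_gen m \<rho>)" if "\<rho> \<in> star_reps A" for m n \<rho>
    unfolding reduced_gen_induced_op[OF that]
    using pair_op[OF induced_cov_pair(1)[OF star_rep_restrict[OF that]]] induced_cov_pair(2)[OF star_rep_restrict[OF that]]
    by simp_all
  have p': "clin (reduced_gen m \<rho>)" "norm (reduced_gen m \<rho>) \<le> 1"
    "reduced_gen (pair_mul m n) \<rho> = reduced_gen m \<rho> o\<^sub>L reduced_gen n \<rho>"
    "reduced_gen (pair_inv m) \<rho> = adj (reduced_gen m \<rho>)" for m n \<rho>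
    using p[of \<rho>] z[of \<rho>] by (cases "\<rho> \<in> star_reps A"; simp)+
  show "reduced_gen m \<in> elems (op_family_algebra (star_reps A))"
    by (rule op_family_memI[where C = 1]) (use p' z in auto)
  show "reduced_gen (pair_mul m n) = smult (op_family_algebra (star_reps A)) (reduced_gen m) (reduced_gen n)"
    "reduced_gen (pair_inv m) = sstar (op_family_algebra (star_reps A)) (reduced_gen m)"
    by (simp_all add: fun_eq_iff p')
qed

text \<open>The characters of the elements \<open>t\<close> extend to \<open>A\<close>, and every
  induced representation is controlled by the fibres. Hence the right-hand side no longer refers to
  \<open>A\<close>.\<close>

lemma reduced_gen_norm_le_iff:
  assumes "0 \<le> C"
  shows "snorm (op_family_algebra (star_reps A)) (lcomb (op_family_algebra (star_reps A)) reduced_gen l) \<le> C \<longleftrightarrow>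
    (\<forall>t. norm (lcomb op_algebra (fiber_op t) l) \<le> C)"
proof -
  have lc: "lcomb op_algebra (\<lambda>m. induced_rep \<alpha> \<pi> (e (fst m)) o\<^sub>L left_translation (snd m)) l
      = lcomb op_algebra (induced_op (\<lambda>x. \<pi> (e x))) l" for \<pi> :: "'a \<Rightarrow> ('a \<times> nat) op"
    by (intro arg_cong[where f = "\<lambda>w. lcomb op_algebra w l"] ext)
      (simp add: induced_op_def induced_rep_diag \<alpha>_e)
  have "snorm (op_family_algebra (star_reps A)) (lcomb (op_family_algebra (star_reps A)) reduced_gen l) \<le> C \<longleftrightarrow>
      (\<forall>\<pi>\<in>(star_reps A :: ('a \<Rightarrow> ('a \<times> nat) op) set). norm (lcomb op_algebra (\<lambda>m. induced_rep \<alpha> \<pi> (e (fst m)) o\<^sub>L left_translation (snd m)) l) \<le> C)"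
    unfolding reduced_gen_def[abs_def]
    by (rule lcomb_family_norm_le_iff[where M = UNIV
        and f = "\<lambda>m \<pi>. induced_rep \<alpha> \<pi> (e (fst m)) o\<^sub>L left_translation (snd m)"]) (use reduced_gen(1)[unfolded reduced_gen_def] assms in auto)
  also have "\<dots> \<longleftrightarrow> (\<forall>t. norm (lcomb op_algebra (fiber_op t) l) \<le> C)"
    unfolding lc
  proof (intro iffI allI ballI)
    fix t assume *: "\<forall>\<pi>\<in>star_reps A. norm (lcomb op_algebra (induced_op (\<lambda>x. \<pi> (e x) :: ('a \<times> nat) op)) l) \<le> C"
    obtain \<pi> where \<pi>: "\<pi> \<in> star_reps A" "\<And>x. \<pi> (e x) = (character_rep t x :: ('a \<times> nat) op)"
      using star_rep_extend[OF character_rep] by blast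
    then have "norm (lcomb op_algebra (induced_op (character_rep t :: 'x \<Rightarrow> ('a \<times> nat) op)) l) \<le> C"
      using * by (metis (no_types, lifting) ext)
    then show "norm (lcomb op_algebra (fiber_op t) l) \<le> C"
      using fiber_le_induced_character order_trans by blast
  next
    fix \<pi> :: "'a \<Rightarrow> ('a \<times> nat) op" assume "\<forall>t. norm (lcomb op_algebra (fiber_op t) l) \<le> C" "\<pi> \<in> star_reps A"
    then show "norm (lcomb op_algebra (induced_op (\<lambda>x. \<pi> (e x))) l) \<le> C"
      using induced_le_fibers[OF star_rep_restrict] by blast
  qed
  finally show ?thesis .
qed

end

lemma eq_of_le_iff:
  fixes a b :: real
  assumes "0 \<le> a" "0 \<le> b" "\<And>C. 0 \<le> C \<Longrightarrow> a \<le> C \<longleftrightarrow> b \<le> C"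
  shows "a = b"
  using assms(3)[OF assms(1)] assms(3)[OF assms(2)] by simp

text \<open>The two full norms are suprema over covariant pairs of \<open>X\<close> and
  \<open>G\<close> on different index types, which \<open>cov_pairs_norm_transfer\<close>
  reconciles; the two reduced norms are the same supremum over fibres.\<close>

lemma crossed_products_isomorphic:
  fixes act :: "'g::group_add \<Rightarrow> 'x::order \<Rightarrow> 'x" and A :: "'a star_algebra" and B :: "'b star_algebra"
  assumes "countable_semilattice_action act" "semilattice_algebra act A e \<alpha>" "semilattice_algebra act B f \<beta>"
  shows "star_isomorphic (crossed_product A \<alpha>) (crossed_product B \<beta>)"
    and "star_isomorphic (reduced_crossed_product A \<alpha>) (reduced_crossed_product B \<beta>)"
proof -
  interpret countable_semilattice_action act by fact
  interpret A: semilattice_algebra act A e \<alpha> by fact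
  interpret B: semilattice_algebra act B f \<beta> by fact
  have iA: "inj (\<lambda>n::nat. (undefined :: 'a, undefined :: 'g, n))"
    and iB: "inj (\<lambda>n::nat. (undefined :: 'b, undefined :: 'g, n))" by (auto simp: inj_on_def)
  let ?A = "op_family_algebra (covariant_reps A \<alpha>) :: (_ \<Rightarrow> ('a \<times> 'g \<times> nat) op) star_algebra"
  let ?B = "op_family_algebra (covariant_reps B \<beta>) :: (_ \<Rightarrow> ('b \<times> 'g \<times> nat) op) star_algebra"
  interpret P: comb_pair ?A ?B A.crossed_gen B.crossed_gen UNIV pair_mul pair_inv
    by (intro comb_pair.intro comb_pair_axioms.intro cstar_algebra_op_family)
      (simp_all only: A.crossed_gen B.crossed_gen UNIV_I)
  have eq: "snorm ?B (lcomb ?B B.crossed_gen l) = snorm ?A (lcomb ?A A.crossed_gen l)" for l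
  proof (rule eq_of_le_iff)
    fix C :: real assume C: "0 \<le> C"
    show "snorm ?B (lcomb ?B B.crossed_gen l) \<le> C \<longleftrightarrow> snorm ?A (lcomb ?A A.crossed_gen l) \<le> C"
      unfolding A.crossed_gen_norm_le_iff[OF C] B.crossed_gen_norm_le_iff[OF C]
      by (intro iffI allI impI)
        (rule cov_pairs_norm_transfer[OF _ iA C] cov_pairs_norm_transfer[OF _ iB C], assumption, blast)+
  qed (auto intro!: P.B.norm_nonneg P.A.norm_nonneg P.lcomb_A(1) P.lcomb_B(1))
  show "star_isomorphic (crossed_product A \<alpha>) (crossed_product B \<beta>)"
    unfolding A.crossed_product_generated B.crossed_product_generated
    by (rule P.generated_star_isomorphic[OF eq])
  let ?A = "op_family_algebra (star_reps A) :: (_ \<Rightarrow> ('g \<times> 'a \<times> nat) op) star_algebra"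
  let ?B = "op_family_algebra (star_reps B) :: (_ \<Rightarrow> ('g \<times> 'b \<times> nat) op) star_algebra"
  interpret Q: comb_pair ?A ?B A.reduced_gen B.reduced_gen UNIV pair_mul pair_inv
    by (intro comb_pair.intro comb_pair_axioms.intro cstar_algebra_op_family)
      (simp_all only: A.reduced_gen B.reduced_gen UNIV_I)
  have eq': "snorm ?B (lcomb ?B B.reduced_gen l) = snorm ?A (lcomb ?A A.reduced_gen l)" for l
    by (rule eq_of_le_iff)
      (auto simp: A.reduced_gen_norm_le_iff B.reduced_gen_norm_le_iff
        intro!: Q.B.norm_nonneg Q.A.norm_nonneg Q.lcomb_A(1) Q.lcomb_B(1))
  show "star_isomorphic (reduced_crossed_product A \<alpha>) (reduced_crossed_product B \<beta>)"
    unfolding A.reduced_crossed_product_generated B.reduced_crossed_product_generated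
    by (rule Q.generated_star_isomorphic[OF eq'])
qed

section \<open>The two algebras of a semilattice\<close>

text \<open>The closed span is taken inside the generated algebra, as \<open>e_span\<close> demands,
  and not in the ambient one.\<close>

lemma (in cstar_algebra) cspan_generated:
  assumes T: "T \<subseteq> elems A" "\<And>s t. s \<in> T \<Longrightarrow> t \<in> T \<Longrightarrow> smult A s t \<in> T" "\<And>t. t \<in> T \<Longrightarrow> sstar A t \<in> T"
  shows "elems (cstar_generated A T) \<subseteq> cstar_algebra.cspan (cstar_generated A T) T"
proof -
  let ?G = "cstar_generated A T"
  interpret G: cstar_algebra ?G by (rule cstar_algebra_generated)
  have "elems ?G \<subseteq> C" if C: "closed_subspace ?G C" "T \<subseteq> C" for C
  proof -
    have sub: "closed_star_subalgebra A (elems ?G)" by (rule closed_star_subalgebra_generated)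
    have "closed_subspace A C"
      by (rule closed_subspace_of_subalgebra[OF sub]) (use C in \<open>simp add: cstar_generated_def\<close>)
    then show ?thesis using cspan_least[OF _ C(2)] elems_cstar_generated[OF T] by simp
  qed
  then show ?thesis by (auto simp: G.cspan_def)
qed

context semilattice_action
begin

lemma lcomb_character_rep:
  "lcomb op_algebra (character_rep t) l = op_scale (character_value t l) (id_blinfun :: 'k op)"
  by (induction l) (auto simp: character_value_def character_rep_def op_scale_unary op_scale_0)

lemma norm_op_scale_id: "norm (op_scale c (id_blinfun :: 'k op)) = cmod c"
proof (rule antisym)
  show "norm (op_scale c (id_blinfun :: 'k op)) \<le> cmod c"
    using mult_left_mono[OF norm_blinfun_id_le[where 'a = "'k ell2"], of "cmod c"] by simp
  have "norm (op_scale c (id_blinfun :: 'k op) (ell2_delta undefined)) \<le> norm (op_scale c (id_blinfun :: 'k op)) * norm (ell2_delta undefined :: 'k ell2)"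
    by (rule norm_blinfun)
  then show "cmod c \<le> norm (op_scale c (id_blinfun :: 'k op))" by (simp only: op_scale_apply clin_intros) simp
qed

text \<open>\<open>character_le\<close> holds by evaluating a family at the scalar representation
  given by \<open>t\<close>. The action permutes the representations over which the supremum is
  taken, so it does not increase norms.\<close>

lemma semilattice_algebra_cstar:
  "semilattice_algebra act (semigroup_cstar meet_semigroup)
    (\<lambda>x. family_on (semigroup_reps meet_semigroup) (\<lambda>\<pi>. \<pi> x)) (semilattice_cstar_action act)"
proof -
  let ?R = "semigroup_reps (meet_semigroup :: 'x semigrp) :: ('x \<Rightarrow> ('x \<times> nat) op) set"
  let ?e = "\<lambda>x. family_on ?R (\<lambda>\<pi>. \<pi> x)"
  let ?F = "op_family_algebra ?R :: (('x \<Rightarrow> ('x \<times> nat) op) \<Rightarrow> ('x \<times> nat) op) star_algebra"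
  let ?G = "cstar_generated ?F (range ?e)"
  let ?\<alpha> = "semilattice_cstar_action act :: 'g \<Rightarrow> (('x \<Rightarrow> ('x \<times> nat) op) \<Rightarrow> ('x \<times> nat) op) \<Rightarrow> _"
  have A: "semigroup_cstar (meet_semigroup :: 'x semigrp) = ?G"
    unfolding semigroup_cstar_def by (rule arg_cong[where f = "cstar_generated ?F"]) auto
  interpret F: cstar_algebra ?F by (rule cstar_algebra_op_family)
  interpret G: cstar_algebra ?G by (rule F.cstar_algebra_generated)
  have eF: "?e x \<in> elems ?F" for x
    by (rule family_on_op_family[where C = 1]) (auto simp: meet_repsD intro!: norm_projection_le)
  have em: "smult ?F (?e x) (?e y) = ?e (meet x y)" and es: "sstar ?F (?e x) = ?e x" for x y
    by (auto simp: family_on_def fun_eq_iff meet_repsD)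
  have eG: "?e x \<in> elems ?G" for x using F.generated_superset[of "range ?e"] eF by blast
  have span: "elems ?G = F.cspan (range ?e)"
    by (rule F.elems_cstar_generated) (auto simp: eF em es simp del: op_family_simps)
  have shift: "(\<lambda>x. \<pi> (act g x)) \<in> ?R \<longleftrightarrow> \<pi> \<in> ?R" for \<pi> g
  proof
    have "(\<lambda>x. \<pi> (act g x)) \<in> ?R" if "\<pi> \<in> ?R" for \<pi> g
      using that unfolding meet_reps_iff by (simp add: act_meet)
    from this[of _ "- g"] this[of _ g]
    show "(\<lambda>x. \<pi> (act g x)) \<in> ?R \<Longrightarrow> \<pi> \<in> ?R" "\<pi> \<in> ?R \<Longrightarrow> (\<lambda>x. \<pi> (act g x)) \<in> ?R" by force+
  qed
  have \<alpha>F: "?\<alpha> g a \<in> elems ?F" "snorm ?F (?\<alpha> g a) \<le> snorm ?F a" if "a \<in> elems ?F" for g a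
    unfolding semilattice_cstar_action_def
    using op_familyD[OF that] shift
    by (auto intro!: op_family_memI[where C = "snorm ?F a"] op_family_norm_le)
  have \<alpha>e: "?\<alpha> g (?e x) = ?e (act g x)" for g x
    unfolding semilattice_cstar_action_def by (auto simp: family_on_def fun_eq_iff shift)
  have \<alpha>G: "?\<alpha> g a \<in> elems ?G" if "a \<in> elems ?G" for g a
  proof -
    have C: "closed_subspace ?F (elems ?G)"
      by (rule F.closed_star_subalgebraD(1)[OF F.closed_star_subalgebra_generated])
    have "closed_subspace ?F {a \<in> elems ?F. ?\<alpha> g a \<in> elems ?G}"
      by (rule F.closed_subspace_preimage[OF C F.closed_subspace_elems F.cstar_algebra_axioms, where K = 1])
        (use \<alpha>F in auto, simp_all add: semilattice_cstar_action_def)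
    then have "F.cspan (range ?e) \<subseteq> {a \<in> elems ?F. ?\<alpha> g a \<in> elems ?G}"
      by (rule F.cspan_least) (use eF eG \<alpha>e in auto)
    then show ?thesis using that span by auto
  qed
  show ?thesis
    unfolding A
  proof (intro semilattice_algebra.intro semilattice_algebra_axioms.intro semilattice_action_axioms G.cstar_algebra_axioms)
    show "?e x \<in> elems ?G" for x by (rule eG)
    show "?e (meet x y) = smult ?G (?e x) (?e y)" "sstar ?G (?e x) = ?e x" for x y
      unfolding cstar_generated_simps by (rule em[symmetric] es)+
    show "elems ?G \<subseteq> G.cspan (range ?e)"
      by (rule F.cspan_generated) (auto simp: eF em es simp del: op_family_simps)
    show "cmod (character_value t l) \<le> snorm ?G (lcomb ?G ?e l)" for t l
    proof -
      have lF: "lcomb ?F ?e l \<in> elems ?F" by (rule F.lcomb_closed[where M = UNIV]) (use eF in auto)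
      have "lcomb ?F ?e l (character_rep t) = lcomb op_algebra (character_rep t) l"
        unfolding lcomb_op_family by (rule arg_cong[where f = "\<lambda>w. lcomb op_algebra w l"])
          (simp add: family_on_def character_rep)
      then have "cmod (character_value t l) = norm (lcomb ?F ?e l (character_rep t))"
        by (simp only: lcomb_character_rep norm_op_scale_id)
      then show ?thesis using op_familyD(3)[OF lF, of "character_rep t"] by simp
    qed
    show "star_hom ?G ?G (?\<alpha> g)" for g
      unfolding star_hom_def using \<alpha>G by (simp add: semilattice_cstar_action_def)
    show "snorm ?G (?\<alpha> g a) \<le> snorm ?G a" if "a \<in> elems ?G" for g a
      using \<alpha>F(2)[OF subsetD[OF elems_generated_subset that]] by simp
    show "?\<alpha> g (?e x) = ?e (act g x)" for g x by (rule \<alpha>e)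
  qed
qed

end

section \<open>Continuous functions vanishing at infinity\<close>

lemma C0_simps [simp]:
  "szero (C0_algebra T) = (\<lambda>_. 0)" "splus (C0_algebra T) = (\<lambda>f g t. f t + g t)"
  "sscale (C0_algebra T) = (\<lambda>c f t. c * f t)" "smult (C0_algebra T) = (\<lambda>f g t. f t * g t)"
  "sstar (C0_algebra T) = (\<lambda>f t. cnj (f t))"
  by (simp_all add: C0_algebra_def)

lemma elems_C0: "elems (C0_algebra T) =
    {f. (\<forall>t. t \<notin> T \<longrightarrow> f t = 0) \<and> continuous_on T f \<and> (\<forall>e>0. compact {t \<in> T. e \<le> cmod (f t)})}"
  and snorm_C0: "snorm (C0_algebra T) = (\<lambda>f. SUP t. cmod (f t))"
  by (simp_all add: C0_algebra_def)

text \<open>An enclosing compact set is enough, because continuity makes the superlevel set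
  relatively closed in it. This form suits sums and products, whose superlevel sets are only
  estimated.\<close>

lemma C0_memI:
  assumes "\<And>t. t \<notin> T \<Longrightarrow> f t = 0" and cont: "continuous_on T f"
    and K: "\<And>e. e > 0 \<Longrightarrow> \<exists>K. compact K \<and> K \<subseteq> T \<and> {t \<in> T. e \<le> cmod (f t)} \<subseteq> K"
  shows "f \<in> elems (C0_algebra T)"
proof -
  have "compact {t \<in> T. e \<le> cmod (f t)}" if e: "e > 0" for e
  proof -
    obtain K where K: "compact K" "K \<subseteq> T" "{t \<in> T. e \<le> cmod (f t)} \<subseteq> K" using K[OF e] by blast
    have "continuous_on K (\<lambda>t. cmod (f t))"
      using continuous_on_subset[OF cont K(2)] by (intro continuous_intros)
    then have "closedin (top_of_set K) (K \<inter> (\<lambda>t. cmod (f t)) -` {e..})"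
      by (rule continuous_closedin_preimage) simp
    moreover have "K \<inter> (\<lambda>t. cmod (f t)) -` {e..} = {t \<in> T. e \<le> cmod (f t)}" using K by auto
    ultimately show ?thesis using closedin_compact[OF K(1)] by metis
  qed
  then show ?thesis using assms by (simp add: elems_C0)
qed

lemma C0_D:
  assumes "f \<in> elems (C0_algebra T)"
  shows "t \<notin> T \<Longrightarrow> f t = 0" "continuous_on T f" "e > 0 \<Longrightarrow> compact {t \<in> T. e \<le> cmod (f t)}"
    "bdd_above (range (\<lambda>t. cmod (f t)))" "cmod (f t) \<le> snorm (C0_algebra T) f"
proof -
  show f: "t \<notin> T \<Longrightarrow> f t = 0" "continuous_on T f" "e > 0 \<Longrightarrow> compact {t \<in> T. e \<le> cmod (f t)}" for t e
    using assms by (auto simp: elems_C0)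
  \<comment> \<open>Off this compact set, \<open>f\<close> is bounded by 1.\<close>
  let ?K = "{t \<in> T. 1 \<le> cmod (f t)}"
  have "compact ((\<lambda>t. cmod (f t)) ` ?K)"
    by (rule compact_continuous_image[OF _ f(3)]) (auto intro!: continuous_intros continuous_on_subset[OF f(2)])
  then have "bounded ((\<lambda>t. cmod (f t)) ` ?K)" by (rule compact_imp_bounded)
  then obtain M where "\<forall>y\<in>(\<lambda>t. cmod (f t)) ` ?K. norm y \<le> M" unfolding bounded_iff ..
  then have M: "cmod (f t) \<le> M" if "t \<in> ?K" for t using that by auto
  have "cmod (f t) \<le> max 1 M" for t
    using M[of t] f(1)[of t] by (cases "t \<in> ?K") (auto simp: not_le)
  then show b: "bdd_above (range (\<lambda>t. cmod (f t)))" by (auto intro!: bdd_aboveI[of _ "max 1 M"])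
  show "cmod (f t) \<le> snorm (C0_algebra T) f" unfolding snorm_C0 by (rule cSUP_upper[OF _ b]) simp
qed

lemma C0_norm_le: "(\<And>t. cmod (f t) \<le> C) \<Longrightarrow> snorm (C0_algebra T) f \<le> C"
  unfolding snorm_C0 by (rule cSUP_least) auto

lemma cstar_algebra_C0: "cstar_algebra (C0_algebra T)"
proof
  let ?A = "C0_algebra T"
  have cont0: "continuous_on T (\<lambda>_. 0 :: complex)" by simp
  show "szero ?A \<in> elems ?A" by (auto intro!: C0_memI exI[of _ "{}"])
  fix f g h :: "'a \<Rightarrow> complex" and c d :: complex
  assume f: "f \<in> elems ?A"
  note F = C0_D[OF f]
  have nf: "0 \<le> snorm ?A f" using F(5) norm_ge_zero order_trans by blast
  show "sscale ?A c f \<in> elems ?A"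
  proof (rule C0_memI)
    fix e :: real assume e: "e > 0"
    let ?M = "cmod c + 1"
    have M: "?M > 0" by (simp add: add_nonneg_pos)
    have "{t \<in> T. e \<le> cmod (sscale ?A c f t)} \<subseteq> {t \<in> T. e / ?M \<le> cmod (f t)}"
    proof safe
      fix t assume "e \<le> cmod (sscale ?A c f t)"
      also have "\<dots> \<le> cmod (f t) * ?M" by (simp add: norm_mult algebra_simps)
      finally show "e / ?M \<le> cmod (f t)" using M by (simp add: pos_divide_le_eq)
    qed
    then show "\<exists>K. compact K \<and> K \<subseteq> T \<and> {t \<in> T. e \<le> cmod (sscale ?A c f t)} \<subseteq> K"
      by (intro exI[of _ "{t \<in> T. e / ?M \<le> cmod (f t)}"]) (use F(3)[OF divide_pos_pos[OF e M]] in auto)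
  qed (use F in \<open>auto intro!: continuous_intros\<close>)
  show "sstar ?A f \<in> elems ?A"
    by (rule C0_memI) (use F in \<open>auto intro!: continuous_intros\<close>)
  show "snorm ?A f = 0 \<longleftrightarrow> f = szero ?A"
  proof
    assume "snorm ?A f = 0"
    then have "cmod (f t) \<le> 0" for t using F(5)[of t] by simp
    then show "f = szero ?A" by (simp add: fun_eq_iff)
  qed (simp add: snorm_C0)
  show "snorm ?A (sscale ?A c f) = cmod c * snorm ?A f"
  proof (cases "c = 0")
    case False
    have le: "snorm ?A (sscale ?A c f) \<le> cmod c * snorm ?A f" if "f \<in> elems ?A" for c f
      by (rule C0_norm_le) (use C0_D(5)[OF that] in \<open>simp add: norm_mult mult_left_mono\<close>)
    have cf: "sscale ?A c f \<in> elems ?A" by fact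
    have "snorm ?A (sscale ?A (1 / c) (sscale ?A c f)) \<le> cmod (1 / c) * snorm ?A (sscale ?A c f)"
      by (rule le[OF cf])
    then have "snorm ?A f \<le> snorm ?A (sscale ?A c f) / cmod c"
      using False by (simp add: norm_divide)
    then show ?thesis using le[OF f, of c] False by (simp add: field_simps)
  qed (simp add: snorm_C0)
  show "snorm ?A (smult ?A (sstar ?A f) f) = (snorm ?A f)\<^sup>2"
  proof (rule antisym)
    show "snorm ?A (smult ?A (sstar ?A f) f) \<le> (snorm ?A f)\<^sup>2"
      by (rule C0_norm_le) (use F(5) in \<open>simp add: norm_mult power2_eq_square mult_mono'\<close>)
    let ?s = "snorm ?A (smult ?A (sstar ?A f) f)"
    have b: "bdd_above (range (\<lambda>t. cmod (cnj (f t) * f t)))"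
      using F(5) by (intro bdd_aboveI[of _ "snorm ?A f * snorm ?A f"]) (auto simp: norm_mult mult_mono')
    have "(cmod (f t))\<^sup>2 \<le> ?s" for t
      using cSUP_upper[OF UNIV_I b, of t] by (simp add: snorm_C0 norm_mult power2_eq_square)
    then have "cmod (f t) \<le> sqrt ?s" for t by (simp add: real_le_rsqrt)
    then have "snorm ?A f \<le> sqrt ?s" by (rule C0_norm_le)
    then have "(snorm ?A f)\<^sup>2 \<le> (sqrt ?s)\<^sup>2" using nf by (intro power_mono)
    moreover have "0 \<le> ?s" using \<open>\<And>t. (cmod (f t))\<^sup>2 \<le> ?s\<close> zero_le_power2 order_trans by blast
    ultimately show "(snorm ?A f)\<^sup>2 \<le> ?s" by simp
  qed
  assume g: "g \<in> elems ?A"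
  note G = C0_D[OF g]
  show "splus ?A f g \<in> elems ?A"
  proof (rule C0_memI)
    fix e :: real assume e: "e > 0"
    have "{t \<in> T. e \<le> cmod (splus ?A f g t)} \<subseteq> {t \<in> T. e / 2 \<le> cmod (f t)} \<union> {t \<in> T. e / 2 \<le> cmod (g t)}"
      using norm_triangle_ineq[of "f t" "g t" for t] by (auto simp: not_le) (smt (verit) field_sum_of_halves)
    then show "\<exists>K. compact K \<and> K \<subseteq> T \<and> {t \<in> T. e \<le> cmod (splus ?A f g t)} \<subseteq> K"
      by (intro exI[of _ "{t \<in> T. e / 2 \<le> cmod (f t)} \<union> {t \<in> T. e / 2 \<le> cmod (g t)}"])
        (use e F(3)[of "e / 2"] G(3)[of "e / 2"] in auto)
  qed (use F G in \<open>auto intro!: continuous_intros\<close>)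
  show "smult ?A f g \<in> elems ?A"
  proof (rule C0_memI)
    fix e :: real assume e: "e > 0"
    let ?M = "snorm ?A g + 1"
    have M: "?M > 0" using order_trans[OF norm_ge_zero G(5)[of undefined]] by simp
    have "{t \<in> T. e \<le> cmod (smult ?A f g t)} \<subseteq> {t \<in> T. e / ?M \<le> cmod (f t)}"
    proof safe
      fix t assume "e \<le> cmod (smult ?A f g t)"
      also have "\<dots> \<le> cmod (f t) * ?M"
        using G(5)[of t] by (simp add: norm_mult mult_left_mono)
      finally show "e / ?M \<le> cmod (f t)" using M by (simp add: pos_divide_le_eq)
    qed
    then show "\<exists>K. compact K \<and> K \<subseteq> T \<and> {t \<in> T. e \<le> cmod (smult ?A f g t)} \<subseteq> K"
      by (intro exI[of _ "{t \<in> T. e / ?M \<le> cmod (f t)}"]) (use F(3)[OF divide_pos_pos[OF e M]] in auto)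
  qed (use F G in \<open>auto intro!: continuous_intros\<close>)
  show "snorm ?A (splus ?A f g) \<le> snorm ?A f + snorm ?A g"
    by (rule C0_norm_le) (use F(5) G(5) in \<open>auto intro: order_trans[OF norm_triangle_ineq] add_mono\<close>)
  show "snorm ?A (smult ?A f g) \<le> snorm ?A f * snorm ?A g"
    by (rule C0_norm_le) (use F(5) G(5) in \<open>auto simp: norm_mult intro: mult_mono'\<close>)
next
  let ?A = "C0_algebra T"
  show "dist_complete (elems ?A) (sdist ?A)"
    unfolding dist_complete_def
  proof (intro allI impI)
    fix f :: "nat \<Rightarrow> 'a \<Rightarrow> complex"
    assume f: "(\<forall>n. f n \<in> elems ?A) \<and> (\<forall>e>0. \<exists>N. \<forall>m\<ge>N. \<forall>n\<ge>N. sdist ?A (f m) (f n) < e)"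
    then have fA: "f n \<in> elems ?A" for n by simp
    have C: "\<exists>N. \<forall>m\<ge>N. \<forall>n\<ge>N. \<forall>t. dist (f m t) (f n t) < e" if e: "e > 0" for e
    proof -
      obtain N where N: "\<forall>m\<ge>N. \<forall>n\<ge>N. sdist ?A (f m) (f n) < e" using f e by blast
      have "dist (f m t) (f n t) < e" if "m \<ge> N" "n \<ge> N" for m n t
      proof -
        have "bdd_above (range (\<lambda>t. cmod (f m t - f n t)))"
          using C0_D(5)[OF fA] by (intro bdd_aboveI[of _ "snorm ?A (f m) + snorm ?A (f n)"])
            (auto intro: order_trans[OF norm_triangle_ineq4] add_mono)
        then have "cmod (f m t - f n t) \<le> sdist ?A (f m) (f n)"
          using cSUP_upper[of t UNIV "\<lambda>t. cmod (f m t - f n t)"] by (simp add: sdist_def snorm_C0)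
        then show ?thesis using N[rule_format, OF that] by (simp add: dist_norm)
      qed
      then show ?thesis by blast
    qed
    have "Cauchy (\<lambda>n. f n t)" for t unfolding Cauchy_def by (meson C)
    then obtain l where l: "\<And>t. (\<lambda>n. f n t) \<longlonglongrightarrow> l t"
      unfolding Cauchy_convergent_iff convergent_def by metis
    have close: "\<exists>N. \<forall>m\<ge>N. \<forall>t. cmod (f m t - l t) \<le> e" if e: "e > 0" for e
    proof -
      obtain N where N: "\<And>m n t. m \<ge> N \<Longrightarrow> n \<ge> N \<Longrightarrow> dist (f m t) (f n t) < e" using C[OF e] by blast
      have "cmod (f m t - l t) \<le> e" if m: "m \<ge> N" for m t
      proof (rule Lim_bounded)
        show "(\<lambda>n. cmod (f m t - f n t)) \<longlonglongrightarrow> cmod (f m t - l t)" by (intro tendsto_intros l)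
        show "\<forall>n\<ge>N. cmod (f m t - f n t) \<le> e" using N[OF m] by (auto simp: dist_norm less_imp_le)
      qed
      then show ?thesis by blast
    qed
    have unif: "uniform_limit T f l sequentially"
      unfolding uniform_limit_iff
    proof (intro allI impI)
      fix e :: real assume "e > 0"
      then obtain N where "\<forall>m\<ge>N. \<forall>t. cmod (f m t - l t) \<le> e / 2" using close[of "e / 2"] by auto
      then show "\<forall>\<^sub>F n in sequentially. \<forall>t\<in>T. dist (f n t) (l t) < e"
        using \<open>e > 0\<close> unfolding eventually_sequentially dist_norm
        by (intro exI[of _ N]) (smt (verit) field_sum_of_halves)
    qed
    have lA: "l \<in> elems ?A"
    proof (rule C0_memI)
      show "l t = 0" if "t \<notin> T" for t using l[of t] C0_D(1)[OF fA that] by (simp add: LIMSEQ_const_iff)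
      show "continuous_on T l"
        by (rule uniform_limit_theorem[OF _ unif]) (use C0_D(2)[OF fA] in auto)
      fix e :: real assume e: "e > 0"
      then obtain N where N: "\<And>t. cmod (f N t - l t) \<le> e / 2" using close[of "e / 2"] by auto
      have "{t \<in> T. e \<le> cmod (l t)} \<subseteq> {t \<in> T. e / 2 \<le> cmod (f N t)}"
        using N norm_triangle_ineq4[of "f N t" "f N t - l t" for t] by auto (smt (verit) field_sum_of_halves)
      then show "\<exists>K. compact K \<and> K \<subseteq> T \<and> {t \<in> T. e \<le> cmod (l t)} \<subseteq> K"
        by (intro exI[of _ "{t \<in> T. e / 2 \<le> cmod (f N t)}"]) (use C0_D(3)[OF fA, of "e / 2" N] e in auto)
    qed
    have "(\<lambda>n. sdist ?A (f n) l) \<longlonglongrightarrow> 0"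
    proof (rule LIMSEQ_I)
      fix r :: real assume "r > 0"
      then obtain N where N: "\<And>m t. m \<ge> N \<Longrightarrow> cmod (f m t - l t) \<le> r / 2" using close[of "r / 2"] by auto
      have "norm (sdist ?A (f n) l - 0) < r" if n: "n \<ge> N" for n
      proof -
        have "0 \<le> (SUP t. cmod (f n t - l t))"
          by (rule cSUP_upper2[where x = undefined]) (use N[OF n] in \<open>auto intro!: bdd_aboveI[of _ "r / 2"]\<close>)
        moreover have "(SUP t. cmod (f n t - l t)) \<le> r / 2" by (rule cSUP_least) (use N[OF n] in auto)
        ultimately show ?thesis using \<open>r > 0\<close> by (simp add: sdist_def snorm_C0)
      qed
      then show "\<exists>N. \<forall>n\<ge>N. norm (sdist ?A (f n) l - 0) < r" by blast
    qed
    then show "\<exists>l\<in>elems ?A. (\<lambda>n. sdist ?A (f n) l) \<longlonglongrightarrow> 0" using lA by blast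
  qed
qed (auto simp: fun_eq_iff algebra_simps)

section \<open>The space of predicates is compact and Hausdorff\<close>

lemma open_vimage_apply: "open W \<Longrightarrow> open ((\<lambda>h :: 'a \<Rightarrow> 'b::topological_space. h x) -` W)"
  by (rule open_vimage[OF _ continuous_on_product_coordinates])

instance "fun" :: (type, t0_space) t0_space
proof
  fix f g :: "'a \<Rightarrow> 'b"
  assume "f \<noteq> g"
  then obtain x where x: "f x \<noteq> g x" by auto
  obtain U where "open U" "\<not> (f x \<in> U \<longleftrightarrow> g x \<in> U)" using t0_space_class.t0_space[OF x] by (elim exE conjE) (rule that)
  then show "\<exists>U. open U \<and> \<not> (f \<in> U \<longleftrightarrow> g \<in> U)"
    by (intro exI[of _ "(\<lambda>h. h x) -` U"]) (simp add: open_vimage_apply)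
qed

instance "fun" :: (type, t1_space) t1_space
proof
  fix f g :: "'a \<Rightarrow> 'b"
  assume "f \<noteq> g"
  then obtain x where x: "f x \<noteq> g x" by auto
  obtain U where "open U" "f x \<in> U" "g x \<notin> U" using t1_space_class.t1_space[OF x] by (elim exE conjE) (rule that)
  then show "\<exists>U. open U \<and> f \<in> U \<and> g \<notin> U"
    by (intro exI[of _ "(\<lambda>h. h x) -` U"]) (simp add: open_vimage_apply)
qed

text \<open>Makes compact sets of characters closed, as continuity at the zero homomorphism
  requires.\<close>

instance "fun" :: (type, t2_space) t2_space
proof
  fix f g :: "'a \<Rightarrow> 'b"
  assume "f \<noteq> g"
  then obtain x where "f x \<noteq> g x" by auto
  then obtain U V where UV: "open U" "open V" "f x \<in> U" "g x \<in> V" "U \<inter> V = {}"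
    using hausdorff by metis
  then show "\<exists>U V. open U \<and> open V \<and> f \<in> U \<and> g \<in> V \<and> U \<inter> V = {}"
    by (intro exI[of _ "(\<lambda>h. h x) -` U"] exI[of _ "(\<lambda>h. h x) -` V"]) (auto simp: open_vimage_apply)
qed

lemma compact_UNIV_predicates: "compact (UNIV :: ('x \<Rightarrow> bool) set)"
proof -
  have "compact_space (product_topology (\<lambda>_::'x. euclidean :: bool topology) UNIV)"
    unfolding compact_space_product_topology
    by (simp add: compact_space_def finite_imp_compact)
  then show ?thesis
    by (simp add: euclidean_product_topology compact_space_def)
qed

lemma continuous_on_of_bool_apply: "continuous_on S (\<lambda>\<phi> :: 'x \<Rightarrow> bool. of_bool (\<phi> x) :: 'b :: {zero_neq_one, topological_space})"
proof -
  have "continuous_on UNIV (of_bool :: bool \<Rightarrow> 'b)"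
    unfolding continuous_on_open_vimage[OF open_UNIV] by (simp add: open_discrete)
  moreover have "continuous_on S (\<lambda>\<phi> :: 'x \<Rightarrow> bool. \<phi> x)"
    by (rule continuous_on_subset[OF continuous_on_product_coordinates]) simp
  ultimately show ?thesis using continuous_on_compose2 by blast
qed

context semilattice_action
begin

text \<open>Adding the zero homomorphism compactifies the character space.\<close>

definition all_characters :: "('x \<Rightarrow> bool) set" where
  "all_characters = {\<phi>. \<forall>x y. \<phi> (meet x y) \<longleftrightarrow> \<phi> x \<and> \<phi> y}"

lemma characters_eq: "characters = all_characters - {\<lambda>_. False}"
  by (auto simp: characters_def all_characters_def fun_eq_iff)

lemma closed_all_characters: "closed all_characters"
proof -
  have c: "continuous_on UNIV (\<lambda>\<phi> :: 'x \<Rightarrow> bool. \<phi> x)" for x by simp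
  have 1: "closed {\<phi> :: 'x \<Rightarrow> bool. \<phi> (meet x y) = (\<phi> x \<and> \<phi> y)}" for x y
  proof (rule closed_Collect_eq[OF c])
    have *: "continuous_on UNIV (case_prod (\<and>))"
      unfolding continuous_on_open_vimage[OF open_UNIV]       by (fastforce simp: open_prod_def open_discrete intro: exI[of _ "{_}"])
    show "continuous_on UNIV (\<lambda>\<phi> :: 'x \<Rightarrow> bool. \<phi> x \<and> \<phi> y)"
      using continuous_on_compose2[OF * continuous_on_Pair[OF c[of x] c[of y]]] by simp
  qed
  have 2: "all_characters = (\<Inter>x. \<Inter>y. {\<phi>. \<phi> (meet x y) = (\<phi> x \<and> \<phi> y)})"
    by (auto simp: all_characters_def)
  show ?thesis unfolding 2 by (intro closed_INT ballI 1)
qed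

lemma compact_all_characters: "compact all_characters"
  using compact_Int_closed[OF compact_UNIV_predicates closed_all_characters] by simp

definition point_function :: "'x \<Rightarrow> ('x \<Rightarrow> bool) \<Rightarrow> complex" where
  "point_function x \<phi> = of_bool (\<phi> \<in> characters \<and> \<phi> x)"

text \<open>The homomorphisms with \<open>\<phi> x\<close> form a closed subset of the
  compactification that misses the zero homomorphism, hence a compact set of characters.\<close>

lemma point_function_C0: "point_function x \<in> elems (C0_algebra characters)"
proof (rule C0_memI)
  show "continuous_on characters (point_function x)"
    using continuous_on_of_bool_apply by (rule continuous_on_eq) (simp add: point_function_def)
  fix e :: real assume "e > 0"
  have cl: "closed {\<phi> :: 'x \<Rightarrow> bool. \<phi> x}"
    using closed_Collect_eq[of "\<lambda>\<phi> :: 'x \<Rightarrow> bool. \<phi> x" "\<lambda>_. True"] by simp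
  show "\<exists>K. compact K \<and> K \<subseteq> characters \<and> {\<phi> \<in> characters. e \<le> cmod (point_function x \<phi>)} \<subseteq> K"
    by (rule exI[of _ "all_characters \<inter> {\<phi>. \<phi> x}"])
      (use compact_Int_closed[OF compact_all_characters cl] \<open>e > 0\<close> in \<open>auto simp: characters_eq point_function_def\<close>)
qed (simp add: point_function_def)

text \<open>Near the zero homomorphism, \<open>f\<close> is small because its superlevel sets are
  compact, hence closed, and miss that point. Any other homomorphism has a neighbourhood of the form
  \<open>{\<psi>. \<psi> x}\<close>, which excludes the zero homomorphism.\<close>

lemma C0_continuous_at_infinity:
  assumes f: "f \<in> elems (C0_algebra (characters :: ('x \<Rightarrow> bool) set))"
  shows "continuous_on all_characters f"
  unfolding continuous_on_def
proof
  fix \<phi> :: "'x \<Rightarrow> bool" assume \<phi>: "\<phi> \<in> all_characters"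
  note F = C0_D[OF f]
  show "(f \<longlongrightarrow> f \<phi>) (at \<phi> within all_characters)"
  proof (cases "\<phi> = (\<lambda>_. False)")
    case True
    have f0: "f \<phi> = 0" using F(1)[of \<phi>] True by (simp add: characters_eq)
    show ?thesis unfolding f0 tendsto_iff
    proof (intro allI impI)
      fix e :: real assume e: "e > 0"
      let ?K = "{\<psi> \<in> characters. e \<le> cmod (f \<psi>)}"
      have "closed ?K" using F(3)[OF e] by (rule compact_imp_closed)
      then have "open (- ?K)" by (rule open_Compl)
      moreover have "\<phi> \<in> - ?K" using True by (simp add: characters_eq)
      ultimately show "\<forall>\<^sub>F \<psi> in at \<phi> within all_characters. dist (f \<psi>) 0 < e"
      proof -
        have "dist (f \<psi>) 0 < e" if "\<psi> \<in> - ?K" for \<psi>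
          using that F(1)[of \<psi>] e by (cases "\<psi> \<in> characters") auto
        then show ?thesis
          unfolding eventually_at_topological using \<open>open (- ?K)\<close> \<open>\<phi> \<in> - ?K\<close> by blast
      qed
    qed
  next
    case False
    then obtain x where x: "\<phi> x" by (auto simp: fun_eq_iff)
    have "\<phi> \<in> characters" using \<phi> False by (simp add: characters_eq)
    then have "(f \<longlongrightarrow> f \<phi>) (at \<phi> within characters)" using F(2) by (simp add: continuous_on_def)
    moreover have "open {\<psi> :: 'x \<Rightarrow> bool. \<psi> x}"
      using continuous_on_product_coordinates[of x, THEN open_vimage[rotated], of "{True}"]
      by (simp add: vimage_def open_discrete)
    then have "at \<phi> within all_characters = at \<phi> within characters"
      by (rule at_within_nhd[rotated]) (use x in \<open>auto simp: characters_eq\<close>)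
    ultimately show ?thesis by simp
  qed
qed

text \<open>Stone-Weierstrass on the compactification. Products of evaluations are evaluations at
  meets, so constants plus combinations of evaluations form an algebra. Evaluation at the zero
  homomorphism shows that the constant is small, and dropping it uses up the second half of
  \<open>e\<close>.\<close>

lemma real_approximation:
  fixes f :: "('x \<Rightarrow> bool) \<Rightarrow> real"
  assumes "continuous_on all_characters f" "f (\<lambda>_. False) = 0" "e > 0"
  shows "\<exists>l. \<forall>\<phi>\<in>all_characters. \<bar>f \<phi> - (\<Sum>(a, x)\<leftarrow>l. a * of_bool (\<phi> x))\<bar> < e"
proof -
  let ?s = "\<lambda>(l :: (real \<times> 'x) list) \<phi>. \<Sum>(a, x)\<leftarrow>l. a * of_bool (\<phi> x)"
  define R where "R = {g. \<exists>c l. \<forall>\<phi>\<in>all_characters. g \<phi> = c + ?s l \<phi>}"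
  have scale: "?s (map (\<lambda>(a, x). (c * a, x)) l) \<phi> = c * ?s l \<phi>" for c l \<phi>
    by (induction l) (auto simp: algebra_simps)
  have mult1: "?s (map (\<lambda>(a, x). (c * a, meet y x)) l) \<phi> = c * of_bool (\<phi> y) * ?s l \<phi>"
    if "\<phi> \<in> all_characters" for c l y \<phi>
    using that by (induction l) (auto simp: algebra_simps all_characters_def)
  have mult: "\<exists>k. \<forall>\<phi>\<in>all_characters. ?s k \<phi> = ?s l \<phi> * ?s l' \<phi>" for l l'
  proof (induction l)
    case Nil
    show ?case by (rule exI[of _ "[]"]) simp
  next
    case (Cons p l)
    then obtain k where "\<forall>\<phi>\<in>all_characters. ?s k \<phi> = ?s l \<phi> * ?s l' \<phi>" by blast
    then show ?case
      by (intro exI[of _ "map (\<lambda>(a, x). (fst p * a, meet (snd p) x)) l' @ k"])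
        (cases p, auto simp: mult1 distrib_right simp del: map_map)
  qed
  interpret function_ring_on R all_characters
  proof
    show "compact all_characters" by (rule compact_all_characters)
    show "continuous_on all_characters g" if g: "g \<in> R" for g
    proof -
      obtain c l where "\<forall>\<phi>\<in>all_characters. g \<phi> = c + ?s l \<phi>" using g by (auto simp: R_def)
      moreover have "continuous_on all_characters (?s l)"
        by (induction l) (auto intro!: continuous_intros continuous_on_of_bool_apply)
      then have "continuous_on all_characters (\<lambda>\<phi>. c + ?s l \<phi>)" by (intro continuous_intros)
      ultimately show ?thesis by (simp cong: continuous_on_cong)
    qed
    show "(\<lambda>x. g x + h x) \<in> R" "(\<lambda>x. g x * h x) \<in> R" if g: "g \<in> R" and h: "h \<in> R" for g h
    proof -
      obtain c l where 1: "\<forall>\<phi>\<in>all_characters. g \<phi> = c + ?s l \<phi>" using g by (auto simp: R_def)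
      obtain d k where 2: "\<forall>\<phi>\<in>all_characters. h \<phi> = d + ?s k \<phi>" using h by (auto simp: R_def)
      have "\<forall>\<phi>\<in>all_characters. g \<phi> + h \<phi> = (c + d) + ?s (l @ k) \<phi>" using 1 2 by simp
      then show "(\<lambda>x. g x + h x) \<in> R" unfolding R_def by blast
      obtain m where m: "\<forall>\<phi>\<in>all_characters. ?s m \<phi> = ?s l \<phi> * ?s k \<phi>" using mult by blast
      have "\<forall>\<phi>\<in>all_characters. g \<phi> * h \<phi> = (c * d)
          + ?s (map (\<lambda>(a, x). (c * a, x)) k @ map (\<lambda>(a, x). (d * a, x)) l @ m) \<phi>"
        using 1 2 m by (simp add: scale del: map_map) (simp add: algebra_simps)
      then show "(\<lambda>x. g x * h x) \<in> R" unfolding R_def by blast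
    qed
    show "(\<lambda>_. c) \<in> R" for c unfolding R_def by (auto intro!: exI[of _ c] exI[of _ "[]"])
    show "\<exists>g\<in>R. g \<phi> \<noteq> g \<psi>" if "\<phi> \<in> all_characters" "\<psi> \<in> all_characters" "\<phi> \<noteq> \<psi>" for \<phi> \<psi>
    proof -
      obtain x where "\<phi> x \<noteq> \<psi> x" using \<open>\<phi> \<noteq> \<psi>\<close> by auto
      moreover have "(\<lambda>\<phi>. of_bool (\<phi> x)) \<in> R" unfolding R_def by (auto intro!: exI[of _ 0] exI[of _ "[(1, x)]"])
      ultimately show ?thesis by (intro bexI[of _ "\<lambda>\<phi>. of_bool (\<phi> x)"]) auto
    qed
  qed
  obtain g where g: "g \<in> R" "\<forall>\<phi>\<in>all_characters. \<bar>f \<phi> - g \<phi>\<bar> < e / 2"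
    using Stone_Weierstrass_basic[OF assms(1), of "e / 2"] assms(3) by auto
  obtain c l where cl: "\<forall>\<phi>\<in>all_characters. g \<phi> = c + ?s l \<phi>" using g(1) by (auto simp: R_def)
  have z: "(\<lambda>_. False) \<in> all_characters" by (simp add: all_characters_def)
  have "?s l (\<lambda>_. False) = 0" by (induction l) auto
  then have "\<bar>c\<bar> < e / 2" using g(2) cl z assms(2) by force
  then have "\<bar>f \<phi> - ?s l \<phi>\<bar> < e" if "\<phi> \<in> all_characters" for \<phi>
    using g(2)[rule_format, OF that] cl[rule_format, OF that] by linarith
  then show ?thesis by blast
qed

lemma lcomb_point_function:
  "\<phi> \<in> characters \<Longrightarrow> lcomb (C0_algebra characters) point_function l \<phi> = (\<Sum>(c, x)\<leftarrow>l. c * of_bool (\<phi> x))"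
  by (induction l) (auto simp: point_function_def)

text \<open>Real and imaginary parts are approximated separately, each up to \<open>e / 2\<close>,
  and merged with real and purely imaginary coefficients.\<close>

lemma C0_span: "elems (C0_algebra characters) \<subseteq> cstar_algebra.cspan (C0_algebra characters) (range point_function)"
proof
  let ?A = "C0_algebra characters :: (('x \<Rightarrow> bool) \<Rightarrow> complex) star_algebra"
  interpret cstar_algebra ?A by (rule cstar_algebra_C0)
  fix f assume f: "f \<in> elems ?A"
  have f0: "f (\<lambda>_. False) = 0" using C0_D(1)[OF f] by (simp add: characters_eq)
  have lc: "lcomb ?A point_function l \<in> elems ?A" "lcomb ?A point_function l \<in> cspan (range point_function)" for l
    by (rule lcomb_closed[where M = UNIV] lcomb_in_cspan[where M = UNIV]; simp add: point_function_C0)+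
  have "\<exists>l. sdist ?A (lcomb ?A point_function l) f \<le> e" if e: "e > 0" for e
  proof -
    have cont: "continuous_on all_characters (\<lambda>\<phi>. Re (f \<phi>))" "continuous_on all_characters (\<lambda>\<phi>. Im (f \<phi>))"
      using C0_continuous_at_infinity[OF f] by (auto intro!: continuous_intros)
    obtain l where l: "\<And>\<phi>. \<phi> \<in> all_characters \<Longrightarrow> \<bar>Re (f \<phi>) - (\<Sum>(a, x)\<leftarrow>l. a * of_bool (\<phi> x))\<bar> < e / 2"
      using real_approximation[OF cont(1), of "e / 2"] f0 e by auto
    obtain k where k: "\<And>\<phi>. \<phi> \<in> all_characters \<Longrightarrow> \<bar>Im (f \<phi>) - (\<Sum>(a, x)\<leftarrow>k. a * of_bool (\<phi> x))\<bar> < e / 2"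
      using real_approximation[OF cont(2), of "e / 2"] f0 e by auto
    let ?L = "map (\<lambda>(a, x). (complex_of_real a, x)) l @ map (\<lambda>(a, x). (\<i> * complex_of_real a, x)) k"
    have L: "(\<Sum>(c, x)\<leftarrow>?L. c * of_bool (\<phi> x)) = Complex (\<Sum>(a, x)\<leftarrow>l. a * of_bool (\<phi> x)) (\<Sum>(a, x)\<leftarrow>k. a * of_bool (\<phi> x))"
      for \<phi> :: "'x \<Rightarrow> bool"
    proof -
      have "(\<Sum>(c, x)\<leftarrow>map (\<lambda>(a, x). (d * complex_of_real a, x)) l. c * of_bool (\<phi> x))
          = d * complex_of_real (\<Sum>(a, x)\<leftarrow>l. a * of_bool (\<phi> x))" for d l
        by (induction l) (auto simp: algebra_simps)
      from this[of 1 l] this[of \<i> k] show ?thesis by (simp add: complex_eq_iff)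
    qed
    have "sdist ?A (lcomb ?A point_function ?L) f \<le> e"
      unfolding sdist_def
    proof (rule C0_norm_le)
      fix \<phi> :: "'x \<Rightarrow> bool"
      note LA = lc(1)[of ?L]
      show "cmod (splus ?A (lcomb ?A point_function ?L) (sscale ?A (-1) f) \<phi>) \<le> e"
      proof (cases "\<phi> \<in> characters")
        case True
        let ?d = "lcomb ?A point_function ?L \<phi> - f \<phi>"
        have "lcomb ?A point_function ?L \<phi> = Complex (\<Sum>(a, x)\<leftarrow>l. a * of_bool (\<phi> x)) (\<Sum>(a, x)\<leftarrow>k. a * of_bool (\<phi> x))"
          using lcomb_point_function[OF True] L by simp
        then have "\<bar>Re ?d\<bar> < e / 2" "\<bar>Im ?d\<bar> < e / 2"
          using l[of \<phi>] k[of \<phi>] True by (auto simp: characters_eq abs_minus_commute)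
        then have "cmod ?d \<le> e" using cmod_le[of ?d] by linarith
        then show ?thesis by simp
      next
        case False
        then show ?thesis using C0_D(1)[OF LA False] C0_D(1)[OF f False] e by simp
      qed
    qed
    then show ?thesis by blast
  qed
  then have "\<forall>n. \<exists>l. sdist ?A (lcomb ?A point_function l) f \<le> 1 / real (Suc n)"
    by simp
  then obtain L where L: "\<And>n. sdist ?A (lcomb ?A point_function (L n)) f \<le> 1 / real (Suc n)" by metis
  have "converges (\<lambda>n. lcomb ?A point_function (L n)) f"
    by (rule converges_squeeze[where g = "\<lambda>n. 1 / real (Suc n)"])
      (use L f LIMSEQ_Suc[OF lim_1_over_n] lc in auto)
  then show "f \<in> cspan (range point_function)"
    by (rule closed_subspace_limit[OF closed_subspace_cspan, rotated]) (use lc in auto)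
qed

section \<open>The action of the group on functions of characters\<close>

lemma shift_characters: "(\<lambda>x. \<phi> (act g x)) \<in> characters \<longleftrightarrow> \<phi> \<in> characters" for \<phi> :: "'x \<Rightarrow> bool"
proof
  have *: "(\<lambda>x. \<phi> (act g x)) \<in> characters" if "\<phi> \<in> characters" for \<phi> :: "'x \<Rightarrow> bool" and g
    using that unfolding characters_def by (auto simp: act_meet) (metis act_cancel(2))
  show "(\<lambda>x. \<phi> (act g x)) \<in> characters \<Longrightarrow> \<phi> \<in> characters"
    using *[of "\<lambda>x. \<phi> (act g x)" "- g"] by simp
  show "\<phi> \<in> characters \<Longrightarrow> (\<lambda>x. \<phi> (act g x)) \<in> characters" by (rule *)
qed

lemma C0_action_apply: "C0_action act g f \<phi> = f (\<lambda>x. \<phi> (act g x))"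
  by (simp add: C0_action_def character_action_def)

lemma C0_action_closed:
  assumes f: "f \<in> elems (C0_algebra characters)"
  shows "C0_action act g f \<in> elems (C0_algebra characters)"
proof (rule C0_memI)
  note F = C0_D[OF f]
  have cont: "continuous_on S (\<lambda>(\<phi> :: 'x \<Rightarrow> bool) x. \<phi> (act g x))" for S g
    by (intro continuous_on_coordinatewise_then_product continuous_on_subset[OF continuous_on_product_coordinates]) simp
  show "C0_action act g f \<phi> = 0" if "\<phi> \<notin> characters" for \<phi>
    using F(1)[of "\<lambda>x. \<phi> (act g x)"] that by (simp add: C0_action_apply shift_characters)
  have "continuous_on characters (\<lambda>\<phi>. f (\<lambda>x. \<phi> (act g x)))"
    by (rule continuous_on_compose2[OF F(2) cont]) (auto simp: shift_characters)
  then show "continuous_on characters (C0_action act g f)"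
    by (simp add: C0_action_apply[abs_def])
  fix e :: real assume e: "e > 0"
  let ?K = "{\<psi> \<in> characters. e \<le> cmod (f \<psi>)}"
  have K: "compact ((\<lambda>\<psi> x. \<psi> (act (- g) x)) ` ?K)" by (rule compact_continuous_image[OF cont F(3)[OF e]])
  have "{\<phi> \<in> characters. e \<le> cmod (C0_action act g f \<phi>)} \<subseteq> (\<lambda>\<psi> x. \<psi> (act (- g) x)) ` ?K"
  proof safe
    fix \<phi> assume "\<phi> \<in> characters" "e \<le> cmod (C0_action act g f \<phi>)"
    then show "\<phi> \<in> (\<lambda>\<psi> x. \<psi> (act (- g) x)) ` ?K"
      by (intro image_eqI[of _ _ "\<lambda>x. \<phi> (act g x)"]) (auto simp: C0_action_apply shift_characters)
  qed
  then show "\<exists>K. compact K \<and> K \<subseteq> characters \<and> {\<phi> \<in> characters. e \<le> cmod (C0_action act g f \<phi>)} \<subseteq> K"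
    using K by (intro exI[of _ "(\<lambda>\<psi> x. \<psi> (act (- g) x)) ` ?K"]) (auto simp: shift_characters)
qed

lemma semilattice_algebra_C0:
  "semilattice_algebra act (C0_algebra characters) point_function (C0_action act)"
proof (intro semilattice_algebra.intro semilattice_algebra_axioms.intro semilattice_action_axioms cstar_algebra_C0)
  let ?A = "C0_algebra characters :: (('x \<Rightarrow> bool) \<Rightarrow> complex) star_algebra"
  interpret A: cstar_algebra ?A by (rule cstar_algebra_C0)
  show "point_function x \<in> elems ?A" for x by (rule point_function_C0)
  show "point_function (meet x y) = smult ?A (point_function x) (point_function y)" for x y
    by (auto simp: point_function_def fun_eq_iff characters_def)
  show "sstar ?A (point_function x) = point_function x" for x
    by (simp add: point_function_def fun_eq_iff)
  show "elems ?A \<subseteq> A.cspan (range point_function)" by (rule C0_span)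
  show "cmod (character_value t l) \<le> snorm ?A (lcomb ?A point_function l)" for t l
  proof -
    have l: "lcomb ?A point_function l \<in> elems ?A"
      by (rule A.lcomb_closed[where M = UNIV]) (auto simp: point_function_C0)
    have t: "(\<lambda>x. t \<le> x) \<in> characters" by (auto simp: characters_def)
    have "character_value t l = lcomb ?A point_function l (\<lambda>x. t \<le> x)"
      unfolding lcomb_point_function[OF t] character_value_def
      by (intro arg_cong[where f = sum_list] map_cong refl) auto
    then show ?thesis using C0_D(5)[OF l] by simp
  qed
  show "star_hom ?A ?A (C0_action act g)" for g
    unfolding star_hom_def using C0_action_closed by (auto simp: C0_action_apply[abs_def])
  show "snorm ?A (C0_action act g f) \<le> snorm ?A f" if "f \<in> elems ?A" for f g
    by (rule C0_norm_le) (use C0_D(5)[OF that] in \<open>simp add: C0_action_apply\<close>)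
  show "C0_action act g (point_function x) = point_function (act g x)" for g x
    by (simp add: fun_eq_iff C0_action_apply point_function_def shift_characters)
qed

end

section \<open>Factorization of kernels\<close>

text \<open>A partial-isometry valued kernel with commuting range projections factors as
  \<open>\<theta>\<^sub>i\<^sub>j = J\<^sub>i\<^sup>* J\<^sub>j\<close>. As \<open>\<theta>\<^sub>i\<^sub>j - \<theta>\<^sub>i\<^sub>n \<theta>\<^sub>n\<^sub>j = (1 - P\<^sub>i\<^sub>n) \<theta>\<^sub>i\<^sub>j\<close>, the Schur complement
  of such a kernel is of the same kind, and Cholesky's factorization terminates after each index has
  been used once.\<close>

locale partial_isometry_kernel =
  fixes \<theta> :: "'i \<Rightarrow> 'i \<Rightarrow> 'k op" and I :: "'i set" and idx :: "nat \<Rightarrow> 'i"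
  assumes clin_\<theta> [simp]: "i \<in> I \<Longrightarrow> j \<in> I \<Longrightarrow> clin (\<theta> i j)"
    and adj_\<theta> [simp]: "i \<in> I \<Longrightarrow> j \<in> I \<Longrightarrow> adj (\<theta> i j) = \<theta> j i"
    and \<theta>_comp: "i \<in> I \<Longrightarrow> j \<in> I \<Longrightarrow> k \<in> I \<Longrightarrow> \<theta> i j o\<^sub>L \<theta> j k = \<theta> i j o\<^sub>L \<theta> j i o\<^sub>L \<theta> i k"
    and \<theta>_diag: "i \<in> I \<Longrightarrow> j \<in> I \<Longrightarrow> \<theta> i i o\<^sub>L \<theta> i j = \<theta> i j"
    and P_commute': "i \<in> I \<Longrightarrow> j \<in> I \<Longrightarrow> k \<in> I \<Longrightarrow>
      (\<theta> i j o\<^sub>L \<theta> j i) o\<^sub>L (\<theta> i k o\<^sub>L \<theta> k i) = (\<theta> i k o\<^sub>L \<theta> k i) o\<^sub>L (\<theta> i j o\<^sub>L \<theta> j i)"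
    and range_idx: "range idx = I"
begin

text \<open>The range projection of the partial isometry \<open>\<theta> i j\<close>.\<close>

definition P :: "'i \<Rightarrow> 'i \<Rightarrow> 'k op" where "P i j = \<theta> i j o\<^sub>L \<theta> j i"

lemma idx [simp]: "idx n \<in> I"
  using range_idx by auto

lemma clin_P [simp]: "i \<in> I \<Longrightarrow> j \<in> I \<Longrightarrow> clin (P i j)"
  and adj_P [simp]: "i \<in> I \<Longrightarrow> j \<in> I \<Longrightarrow> adj (P i j) = P i j"
  and P_commute: "i \<in> I \<Longrightarrow> j \<in> I \<Longrightarrow> k \<in> I \<Longrightarrow> P i j o\<^sub>L P i k = P i k o\<^sub>L P i j"
  by (simp_all add: P_def P_commute')

lemma \<theta>_comp_P: "i \<in> I \<Longrightarrow> j \<in> I \<Longrightarrow> k \<in> I \<Longrightarrow> \<theta> i j o\<^sub>L \<theta> j k = P i j o\<^sub>L \<theta> i k"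
  by (simp add: P_def \<theta>_comp[of i j k])

lemma P_\<theta>_same: "i \<in> I \<Longrightarrow> j \<in> I \<Longrightarrow> P i j o\<^sub>L \<theta> i j = \<theta> i j"
proof -
  assume ij: "i \<in> I" "j \<in> I"
  have "\<theta> i j o\<^sub>L \<theta> j j = P i j o\<^sub>L \<theta> i j" by (rule \<theta>_comp_P) (use ij in auto)
  moreover have "\<theta> i j o\<^sub>L \<theta> j j = \<theta> i j"
    using arg_cong[OF \<theta>_diag[OF ij(2,1)], of adj] ij by simp
  ultimately show ?thesis by simp
qed

text \<open>Range projections at \<open>i\<close> move through \<open>\<theta> i k\<close> to those
  at \<open>k\<close>; hence elimination changes the kernel only by projections attached to single
  indices.\<close>

lemma P_\<theta>: assumes "i \<in> I" "j \<in> I" "k \<in> I" shows "P i j o\<^sub>L \<theta> i k = \<theta> i k o\<^sub>L P k j"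
proof -
  have "\<theta> i k o\<^sub>L P k j = (\<theta> i k o\<^sub>L \<theta> k j) o\<^sub>L \<theta> j k" by (simp add: P_def blinfun_compose_assoc)
  also have "\<dots> = P i k o\<^sub>L (\<theta> i j o\<^sub>L \<theta> j k)" using assms by (simp add: \<theta>_comp_P blinfun_compose_assoc)
  also have "\<dots> = (P i k o\<^sub>L P i j) o\<^sub>L \<theta> i k" using assms by (simp add: \<theta>_comp_P blinfun_compose_assoc)
  also have "\<dots> = P i j o\<^sub>L (P i k o\<^sub>L \<theta> i k)" using assms by (simp add: P_commute[of i k j] blinfun_compose_assoc)
  finally show ?thesis using assms by (simp add: P_\<theta>_same)
qed

lemma P_idem: "i \<in> I \<Longrightarrow> j \<in> I \<Longrightarrow> P i j o\<^sub>L P i j = P i j"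
  using P_\<theta>_same[of i j, THEN arg_cong[where f = "\<lambda>T. T o\<^sub>L \<theta> j i"]]
  by (simp add: P_def blinfun_compose_assoc)

text \<open>What is left of index \<open>i\<close> after eliminating the indices
  \<open>idx m\<close> with \<open>m < n\<close>: the Schur complement at that stage has the entries
  \<open>remainder n i o\<^sub>L \<theta> i j\<close>.\<close>

fun remainder :: "nat \<Rightarrow> 'i \<Rightarrow> 'k op" where
  "remainder 0 i = id_blinfun"
| "remainder (Suc n) i = (id_blinfun - P i (idx n)) o\<^sub>L remainder n i"

lemma remainder_commute_P: "i \<in> I \<Longrightarrow> j \<in> I \<Longrightarrow> P i j o\<^sub>L remainder n i = remainder n i o\<^sub>L P i j"
proof (induction n)
  case (Suc n)
  have "P i j o\<^sub>L remainder (Suc n) i = (P i j o\<^sub>L (id_blinfun - P i (idx n))) o\<^sub>L remainder n i"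
    by (simp add: blinfun_compose_assoc)
  also have "P i j o\<^sub>L (id_blinfun - P i (idx n)) = (id_blinfun - P i (idx n)) o\<^sub>L P i j"
    using Suc.prems by (simp add: blinfun_compose_add P_commute)
  finally show ?case using Suc by (simp add: blinfun_compose_assoc)
qed simp

lemma clin_remainder [simp]: "i \<in> I \<Longrightarrow> clin (remainder n i)"
  by (induction n) auto

lemma adj_remainder [simp]: "i \<in> I \<Longrightarrow> adj (remainder n i) = remainder n i"
proof (induction n)
  case (Suc n)
  then show ?case by (simp add: blinfun_compose_add remainder_commute_P)
qed simp

lemma remainder_idem: "i \<in> I \<Longrightarrow> remainder n i o\<^sub>L remainder n i = remainder n i"
proof (induction n)
  case (Suc n)
  let ?q = "id_blinfun - P i (idx n)" and ?r = "remainder n i"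
  have "?r o\<^sub>L ?q = ?q o\<^sub>L ?r" using Suc.prems by (simp add: blinfun_compose_add remainder_commute_P)
  then have "(?q o\<^sub>L ?r) o\<^sub>L (?q o\<^sub>L ?r) = (?q o\<^sub>L ?q) o\<^sub>L (?r o\<^sub>L ?r)"
    by (simp only: blinfun_compose_assoc flip: blinfun_compose_assoc[of ?r ?q ?r])
  also have "?q o\<^sub>L ?q = ?q" using Suc.prems by (simp add: blinfun_compose_add P_idem)
  finally show ?case using Suc by simp
qed simp

lemma remainder_\<theta>: "i \<in> I \<Longrightarrow> k \<in> I \<Longrightarrow> remainder n i o\<^sub>L \<theta> i k = \<theta> i k o\<^sub>L remainder n k"
proof (induction n)
  case (Suc n)
  have "remainder (Suc n) i o\<^sub>L \<theta> i k = (id_blinfun - P i (idx n)) o\<^sub>L (remainder n i o\<^sub>L \<theta> i k)"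
    by (simp add: blinfun_compose_assoc)
  also have "\<dots> = ((id_blinfun - P i (idx n)) o\<^sub>L \<theta> i k) o\<^sub>L remainder n k"
    using Suc by (simp add: blinfun_compose_assoc)
  also have "(id_blinfun - P i (idx n)) o\<^sub>L \<theta> i k = \<theta> i k o\<^sub>L (id_blinfun - P k (idx n))"
    using Suc.prems by (simp add: blinfun_compose_add P_\<theta>)
  finally show ?case by (simp add: blinfun_compose_assoc)
qed simp

text \<open>Eliminating an index contributes the factor \<open>1 - P i i\<close> to its own
  remainder. By \<open>\<theta>_diag\<close> this annihilates the row of \<open>i\<close>, which
  stays zero afterwards.\<close>

lemma remainder_vanishes:
  assumes i: "idx m \<in> I" "k \<in> I" and n: "m < n"
  shows "remainder n (idx m) o\<^sub>L \<theta> (idx m) k = 0"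
proof -
  let ?i = "idx m"
  have "remainder (Suc m) ?i o\<^sub>L \<theta> ?i k = remainder m ?i o\<^sub>L ((id_blinfun - P ?i ?i) o\<^sub>L \<theta> ?i k)"
    using i by (simp add: blinfun_compose_add remainder_commute_P) (simp add: blinfun_compose_assoc)
  also have "(id_blinfun - P ?i ?i) o\<^sub>L \<theta> ?i k = 0"
    using i by (simp add: blinfun_compose_add P_def \<theta>_diag blinfun_compose_assoc)
  finally have "remainder (Suc m) ?i o\<^sub>L \<theta> ?i k = 0" by simp
  moreover have "remainder n ?i o\<^sub>L \<theta> ?i k = 0 \<Longrightarrow> remainder (Suc n) ?i o\<^sub>L \<theta> ?i k = 0" for n
    by (simp add: blinfun_compose_assoc)
  moreover have "Suc m \<le> n" using n by simp
  ultimately show ?thesis by (rotate_tac 2) (induction n rule: dec_induct, auto)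
qed

text \<open>The entry in row \<open>n\<close> and column \<open>i\<close> of the Cholesky
  factor.\<close>

definition block :: "nat \<Rightarrow> 'i \<Rightarrow> 'k op" where
  "block n i = \<theta> (idx n) i o\<^sub>L remainder n i"

lemma clin_block [simp]: "i \<in> I \<Longrightarrow> clin (block n i)"
  by (simp add: block_def)

text \<open>Step \<open>n\<close> contributes a difference of consecutive remainders, ready for
  telescoping.\<close>

lemma block_product:
  assumes "i \<in> I" "j \<in> I"
  shows "adj (block n i) o\<^sub>L block n j = (remainder n i - remainder (Suc n) i) o\<^sub>L \<theta> i j"
proof -
  let ?r = "remainder n i" and ?n = "idx n"
  have "adj (block n i) o\<^sub>L block n j = ?r o\<^sub>L (\<theta> i ?n o\<^sub>L \<theta> ?n j) o\<^sub>L remainder n j"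
    using assms by (simp add: block_def blinfun_compose_assoc)
  also have "\<dots> = ?r o\<^sub>L P i ?n o\<^sub>L (\<theta> i j o\<^sub>L remainder n j)"
    using assms by (simp add: \<theta>_comp_P blinfun_compose_assoc)
  also have "\<dots> = (?r o\<^sub>L P i ?n o\<^sub>L ?r) o\<^sub>L \<theta> i j"
    using assms by (simp add: remainder_\<theta>[symmetric] blinfun_compose_assoc)
  also have "?r o\<^sub>L P i ?n o\<^sub>L ?r = P i ?n o\<^sub>L ?r"
    using assms by (simp add: remainder_commute_P[symmetric] blinfun_compose_assoc remainder_idem)
  finally show ?thesis by (simp add: blinfun_compose_add)
qed

lemma block_vanishes: "i = idx m \<Longrightarrow> m < n \<Longrightarrow> block n i = 0"
  using arg_cong[OF remainder_vanishes[of m "idx n" n], of adj] by (simp add: block_def)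

text \<open>Column \<open>i\<close> of the Cholesky factor. The sum is finite since the blocks after
  an occurrence of \<open>i\<close> vanish; the enumeration may repeat indices, hence the
  \<open>LEAST\<close>.\<close>

definition factor :: "'i \<Rightarrow> 'k ell2 \<Rightarrow>\<^sub>L (nat \<times> 'k) ell2" where
  "factor i = (\<Sum>n\<le>(LEAST m. idx m = i). index_embedding (Pair n) o\<^sub>L block n i)"

lemma factor_sum:
  assumes "i \<in> I" "(LEAST m. idx m = i) < N"
  shows "factor i = (\<Sum>n<N. index_embedding (Pair n) o\<^sub>L block n i)"
proof -
  obtain m where "idx m = i" using assms(1) range_idx by auto
  then have l: "idx (LEAST m. idx m = i) = i" by (rule LeastI)
  show ?thesis
    unfolding factor_def
    by (rule sum.mono_neutral_left) (use assms(2) block_vanishes[OF l[symmetric]] in auto)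
qed

lemma inj_Pair: "inj (Pair n)"
  by (simp add: inj_on_def)

lemma clin_factor [simp]: "i \<in> I \<Longrightarrow> clin (factor i)"
  unfolding factor_def by (auto simp: inj_Pair)

text \<open>Different rows are orthogonal, so the inner products of blocks with equal row add up;
  the sum telescopes from the identity to a remainder that annihilates
  \<open>\<theta> i j\<close>.\<close>

lemma factor: assumes i: "i \<in> I" and j: "j \<in> I" shows "adj (factor i) o\<^sub>L factor j = \<theta> i j"
proof (rule blinfun_eqI, rule cinner_extI_right)
  fix x y
  define N where "N = Suc (max (LEAST m. idx m = i) (LEAST m. idx m = j))"
  have f: "factor i = (\<Sum>n<N. index_embedding (Pair n) o\<^sub>L block n i)"
    "factor j = (\<Sum>n<N. index_embedding (Pair n) o\<^sub>L block n j)"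
    by (rule factor_sum; use i j in \<open>simp add: N_def less_Suc_eq_le del: sum.lessThan_Suc\<close>)+
  have em: "\<langle>index_embedding (Pair n) v | index_embedding (Pair m) w\<rangle> = (if n = m then \<langle>v | w\<rangle> else 0)"
    for n m :: nat and v w :: "'k ell2"
  proof (cases "n = m")
    case False
    then have "\<langle>index_embedding (Pair n) v | index_embedding (Pair m) w\<rangle> = 0"
      by (intro cinner_eq_0_disjoint) (auto simp: coord_index_embedding[OF inj_Pair])
    then show ?thesis using False by simp
  qed (simp add: cinner_index_embedding[OF inj_Pair])
  have app: "blinfun_apply (sum T F) v = (\<Sum>n\<in>F. blinfun_apply (T n) v)" for T :: "nat \<Rightarrow> 'k ell2 \<Rightarrow>\<^sub>L (nat \<times> 'k) ell2" and F v
    by (rule blinfun.sum_left)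
  have "\<langle>y | (adj (factor i) o\<^sub>L factor j) x\<rangle> = \<langle>factor i y | factor j x\<rangle>"
    using i by (simp add: cinner_adj_right)
  also have "\<dots> = (\<Sum>n<N. \<langle>block n i y | block n j x\<rangle>)"
    unfolding f app by (simp add: cinner_sum_left cinner_sum_right em)
  also have "\<dots> = (\<Sum>n<N. \<langle>y | (adj (block n i) o\<^sub>L block n j) x\<rangle>)"
    using i by (simp add: cinner_adj_right)
  also have "\<dots> = (\<Sum>n<N. \<langle>y | (remainder n i o\<^sub>L \<theta> i j) x\<rangle> - \<langle>y | (remainder (Suc n) i o\<^sub>L \<theta> i j) x\<rangle>)"
    unfolding block_product[OF i j] by (simp add: blinfun_compose_add blinfun.diff_left cinner_diff_right del: remainder.simps)
  also have "\<dots> = \<langle>y | (remainder 0 i o\<^sub>L \<theta> i j) x\<rangle> - \<langle>y | (remainder N i o\<^sub>L \<theta> i j) x\<rangle>"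
    by (rule sum_lessThan_telescope')
  also have "remainder N i o\<^sub>L \<theta> i j = 0"
  proof -
    obtain m where "idx m = i" using i range_idx by auto
    then have l: "idx (LEAST m. idx m = i) = i" by (rule LeastI)
    show ?thesis
      using remainder_vanishes[of "LEAST m. idx m = i" j N] j i unfolding l by (simp add: N_def)
  qed
  finally show "\<langle>y | (adj (factor i) o\<^sub>L factor j) x\<rangle> = \<langle>y | \<theta> i j x\<rangle>" by simp
qed

text \<open>Each value of the difference lies in the sum of two of the ranges and is orthogonal to
  all of them, hence it is zero.\<close>

lemma factor_eqI:
  assumes ij: "i \<in> I" "j \<in> I" and "\<And>k. k \<in> I \<Longrightarrow> \<theta> k i o\<^sub>L A = \<theta> k j o\<^sub>L B"
  shows "factor i o\<^sub>L A = factor j o\<^sub>L B"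
proof (rule blinfun_eqI)
  fix v
  let ?d = "factor i (A v) - factor j (B v)"
  have 0: "adj (factor k) ?d = 0" if k: "k \<in> I" for k
    using arg_cong[OF assms(3)[OF k], of "\<lambda>T. T v"] factor[OF k ij(1), symmetric] factor[OF k ij(2), symmetric]
    by (simp add: blinfun.diff_right)
  have "\<langle>?d | ?d\<rangle> = \<langle>A v | adj (factor i) ?d\<rangle> - \<langle>B v | adj (factor j) ?d\<rangle>"
    using ij by (simp add: cinner_adj_right cinner_diff_left)
  then have "?d = 0" using 0 ij by simp
  then show "(factor i o\<^sub>L A) v = (factor j o\<^sub>L B) v" by simp
qed

end

section \<open>McAlister semigroups\<close>

lemma McAlister_tripleD:
  assumes "McAlister_triple act Y"
  shows "act 0 x = x" "act (g + h) x = act g (act h x)" "x \<le> y \<Longrightarrow> act g x \<le> act g y"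
    "y \<in> Y \<Longrightarrow> x \<le> y \<Longrightarrow> x \<in> Y" "x \<in> Y \<Longrightarrow> y \<in> Y \<Longrightarrow> is_meet x y (meet x y)"
    "\<exists>h. \<exists>y\<in>Y. x = act h y" "\<exists>y\<in>Y. act g y \<in> Y"
proof -
  show "is_meet x y (meet x y)" if xy: "x \<in> Y" "y \<in> Y"
  proof -
    have "\<exists>z. is_meet x y z" using assms xy unfolding McAlister_triple_def by blast
    then obtain z where z: "is_meet x y z" by blast
    have "meet x y = z"
      unfolding meet_def by (rule the_equality) (use z in \<open>auto simp: is_meet_def intro: antisym\<close>)
    then show ?thesis using z by simp
  qed
  have "x \<in> (\<Union>g. act g ` Y)" using assms by (simp add: McAlister_triple_def)
  then show "\<exists>h. \<exists>y\<in>Y. x = act h y" by blast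
  have "act g ` Y \<inter> Y \<noteq> {}" using assms by (simp add: McAlister_triple_def)
  then show "\<exists>y\<in>Y. act g y \<in> Y" by blast
qed (use assms in \<open>auto simp: McAlister_triple_def\<close>)

lemma McAlister_semigroup_simps:
  "s \<in> selems (McAlister_semigroup act Y) \<longleftrightarrow> fst s \<in> Y \<and> act (- snd s) (fst s) \<in> Y"
  "sgmult (McAlister_semigroup act Y) s t = (act (snd s) (meet (act (- snd s) (fst s)) (fst t)), snd s + snd t)"
  by (auto simp: McAlister_semigroup_def case_prod_unfold)

context
  fixes act :: "'g::group_add \<Rightarrow> 'x::order \<Rightarrow> 'x" and Y :: "'x set"
  assumes triple: "McAlister_triple act Y"
begin

lemmas triple_facts = McAlister_tripleD[OF triple]

lemma McAlister_idempotents: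
  "s \<in> idempotents (McAlister_semigroup act Y) \<longleftrightarrow> fst s \<in> Y \<and> snd s = 0"
proof -
  have m: "meet u u = u" if "u \<in> Y" for u
    using triple_facts(5)[OF that that] by (auto simp: is_meet_def intro: antisym)
  have z: "b = 0" if "b + b = b" for b :: 'g using that by (metis add.right_neutral add_left_cancel)
  show ?thesis by (cases s) (auto simp: idempotents_def McAlister_semigroup_simps triple_facts(1) m intro: z)
qed

lemma McAlister_le:
  assumes s: "s \<in> selems (McAlister_semigroup act Y)" and r: "r \<in> selems (McAlister_semigroup act Y)"
  shows "sgle (McAlister_semigroup act Y) r s \<longleftrightarrow> fst r \<le> fst s \<and> snd r = snd s"
proof
  have sY: "fst s \<in> Y" "fst r \<in> Y" using s r by (auto simp: McAlister_semigroup_simps)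
  {
    assume "sgle (McAlister_semigroup act Y) r s"
    then obtain e where e: "fst e \<in> Y" "snd e = 0" "r = sgmult (McAlister_semigroup act Y) e s"
      by (auto simp: sgle_def McAlister_idempotents)
    then show "fst r \<le> fst s \<and> snd r = snd s"
      using triple_facts(5)[OF e(1) sY(1)] by (simp add: McAlister_semigroup_simps triple_facts(1) is_meet_def)
  next
    assume le: "fst r \<le> fst s \<and> snd r = snd s"
    then have "meet (fst r) (fst s) = fst r"
      using triple_facts(5)[OF sY(2,1)] by (auto simp: is_meet_def intro: antisym)
    then have "r = sgmult (McAlister_semigroup act Y) (fst r, 0) s"
      using le by (simp add: McAlister_semigroup_simps triple_facts(1) prod_eq_iff)
    then show "sgle (McAlister_semigroup act Y) r s"
      using sY by (auto simp: sgle_def McAlister_idempotents)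
  }
qed

text \<open>Two elements over the same group element have a common lower bound, given by the meet of
  their first components; so the classes are the fibres of \<open>snd\<close>.\<close>

lemma McAlister_sigma:
  "(s, s') \<in> sigma_rel (McAlister_semigroup act Y) \<longleftrightarrow>
    s \<in> selems (McAlister_semigroup act Y) \<and> s' \<in> selems (McAlister_semigroup act Y) \<and> snd s = snd s'"
proof -
  have "\<exists>r\<in>selems (McAlister_semigroup act Y). fst r \<le> fst s \<and> snd r = snd s \<and> fst r \<le> fst s' \<and> snd r = snd s'"
    if s: "s \<in> selems (McAlister_semigroup act Y)" "s' \<in> selems (McAlister_semigroup act Y)" "snd s = snd s'"
  proof -
    have Y: "fst s \<in> Y" "fst s' \<in> Y" "act (- snd s) (fst s) \<in> Y"
      using s(1,2) by (auto simp: McAlister_semigroup_simps)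
    let ?z = "meet (fst s) (fst s')"
    have z: "?z \<le> fst s" "?z \<le> fst s'" using triple_facts(5)[OF Y(1,2)] by (auto simp: is_meet_def)
    have "(?z, snd s) \<in> selems (McAlister_semigroup act Y)"
      using triple_facts(4)[OF Y(1) z(1)] triple_facts(4)[OF Y(3) triple_facts(3)[OF z(1)]] by (simp add: McAlister_semigroup_simps)
    then show ?thesis using z s(3) by (intro bexI[of _ "(?z, snd s)"]) auto
  qed
  then show ?thesis unfolding sigma_rel_def by (auto simp: McAlister_le)
qed

text \<open>For the idempotents \<open>(u, 0)\<close> and \<open>(v, 0)\<close>, the set
  \<open>?D\<close> consists of the \<open>(w, g)\<close> with \<open>w \<le> u\<close> and
  \<open>w \<le> act g v\<close>, so its maximum is a meet of \<open>u\<close> and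
  \<open>act g v\<close>. Any two elements of \<open>X\<close> are simultaneous translates of such a
  pair.\<close>

lemma F_inverse_meets:
  assumes F: "F_inverse (McAlister_semigroup act Y)"
  shows "\<exists>z. is_meet (x::'x) y z"
proof -
  let ?S = "McAlister_semigroup act Y"
  have inv: "act (- k) (act k x) = x" "act k (act (- k) x) = x" for k x
    by (simp_all add: triple_facts(1) flip: triple_facts(2))
  have main: "\<exists>z. is_meet u (act g v) z" if u: "u \<in> Y" and v: "v \<in> Y" for u v g
  proof -
    \<comment> \<open>An element over \<open>g\<close> is needed to name the class of
      \<open>g\<close>.\<close>
    obtain a where a: "a \<in> Y" "act g a \<in> Y" using triple_facts(7) by blast
    let ?s0 = "(act g a, g)"
    have s0: "?s0 \<in> selems ?S" using a by (simp add: McAlister_semigroup_simps inv)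
    let ?C = "sigma_rel ?S `` {?s0}"
    have C: "s \<in> ?C \<longleftrightarrow> s \<in> selems ?S \<and> snd s = g" for s
      using s0 by (auto simp: McAlister_sigma)
    have e: "(u, 0) \<in> idempotents ?S" "(v, 0) \<in> idempotents ?S"
      using u v by (auto simp: McAlister_idempotents)
    let ?D = "?C \<inter> {sgmult ?S (sgmult ?S (u, 0) s) (v, 0) | s. s \<in> selems ?S}"
    have "\<exists>m\<in>?D. \<forall>r\<in>?D. sgle ?S r m"
      using F quotientI[OF s0, of "sigma_rel ?S"] e unfolding F_inverse_def Let_def by blast
    then obtain m where m: "m \<in> ?D" "\<And>r. r \<in> ?D \<Longrightarrow> sgle ?S r m" by blast
    have mS: "m \<in> selems ?S" "snd m = g" using m(1) C by blast+
    obtain s where s: "s \<in> selems ?S" "m = sgmult ?S (sgmult ?S (u, 0) s) (v, 0)" using m(1) by blast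
    have sg: "snd s = g" using s(2) mS(2) by (simp add: McAlister_semigroup_simps)
    have sY: "fst s \<in> Y" "act (- g) (fst s) \<in> Y" using s(1) sg by (auto simp: McAlister_semigroup_simps)
    have us: "meet u (fst s) \<le> u" "meet u (fst s) \<le> fst s" using triple_facts(5)[OF u sY(1)] by (auto simp: is_meet_def)
    have uY: "act (- g) (meet u (fst s)) \<in> Y" by (rule triple_facts(4)[OF sY(2) triple_facts(3)[OF us(2)]])
    have fm: "fst m = act g (meet (act (- g) (meet u (fst s))) v)"
      unfolding s(2) by (simp add: McAlister_semigroup_simps sg triple_facts(1))
    have mv: "meet (act (- g) (meet u (fst s))) v \<le> act (- g) (meet u (fst s))"
      "meet (act (- g) (meet u (fst s))) v \<le> v" using triple_facts(5)[OF uY v] by (auto simp: is_meet_def)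
    have "fst m \<le> u" using triple_facts(3)[OF mv(1), of g] us(1) unfolding fm inv by (rule order_trans)
    moreover have "fst m \<le> act g v" unfolding fm by (rule triple_facts(3)[OF mv(2)])
    moreover have "w \<le> fst m" if w: "w \<le> u" "w \<le> act g v" for w
    proof -
      have w': "act (- g) w \<le> v" using triple_facts(3)[OF w(2), of "- g"] by (simp add: inv)
      have wY: "w \<in> Y" "act (- g) w \<in> Y" using triple_facts(4)[OF u w(1)] triple_facts(4)[OF v w'] .
      have wS: "(w, g) \<in> selems ?S" using wY by (simp add: McAlister_semigroup_simps)
      have "meet u w = w" using triple_facts(5)[OF u wY(1)] w(1) by (auto simp: is_meet_def intro: antisym)
      moreover have "meet (act (- g) w) v = act (- g) w"
        using triple_facts(5)[OF wY(2) v] w' by (auto simp: is_meet_def intro: antisym)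
      ultimately have "(w, g) = sgmult ?S (sgmult ?S (u, 0) (w, g)) (v, 0)"
        by (simp add: McAlister_semigroup_simps triple_facts(1) inv)
      then have "(w, g) \<in> ?D" using wS C[of "(w, g)"] by fastforce
      then have "sgle ?S (w, g) m" by (rule m(2))
      then show ?thesis using McAlister_le[OF mS(1) wS] by simp
    qed
    ultimately show ?thesis by (auto simp: is_meet_def)
  qed
  obtain k u where x: "u \<in> Y" "x = act k u" using triple_facts(6) by blast
  obtain l v where y: "v \<in> Y" "y = act l v" using triple_facts(6) by blast
  \<comment> \<open>Translation by \<open>- k\<close> brings \<open>x\<close> into \<open>Y\<close>,
    where the previous case applies.\<close>
  obtain z where z: "is_meet u (act (- k + l) v) z" using main[OF x(1) y(1)] by blast
  have act_le: "act k p \<le> q" if "p \<le> act (- k) q" for p q using triple_facts(3)[OF that, of k] by (simp add: inv)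
  have y': "act (- k + l) v = act (- k) y" "u = act (- k) x" by (simp_all add: x y triple_facts(2) inv)
  have "is_meet x y (act k z)"
    unfolding is_meet_def
  proof (intro conjI allI impI)
    show "act k z \<le> x" "act k z \<le> y" using z by (auto simp: is_meet_def y' intro: act_le)
    fix w assume "w \<le> x \<and> w \<le> y"
    then have "act (- k) w \<le> z" using z unfolding is_meet_def y' by (blast intro: triple_facts(3))
    then show "w \<le> act k z" using triple_facts(3)[of "act (- k) w" z k] by (simp add: inv)
  qed
  then show ?thesis by blast
qed

text \<open>Every group element occurs as a second component because \<open>Y\<close> meets all of
  its translates, and \<open>X\<close> is the union of the countably many translates of
  \<open>Y\<close>.\<close>

lemma McAlister_countable:
  assumes c: "countable (selems (McAlister_semigroup act Y))"
  shows "countable (UNIV :: 'g set)" "countable (UNIV :: 'x set)"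
proof -
  let ?S = "McAlister_semigroup act Y"
  have "g \<in> snd ` selems ?S" for g
  proof -
    obtain y where y: "y \<in> Y" "act g y \<in> Y" using triple_facts(7) by blast
    then have "(act g y, g) \<in> selems ?S" by (simp add: McAlister_semigroup_simps triple_facts(1) flip: triple_facts(2))
    then show ?thesis by force
  qed
  then have "snd ` selems ?S = UNIV" by blast
  then show g: "countable (UNIV :: 'g set)" using countable_image[OF c, of snd] by simp
  have "y \<in> fst ` selems ?S" if "y \<in> Y" for y
    using that by (intro image_eqI[of _ _ "(y, 0)"]) (auto simp: McAlister_semigroup_simps triple_facts(1))
  then have "countable Y" using countable_image[OF c, of fst] countable_subset by (metis subsetI)
  then have "countable (\<Union>g\<in>UNIV. act g ` Y)" using g by (intro countable_UN countable_image)
  moreover have "(\<Union>g\<in>UNIV. act g ` Y) = UNIV" using triple_facts(6) by blast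
  ultimately show "countable (UNIV :: 'x set)" by simp
qed

end

locale McAlister = countable_semilattice_action act
  for act :: "'g::group_add \<Rightarrow> 'x::order \<Rightarrow> 'x" +
  fixes Y :: "'x set"
  assumes downset: "y \<in> Y \<Longrightarrow> x \<le> y \<Longrightarrow> x \<in> Y"
    and covering: "\<exists>h. \<exists>y\<in>Y. x = act h y"
    and meets_Y: "\<exists>y\<in>Y. act g y \<in> Y"
begin

abbreviation "S \<equiv> McAlister_semigroup act Y"

lemma selems_S: "s \<in> selems S \<longleftrightarrow> fst s \<in> Y \<and> act (- snd s) (fst s) \<in> Y"
  by (rule McAlister_semigroup_simps)

lemma sgmult_S [simp]: "sgmult S s t = pair_mul s t"
  by (simp add: McAlister_semigroup_simps pair_mul_def act_meet)

lemma pair_mul_S: "s \<in> selems S \<Longrightarrow> t \<in> selems S \<Longrightarrow> pair_mul s t \<in> selems S"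
proof -
  assume s: "s \<in> selems S" "t \<in> selems S"
  have "act (- (snd s + snd t)) (act (snd s) (fst t)) = act (- snd t) (fst t)"
    by (simp only: minus_add act_add act_cancel)
  then have "act (- (snd s + snd t)) (meet (fst s) (act (snd s) (fst t))) \<le> act (- snd t) (fst t)"
    using act_mono[OF meet_lower(2)] by metis
  then show ?thesis
    using s downset[of "fst s" "meet (fst s) (act (snd s) (fst t))"] downset[of "act (- snd t) (fst t)"]
    by (simp add: selems_S pair_mul_def meet_lower)
qed

lemma pair_inv_S: "s \<in> selems S \<Longrightarrow> pair_inv s \<in> selems S"
  by (simp add: selems_S pair_inv_def)

lemma pair_inv_mul: "pair_mul (pair_mul s (pair_inv s)) s = s" "pair_inv (pair_inv s) = s"
  by (simp_all add: pair_mul_def pair_inv_def)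

lemma sginv_S: "s \<in> selems S \<Longrightarrow> sginv S s = pair_inv s"
  unfolding sginv_def
proof (rule the_equality)
  assume s: "s \<in> selems S"
  show "pair_inv s \<in> selems S \<and> sgmult S (sgmult S s (pair_inv s)) s = s \<and>
      sgmult S (sgmult S (pair_inv s) s) (pair_inv s) = pair_inv s"
    using pair_inv_S[OF s] pair_inv_mul(1)[of s] pair_inv_mul(1)[of "pair_inv s"] by (simp add: pair_inv_mul(2))
  fix t assume "t \<in> selems S \<and> sgmult S (sgmult S s t) s = s \<and> sgmult S (sgmult S t s) t = t"
  then have 1: "pair_mul (pair_mul s t) s = s" and 2: "pair_mul (pair_mul t s) t = t" by auto
  have g: "snd t = - snd s"
  proof -
    have "snd s + (snd t + snd s) = snd s" using arg_cong[OF 1, of snd] by (simp add: pair_mul_def add.assoc)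
    then show ?thesis by (metis add.right_neutral add_left_cancel eq_neg_iff_add_eq_0)
  qed
  have "fst s \<le> act (snd s) (fst t)" using arg_cong[OF 1, of fst] by (simp add: pair_mul_def g) (metis meet_lower order_trans)
  moreover have "fst t \<le> act (- snd s) (fst s)" using arg_cong[OF 2, of fst] by (simp add: pair_mul_def g) (metis meet_lower order_trans)
  ultimately have "fst t = act (- snd s) (fst s)" by (simp add: act_le_iff' order_antisym)
  then show "t = pair_inv s" using g by (simp add: pair_inv_def prod_eq_iff)
qed

lemma S_reps_iff: "\<pi> \<in> semigroup_reps S \<longleftrightarrow>
    (\<forall>s\<in>selems S. clin (\<pi> s)) \<and> (\<forall>s\<in>selems S. \<forall>t\<in>selems S. \<pi> (pair_mul s t) = \<pi> s o\<^sub>L \<pi> t) \<and>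
    (\<forall>s\<in>selems S. \<pi> (pair_inv s) = adj (\<pi> s))"
  by (auto simp: semigroup_reps_iff sginv_S)

lemma pair_op_S_rep: "(\<rho>, U) \<in> cov_pairs \<Longrightarrow> pair_op \<rho> U \<in> semigroup_reps S"
  by (simp add: S_reps_iff pair_op)

lemma countable_S: "countable (selems S)"
  using countable_SIGMA[OF countable_X, of "\<lambda>_. UNIV :: 'g set"] countable_G
  by (simp add: countable_subset[OF subset_UNIV])

end

section \<open>Dilation of representations to covariant pairs\<close>

text \<open>The index type is countable so that the ranges of all factors are spanned by a sequence,
  to which the Gram-Schmidt tools apply.\<close>

locale McAlister_rep = McAlister act Y
  for act :: "'g::group_add \<Rightarrow> 'x::order \<Rightarrow> 'x" and Y +
  fixes \<rho> :: "'x \<times> 'g \<Rightarrow> 'k op"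
  assumes \<rho>: "\<rho> \<in> semigroup_reps S" and countable_k: "countable (UNIV :: 'k set)"
begin

definition translate :: "'x \<times> 'g \<Rightarrow> 'x \<times> 'g \<Rightarrow> 'x \<times> 'g" where
  "translate i j = (meet (fst i) (act (- snd i + snd j) (fst j)), - snd i + snd j)"

abbreviation I :: "('x \<times> 'g) set" where "I \<equiv> Y \<times> UNIV"

abbreviation kernel :: "'x \<times> 'g \<Rightarrow> 'x \<times> 'g \<Rightarrow> 'k op" where
  "kernel i j \<equiv> \<rho> (translate i j)"

lemma rep: "s \<in> selems S \<Longrightarrow> clin (\<rho> s)"
  "s \<in> selems S \<Longrightarrow> t \<in> selems S \<Longrightarrow> \<rho> s o\<^sub>L \<rho> t = \<rho> (pair_mul s t)"
  "s \<in> selems S \<Longrightarrow> adj (\<rho> s) = \<rho> (pair_inv s)"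
  using \<rho> unfolding S_reps_iff by simp_all

lemma translate_S: "i \<in> I \<Longrightarrow> j \<in> I \<Longrightarrow> translate i j \<in> selems S"
proof -
  assume ij: "i \<in> I" "j \<in> I"
  have "meet (fst i) (act (- snd i + snd j) (fst j)) \<le> fst i"
    "act (- (- snd i + snd j)) (meet (fst i) (act (- snd i + snd j) (fst j))) \<le> fst j"
    by (simp_all only: act_le_iff' meet_lower)
  with ij show ?thesis unfolding selems_S translate_def by (auto intro: downset)
qed

lemma cancel_middle [simp]: "a + b + (- b + c) = a + c" "- b + c + (- c + d) = - b + d" for a b c d :: 'g
  by (simp_all add: add.assoc add_minus_cancel)

lemma translate_inv: "pair_inv (translate i j) = translate j i"
  by (simp add: translate_def pair_inv_def minus_add act_meet meet.inf.commute flip: act_add)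

lemma translate_mul: "pair_mul (translate i j) (translate j k) =
    (meet (meet (fst i) (act (- snd i + snd j) (fst j))) (act (- snd i + snd k) (fst k)), - snd i + snd k)"
  by (simp add: translate_def pair_mul_def act_meet meet.inf.assoc meet.inf.left_idem flip: act_add)

lemma translate_mul_inv: "pair_mul (translate i j) (translate j i) = (meet (fst i) (act (- snd i + snd j) (fst j)), 0)"
  by (simp add: translate_mul meet.inf.absorb1 meet.inf.coboundedI1)

lemma translate_mul_mul:
  "pair_mul (pair_mul (translate i j) (translate j i)) (translate i k) = pair_mul (translate i j) (translate j k)"
  unfolding translate_mul_inv translate_mul
  by (simp add: translate_def pair_mul_def meet.inf_aci)

lemma zero_S: "y \<in> Y \<Longrightarrow> (y, 0) \<in> selems S"
  by (simp add: selems_S)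

definition idx :: "nat \<Rightarrow> 'x \<times> 'g" where "idx = from_nat_into I"

lemma I_nonempty: "I \<noteq> {}"
  using meets_Y by blast

lemma range_idx: "range idx = I"
  unfolding idx_def
  by (rule range_from_nat_into[OF I_nonempty]) (intro countable_SIGMA countable_G countable_subset[OF subset_UNIV countable_X])

sublocale partial_isometry_kernel kernel I idx
proof
  fix i j k :: "'x \<times> 'g"
  assume i: "i \<in> I" and j: "j \<in> I"
  note S = translate_S pair_mul_S
  show "clin (kernel i j)" by (intro rep S i j)
  show "adj (kernel i j) = kernel j i" using i j by (simp add: rep S translate_inv)
  have "pair_mul (translate i i) (translate i j) = translate i j"
    by (simp add: translate_mul) (simp add: translate_def)
  then show "kernel i i o\<^sub>L kernel i j = kernel i j" using i j by (simp add: rep S)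
  assume k: "k \<in> I"
  show "kernel i j o\<^sub>L kernel j k = kernel i j o\<^sub>L kernel j i o\<^sub>L kernel i k"
    using i j k by (simp add: rep(2) S translate_mul_mul)
  have "pair_mul (x, 0) (y, 0) = pair_mul (y, 0) (x, 0)" for x y
    by (simp add: pair_mul_def meet.inf.commute)
  then show "(kernel i j o\<^sub>L kernel j i) o\<^sub>L (kernel i k o\<^sub>L kernel k i) =
      (kernel i k o\<^sub>L kernel k i) o\<^sub>L (kernel i j o\<^sub>L kernel j i)"
    using i j k by (simp add: rep(2) S) (simp add: translate_mul_inv)
qed (rule range_idx)

text \<open>\<open>P i j\<close> is the initial projection of \<open>kernel j i\<close>. So
  \<open>factor i\<close> agrees on this initial space with \<open>factor j\<close> after
  \<open>kernel j i\<close>: the ranges of the factors overlap as the kernel prescribes.\<close>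

lemma factor_kernel:
  assumes i: "i \<in> I" and j: "j \<in> I"
  shows "factor j o\<^sub>L kernel j i = factor i o\<^sub>L P i j"
  by (rule factor_eqI) (use i j in \<open>simp_all add: \<theta>_comp_P P_\<theta>\<close>)

text \<open>The projection depends on \<open>j\<close> only through
  \<open>act (snd j) (fst j)\<close>, which is what allows \<open>proj\<close> to be indexed by
  elements of \<open>X\<close>.\<close>

lemma P_eq: "i \<in> I \<Longrightarrow> j \<in> I \<Longrightarrow> P i j = \<rho> (meet (fst i) (act (- snd i + snd j) (fst j)), 0)"
  by (simp add: P_def rep(2) translate_S translate_mul_inv)

definition basis :: "nat \<Rightarrow> ('x \<times> 'g) \<times> 'k" where "basis = from_nat_into (I \<times> UNIV)"

lemma range_basis: "range basis = I \<times> UNIV"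
  unfolding basis_def
  by (rule range_from_nat_into)
    (use I_nonempty in \<open>auto intro!: countable_SIGMA countable_G countable_k countable_subset[OF subset_UNIV countable_X]\<close>)

lemma basis_in [simp]: "fst (basis n) \<in> I"
  using range_basis by (metis SigmaE fst_conv rangeI)

lemma ex_basis: "i \<in> I \<Longrightarrow> \<exists>n. basis n = (i, k)"
  using range_basis by (metis SigmaI UNIV_I rangeE)

lemma orthogonal_factors:
  assumes "i \<in> I" and 0: "\<And>n. \<langle>factor (fst (basis n)) (ell2_delta (snd (basis n))) | x\<rangle> = 0"
  shows "adj (factor i) x = 0"
proof (rule ell2_eqI)
  fix k
  obtain n where "basis n = (i, k)" using ex_basis assms by blast
  then have "\<langle>ell2_delta k | adj (factor i) x\<rangle> = 0"
    using 0[of n] assms(1) by (simp add: cinner_adj_right)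
  then show "ell2_coord (adj (factor i) x) k = ell2_coord 0 k" by (simp add: cinner_delta)
qed

text \<open>Identities for the dilation are verified on the ranges of the factors, where they become
  identities of the kernel, and on the common orthogonal complement.\<close>

lemma factor_ops_agree:
  fixes T T' :: "(nat \<times> 'k) ell2 \<Rightarrow>\<^sub>L 'j ell2"
  assumes "clin T" "clin T'" and f: "\<And>i. i \<in> I \<Longrightarrow> T o\<^sub>L factor i = T' o\<^sub>L factor i"
    and 0: "\<And>x. (\<And>i. i \<in> I \<Longrightarrow> adj (factor i) x = 0) \<Longrightarrow> T x = T' x"
  shows "T = T'"
proof (rule clin_ops_agree[where u = "\<lambda>n. factor (fst (basis n)) (ell2_delta (snd (basis n)))"])
  show "T (factor (fst (basis n)) (ell2_delta (snd (basis n)))) = T' (factor (fst (basis n)) (ell2_delta (snd (basis n))))" for n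
    using arg_cong[OF f[OF basis_in], of "\<lambda>T. T (ell2_delta (snd (basis n)))" n] by simp
  show "T x = T' x" if "\<And>n. \<langle>factor (fst (basis n)) (ell2_delta (snd (basis n))) | x\<rangle> = 0" for x
    by (rule 0) (rule orthogonal_factors[OF _ that])
qed fact+

section \<open>The unitary representation of the group\<close>

definition shift :: "'g \<Rightarrow> 'x \<times> 'g \<Rightarrow> 'x \<times> 'g" where "shift g i = (fst i, g + snd i)"

lemma shift_simps [simp]: "shift g i \<in> I \<longleftrightarrow> i \<in> I" "shift g (shift h i) = shift (g + h) i"
  "shift 0 i = i" "fst (shift g i) = fst i" "snd (shift g i) = g + snd i"
  by (auto simp: shift_def add.assoc mem_Times_iff)

lemma translate_shift: "translate (shift g i) (shift g j) = translate i j"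
proof -
  have "- (g + snd i) + (g + snd j) = - snd i + snd j"
    by (simp only: minus_add add.assoc) (simp flip: add.assoc)
  then show ?thesis by (simp add: translate_def)
qed

definition is_unitary_shift :: "'g \<Rightarrow> (nat \<times> 'k) op \<Rightarrow> bool" where
  "is_unitary_shift g U \<longleftrightarrow> clin U \<and>
    (\<forall>i\<in>I. U o\<^sub>L factor i = factor (shift g i) \<and> adj U o\<^sub>L factor i = factor (shift (- g) i)) \<and>
    (\<forall>x. (\<forall>i\<in>I. adj (factor i) x = 0) \<longrightarrow> U x = x \<and> adj U x = x)"

text \<open>The kernel depends on the group components only through \<open>- snd i + snd j\<close>,
  so a shift leaves the Gram matrix of the spanning vectors unchanged, and
  \<open>partial_isometry_of_gram\<close> applies.\<close>

lemma ex_partial_shift: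
  "\<exists>V. clin V \<and>
    (\<forall>i\<in>I. V o\<^sub>L factor i = factor (shift g i) \<and> adj V o\<^sub>L factor i = factor (shift (- g) i)) \<and>
    (\<forall>x. (\<forall>i\<in>I. adj (factor i) x = 0) \<longrightarrow> V x = 0 \<and> adj V x = 0)"
proof -
  define a where "a n = factor (fst (basis n)) (ell2_delta (snd (basis n)))" for n
  define b where "b n = factor (shift g (fst (basis n))) (ell2_delta (snd (basis n)))" for n
  have "\<langle>factor i v | factor j w\<rangle> = \<langle>v | kernel i j w\<rangle>" if "i \<in> I" "j \<in> I" for i j v w
    using that by (simp add: cinner_adj_right flip: factor)
  then have gram: "\<langle>a m | a n\<rangle> = \<langle>b m | b n\<rangle>" for m n by (simp add: a_def b_def translate_shift)
  obtain V :: "(nat \<times> 'k) op" where V: "clin V" "\<And>n. V (a n) = b n" "\<And>x. (\<And>n. \<langle>a n | x\<rangle> = 0) \<Longrightarrow> V x = 0"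
    "\<And>n. adj V (b n) = a n" "\<And>x. (\<And>n. \<langle>b n | x\<rangle> = 0) \<Longrightarrow> adj V x = 0"
    using partial_isometry_of_gram[of a b, OF gram] by blast
  have 1: "V o\<^sub>L factor i = factor (shift g i)" if i: "i \<in> I" for i
  proof (rule clin_eqI)
    fix k
    obtain n where "basis n = (i, k)" using ex_basis i by blast
    then show "(V o\<^sub>L factor i) (ell2_delta k) = factor (shift g i) (ell2_delta k)" using V(2)[of n] by (simp add: a_def b_def)
  qed (use V(1) i in auto)
  have 2: "adj V o\<^sub>L factor (shift g i) = factor i" if i: "i \<in> I" for i
  proof (rule clin_eqI)
    fix k
    obtain n where "basis n = (i, k)" using ex_basis i by blast
    then show "(adj V o\<^sub>L factor (shift g i)) (ell2_delta k) = factor i (ell2_delta k)" using V(4)[of n] by (simp add: a_def b_def)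
  qed (use V(1) i in auto)
  have 3: "\<langle>factor i v | x\<rangle> = 0" if "\<forall>i\<in>I. adj (factor i) x = 0" "i \<in> I" for i x v
    using bspec[OF that] cinner_adj_right[OF clin_factor[OF that(2)], of v x] by simp
  have "V x = 0 \<and> adj V x = 0" if "\<forall>i\<in>I. adj (factor i) x = 0" for x
    using V(3,5) 3[OF that] by (simp add: a_def b_def)
  moreover have "adj V o\<^sub>L factor i = factor (shift (- g) i)" if "i \<in> I" for i
    using 2[of "shift (- g) i"] that by simp
  ultimately show ?thesis using V(1) 1 by blast
qed

lemma ex_unitary_shift: "\<exists>U. is_unitary_shift g U"
proof -
  obtain V where V: "clin V" "\<And>i. i \<in> I \<Longrightarrow> V o\<^sub>L factor i = factor (shift g i)"
      "\<And>i. i \<in> I \<Longrightarrow> adj V o\<^sub>L factor i = factor (shift (- g) i)"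
      "\<And>x. \<forall>i\<in>I. adj (factor i) x = 0 \<Longrightarrow> V x = 0" "\<And>x. \<forall>i\<in>I. adj (factor i) x = 0 \<Longrightarrow> adj V x = 0"
    using ex_partial_shift[of g] by blast
  \<comment> \<open>The shift by 0 is the projection onto the closed span of the ranges; adding its
    complement extends \<open>V\<close> to a unitary.\<close>
  obtain Q where Q: "clin Q" "\<And>i. i \<in> I \<Longrightarrow> Q o\<^sub>L factor i = factor (shift 0 i)"
      "\<And>i. i \<in> I \<Longrightarrow> adj Q o\<^sub>L factor i = factor (shift (- 0) i)"
      "\<And>x. \<forall>i\<in>I. adj (factor i) x = 0 \<Longrightarrow> Q x = 0" "\<And>x. \<forall>i\<in>I. adj (factor i) x = 0 \<Longrightarrow> adj Q x = 0"
    using ex_partial_shift[of 0] by blast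
  have "is_unitary_shift g (V + (id_blinfun - Q))"
    unfolding is_unitary_shift_def using V Q by (auto simp: blinfun_compose_add blinfun.add_left blinfun.diff_left)
  then show ?thesis by blast
qed

definition unitary :: "'g \<Rightarrow> (nat \<times> 'k) op" where "unitary g = (SOME U. is_unitary_shift g U)"

lemma unitary:
  shows clin_unitary [simp]: "clin (unitary g)"
    and unitary_factor: "i \<in> I \<Longrightarrow> unitary g o\<^sub>L factor i = factor (shift g i)"
    and adj_unitary_factor: "i \<in> I \<Longrightarrow> adj (unitary g) o\<^sub>L factor i = factor (shift (- g) i)"
    and unitary_orthogonal: "(\<And>i. i \<in> I \<Longrightarrow> adj (factor i) x = 0) \<Longrightarrow> unitary g x = x"
    and adj_unitary_orthogonal: "(\<And>i. i \<in> I \<Longrightarrow> adj (factor i) x = 0) \<Longrightarrow> adj (unitary g) x = x"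
proof -
  have "is_unitary_shift g (unitary g)" for g
    unfolding unitary_def by (rule someI_ex[OF ex_unitary_shift])
  note u = this[unfolded is_unitary_shift_def]
  show "clin (unitary g)" "i \<in> I \<Longrightarrow> unitary g o\<^sub>L factor i = factor (shift g i)"
    "i \<in> I \<Longrightarrow> adj (unitary g) o\<^sub>L factor i = factor (shift (- g) i)"
    using u by blast+
  show "(\<And>i. i \<in> I \<Longrightarrow> adj (factor i) x = 0) \<Longrightarrow> unitary g x = x"
    "(\<And>i. i \<in> I \<Longrightarrow> adj (factor i) x = 0) \<Longrightarrow> adj (unitary g) x = x"
    using u by blast+
qed

lemma unitary_reps: "unitary \<in> unitary_reps"
  unfolding unitary_reps_iff
proof (intro conjI allI)
  show "unitary 0 = id_blinfun"
    by (rule factor_ops_agree) (simp_all add: unitary_factor unitary_orthogonal)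
  show "adj (unitary g) = unitary (- g)" for g
    by (rule factor_ops_agree) (simp_all add: unitary_factor unitary_orthogonal adj_unitary_factor adj_unitary_orthogonal)
  show "unitary (g + h) = unitary g o\<^sub>L unitary h" for g h
    by (rule factor_ops_agree) (simp_all add: blinfun_compose_assoc unitary_factor unitary_orthogonal)
qed simp

section \<open>The projections attached to the elements of X\<close>

definition cover :: "'x \<Rightarrow> 'x \<times> 'g" where "cover x = (SOME j. j \<in> I \<and> act (snd j) (fst j) = x)"

lemma cover: "cover x \<in> I" "act (snd (cover x)) (fst (cover x)) = x"
proof -
  obtain h y where "y \<in> Y" "x = act h y" using covering by blast
  then have "\<exists>j. j \<in> I \<and> act (snd j) (fst j) = x" by (intro exI[of _ "(y, h)"]) simp
  from someI_ex[OF this] show "cover x \<in> I" "act (snd (cover x)) (fst (cover x)) = x"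
    unfolding cover_def by blast+
qed

text \<open>The range projection of \<open>factor (cover x)\<close>. By \<open>factor_factor\<close>
  its effect on the ranges of the factors depends on \<open>x\<close> alone, so any other pair
  covering \<open>x\<close> yields the same projection.\<close>

definition proj :: "'x \<Rightarrow> (nat \<times> 'k) op" where
  "proj x = factor (cover x) o\<^sub>L adj (factor (cover x))"

lemma clin_proj [simp]: "clin (proj x)" and adj_proj: "adj (proj x) = proj x"
  using cover(1)[of x] by (simp_all add: proj_def)

lemma proj_orthogonal: "(\<And>i. i \<in> I \<Longrightarrow> adj (factor i) v = 0) \<Longrightarrow> proj x v = 0"
  by (simp add: proj_def cover)

lemma factor_factor: "i \<in> I \<Longrightarrow> j \<in> I \<Longrightarrow> act (snd j) (fst j) = x \<Longrightarrow>
    factor j o\<^sub>L adj (factor j) o\<^sub>L factor i = factor i o\<^sub>L \<rho> (meet (fst i) (act (- snd i) x), 0)"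
  by (simp add: blinfun_compose_assoc factor factor_kernel P_eq flip: act_add)
    (simp add: act_add)

lemma proj_factor: "i \<in> I \<Longrightarrow> proj x o\<^sub>L factor i = factor i o\<^sub>L \<rho> (meet (fst i) (act (- snd i) x), 0)"
  unfolding proj_def by (rule factor_factor) (rule cover | assumption)+

lemma proj_Y: assumes x: "x \<in> Y" shows "proj x = factor (x, 0) o\<^sub>L adj (factor (x, 0))"
  by (rule factor_ops_agree)
    (use x in \<open>simp_all add: proj_factor factor_factor proj_orthogonal\<close>)

lemma proj_reps: "proj \<in> semigroup_reps meet_semigroup"
  unfolding meet_reps_iff
proof (intro conjI allI)
  fix x y
  show "proj (meet x y) = proj x o\<^sub>L proj y"
  proof (rule factor_ops_agree)
    fix i assume i: "i \<in> I"
    have z: "(meet (fst i) u, 0) \<in> selems S" for u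
      using i by (intro zero_S) (auto intro: downset meet_lower)
    have "proj x o\<^sub>L proj y o\<^sub>L factor i =
        factor i o\<^sub>L (\<rho> (meet (fst i) (act (- snd i) x), 0) o\<^sub>L \<rho> (meet (fst i) (act (- snd i) y), 0))"
      using i by (simp add: blinfun_compose_assoc proj_factor) (simp add: proj_factor flip: blinfun_compose_assoc)
    also have "\<dots> = proj (meet x y) o\<^sub>L factor i"
    proof -
      have "meet (meet (fst i) a) (meet (fst i) b) = meet (fst i) (meet a b)" for a b
        by (simp add: meet.inf_aci)
      then show ?thesis using i z by (simp add: proj_factor rep(2) pair_mul_def act_meet)
    qed
    finally show "proj (meet x y) o\<^sub>L factor i = proj x o\<^sub>L proj y o\<^sub>L factor i" by simp
  qed (simp_all add: proj_orthogonal)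
qed (simp_all add: adj_proj)

lemma cov_pair: "(proj, unitary) \<in> cov_pairs"
  unfolding cov_pairs_def
proof (clarsimp simp: proj_reps unitary_reps)
  fix g x
  show "unitary g o\<^sub>L proj x o\<^sub>L unitary (- g) = proj (act g x)"
  proof (rule factor_ops_agree)
    fix i assume i: "i \<in> I"
    let ?p = "\<rho> (meet (fst i) (act (- snd i) (act g x)), 0)"
    have "- (- g + snd i) = - snd i + g" by (simp only: minus_add minus_minus)
    then have "proj x o\<^sub>L factor (shift (- g) i) = factor (shift (- g) i) o\<^sub>L ?p"
      using i by (simp add: proj_factor flip: act_add)
    then have "unitary g o\<^sub>L proj x o\<^sub>L unitary (- g) o\<^sub>L factor i = unitary g o\<^sub>L (factor (shift (- g) i) o\<^sub>L ?p)"
      using i by (simp add: blinfun_compose_assoc unitary_factor)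
    also have "\<dots> = (unitary g o\<^sub>L factor (shift (- g) i)) o\<^sub>L ?p" by (rule blinfun_compose_assoc[symmetric])
    also have "\<dots> = proj (act g x) o\<^sub>L factor i"
      using i unitary_factor[of "shift (- g) i" g] by (simp add: proj_factor)
    finally show "unitary g o\<^sub>L proj x o\<^sub>L unitary (- g) o\<^sub>L factor i = proj (act g x) o\<^sub>L factor i" .
  qed (simp_all add: unitary_orthogonal proj_orthogonal)
qed

lemma pair_op_factor:
  assumes s: "s \<in> selems S" and y: "y \<in> Y"
  shows "pair_op proj unitary s o\<^sub>L factor (y, 0) = factor (fst s, 0) o\<^sub>L \<rho> s o\<^sub>L \<rho> (y, 0)"
proof -
  have sY: "fst s \<in> Y" using s by (simp add: selems_S)
  have "translate (fst s, 0) (y, snd s) = pair_mul s (y, 0)" by (simp add: translate_def pair_mul_def)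
  then have "adj (factor (fst s, 0)) o\<^sub>L factor (y, snd s) = \<rho> s o\<^sub>L \<rho> (y, 0)"
    using sY y s by (simp add: factor rep(2) zero_S)
  moreover have "unitary (snd s) o\<^sub>L factor (y, 0) = factor (y, snd s)"
    using y by (simp add: unitary_factor) (simp add: shift_def)
  ultimately show ?thesis
    by (simp add: pair_op_def proj_Y[OF sY] blinfun_compose_assoc)
qed

text \<open>\<open>Y\<close> need not have upper bounds, so the ranges of the \<open>\<rho> (y, 0)\<close> are exhausted one \<open>y\<close> at a time; the dilation
  agrees with \<open>factor (y, 0)\<close> on the range of \<open>\<rho> (y, 0)\<close>.\<close>

fun complement :: "'x list \<Rightarrow> 'k op" where
  "complement [] = id_blinfun"
| "complement (y # ys) = (id_blinfun - \<rho> (y, 0)) o\<^sub>L complement ys"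

fun dilation :: "'x list \<Rightarrow> 'k ell2 \<Rightarrow>\<^sub>L (nat \<times> 'k) ell2" where
  "dilation [] = 0"
| "dilation (y # ys) = dilation ys + (factor (y, 0) o\<^sub>L complement ys)"

lemma \<rho>_zero:
  assumes "x \<in> Y" "y \<in> Y"
  shows "\<rho> (x, 0) o\<^sub>L \<rho> (y, 0) = \<rho> (y, 0) o\<^sub>L \<rho> (x, 0)" "\<rho> (x, 0) o\<^sub>L \<rho> (x, 0) = \<rho> (x, 0)"
    "adj (\<rho> (x, 0)) = \<rho> (x, 0)" "clin (\<rho> (x, 0))"
  using assms by (simp_all add: rep zero_S pair_mul_def pair_inv_def meet.inf.commute)

lemma complement:
  assumes "set ys \<subseteq> Y"
  shows clin_complement: "clin (complement ys)"
    and complement_commute: "y \<in> Y \<Longrightarrow> \<rho> (y, 0) o\<^sub>L complement ys = complement ys o\<^sub>L \<rho> (y, 0)"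
proof -
  show "clin (complement ys)" using assms by (induction ys) (auto simp: \<rho>_zero)
  show "\<rho> (y, 0) o\<^sub>L complement ys = complement ys o\<^sub>L \<rho> (y, 0)" if y: "y \<in> Y" using assms
  proof (induction ys)
    case (Cons z ys)
    have "\<rho> (y, 0) o\<^sub>L complement (z # ys) = (\<rho> (y, 0) o\<^sub>L (id_blinfun - \<rho> (z, 0))) o\<^sub>L complement ys"
      by (simp add: blinfun_compose_assoc)
    also have "\<rho> (y, 0) o\<^sub>L (id_blinfun - \<rho> (z, 0)) = (id_blinfun - \<rho> (z, 0)) o\<^sub>L \<rho> (y, 0)"
      using Cons.prems y \<rho>_zero(1)[of y z] by (simp add: blinfun_compose_add)
    finally show ?case using Cons by (simp add: blinfun_compose_assoc)
  qed simp
qed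

lemma complement_idem: "set ys \<subseteq> Y \<Longrightarrow> complement ys o\<^sub>L complement ys = complement ys"
  and adj_complement: "set ys \<subseteq> Y \<Longrightarrow> adj (complement ys) = complement ys"
proof -
  let ?q = "\<lambda>y. id_blinfun - \<rho> (y, 0)"
  have q: "?q y o\<^sub>L complement ys = complement ys o\<^sub>L ?q y" if "y \<in> Y" "set ys \<subseteq> Y" for y ys
    using that by (simp add: blinfun_compose_add complement_commute)
  show "complement ys o\<^sub>L complement ys = complement ys" if "set ys \<subseteq> Y"
    using that
  proof (induction ys)
    case (Cons y ys)
    then have y: "y \<in> Y" and ys: "set ys \<subseteq> Y" by auto
    have "complement (y # ys) o\<^sub>L complement (y # ys) = ?q y o\<^sub>L (complement ys o\<^sub>L ?q y) o\<^sub>L complement ys"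
      by (simp only: complement.simps blinfun_compose_assoc)
    also have "\<dots> = (?q y o\<^sub>L ?q y) o\<^sub>L (complement ys o\<^sub>L complement ys)"
      unfolding q[OF y ys, symmetric] by (simp only: blinfun_compose_assoc)
    also have "?q y o\<^sub>L ?q y = ?q y" by (simp add: blinfun_compose_add \<rho>_zero(2)[OF y y])
    finally show ?case using Cons.IH[OF ys] by simp
  qed simp
  show "adj (complement ys) = complement ys" if "set ys \<subseteq> Y"
    using that
  proof (induction ys)
    case (Cons y ys)
    then have y: "y \<in> Y" and ys: "set ys \<subseteq> Y" by auto
    then show ?case using Cons.IH[OF ys] q[OF y ys] by (simp add: clin_complement \<rho>_zero)
  qed simp
qed

lemma complement_kills: "set ys \<subseteq> Y \<Longrightarrow> y \<in> set ys \<Longrightarrow> \<rho> (y, 0) o\<^sub>L complement ys = 0"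
proof (induction ys)
  case (Cons z ys)
  have "\<rho> (y, 0) o\<^sub>L complement (z # ys) = (\<rho> (y, 0) o\<^sub>L (id_blinfun - \<rho> (z, 0))) o\<^sub>L complement ys"
    by (simp add: blinfun_compose_assoc)
  also have "\<rho> (y, 0) o\<^sub>L (id_blinfun - \<rho> (z, 0)) = (id_blinfun - \<rho> (z, 0)) o\<^sub>L \<rho> (y, 0)"
    using Cons.prems \<rho>_zero(1)[of y z] by (auto simp: blinfun_compose_add)
  also have "\<dots> o\<^sub>L complement ys = 0"
  proof (cases "y = z")
    case True
    then show ?thesis using Cons.prems by (simp add: blinfun_compose_add \<rho>_zero(2)[of z z] flip: blinfun_compose_assoc)
  next
    case False
    then show ?thesis using Cons by (simp add: blinfun_compose_assoc)
  qed
  finally show ?case .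
qed simp

text \<open>Against \<open>factor (y, 0)\<close> the dilation behaves like
  \<open>\<rho> (y, 0)\<close> on the part of the space exhausted by \<open>ys\<close>, the range of
  \<open>1 - complement ys\<close>.\<close>

lemma adj_factor_dilation:
  "set ys \<subseteq> Y \<Longrightarrow> y \<in> Y \<Longrightarrow> adj (factor (y, 0)) o\<^sub>L dilation ys = \<rho> (y, 0) o\<^sub>L (id_blinfun - complement ys)"
proof (induction ys)
  case (Cons z ys)
  have "translate (y, 0) (z, 0) = pair_mul (y, 0) (z, 0)" by (simp add: translate_def pair_mul_def)
  then have "adj (factor (y, 0)) o\<^sub>L factor (z, 0) = \<rho> (y, 0) o\<^sub>L \<rho> (z, 0)"
    using Cons.prems by (simp add: factor rep(2) zero_S)
  then have "adj (factor (y, 0)) o\<^sub>L (factor (z, 0) o\<^sub>L complement ys) = \<rho> (y, 0) o\<^sub>L (\<rho> (z, 0) o\<^sub>L complement ys)"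
    by (simp flip: blinfun_compose_assoc)
  then show ?case using Cons by (simp add: blinfun_compose_add)
qed (simp add: blinfun_compose_add)

text \<open>Pythagoras: the squared norm of \<open>v\<close> is that of its dilation plus that of
  the part \<open>complement ys v\<close> not yet captured.\<close>

lemma norm_dilation: "set ys \<subseteq> Y \<Longrightarrow> norm (dilation ys v) \<le> norm v"
proof -
  assume "set ys \<subseteq> Y"
  then have "\<langle>dilation ys v | dilation ys v\<rangle> + \<langle>complement ys v | complement ys v\<rangle> = \<langle>v | v\<rangle>"
  proof (induction ys)
    case (Cons y ys)
    then have y: "y \<in> Y" and ys: "set ys \<subseteq> Y" by auto
    let ?p = "\<rho> (y, 0)" and ?c = "complement ys" and ?d = "dilation ys"
    note p = \<rho>_zero[OF y y]
    have pp: "?p (?p w) = ?p w" for w using arg_cong[OF p(2), of "\<lambda>T. T w"] by simp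
    have pc: "\<langle>?p u | w\<rangle> = \<langle>u | ?p w\<rangle>" for u w using cinner_adj[OF p(4), of u w] p(3) by simp
    have "translate (y, 0) (y, 0) = (y, 0)" by (simp add: translate_def)
    then have "adj (factor (y, 0)) (factor (y, 0) w) = ?p w" for w
      using y arg_cong[OF factor[of "(y, 0)" "(y, 0)"], of "\<lambda>T. T w"] by simp
    then have jj: "\<langle>factor (y, 0) u | factor (y, 0) w\<rangle> = \<langle>u | ?p w\<rangle>" for u w
      using y by (simp flip: cinner_adj_right)
    have "?p ((id_blinfun - ?c) v) = ?p v - ?c (?p v)"
      using arg_cong[OF complement_commute[OF ys y], of "\<lambda>T. T v"] by (simp add: blinfun.diff_left blinfun.diff_right)
    \<comment> \<open>The cross term vanishes because \<open>?c\<close> is a projection commuting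
      with \<open>?p\<close>: the new summand uses only the range of \<open>?c\<close>, while the
      old one sees the range of \<open>1 - ?c\<close>.\<close>
    then have "\<langle>factor (y, 0) (?c v) | ?d v\<rangle> = \<langle>?c v | ?p v - ?c (?p v)\<rangle>"
      using y arg_cong[OF adj_factor_dilation[OF ys y], of "\<lambda>T. T v"] by (simp flip: cinner_adj_right)
    also have "\<dots> = \<langle>v | ?c (?p v) - ?c (?c (?p v))\<rangle>"
      using cinner_adj[OF clin_complement[OF ys], of v] by (simp add: adj_complement[OF ys] blinfun.diff_right)
    also have "\<dots> = 0"
      using arg_cong[OF complement_idem[OF ys], of "\<lambda>T. T (?p v)"] by simp
    finally have cross: "\<langle>factor (y, 0) (?c v) | ?d v\<rangle> = 0" "\<langle>?d v | factor (y, 0) (?c v)\<rangle> = 0"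
      by (simp_all add: cinner_commute[of "?d v"])
    show ?case
      using Cons.IH[OF ys] by (simp add: blinfun.add_left blinfun.diff_left cinner_add_left cinner_add_right
        cinner_diff_left cinner_diff_right cross jj pc pp)
  qed simp
  then have "(norm (dilation ys v))\<^sup>2 \<le> (norm v)\<^sup>2"
    using arg_cong[of _ _ Re] zero_le_power2[of "norm (complement ys v)"]
    unfolding norm_eq_cinner by (metis le_add_same_cancel1 plus_complex.sel(1))
  then show ?thesis by (metis norm_ge_zero power2_le_imp_le)
qed

text \<open>It is enough that the list contains the source of \<open>s\<close>, since
  \<open>\<rho> s\<close> then vanishes on the part that is not exhausted.\<close>

lemma pair_op_dilation:
  assumes s: "s \<in> selems S" and ys: "set ys \<subseteq> Y" "act (- snd s) (fst s) \<in> set ys"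
  shows "pair_op proj unitary s o\<^sub>L dilation ys = factor (fst s, 0) o\<^sub>L \<rho> s"
proof -
  let ?y = "act (- snd s) (fst s)"
  have 1: "pair_op proj unitary s o\<^sub>L dilation ys = factor (fst s, 0) o\<^sub>L \<rho> s o\<^sub>L (id_blinfun - complement ys)"
    using ys(1)
  proof (induction ys)
    case (Cons y ys)
    have "pair_op proj unitary s o\<^sub>L (factor (y, 0) o\<^sub>L complement ys) = factor (fst s, 0) o\<^sub>L (\<rho> s o\<^sub>L (\<rho> (y, 0) o\<^sub>L complement ys))"
      using Cons.prems by (simp add: pair_op_factor[OF s] blinfun_compose_assoc flip: blinfun_compose_assoc[of "pair_op proj unitary s"])
    then show ?case using Cons by (simp add: blinfun_compose_add blinfun_compose_assoc)
  qed (simp add: blinfun_compose_add)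
  have y: "?y \<in> Y" "s = pair_mul s (?y, 0)" using s by (simp_all add: selems_S pair_mul_def)
  have "\<rho> s o\<^sub>L complement ys = \<rho> s o\<^sub>L (\<rho> (?y, 0) o\<^sub>L complement ys)"
    using y s by (simp add: rep(2) zero_S flip: blinfun_compose_assoc)
  also have "\<dots> = 0" by (simp add: complement_kills[OF ys])
  finally show ?thesis unfolding 1 by (simp add: blinfun_compose_add blinfun_compose_assoc)
qed

text \<open>On the ranges of the \<open>\<rho> (y, 0)\<close>, the maps \<open>factor (y, 0)\<close>
  preserve inner products even across different \<open>y\<close>, as restrictions of a single
  isometry would.\<close>

lemma cinner_dilated:
  assumes s: "s \<in> selems S" "t \<in> selems S"
  shows "\<langle>factor (fst s, 0) (\<rho> s v) | factor (fst t, 0) (\<rho> t v)\<rangle> = \<langle>\<rho> s v | \<rho> t v\<rangle>"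
proof -
  have Y: "fst s \<in> Y" "fst t \<in> Y" using s by (simp_all add: selems_S)
  have p: "\<rho> (fst u, 0) (\<rho> u v) = \<rho> u v" if u: "u \<in> selems S" for u
  proof -
    have "pair_mul (fst u, 0) u = u" by (simp add: pair_mul_def)
    moreover have "fst u \<in> Y" using u by (simp add: selems_S)
    ultimately have "\<rho> (fst u, 0) o\<^sub>L \<rho> u = \<rho> u" using u by (simp add: rep(2) zero_S)
    from arg_cong[OF this, of "\<lambda>T. T v"] show ?thesis by simp
  qed
  have "translate (fst s, 0) (fst t, 0) = pair_mul (fst s, 0) (fst t, 0)"
    by (simp add: translate_def pair_mul_def)
  then have "adj (factor (fst s, 0)) o\<^sub>L factor (fst t, 0) = \<rho> (fst s, 0) o\<^sub>L \<rho> (fst t, 0)"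
    using Y by (simp add: factor rep(2) zero_S)
  from arg_cong[OF this, of "\<lambda>T. T (\<rho> t v)"]
  have "\<langle>factor (fst s, 0) (\<rho> s v) | factor (fst t, 0) (\<rho> t v)\<rangle> = \<langle>\<rho> s v | \<rho> (fst s, 0) (\<rho> t v)\<rangle>"
    using Y p[OF s(2)] by (simp flip: cinner_adj_right)
  also have "\<dots> = \<langle>\<rho> (fst s, 0) (\<rho> s v) | \<rho> t v\<rangle>"
    using cinner_adj[OF \<rho>_zero(4), of "fst s" "fst s" "\<rho> s v"] Y \<rho>_zero(3)[OF Y(1,1)] by simp
  finally show ?thesis unfolding p[OF s(1)] .
qed

text \<open>For each \<open>v\<close>, the combination evaluated in the dilating pair at
  \<open>dilation ys v\<close> has the same norm as its value under \<rho> at \<open>v\<close>, and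
  \<open>dilation ys\<close> is a contraction.\<close>

lemma norm_le_cov_pairs:
  assumes l: "l \<in> combs (selems S)" and C: "0 \<le> C"
    and le: "\<And>(\<rho>' :: 'x \<Rightarrow> (nat \<times> 'k) op) U'. (\<rho>', U') \<in> cov_pairs \<Longrightarrow> norm (lcomb op_algebra (pair_op \<rho>' U') l) \<le> C"
  shows "norm (lcomb op_algebra \<rho> l) \<le> C"
proof (rule norm_blinfun_bound[OF C])
  fix v
  \<comment> \<open>The sources of all elements occurring in \<open>l\<close>, as
    \<open>pair_op_dilation\<close> demands.\<close>
  define ys where "ys = map (\<lambda>(c, s). act (- snd s) (fst s)) l"
  have ys: "set ys \<subseteq> Y" using l by (auto simp: ys_def selems_S in_lists_conv_set split: prod.splits)
  let ?T = "lcomb op_algebra (pair_op proj unitary) l"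
  define D where "D k = (\<Sum>(c, s)\<leftarrow>k. c *\<^sub>c factor (fst s, 0) (\<rho> s v))" for k
  define L where "L k = (\<Sum>(c, s)\<leftarrow>k. c *\<^sub>c \<rho> s v)" for k :: "(complex \<times> 'x \<times> 'g) list"
  have "?T (dilation ys v) = (\<Sum>(c, s)\<leftarrow>l. c *\<^sub>c pair_op proj unitary s (dilation ys v))"
    by (rule lcomb_op_apply_on[OF l]) (rule pair_op(1)[OF cov_pair])
  also have "\<dots> = D l"
    unfolding D_def
  proof (rule arg_cong[where f = sum_list], rule map_cong[OF refl], clarify)
    fix c x g assume m: "(c, x, g) \<in> set l"
    then have s: "(x, g) \<in> selems S" using l by (auto simp: in_lists_conv_set)
    have "act (- g) x \<in> set ys" using m by (force simp: ys_def)
    from arg_cong[OF pair_op_dilation[OF s ys], of "\<lambda>T. T v"] this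
    show "c *\<^sub>c pair_op proj unitary (x, g) (dilation ys v) = c *\<^sub>c factor (fst (x, g), 0) (\<rho> (x, g) v)"
      by simp
  qed
  finally have TD: "?T (dilation ys v) = D l" .
  have L: "lcomb op_algebra \<rho> l v = L l"
    unfolding L_def by (rule lcomb_op_apply_on[OF l]) (rule rep(1))
  have 1: "\<langle>factor (fst s, 0) (\<rho> s v) | D k\<rangle> = \<langle>\<rho> s v | L k\<rangle>" if "k \<in> combs (selems S)" "s \<in> selems S" for k s
    using that
  proof (induction k)
    case (Cons p k)
    obtain c t where p: "p = (c, t)" by (cases p) simp
    have t: "t \<in> selems S" using Cons.hyps by (simp add: p)
    show ?case using Cons.IH[OF Cons.prems] by (simp add: p D_def L_def cinner_add_right cinner_dilated[OF Cons.prems t])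
  qed (simp add: D_def L_def)
  have 2: "\<langle>D k | D l\<rangle> = \<langle>L k | L l\<rangle>" if "k \<in> combs (selems S)" for k
    using that
  proof (induction k)
    case (Cons p k)
    obtain c t where p: "p = (c, t)" by (cases p) simp
    have t: "t \<in> selems S" using Cons.hyps by (simp add: p)
    have "D (p # k) = c *\<^sub>c factor (fst t, 0) (\<rho> t v) + D k" "L (p # k) = c *\<^sub>c \<rho> t v + L k"
      by (simp_all add: D_def L_def p)
    then show ?case using Cons.IH by (simp add: cinner_add_left 1[OF l t])
  qed (simp add: D_def[of "[]"] L_def[of "[]"])
  have "(norm (L l))\<^sup>2 = (norm (D l))\<^sup>2"
    unfolding norm_eq_cinner 2[OF l] ..
  then have "norm (L l) = norm (D l)" by simp
  also have "\<dots> \<le> norm ?T * norm (dilation ys v)" unfolding TD[symmetric] by (rule norm_blinfun)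
  also have "\<dots> \<le> C * norm v"
    by (intro mult_mono le cov_pair norm_dilation ys C) simp
  finally show "norm (lcomb op_algebra \<rho> l v) \<le> C * norm v" unfolding L .
qed

end

section \<open>The regular representation\<close>

text \<open>Right translation by \<open>k\<close> commutes with left translations and turns the
  condition on \<open>act h t\<close> into the one on \<open>act (h + k) t\<close>, so it
  intertwines the two fibres.\<close>

lemma (in semilattice_action) fiber_translate_le:
  "norm (lcomb op_algebra (fiber_op (act k t)) l) \<le> norm (lcomb op_algebra (fiber_op t) l)"
proof (rule norm_blinfun_bound)
  fix \<zeta> :: "'g ell2"
  define R :: "'g \<Rightarrow> 'g op" where "R k = pmap_op (\<lambda>_. True) (\<lambda>h. h + k)" for k
  have i: "inj_on (\<lambda>h. h + k) {j. True}" for k :: 'g by (simp add: inj_on_def)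
  have s: "(\<lambda>h. h + k) ` {j. True} = UNIV" for k :: 'g
  proof -
    have "h \<in> (\<lambda>h. h + k) ` {j. True}" for h by (rule image_eqI[of _ _ "h - k"]) auto
    then show ?thesis by blast
  qed
  have iso: "norm (R k \<zeta>) = norm \<zeta>" for k \<zeta>
  proof -
    have "(norm (R k \<zeta>))\<^sup>2 = (norm \<zeta>)\<^sup>2" unfolding norm_eq_cinner by (simp add: R_def cinner_pmap_op[OF i s])
    then show ?thesis by simp
  qed
  have R: "ell2_coord (R k \<zeta>) h = ell2_coord \<zeta> (h + k)" "clin (R k)" for k \<zeta> h
    unfolding R_def by (simp_all add: coord_pmap_op[OF i] clin_pmap_op[OF i])
  have "lcomb op_algebra (fiber_op (act k t)) l \<zeta> = R k (lcomb op_algebra (fiber_op t) l (R (- k) \<zeta>))"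
    unfolding lcomb_op_apply[OF clin_fiber_op] apply_sum_list[OF R(2)]
    by (rule ell2_eqI) (auto simp: coord_sum_list R clinD act_add add.assoc simp del: add_uminus_conv_diff intro!: arg_cong[where f = sum_list])
  then show "norm (lcomb op_algebra (fiber_op (act k t)) l \<zeta>) \<le> norm (lcomb op_algebra (fiber_op t) l) * norm \<zeta>"
    using norm_blinfun[of "lcomb op_algebra (fiber_op t) l" "R (- k) \<zeta>"] by (simp add: iso)
qed simp

context McAlister
begin

text \<open>The coordinate form of the left regular representation: for \<open>s\<close> in
  \<open>S\<close>, the basis vector at \<open>j\<close> is the image of the one at the
  \<open>t\<close> with \<open>j = s t\<close>, and the condition says that \<open>j\<close> lies in
  \<open>S\<close> below the range of \<open>s\<close>.\<close>

definition regular_op :: "'x \<times> 'g \<Rightarrow> ('x \<times> 'g) op" where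
  "regular_op s = pmap_op (\<lambda>j. fst j \<le> fst s \<and> act (- snd j) (fst j) \<in> Y) (\<lambda>j. (act (- snd s) (fst j), - snd s + snd j))"

lemma coord_regular_op: "ell2_coord (regular_op s \<xi>) j =
      (if fst j \<le> fst s \<and> act (- snd j) (fst j) \<in> Y then ell2_coord \<xi> (act (- snd s) (fst j), - snd s + snd j) else 0)"
  and clin_regular_op [simp]: "clin (regular_op s)"
  unfolding regular_op_def
  by (rule coord_pmap_op clin_pmap_op, auto simp: inj_on_def prod_eq_iff dest: arg_cong[of _ _ "act (snd s)"])+

lemma sgle_iff:
  assumes s: "s \<in> selems S" and t: "t \<in> selems S"
  shows "sgle S (sgmult S t (sginv S t)) (sgmult S (sginv S s) s) \<longleftrightarrow> fst t \<le> act (- snd s) (fst s)"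
proof -
  have "McAlister_triple act Y"
    unfolding McAlister_triple_def
  proof (intro conjI allI ballI impI)
    show "(\<Union>g. act g ` Y) = UNIV" using covering by blast
    show "act g ` Y \<inter> Y \<noteq> {}" for g using meets_Y by blast
  qed (use downset in \<open>auto simp: act_add act_mono ex_meet\<close>)
  note le = McAlister_le[OF this]
  have 1: "pair_mul t (pair_inv t) = (fst t, 0)" "pair_mul (pair_inv s) s = (act (- snd s) (fst s), 0)"
    by (simp_all add: pair_mul_def pair_inv_def)
  have "fst t \<in> Y" "act (- snd s) (fst s) \<in> Y" using s t by (simp_all add: selems_S)
  then show ?thesis using s t by (simp add: sginv_S 1 le selems_S)
qed

lemma left_regular_eq:
  assumes s: "s \<in> selems S"
  shows "left_regular S s = regular_op s"
  unfolding left_regular_def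
proof (rule the_equality)
  have sY: "act (- snd s) (fst s) \<in> Y" using s by (simp add: selems_S)
  have "regular_op s (ell2_delta t) =
      (if t \<in> selems S \<and> fst t \<le> act (- snd s) (fst s) then ell2_delta (pair_mul s t) else 0)" for t
  proof (rule ell2_eqI)
    fix j
    have st: "pair_mul s t = (act (snd s) (fst t), snd s + snd t)" if "fst t \<le> act (- snd s) (fst s)"
      using that by (simp add: pair_mul_def act_le_iff' meet.inf.absorb2)
    have pre: "(act (- snd s) (fst j), - snd s + snd j) = t \<longleftrightarrow> j = (act (snd s) (fst t), snd s + snd t)"
    proof
      assume t: "(act (- snd s) (fst j), - snd s + snd j) = t"
      show "j = (act (snd s) (fst t), snd s + snd t)" unfolding t[symmetric] by simp
    qed simp
    have "fst t \<in> Y" if "fst t \<le> act (- snd s) (fst s)" using downset[OF sY that] .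
    moreover have "act (- (snd s + snd t)) (act (snd s) (fst t)) = act (- snd t) (fst t)"
      by (simp only: minus_add act_add act_cancel)
    ultimately show "ell2_coord (regular_op s (ell2_delta t)) j = ell2_coord (if t \<in> selems S \<and> fst t \<le> act (- snd s) (fst s) then ell2_delta (pair_mul s t) else 0) j"
      by (auto simp: coord_regular_op ell2_delta.rep_eq zero_ell2.rep_eq pre selems_S st act_le_iff')
  qed
  then show reg: "clinear_op (regular_op s) \<and>
      (\<forall>t. regular_op s (ell2_delta t) =
        (if t \<in> selems S \<and> sgle S (sgmult S t (sginv S t)) (sgmult S (sginv S s) s)
         then ell2_delta (sgmult S s t) else 0))"
    using sgle_iff[OF s] by (auto simp: clinear_op_clin)
  fix T
  assume "clinear_op T \<and>
      (\<forall>t. T (ell2_delta t) =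
        (if t \<in> selems S \<and> sgle S (sgmult S t (sginv S t)) (sgmult S (sginv S s) s)
         then ell2_delta (sgmult S s t) else 0))"
  then show "T = regular_op s" using reg by (intro clin_eqI) (auto simp: clinear_op_clin)
qed

text \<open>In the coordinates \<open>(h, t) \<mapsto> (h t, h)\<close>, the regular representation is the direct sum of the
  fibres over the elements of \<open>Y\<close>.\<close>

definition untwist :: "('x \<times> 'g) ell2 \<Rightarrow>\<^sub>L ('g \<times> 'x) ell2" where
  "untwist = pmap_op (\<lambda>_. True) (\<lambda>j. (act (fst j) (snd j), fst j))"

lemma untwist:
  shows coord_untwist [simp]: "ell2_coord (untwist \<xi>) j = ell2_coord \<xi> (act (fst j) (snd j), fst j)"
    and clin_untwist [simp]: "clin untwist"
    and norm_untwist: "norm (untwist \<xi>) = norm \<xi>"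
proof -
  let ?p = "\<lambda>j :: 'g \<times> 'x. (act (fst j) (snd j), fst j)"
  have i: "inj_on ?p {j. True}"
    by (rule inj_on_inverseI[where g = "\<lambda>(x, h). (h, act (- h) x)"]) simp
  have "k \<in> ?p ` {j. True}" for k by (rule image_eqI[of _ _ "(snd k, act (- snd k) (fst k))"]) simp_all
  then have s: "?p ` {j. True} = UNIV" by blast
  show "ell2_coord (untwist \<xi>) j = ell2_coord \<xi> (act (fst j) (snd j), fst j)" "clin untwist"
    unfolding untwist_def by (simp_all add: coord_pmap_op[OF i] clin_pmap_op[OF i])
  have "(norm (untwist \<xi>))\<^sup>2 = (norm \<xi>)\<^sup>2"
    unfolding norm_eq_cinner untwist_def by (simp add: cinner_pmap_op[OF i s])
  then show "norm (untwist \<xi>) = norm \<xi>" by simp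
qed

lemma column_regular:
  "column t (untwist (lcomb op_algebra regular_op l \<xi>)) =
    (if t \<in> Y then lcomb op_algebra (fiber_op t) l (column t (untwist \<xi>)) else 0)"
proof -
  have "column t (untwist (lcomb op_algebra regular_op l \<xi>)) =
      (\<Sum>(c, m)\<leftarrow>l. c *\<^sub>c column t (untwist (regular_op m \<xi>)))"
    unfolding lcomb_op_apply[OF clin_regular_op] apply_sum_list[OF clin_untwist] apply_sum_list[OF clin_column]
    by (auto simp: clinD intro!: arg_cong[where f = sum_list])
  also have "column t (untwist (regular_op m \<xi>)) = (if t \<in> Y then fiber_op t m (column t (untwist \<xi>)) else 0)" for m
    by (rule ell2_eqI) (simp add: coord_regular_op zero_ell2.rep_eq act_add)
  then have "(\<Sum>(c, m)\<leftarrow>l. c *\<^sub>c column t (untwist (regular_op m \<xi>))) =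
      (if t \<in> Y then \<Sum>(c, m)\<leftarrow>l. c *\<^sub>c fiber_op t m (column t (untwist \<xi>)) else 0)"
    by (induction l) auto
  finally show ?thesis unfolding lcomb_op_apply[OF clin_fiber_op] .
qed

text \<open>The fibre over \<open>t\<close> sits in the regular representation along
  \<open>h \<mapsto> (act h t, h)\<close>.\<close>

lemma ex_column:
  "\<exists>\<xi>. norm \<xi> = norm \<zeta> \<and> column t (untwist \<xi>) = \<zeta>"
proof -
  let ?\<iota> = "\<lambda>h :: 'g. (act h t, h)"
  have i: "inj ?\<iota>" by (simp add: inj_on_def)
  have "inv ?\<iota> (act h t, h) = h" for h using inv_f_f[OF i, of h] by simp
  then have "column t (untwist (index_embedding ?\<iota> \<zeta>)) = \<zeta>"
    by (intro ell2_eqI) (simp add: coord_index_embedding[OF i])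
  then show ?thesis using norm_index_embedding[OF i] by blast
qed

lemma regular_norm_le_iff:
  assumes "0 \<le> C"
  shows "norm (lcomb op_algebra regular_op l) \<le> C \<longleftrightarrow> (\<forall>t. norm (lcomb op_algebra (fiber_op t) l) \<le> C)"
proof
  assume C: "norm (lcomb op_algebra regular_op l) \<le> C"
  have Y: "norm (lcomb op_algebra (fiber_op t) l) \<le> C" if t: "t \<in> Y" for t
  proof (rule norm_blinfun_bound[OF assms])
    fix \<zeta>
    obtain \<xi> :: "('x \<times> 'g) ell2" where \<xi>: "norm \<xi> = norm \<zeta>" "column t (untwist \<xi>) = \<zeta>" using ex_column by blast
    let ?\<eta> = "untwist (lcomb op_algebra regular_op l \<xi>)"
    have "(norm (column t ?\<eta>))\<^sup>2 \<le> (norm ?\<eta>)\<^sup>2"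
      unfolding norm2_columns(2)[of ?\<eta>]
      using finite_sum_le_infsum[OF norm2_columns(1)[of ?\<eta>], of "{t}"] by simp
    then have "norm (column t ?\<eta>) \<le> norm ?\<eta>" by (metis norm_ge_zero power2_le_imp_le)
    also have "\<dots> \<le> norm (lcomb op_algebra regular_op l) * norm \<zeta>"
      unfolding norm_untwist \<xi>(1)[symmetric] by (rule norm_blinfun)
    also have "\<dots> \<le> C * norm \<zeta>" using C by (rule mult_right_mono) simp
    finally show "norm (lcomb op_algebra (fiber_op t) l \<zeta>) \<le> C * norm \<zeta>"
      unfolding column_regular using t by (simp add: \<xi>(2))
  qed
  show "\<forall>t. norm (lcomb op_algebra (fiber_op t) l) \<le> C"
  proof
    fix t
    obtain h y where "y \<in> Y" "t = act h y" using covering by blast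
    then show "norm (lcomb op_algebra (fiber_op t) l) \<le> C"
      using fiber_translate_le[of h y l] Y[of y] by simp
  qed
next
  assume C: "\<forall>t. norm (lcomb op_algebra (fiber_op t) l) \<le> C"
  show "norm (lcomb op_algebra regular_op l) \<le> C"
  proof (rule norm_blinfun_bound[OF assms])
    fix \<xi>
    let ?\<eta> = "untwist (lcomb op_algebra regular_op l \<xi>)"
    have "(norm ?\<eta>)\<^sup>2 \<le> (C * norm (untwist \<xi>))\<^sup>2"
      unfolding power_mult_distrib norm2_columns(2)[of ?\<eta>] norm2_columns(2)[of "untwist \<xi>"]
    proof (subst infsum_cmult_right'[symmetric], rule infsum_mono)
      fix t
      have "norm (column t ?\<eta>) \<le> C * norm (column t (untwist \<xi>))"
      proof (cases "t \<in> Y")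
        case True
        then show ?thesis
          using norm_blinfun[of "lcomb op_algebra (fiber_op t) l" "column t (untwist \<xi>)"]
            mult_right_mono[OF C[rule_format, of t] norm_ge_zero[of "column t (untwist \<xi>)"]]
          unfolding column_regular by simp
      qed (simp add: column_regular assms)
      then show "(norm (column t ?\<eta>))\<^sup>2 \<le> C\<^sup>2 * (norm (column t (untwist \<xi>)))\<^sup>2"
        unfolding power_mult_distrib[symmetric] by (rule power_mono) simp
    qed (intro norm2_columns(1) summable_on_cmult_right)+
    then show "norm (lcomb op_algebra regular_op l \<xi>) \<le> C * norm \<xi>"
      unfolding norm_untwist using assms by (metis mult_nonneg_nonneg norm_ge_zero power2_le_imp_le)
  qed
qed

lemma regular_op_mul: 
  assumes s: "s \<in> selems S" and t: "t \<in> selems S"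
  shows "regular_op (pair_mul s t) = regular_op s o\<^sub>L regular_op t"
proof (rule blinfun_eqI, rule ell2_eqI)
  fix \<xi> and j :: "'x \<times> 'g"
  have 1: "- (snd s + snd t) = - snd t + - snd s" by (rule minus_add)
  have 2: "- (- snd s + snd j) = - snd j + snd s" by (simp only: minus_add minus_minus)
  have "act (- snd j) (fst j) \<in> Y \<longleftrightarrow> act (- (- snd s + snd j)) (act (- snd s) (fst j)) \<in> Y"
    unfolding 2 by (simp only: act_add act_cancel)
  then show "ell2_coord (regular_op (pair_mul s t) \<xi>) j = ell2_coord ((regular_op s o\<^sub>L regular_op t) \<xi>) j"
    unfolding blinfun_apply_blinfun_compose coord_regular_op
    by (auto simp: pair_mul_def 1 act_add act_le_iff' add.assoc simp del: add_uminus_conv_diff)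
qed

text \<open>The coordinate map \<open>?p\<close> of \<open>regular_op s\<close> is a bijection from
  \<open>?D\<close> onto \<open>?D'\<close> whose inverse is the coordinate map of
  \<open>regular_op (pair_inv s)\<close>; the adjoint is a change of summation index.\<close>

lemma regular_op_inv:
  assumes s: "s \<in> selems S"
  shows "regular_op (pair_inv s) = adj (regular_op s)"
proof (rule adjI[symmetric])
  fix x y :: "('x \<times> 'g) ell2"
  let ?p = "\<lambda>j. (act (- snd s) (fst j), - snd s + snd j)" and ?D = "{j. fst j \<le> fst s \<and> act (- snd j) (fst j) \<in> Y}"
  let ?p' = "\<lambda>j. (act (snd s) (fst j), snd s + snd j)" and ?D' = "{j. fst j \<le> act (- snd s) (fst s) \<and> act (- snd j) (fst j) \<in> Y}"
  have pp: "?p (?p' j) = j" "?p' (?p j) = j" for j by simp_all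
  have "act (- (- snd s + snd j)) (act (- snd s) (fst j)) = act (- snd j) (fst j)" for j
    by (simp only: minus_add minus_minus act_add act_cancel)
  then have D: "?p ` ?D \<subseteq> ?D'" by (auto simp: act_le_iff')
  have "act (- (snd s + snd j)) (act (snd s) (fst j)) = act (- snd j) (fst j)" for j
    by (simp only: minus_add act_add act_cancel)
  then have D': "?p' ` ?D' \<subseteq> ?D" by (auto simp: act_le_iff')
  have i: "inj_on ?p ?D" by (rule inj_on_inverseI[where g = ?p']) (simp add: pp)
  have img: "?p ` ?D = ?D'"
    using D D' pp(1) by (metis (no_types, lifting) image_eqI subsetI subset_antisym image_subset_iff)
  have "\<langle>x | regular_op s y\<rangle> = (\<Sum>\<^sub>\<infinity>j\<in>?D. cnj (ell2_coord x (?p' (?p j))) * ell2_coord y (?p j))"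
    unfolding ell2_cinner_def by (rule infsum_cong_neutral) (auto simp: coord_regular_op)
  also have "\<dots> = (\<Sum>\<^sub>\<infinity>j\<in>?p ` ?D. cnj (ell2_coord x (?p' j)) * ell2_coord y j)"
    using infsum_reindex[OF i, of "\<lambda>j. cnj (ell2_coord x (?p' j)) * ell2_coord y j"] by (simp add: o_def)
  also have "\<dots> = \<langle>regular_op (pair_inv s) x | y\<rangle>"
    unfolding img ell2_cinner_def by (rule infsum_cong_neutral) (auto simp: coord_regular_op pair_inv_def)
  finally show "\<langle>regular_op (pair_inv s) x | y\<rangle> = \<langle>x | regular_op s y\<rangle>" by simp
qed

end

section \<open>The Morita equivalences\<close>

context McAlister
begin

text \<open>Common frame for the full and the reduced case: the algebraic rules are the same for
  both, and the only analytic input is the equality of norms on combinations from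
  \<open>S\<close>.\<close>

lemma strongly_Morita_equivalent_generated:
  fixes R :: "'r set" and v :: "'x \<times> 'g \<Rightarrow> 'r \<Rightarrow> 'k op" and u :: "'x \<times> 'g \<Rightarrow> 'c"
  defines "F \<equiv> op_family_algebra R"
  assumes A': "cstar_algebra A'"
    and u: "\<And>s. s \<in> selems S \<Longrightarrow> u s \<in> elems A'"
      "\<And>s t. s \<in> selems S \<Longrightarrow> t \<in> selems S \<Longrightarrow> u (pair_mul s t) = smult A' (u s) (u t)"
      "\<And>s. s \<in> selems S \<Longrightarrow> u (pair_inv s) = sstar A' (u s)"
    and v: "\<And>m. v m \<in> elems F" "\<And>m n. v (pair_mul m n) = smult F (v m) (v n)"
      "\<And>m. v (pair_inv m) = sstar F (v m)"
    and norm: "\<And>l. l \<in> combs (selems S) \<Longrightarrow> snorm F (lcomb F v l) = snorm A' (lcomb A' u l)"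
  shows "strongly_Morita_equivalent (cstar_generated A' (u ` selems S)) (cstar_generated F (range v))"
proof -
  interpret A': cstar_algebra A' by (rule A')
  interpret F: cstar_algebra F unfolding F_def by (rule cstar_algebra_op_family)
  interpret P: comb_pair A' F u v "selems S" pair_mul pair_inv
    by unfold_locales (use u v pair_mul_S pair_inv_S in auto)
  obtain \<phi> where \<phi>: "star_hom (cstar_generated A' (u ` selems S)) (cstar_generated F (v ` selems S)) \<phi>"
    "bij_betw \<phi> (elems (cstar_generated A' (u ` selems S))) (elems (cstar_generated F (v ` selems S)))"
    "\<And>x. x \<in> elems (cstar_generated A' (u ` selems S)) \<Longrightarrow> snorm F (\<phi> x) = snorm A' x"
    by (rule P.generated_iso[OF norm]) (assumption, rule that)
  define A0 where "A0 = elems (cstar_generated F (v ` selems S))"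
  define B0 where "B0 = elems (cstar_generated F (range v))"
  define E0 where "E0 = F.cspan (v ` (Y \<times> UNIV))"
  have A0: "A0 = F.cspan (v ` selems S)" unfolding A0_def by (rule P.generated_elems)
  have B0: "B0 = F.cspan (range v)"
    unfolding B0_def by (rule F.elems_cstar_generated) (use v(1) in \<open>auto simp flip: v(2,3)\<close>)
  have gen: "cstar_generated F T = F\<lparr>elems := elems (cstar_generated F T)\<rparr>" for T
    by (simp add: cstar_generated_def)
  have vF: "v ` T \<subseteq> elems F" for T using v(1) by auto
  note C = F.closed_subspace_cspan
  have sup: "v m \<in> F.cspan (v ` T)" if "m \<in> T" for m T using F.cspan_superset[OF vF] that by blast
  have mult: "smult F x y \<in> D"
    if "closed_subspace F D" "x \<in> F.cspan (v ` T)" "y \<in> F.cspan (v ` T')"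
      "\<And>m n. m \<in> T \<Longrightarrow> n \<in> T' \<Longrightarrow> v (pair_mul m n) \<in> D" for x y T T' D
    by (rule F.cspan_mult[OF that(1) vF vF _ that(2,3)]) (use that(4) in \<open>auto simp flip: v(2)\<close>)
  have star: "sstar F x \<in> F.cspan (v ` (pair_inv ` T))" if "x \<in> F.cspan (v ` T)" for x T
    by (rule F.cspan_star[OF C vF _ that]) (auto simp flip: v(3) intro!: sup)
  \<comment> \<open>For \<open>(x, g)\<close> times the inverse of \<open>(y, h)\<close>, the first
    component is below \<open>x\<close>, and translating it back by the group component of the
    product leads below \<open>y\<close>. Both conditions for \<open>S\<close> follow since
    \<open>Y\<close> is a downset.\<close>
  have EE: "smult F x (sstar F y) \<in> A0" if "x \<in> E0" "y \<in> E0" for x y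
    unfolding A0
  proof (rule mult[OF C that(1)[unfolded E0_def] star[OF that(2)[unfolded E0_def]]])
    fix m n :: "'x \<times> 'g" assume m: "m \<in> Y \<times> UNIV" and "n \<in> pair_inv ` (Y \<times> UNIV)"
    then obtain y h where n: "n = pair_inv (y, h)" "y \<in> Y" by auto
    obtain x g where m': "m = (x, g)" "x \<in> Y" using m by auto
    have "- (g + - h) = h + - g" by (simp only: minus_add minus_minus)
    moreover have "act (h + - g) (act g (act (- h) y)) = y" by (simp only: act_add act_cancel)
    ultimately have "act (- (g + - h)) (meet x (act g (act (- h) y))) \<le> y"
      using act_mono[OF meet_lower(2)] by metis
    moreover have "meet x (act g (act (- h) y)) \<in> Y" using m'(2) by (rule downset) (rule meet_lower)
    ultimately have "pair_mul m n \<in> selems S"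
      using downset[OF n(2)] by (simp add: selems_S pair_mul_def pair_inv_def m' n)
    then show "v (pair_mul m n) \<in> F.cspan (v ` selems S)" by (rule sup)
  qed
  have "strongly_Morita_equivalent (cstar_generated A' (u ` selems S)) (F\<lparr>elems := B0\<rparr>)"
  proof (rule F.strongly_Morita_equivalent_corner)
    show "cstar_algebra (cstar_generated A' (u ` selems S))" by (rule A'.cstar_algebra_generated)
    show "closed_star_subalgebra F A0" "closed_star_subalgebra F B0"
      unfolding A0_def B0_def by (rule F.closed_star_subalgebra_generated)+
    then have A0': "closed_star_subalgebra (op_family_algebra R) A0" by (simp add: F_def)
    show "closed_subspace F E0" unfolding E0_def by (rule C)
    show "E0 \<subseteq> B0" unfolding E0_def B0 by (rule F.cspan_mono) auto
    show "star_hom (cstar_generated A' (u ` selems S)) (F\<lparr>elems := A0\<rparr>) \<phi>"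
      using \<phi>(1) unfolding A0_def gen[symmetric] .
    show "bij_betw \<phi> (elems (cstar_generated A' (u ` selems S))) A0" using \<phi>(2) unfolding A0_def .
    show "snorm F (\<phi> a) = snorm (cstar_generated A' (u ` selems S)) a"
      if "a \<in> elems (cstar_generated A' (u ` selems S))" for a
      using \<phi>(3)[OF that] by simp
    have Y: "meet x y \<in> Y" if "x \<in> Y" for x y using that by (rule downset) (rule meet_lower)
    show "smult F a x \<in> E0" if "a \<in> A0" "x \<in> E0" for a x
      unfolding E0_def
      by (rule mult[OF C that(1)[unfolded A0] that(2)[unfolded E0_def]], rule sup)
        (auto simp: pair_mul_def selems_S intro: Y)
    show "smult F x b \<in> E0" if "x \<in> E0" "b \<in> B0" for x b
      unfolding E0_def
      by (rule mult[OF C that(1)[unfolded E0_def] that(2)[unfolded B0]], rule sup)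
        (auto simp: pair_mul_def intro: Y)
    show "smult F x (sstar F y) \<in> A0" if "x \<in> E0" "y \<in> E0" for x y by (rule EE[OF that])
    show "\<exists>c\<in>A0. smult F x (sstar F x) = smult F (sstar F c) c" if x: "x \<in> E0" for x
    proof -
      have "x \<in> elems (op_family_algebra R)" using x F.cspan_subset unfolding E0_def F_def by blast
      then show ?thesis using op_family_sqrt[OF A0', of x] EE[OF x x] by (simp add: F_def)
    qed
    show "A0 \<subseteq> D" if D: "closed_subspace F D" and xy: "\<And>x y. x \<in> E0 \<Longrightarrow> y \<in> E0 \<Longrightarrow> smult F x (sstar F y) \<in> D" for D
      unfolding A0
    proof (rule F.cspan_least[OF D], clarify)
      fix y g assume s: "(y, g) \<in> selems S"
      \<comment> \<open>The source idempotent of \<open>(y, g)\<close> is a right unit for it and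
        equals its own inverse.\<close>
      then have "(y, g) = pair_mul (y, g) (pair_inv (act (- g) y, 0))"
        by (simp add: pair_mul_def pair_inv_def)
      then have "v (y, g) = smult F (v (y, g)) (sstar F (v (act (- g) y, 0)))" by (metis v(2,3))
      moreover have "v (y, g) \<in> E0" "v (act (- g) y, 0) \<in> E0"
        using s unfolding E0_def by (auto simp: selems_S intro!: sup)
      ultimately show "v (y, g) \<in> D" using xy by metis
    qed
    show "B0 \<subseteq> D" if D: "closed_subspace F D" and xy: "\<And>x y. x \<in> E0 \<Longrightarrow> y \<in> E0 \<Longrightarrow> smult F (sstar F x) y \<in> D" for D
      unfolding B0
    proof (rule F.cspan_least[OF D], clarify)
      fix x g
      obtain k y where y: "y \<in> Y" "x = act k y" using covering by blast
      \<comment> \<open>The inverse of \<open>(y, - k)\<close> is \<open>(act k y, k)\<close>, which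
        provides the first component \<open>x\<close>; the second factor restores the group
        component \<open>g\<close>.\<close>
      have "(x, g) = pair_mul (pair_inv (y, - k)) (y, - k + g)"
        by (simp add: pair_mul_def pair_inv_def y(2) flip: add.assoc)
      then have "v (x, g) = smult F (sstar F (v (y, - k))) (v (y, - k + g))" by (metis v(2,3))
      moreover have "v (y, h) \<in> E0" for h using y(1) unfolding E0_def by (auto intro!: sup)
      ultimately show "v (x, g) \<in> D" using xy by metis
    qed
  qed
  then show ?thesis unfolding B0_def gen[symmetric] .
qed

text \<open>\<open>\<pi> s\<close> is a partial isometry: multiplied on the left by its adjoint it
  becomes the projection \<open>\<pi> e\<close>.\<close>

lemma norm_S_rep_le:
  assumes "\<pi> \<in> semigroup_reps S" "s \<in> selems S"
  shows "norm (\<pi> s) \<le> 1"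
proof -
  have r: "\<And>s. s \<in> selems S \<Longrightarrow> clin (\<pi> s)" "\<And>s t. s \<in> selems S \<Longrightarrow> t \<in> selems S \<Longrightarrow> \<pi> (pair_mul s t) = \<pi> s o\<^sub>L \<pi> t"
    "\<And>s. s \<in> selems S \<Longrightarrow> \<pi> (pair_inv s) = adj (\<pi> s)"
    using assms(1) unfolding S_reps_iff by blast+
  define e where "e = pair_mul (pair_inv s) s"
  have e: "e \<in> selems S" "pair_mul e e = e" "pair_inv e = e" "\<pi> e = adj (\<pi> s) o\<^sub>L \<pi> s"
    using assms(2) by (auto simp: e_def pair_mul_S pair_inv_S r) (simp_all add: pair_mul_def pair_inv_def)
  have "norm (\<pi> e) \<le> 1"
    by (rule norm_projection_le) (use e r in \<open>metis\<close>)+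
  then have "(norm (\<pi> s))\<^sup>2 \<le> 1\<^sup>2"
    using norm_adj_comp_self[OF r(1)[OF assms(2)]] by (simp add: e(4))
  then show ?thesis by (metis norm_ge_zero power2_le_imp_le zero_le_one)
qed

text \<open>Restricting a covariant pair leaves the index type of \<open>semigroup_cstar\<close>,
  and dilating leaves that of \<open>crossed_product\<close>; one transfer lemma repairs each
  direction.\<close>

lemma morita_semigroup_cstar:
  assumes "semilattice_algebra act A e \<alpha>"
  shows "strongly_Morita_equivalent (semigroup_cstar S) (crossed_product A \<alpha>)"
proof -
  interpret X: semilattice_algebra act A e \<alpha> by fact
  let ?R = "semigroup_reps S :: ('x \<times> 'g \<Rightarrow> (('x \<times> 'g) \<times> nat) op) set"
  let ?u = "\<lambda>s. family_on ?R (\<lambda>\<pi>. \<pi> s)"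
  let ?A' = "op_family_algebra ?R" and ?F = "op_family_algebra (covariant_reps A \<alpha>) :: (_ \<Rightarrow> ('a \<times> 'g \<times> nat) op) star_algebra"
  interpret A': cstar_algebra ?A' by (rule cstar_algebra_op_family)
  interpret F: cstar_algebra ?F by (rule cstar_algebra_op_family)
  have r: "clin (\<pi> s)" "t \<in> selems S \<Longrightarrow> \<pi> (pair_mul s t) = \<pi> s o\<^sub>L \<pi> t" "\<pi> (pair_inv s) = adj (\<pi> s)"
    if "\<pi> \<in> ?R" "s \<in> selems S" for \<pi> s t
    using that unfolding S_reps_iff by blast+
  have u: "?u s \<in> elems ?A'" if "s \<in> selems S" for s
    by (rule family_on_op_family[where C = 1]) (use r(1)[OF _ that] norm_S_rep_le[OF _ that] in simp_all)
  have norm: "snorm ?F (lcomb ?F X.crossed_gen l) = snorm ?A' (lcomb ?A' ?u l)" if l: "l \<in> combs (selems S)" for l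
  proof (rule eq_of_le_iff)
    show "0 \<le> snorm ?F (lcomb ?F X.crossed_gen l)"
      by (intro F.norm_nonneg F.lcomb_closed[where M = UNIV] X.crossed_gen) simp
    show "0 \<le> snorm ?A' (lcomb ?A' ?u l)"
      by (intro A'.norm_nonneg A'.lcomb_closed[OF u l])
    fix C :: real assume C: "0 \<le> C"
    have "(\<forall>(\<rho> :: 'x \<Rightarrow> ('a \<times> 'g \<times> nat) op) U. (\<rho>, U) \<in> cov_pairs \<longrightarrow> norm (lcomb op_algebra (pair_op \<rho> U) l) \<le> C)
      \<longleftrightarrow> (\<forall>\<pi>\<in>?R. norm (lcomb op_algebra \<pi> l) \<le> C)"
    proof (intro iffI allI impI ballI)
      fix \<rho> :: "'x \<Rightarrow> ('a \<times> 'g \<times> nat) op" and U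
      assume le: "\<forall>\<pi>\<in>?R. norm (lcomb op_algebra \<pi> l) \<le> C" and p: "(\<rho>, U) \<in> cov_pairs"
      have i: "inj (\<lambda>n::nat. (undefined :: 'x \<times> 'g, n))" by (simp add: inj_on_def)
      show "norm (lcomb op_algebra (pair_op \<rho> U) l) \<le> C"
        by (rule semigroup_reps_norm_transfer[OF countable_S _ pair_op_S_rep[OF p] i l C])
          (use le in \<open>simp_all add: sginv_S pair_inv_S\<close>)
    next
      fix \<pi>
      assume le: "\<forall>(\<rho> :: 'x \<Rightarrow> ('a \<times> 'g \<times> nat) op) U. (\<rho>, U) \<in> cov_pairs \<longrightarrow> norm (lcomb op_algebra (pair_op \<rho> U) l) \<le> C"
        and \<pi>: "\<pi> \<in> ?R"
      have "countable ((UNIV :: 'x set) \<times> (UNIV :: 'g set))" using countable_X countable_G by (rule countable_SIGMA)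
      then have "countable ((UNIV :: ('x \<times> 'g) set) \<times> (UNIV :: nat set))" by (intro countable_SIGMA) simp_all
      then have "countable (UNIV :: (('x \<times> 'g) \<times> nat) set)" by simp
      then interpret M: McAlister_rep act Y \<pi> using \<pi> by unfold_locales auto
      have i: "inj (\<lambda>n::nat. (undefined :: 'a, undefined :: 'g, n))" by (simp add: inj_on_def)
      show "norm (lcomb op_algebra \<pi> l) \<le> C"
        by (rule M.norm_le_cov_pairs[OF l C], rule cov_pairs_norm_transfer[OF _ i C]) (use le in blast)+
    qed
    then show "snorm ?F (lcomb ?F X.crossed_gen l) \<le> C \<longleftrightarrow> snorm ?A' (lcomb ?A' ?u l) \<le> C"
      unfolding X.crossed_gen_norm_le_iff[OF C] using lcomb_family_norm_le_iff[OF u l C] by simp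
  qed
  have "strongly_Morita_equivalent (cstar_generated ?A' (?u ` selems S)) (cstar_generated ?F (range X.crossed_gen))"
  proof (rule strongly_Morita_equivalent_generated[OF A'.cstar_algebra_axioms u _ _ X.crossed_gen norm])
    show "?u (pair_mul s t) = smult ?A' (?u s) (?u t)" if "s \<in> selems S" "t \<in> selems S" for s t
      using that r by (auto simp: fun_eq_iff family_on_def)
    show "?u (pair_inv s) = sstar ?A' (?u s)" if "s \<in> selems S" for s
      using that r by (auto simp: fun_eq_iff family_on_def)
  qed
  moreover have "{?u s | s. s \<in> selems S} = ?u ` selems S" by auto
  ultimately show ?thesis unfolding X.crossed_product_generated semigroup_cstar_def by simp
qed

lemma morita_reduced_semigroup_cstar:
  assumes "semilattice_algebra act A e \<alpha>"
  shows "strongly_Morita_equivalent (reduced_semigroup_cstar S) (reduced_crossed_product A \<alpha>)"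
proof -
  interpret X: semilattice_algebra act A e \<alpha> by fact
  let ?A' = "op_algebra :: ('x \<times> 'g) op star_algebra" and ?F = "op_family_algebra (star_reps A) :: (_ \<Rightarrow> ('g \<times> 'a \<times> nat) op) star_algebra"
  interpret A': cstar_algebra ?A' by (rule cstar_algebra_op_algebra)
  interpret F: cstar_algebra ?F by (rule cstar_algebra_op_family)
  have norm: "snorm ?F (lcomb ?F X.reduced_gen l) = snorm ?A' (lcomb ?A' regular_op l)" for l
  proof (rule eq_of_le_iff)
    show "0 \<le> snorm ?F (lcomb ?F X.reduced_gen l)"
      by (intro F.norm_nonneg F.lcomb_closed[where M = UNIV] X.reduced_gen) simp
    show "snorm ?F (lcomb ?F X.reduced_gen l) \<le> C \<longleftrightarrow> snorm ?A' (lcomb ?A' regular_op l) \<le> C" if C: "0 \<le> C" for C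
      unfolding X.reduced_gen_norm_le_iff[OF C] using regular_norm_le_iff[OF C] by simp
  qed simp
  have "strongly_Morita_equivalent (cstar_generated ?A' (regular_op ` selems S)) (cstar_generated ?F (range X.reduced_gen))"
    by (rule strongly_Morita_equivalent_generated[OF A'.cstar_algebra_axioms _ _ _ X.reduced_gen norm])
      (simp_all add: regular_op_mul regular_op_inv)
  moreover have "left_regular S ` selems S = regular_op ` selems S"
    by (rule image_cong[OF refl left_regular_eq])
  ultimately show ?thesis unfolding X.reduced_crossed_product_generated reduced_semigroup_cstar_def by simp
qed

end

theorem theorem4p10:
  fixes act :: "'g::group_add \<Rightarrow> 'x::order \<Rightarrow> 'x" and Y :: "'x set" and S :: "('x \<times> 'g) semigrp"
  assumes "McAlister_triple act Y"
    and "S = McAlister_semigroup act Y"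
    and "countable (selems S)"
    and "F_inverse S"
  shows "strongly_Morita_equivalent (semigroup_cstar S)
           (crossed_product (semigroup_cstar meet_semigroup) (semilattice_cstar_action act))
       \<and> star_isomorphic
           (crossed_product (semigroup_cstar meet_semigroup) (semilattice_cstar_action act))
           (crossed_product (C0_algebra characters) (C0_action act))
       \<and> strongly_Morita_equivalent (reduced_semigroup_cstar S)
           (reduced_crossed_product (semigroup_cstar meet_semigroup) (semilattice_cstar_action act))
       \<and> star_isomorphic
           (reduced_crossed_product (semigroup_cstar meet_semigroup) (semilattice_cstar_action act))
           (reduced_crossed_product (C0_algebra characters) (C0_action act))"
proof -
  note t = McAlister_tripleD[OF assms(1)]
  \<comment> \<open>The F-inverse property enters through the existence of meets, and countability
    of \<open>S\<close> through that of \<open>X\<close> and \<open>G\<close>.\<close>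
  interpret McAlister act Y
    by unfold_locales
      (use t(4,6,7) F_inverse_meets[OF assms(1)] McAlister_countable[OF assms(1)] assms in \<open>auto simp: t(1,2,3)\<close>)
  show ?thesis
    unfolding assms(2)
    using morita_semigroup_cstar[OF semilattice_algebra_cstar] morita_reduced_semigroup_cstar[OF semilattice_algebra_cstar]
      crossed_products_isomorphic[OF countable_semilattice_action_axioms semilattice_algebra_cstar semilattice_algebra_C0]
    by blast
qed

end
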